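(* Let $(R,\mathfrak m)$ be a Noetherian local ring. For each integer $s\ge0$ and each $\mathfrak m$-primary ideal $I$, $(\operatorname{Ul}^s_I(R),\mathcal S|_{\operatorname{Ul}^s_I(R)})$ is an exact subcategory of $\operatorname{Mod}R$ (hence of $\operatorname{mod}R$). Hence $\operatorname{Ext}^1_{\operatorname{Ul}^s_I(R)}(-,-):\operatorname{Ul}^s_I(R)^{op}\times\operatorname{Ul}^s_I(R)\to\operatorname{mod}R$ is a subfunctor of $\operatorname{Ext}^1_R(-,-):\operatorname{Ul}^s_I(R)^{op}\times\operatorname{Ul}^s_I(R)\to\operatorname{mod}R$.
   Context: $\operatorname{Mod}R$ (resp. $\operatorname{mod}R$) is the category of all (resp. finitely generated) $R$-modules, with its standard exact structure $\mathcal S$ of all short exact sequences. For a full subcategory $\mathcal X$ closed under isomorphism, $\mathcal S|_{\mathcal X}$ is the class of short exact sequences with all three terms in $\mathcal X$. An exact subcategory of $\operatorname{Mod}R$ is a full additive subcategory $\mathcal X$ closed under isomorphism with a class $\mathcal E$ of short exact sequences of modules in $\mathcal X$ making $(\mathcal X,\mathcal E)$ a (Quillen) exact category. $\operatorname{CM}^s(R)$ is the full subcategory of $\operatorname{mod}R$ consisting of $0$ and all Cohen--Macaulay $R$-modules of dimension $s$. $e_R(I,M)=\lim_{n\to\infty}\frac{(\dim M)!}{n^{\dim M}}\lambda_R(M/I^{n+1}M)$ is the multiplicity of $M$ with respect to $I$ ($\lambda_R$ is length; $e_R(I,0)=0$). $\operatorname{Ul}^s_I(R)$ is the full subcategory of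 modules $M\in\operatorname{CM}^s(R)$ with $\lambda_R(M/IM)=e_R(I,M)$. For $M,N\in\operatorname{Ul}^s_I(R)$, $\operatorname{Ext}^1_{\operatorname{Ul}^s_I(R)}(M,N)$ is the set of Yoneda classes in $\operatorname{Ext}^1_R(M,N)$ of short exact sequences $0\to N\to X\to M\to0$ with $X\in\operatorname{Ul}^s_I(R)$. Subfunctor means via the natural inclusions: these are $R$-submodules, preserved by the maps induced by morphisms in each variable. *)

theory Defs
  imports "HOL-Algebra.Ring_Divisibility" "HOL-Algebra.Ideal_Product" "HOL-Algebra.Module" "HOL-Library.Extended_Real"
begin

section \<open>Rings and ideals\<close>

definition local_ring :: "('a, 'r) ring_scheme \<Rightarrow> 'a set \<Rightarrow> bool" where
  "local_ring R \<mm> \<longleftrightarrow> cring R \<and> {J. maximalideal J R} = {\<mm>}"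

definition radical :: "('a, 'r) ring_scheme \<Rightarrow> 'a set \<Rightarrow> 'a set" where
  "radical R I = {a \<in> carrier R. \<exists>n::nat. a [^]\<^bsub>R\<^esub> n \<in> I}"

definition primary_ideal :: "('a, 'r) ring_scheme \<Rightarrow> 'a set \<Rightarrow> bool" where
  "primary_ideal R I \<longleftrightarrow> ideal I R \<and> I \<noteq> carrier R \<and>
     (\<forall>a \<in> carrier R. \<forall>b \<in> carrier R. a \<otimes>\<^bsub>R\<^esub> b \<in> I \<longrightarrow> a \<in> I \<or> b \<in> radical R I)"

definition m_primary :: "('a, 'r) ring_scheme \<Rightarrow> 'a set \<Rightarrow> 'a set \<Rightarrow> bool" where
  "m_primary R \<mm> I \<longleftrightarrow> primary_ideal R I \<and> radical R I = \<mm>"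

primrec ideal_power :: "('a, 'r) ring_scheme \<Rightarrow> 'a set \<Rightarrow> nat \<Rightarrow> 'a set" where
  "ideal_power R I 0 = carrier R"
| "ideal_power R I (Suc n) = ideal_prod R I (ideal_power R I n)"


section \<open>Modules\<close>

text \<open>
  A module is a record of the library. Its multiplicative fields \<open>mult\<close> and \<open>one\<close>, inherited from
  the ring record, play no role. The objects of \<open>Mod_cat R\<close> are the modules with carrier in the
  type \<open>'u\<close>, which plays the part of a universe. If \<open>'u\<close> is infinite and \<open>R\<close> embeds into \<open>'u\<close>,
  then \<open>'u\<close> carries an isomorphic copy of every finitely generated \<open>R\<close>-module, and
  \<open>Mod_cat R\<close> is closed, up to isomorphism, under submodules, quotients and finite direct sums.
\<close>

definition mod_span :: "('a, 'r) ring_scheme \<Rightarrow> ('a, 'b) module \<Rightarrow> 'b set \<Rightarrow> 'b set" where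
  "mod_span R M S = \<Inter> {H. submodule H R M \<and> S \<subseteq> H}"

definition fin_gen :: "('a, 'r) ring_scheme \<Rightarrow> ('a, 'b) module \<Rightarrow> bool" where
  "fin_gen R M \<longleftrightarrow> (\<exists>S. finite S \<and> S \<subseteq> carrier M \<and> mod_span R M S = carrier M)"

definition Mod_cat :: "('a, 'r) ring_scheme \<Rightarrow> ('a, 'u) module set" where
  "Mod_cat R = {M. module R M}"

definition mod_cat :: "('a, 'r) ring_scheme \<Rightarrow> ('a, 'u) module set" where
  "mod_cat R = {M. module R M \<and> fin_gen R M}"

text \<open>
  Homomorphisms are extensional functions, so that equality of functions is equality of morphisms.
  Composition is \<^const>\<open>compose\<close>, restricted to the carrier of the source.
\<close>

definition mod_hom ::
  "('a, 'r) ring_scheme \<Rightarrow> ('a, 'b) module \<Rightarrow> ('a, 'c) module \<Rightarrow> ('b \<Rightarrow> 'c) set" where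
  "mod_hom R M N = {f \<in> carrier M \<rightarrow>\<^sub>E carrier N.
     (\<forall>x \<in> carrier M. \<forall>y \<in> carrier M. f (x \<oplus>\<^bsub>M\<^esub> y) = f x \<oplus>\<^bsub>N\<^esub> f y) \<and>
     (\<forall>r \<in> carrier R. \<forall>x \<in> carrier M. f (r \<odot>\<^bsub>M\<^esub> x) = r \<odot>\<^bsub>N\<^esub> f x)}"

definition mod_id :: "('a, 'b) module \<Rightarrow> 'b \<Rightarrow> 'b" where
  "mod_id M = (\<lambda>x \<in> carrier M. x)"

definition zero_hom :: "('a, 'b) module \<Rightarrow> ('a, 'c) module \<Rightarrow> 'b \<Rightarrow> 'c" where
  "zero_hom M N = (\<lambda>x \<in> carrier M. \<zero>\<^bsub>N\<^esub>)"

definition mod_iso ::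
  "('a, 'r) ring_scheme \<Rightarrow> ('a, 'b) module \<Rightarrow> ('a, 'c) module \<Rightarrow> ('b \<Rightarrow> 'c) set" where
  "mod_iso R M N = {f \<in> mod_hom R M N. bij_betw f (carrier M) (carrier N)}"

definition ideal_smult ::
  "('a, 'r) ring_scheme \<Rightarrow> 'a set \<Rightarrow> ('a, 'b) module \<Rightarrow> 'b set" where
  "ideal_smult R I M = mod_span R M {a \<odot>\<^bsub>M\<^esub> x | a x. a \<in> I \<and> x \<in> carrier M}"

definition quot_mod :: "('a, 'b) module \<Rightarrow> 'b set \<Rightarrow> ('a, 'b set) module" where
  "quot_mod M H =
     \<lparr>carrier = a_rcosets\<^bsub>M\<^esub> H, monoid.mult = (\<lambda>_ _. undefined), monoid.one = undefined,
      ring.zero = H, ring.add = (\<lambda>C D. C <+>\<^bsub>M\<^esub> D),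
      smult = (\<lambda>r C. \<Union>x \<in> C. H +>\<^bsub>M\<^esub> (r \<odot>\<^bsub>M\<^esub> x))\<rparr>"

definition mod_length :: "('a, 'r) ring_scheme \<Rightarrow> ('a, 'b) module \<Rightarrow> enat" where
  "mod_length R M = Sup {enat n | n. \<exists>H :: nat \<Rightarrow> 'b set.
     (\<forall>i \<le> n. submodule (H i) R M) \<and> (\<forall>i < n. H i \<subset> H (Suc i))}"

definition annihilator :: "('a, 'r) ring_scheme \<Rightarrow> ('a, 'b) module \<Rightarrow> 'a set" where
  "annihilator R M = {r \<in> carrier R. \<forall>x \<in> carrier M. r \<odot>\<^bsub>M\<^esub> x = \<zero>\<^bsub>M\<^esub>}"

text \<open>
  The Krull dimension of \<open>R / Ann M\<close>, computed by chains of primes containing \<open>Ann M\<close>. The zero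
  module gets dimension \<open>0\<close> here (the supremum of the empty set); it is always treated separately.
\<close>

definition mod_dim :: "('a, 'r) ring_scheme \<Rightarrow> ('a, 'b) module \<Rightarrow> enat" where
  "mod_dim R M = Sup {enat n | n. \<exists>P :: nat \<Rightarrow> 'a set.
     (\<forall>i \<le> n. primeideal (P i) R \<and> annihilator R M \<subseteq> P i) \<and> (\<forall>i < n. P i \<subset> P (Suc i))}"

definition nonzerodivisor_on :: "('a, 'b) module \<Rightarrow> 'a \<Rightarrow> bool" where
  "nonzerodivisor_on M a \<longleftrightarrow> (\<forall>x \<in> carrier M. a \<odot>\<^bsub>M\<^esub> x = \<zero>\<^bsub>M\<^esub> \<longrightarrow> x = \<zero>\<^bsub>M\<^esub>)"

definition regular_sequence ::
  "('a, 'r) ring_scheme \<Rightarrow> ('a, 'b) module \<Rightarrow> 'a list \<Rightarrow> bool" where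
  "regular_sequence R M as \<longleftrightarrow> set as \<subseteq> carrier R \<and>
     (\<forall>i < length as. nonzerodivisor_on
        (quot_mod M (ideal_smult R (genideal R (set (take i as))) M)) (as ! i)) \<and>
     ideal_smult R (genideal R (set as)) M \<noteq> carrier M"

definition depth :: "('a, 'r) ring_scheme \<Rightarrow> 'a set \<Rightarrow> ('a, 'b) module \<Rightarrow> enat" where
  "depth R \<mm> M = Sup {enat (length as) | as. set as \<subseteq> \<mm> \<and> regular_sequence R M as}"

definition cohen_macaulay :: "('a, 'r) ring_scheme \<Rightarrow> 'a set \<Rightarrow> ('a, 'b) module \<Rightarrow> bool" where
  "cohen_macaulay R \<mm> M \<longleftrightarrow>
     module R M \<and> fin_gen R M \<and> carrier M \<noteq> {\<zero>\<^bsub>M\<^esub>} \<and> depth R \<mm> M = mod_dim R M"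

definition CM :: "('a, 'r) ring_scheme \<Rightarrow> 'a set \<Rightarrow> nat \<Rightarrow> ('a, 'u) module set" where
  "CM R \<mm> s = {M \<in> mod_cat R.
     carrier M = {\<zero>\<^bsub>M\<^esub>} \<or> (cohen_macaulay R \<mm> M \<and> mod_dim R M = enat s)}"

text \<open>
  For an \<open>\<mm>\<close>-primary ideal \<open>I\<close> and a finitely generated \<open>M\<close> the dimension and the lengths below are
  finite, so \<^const>\<open>the_enat\<close> only changes the type.
\<close>

definition multiplicity :: "('a, 'r) ring_scheme \<Rightarrow> 'a set \<Rightarrow> ('a, 'b) module \<Rightarrow> real" where
  "multiplicity R I M = (if carrier M = {\<zero>\<^bsub>M\<^esub>} then 0 else
     let d = the_enat (mod_dim R M) in
       lim (\<lambda>n::nat. fact d / real n ^ d *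
         real (the_enat (mod_length R (quot_mod M (ideal_smult R (ideal_power R I (n + 1)) M))))))"

definition Ul ::
  "('a, 'r) ring_scheme \<Rightarrow> 'a set \<Rightarrow> 'a set \<Rightarrow> nat \<Rightarrow> ('a, 'u) module set" where
  "Ul R \<mm> I s = {M \<in> CM R \<mm> s.
     ereal_of_enat (mod_length R (quot_mod M (ideal_smult R I M))) = ereal (multiplicity R I M)}"


section \<open>Exact subcategories of module categories\<close>

text \<open>
  A full subcategory is given by its class of objects. A short exact sequence
  \<open>0 \<rightarrow> A \<rightarrow> B \<rightarrow> C \<rightarrow> 0\<close> with maps \<open>f\<close> and \<open>g\<close> is the tuple \<open>(A, f, B, g, C)\<close>.
\<close>

type_synonym ('a, 'u) seq =
  "('a, 'u) module \<times> ('u \<Rightarrow> 'u) \<times> ('a, 'u) module \<times> ('u \<Rightarrow> 'u) \<times> ('a, 'u) module"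

definition short_exact :: "('a, 'r) ring_scheme \<Rightarrow> ('a, 'u) seq set" where
  "short_exact R = {(A, f, B, g, C).
     module R A \<and> module R B \<and> module R C \<and> f \<in> mod_hom R A B \<and> g \<in> mod_hom R B C \<and>
     inj_on f (carrier A) \<and> f ` carrier A = {x \<in> carrier B. g x = \<zero>\<^bsub>C\<^esub>} \<and>
     g ` carrier B = carrier C}"

definition short_exact_in ::
  "('a, 'r) ring_scheme \<Rightarrow> ('a, 'u) module set \<Rightarrow> ('a, 'u) seq set" where
  "short_exact_in R \<C> = {(A, f, B, g, C). (A, f, B, g, C) \<in> short_exact R \<and> A \<in> \<C> \<and> B \<in> \<C> \<and> C \<in> \<C>}"

definition is_biproduct ::
  "('a, 'r) ring_scheme \<Rightarrow> ('a, 'u) module \<Rightarrow> ('a, 'u) module \<Rightarrow> ('a, 'u) module \<Rightarrow> bool" where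
  "is_biproduct R A B P \<longleftrightarrow>
     (\<exists>i \<in> mod_hom R A P. \<exists>j \<in> mod_hom R B P. \<exists>p \<in> mod_hom R P A. \<exists>q \<in> mod_hom R P B.
        compose (carrier A) p i = mod_id A \<and> compose (carrier B) q j = mod_id B \<and>
        compose (carrier A) q i = zero_hom A B \<and> compose (carrier B) p j = zero_hom B A \<and>
        (\<forall>x \<in> carrier P. i (p x) \<oplus>\<^bsub>P\<^esub> j (q x) = x))"

definition additive_subcategory ::
  "('a, 'r) ring_scheme \<Rightarrow> ('a, 'u) module set \<Rightarrow> bool" where
  "additive_subcategory R \<C> \<longleftrightarrow> \<C> \<subseteq> Mod_cat R \<and>
     (\<exists>Z \<in> \<C>. carrier Z = {\<zero>\<^bsub>Z\<^esub>}) \<and> (\<forall>A \<in> \<C>. \<forall>B \<in> \<C>. \<exists>P \<in> \<C>. is_biproduct R A B P)"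

definition is_kernel_in :: "('a, 'r) ring_scheme \<Rightarrow> ('a, 'u) module set \<Rightarrow> ('a, 'u) seq \<Rightarrow> bool" where
  "is_kernel_in R \<C> = (\<lambda>(A, f, B, g, C).
     compose (carrier A) g f = zero_hom A C \<and>
     (\<forall>T \<in> \<C>. \<forall>u \<in> mod_hom R T B. compose (carrier T) g u = zero_hom T C \<longrightarrow>
        (\<exists>!v. v \<in> mod_hom R T A \<and> compose (carrier T) f v = u)))"

definition is_cokernel_in :: "('a, 'r) ring_scheme \<Rightarrow> ('a, 'u) module set \<Rightarrow> ('a, 'u) seq \<Rightarrow> bool" where
  "is_cokernel_in R \<C> = (\<lambda>(A, f, B, g, C).
     compose (carrier A) g f = zero_hom A C \<and>
     (\<forall>T \<in> \<C>. \<forall>u \<in> mod_hom R B T. compose (carrier A) u f = zero_hom A T \<longrightarrow>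
        (\<exists>!v. v \<in> mod_hom R C T \<and> compose (carrier B) v g = u)))"

text \<open>
  \<open>is_pushout_in R \<C> A f B h A' f' B' h'\<close>: the square with \<open>f : A \<rightarrow> B\<close>, \<open>h : A \<rightarrow> A'\<close>,
  \<open>f' : A' \<rightarrow> B'\<close>, \<open>h' : B \<rightarrow> B'\<close> is a pushout in the full subcategory \<open>\<C>\<close>.
\<close>

definition is_pushout_in ::
  "('a, 'r) ring_scheme \<Rightarrow> ('a, 'u) module set \<Rightarrow> ('a, 'u) module \<Rightarrow> ('u \<Rightarrow> 'u) \<Rightarrow> ('a, 'u) module \<Rightarrow>
   ('u \<Rightarrow> 'u) \<Rightarrow> ('a, 'u) module \<Rightarrow> ('u \<Rightarrow> 'u) \<Rightarrow> ('a, 'u) module \<Rightarrow> ('u \<Rightarrow> 'u) \<Rightarrow> bool" where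
  "is_pushout_in R \<C> A f B h A' f' B' h' \<longleftrightarrow>
     B' \<in> \<C> \<and> f' \<in> mod_hom R A' B' \<and> h' \<in> mod_hom R B B' \<and>
     compose (carrier A) h' f = compose (carrier A) f' h \<and>
     (\<forall>T \<in> \<C>. \<forall>u \<in> mod_hom R B T. \<forall>v \<in> mod_hom R A' T.
        compose (carrier A) u f = compose (carrier A) v h \<longrightarrow>
        (\<exists>!w. w \<in> mod_hom R B' T \<and>
           compose (carrier B) w h' = u \<and> compose (carrier A') w f' = v))"

text \<open>
  \<open>is_pullback_in R \<C> B g C k C' g' B' k'\<close>: the square with \<open>g : B \<rightarrow> C\<close>, \<open>k : C' \<rightarrow> C\<close>,
  \<open>g' : B' \<rightarrow> C'\<close>, \<open>k' : B' \<rightarrow> B\<close> is a pullback in the full subcategory \<open>\<C>\<close>.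
\<close>

definition is_pullback_in ::
  "('a, 'r) ring_scheme \<Rightarrow> ('a, 'u) module set \<Rightarrow> ('a, 'u) module \<Rightarrow> ('u \<Rightarrow> 'u) \<Rightarrow> ('a, 'u) module \<Rightarrow>
   ('u \<Rightarrow> 'u) \<Rightarrow> ('a, 'u) module \<Rightarrow> ('u \<Rightarrow> 'u) \<Rightarrow> ('a, 'u) module \<Rightarrow> ('u \<Rightarrow> 'u) \<Rightarrow> bool" where
  "is_pullback_in R \<C> B g C k C' g' B' k' \<longleftrightarrow>
     B' \<in> \<C> \<and> g' \<in> mod_hom R B' C' \<and> k' \<in> mod_hom R B' B \<and>
     compose (carrier B') g k' = compose (carrier B') k g' \<and>
     (\<forall>T \<in> \<C>. \<forall>u \<in> mod_hom R T B. \<forall>v \<in> mod_hom R T C'.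
        compose (carrier T) g u = compose (carrier T) k v \<longrightarrow>
        (\<exists>!w. w \<in> mod_hom R T B' \<and>
           compose (carrier T) k' w = u \<and> compose (carrier T) g' w = v))"

definition admissible_mono ::
  "('a, 'u) seq set \<Rightarrow> ('a, 'u) module \<Rightarrow> ('u \<Rightarrow> 'u) \<Rightarrow> ('a, 'u) module \<Rightarrow> bool" where
  "admissible_mono E A f B \<longleftrightarrow> (\<exists>g C. (A, f, B, g, C) \<in> E)"

definition admissible_epi ::
  "('a, 'u) seq set \<Rightarrow> ('a, 'u) module \<Rightarrow> ('u \<Rightarrow> 'u) \<Rightarrow> ('a, 'u) module \<Rightarrow> bool" where
  "admissible_epi E B g C \<longleftrightarrow> (\<exists>A f. (A, f, B, g, C) \<in> E)"

text \<open>
  Quillen's axioms for an exact structure \<open>E\<close> on the full additive subcategory \<open>\<C>\<close>: an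
  isomorphism-closed class of kernel-cokernel pairs such that identities are admissible monos and
  admissible epis, both classes are closed under composition, and pushouts of admissible monos and
  pullbacks of admissible epis along arbitrary morphisms exist in \<open>\<C>\<close> and are again admissible.
\<close>

definition exact_category ::
  "('a, 'r) ring_scheme \<Rightarrow> ('a, 'u) module set \<Rightarrow> ('a, 'u) seq set \<Rightarrow> bool" where
  "exact_category R \<C> E \<longleftrightarrow>
     additive_subcategory R \<C> \<and>
     (\<forall>(A, f, B, g, C) \<in> E. A \<in> \<C> \<and> B \<in> \<C> \<and> C \<in> \<C> \<and> f \<in> mod_hom R A B \<and> g \<in> mod_hom R B C \<and>
        is_kernel_in R \<C> (A, f, B, g, C) \<and> is_cokernel_in R \<C> (A, f, B, g, C)) \<and>
     (\<forall>(A, f, B, g, C) \<in> E. \<forall>A' \<in> \<C>. \<forall>B' \<in> \<C>. \<forall>C' \<in> \<C>.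
        \<forall>f' \<in> mod_hom R A' B'. \<forall>g' \<in> mod_hom R B' C'.
        \<forall>\<alpha> \<in> mod_iso R A A'. \<forall>\<beta> \<in> mod_iso R B B'. \<forall>\<gamma> \<in> mod_iso R C C'.
          compose (carrier A) \<beta> f = compose (carrier A) f' \<alpha> \<and>
          compose (carrier B) \<gamma> g = compose (carrier B) g' \<beta> \<longrightarrow> (A', f', B', g', C') \<in> E) \<and>
     (\<forall>A \<in> \<C>. admissible_mono E A (mod_id A) A) \<and>
     (\<forall>A \<in> \<C>. admissible_epi E A (mod_id A) A) \<and>
     (\<forall>A f B f' B'. admissible_mono E A f B \<and> admissible_mono E B f' B' \<longrightarrow>
        admissible_mono E A (compose (carrier A) f' f) B') \<and>
     (\<forall>B g C g' C'. admissible_epi E B g C \<and> admissible_epi E C g' C' \<longrightarrow>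
        admissible_epi E B (compose (carrier B) g' g) C') \<and>
     (\<forall>A f B. \<forall>A' \<in> \<C>. \<forall>h \<in> mod_hom R A A'. admissible_mono E A f B \<longrightarrow>
        (\<exists>f' B' h'. is_pushout_in R \<C> A f B h A' f' B' h' \<and> admissible_mono E A' f' B')) \<and>
     (\<forall>B g C. \<forall>C' \<in> \<C>. \<forall>k \<in> mod_hom R C' C. admissible_epi E B g C \<longrightarrow>
        (\<exists>g' B' k'. is_pullback_in R \<C> B g C k C' g' B' k' \<and> admissible_epi E B' g' C'))"

definition exact_subcategory ::
  "('a, 'r) ring_scheme \<Rightarrow> ('a, 'u) module set \<Rightarrow> ('a, 'u) module set \<Rightarrow> ('a, 'u) seq set \<Rightarrow> bool" where
  "exact_subcategory R \<A> \<C> E \<longleftrightarrow>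
     \<C> \<subseteq> \<A> \<and> (\<forall>M \<in> \<C>. \<forall>N \<in> \<A>. mod_iso R M N \<noteq> {} \<longrightarrow> N \<in> \<C>) \<and>
     E \<subseteq> short_exact_in R \<C> \<and> exact_category R \<C> E"


section \<open>Yoneda extensions\<close>

text \<open>An extension \<open>0 \<rightarrow> N \<rightarrow> Y \<rightarrow> M \<rightarrow> 0\<close> of \<open>M\<close> by \<open>N\<close> is the triple \<open>(Y, f, g)\<close>.\<close>

type_synonym ('a, 'u) extension = "('a, 'u) module \<times> ('u \<Rightarrow> 'u) \<times> ('u \<Rightarrow> 'u)"

definition extensions ::
  "('a, 'r) ring_scheme \<Rightarrow> ('a, 'u) module \<Rightarrow> ('a, 'u) module \<Rightarrow> ('a, 'u) extension set" where
  "extensions R M N = {(Y, f, g). (N, f, Y, g, M) \<in> short_exact R}"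

definition yoneda_equiv ::
  "('a, 'r) ring_scheme \<Rightarrow> ('a, 'u) module \<Rightarrow> ('a, 'u) module \<Rightarrow>
   (('a, 'u) extension \<times> ('a, 'u) extension) set" where
  "yoneda_equiv R M N = {((Y, f, g), (Y', f', g')).
     (Y, f, g) \<in> extensions R M N \<and> (Y', f', g') \<in> extensions R M N \<and>
     (\<exists>\<phi> \<in> mod_hom R Y Y'.
        compose (carrier N) \<phi> f = f' \<and> compose (carrier Y) g' \<phi> = g)}"

text \<open>
  The class \<open>h\<^sub>* e\<close> for \<open>h : N \<rightarrow> N'\<close> and \<open>e \<in> Ext(M, N)\<close>: its members are the extensions of \<open>M\<close>
  by \<open>N'\<close> that receive a morphism of extensions of the form \<open>(h, \<phi>, 1\<^sub>M)\<close> from a member of \<open>e\<close>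
  (the left-hand square is then a pushout).
\<close>

definition ext_push ::
  "('a, 'r) ring_scheme \<Rightarrow> ('a, 'u) module \<Rightarrow> ('a, 'u) module \<Rightarrow> ('a, 'u) module \<Rightarrow> ('u \<Rightarrow> 'u) \<Rightarrow>
   ('a, 'u) extension set \<Rightarrow> ('a, 'u) extension set" where
  "ext_push R M N N' h e = {(Y', f', g'). (Y', f', g') \<in> extensions R M N' \<and>
     (\<exists>(Y, f, g) \<in> e. \<exists>\<phi> \<in> mod_hom R Y Y'.
       compose (carrier N) \<phi> f = compose (carrier N) f' h \<and> compose (carrier Y) g' \<phi> = g)}"

text \<open>
  Dually, \<open>k\<^sup>* e\<close> for \<open>k : M' \<rightarrow> M\<close> consists of the extensions of \<open>M'\<close> by \<open>N\<close> with a morphism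
  \<open>(1\<^sub>N, \<phi>, k)\<close> to a member of \<open>e\<close> (the right-hand square is then a pullback).
\<close>

definition ext_pull ::
  "('a, 'r) ring_scheme \<Rightarrow> ('a, 'u) module \<Rightarrow> ('a, 'u) module \<Rightarrow> ('a, 'u) module \<Rightarrow> ('u \<Rightarrow> 'u) \<Rightarrow>
   ('a, 'u) extension set \<Rightarrow> ('a, 'u) extension set" where
  "ext_pull R M' M N k e = {(Y', f', g'). (Y', f', g') \<in> extensions R M' N \<and>
     (\<exists>(Y, f, g) \<in> e. \<exists>\<phi> \<in> mod_hom R Y' Y.
       compose (carrier N) \<phi> f' = f \<and> compose (carrier Y') g \<phi> = compose (carrier Y') k g')}"

definition fibre_product ::
  "('a, 'b) module \<Rightarrow> ('b \<Rightarrow> 'd) \<Rightarrow> ('a, 'c) module \<Rightarrow> ('c \<Rightarrow> 'd) \<Rightarrow> ('a, 'b \<times> 'c) module" where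
  "fibre_product Y g Y' g' =
     \<lparr>carrier = {(y, y'). y \<in> carrier Y \<and> y' \<in> carrier Y' \<and> g y = g' y'},
      monoid.mult = (\<lambda>_ _. undefined), monoid.one = undefined,
      ring.zero = (\<zero>\<^bsub>Y\<^esub>, \<zero>\<^bsub>Y'\<^esub>),
      ring.add = (\<lambda>(y, y') (z, z'). (y \<oplus>\<^bsub>Y\<^esub> z, y' \<oplus>\<^bsub>Y'\<^esub> z')),
      smult = (\<lambda>r (y, y'). (r \<odot>\<^bsub>Y\<^esub> y, r \<odot>\<^bsub>Y'\<^esub> y'))\<rparr>"

text \<open>
  The Baer sum \<open>\<nabla>\<^sub>* \<Delta>\<^sup>* (e\<^sub>1 \<oplus> e\<^sub>2)\<close>. The pullback of \<open>0 \<rightarrow> N \<oplus> N \<rightarrow> Y\<^sub>1 \<oplus> Y\<^sub>2 \<rightarrow> M \<oplus> M \<rightarrow> 0\<close> along the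
  diagonal is \<open>0 \<rightarrow> N \<oplus> N \<rightarrow> Y\<^sub>1 \<times>\<^sub>M Y\<^sub>2 \<rightarrow> M \<rightarrow> 0\<close>; the members of the sum are the extensions
  receiving from it a morphism of the form \<open>(\<nabla>, \<phi>, 1\<^sub>M)\<close>, \<open>\<nabla> (n\<^sub>1, n\<^sub>2) = n\<^sub>1 + n\<^sub>2\<close>.
\<close>

definition baer_sum ::
  "('a, 'r) ring_scheme \<Rightarrow> ('a, 'u) module \<Rightarrow> ('a, 'u) module \<Rightarrow>
   ('a, 'u) extension set \<Rightarrow> ('a, 'u) extension set \<Rightarrow> ('a, 'u) extension set" where
  "baer_sum R M N e1 e2 = {(Y, f, g). (Y, f, g) \<in> extensions R M N \<and>
     (\<exists>(Y1, f1, g1) \<in> e1. \<exists>(Y2, f2, g2) \<in> e2. \<exists>\<phi> \<in> mod_hom R (fibre_product Y1 g1 Y2 g2) Y.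
       (\<forall>n1 \<in> carrier N. \<forall>n2 \<in> carrier N. \<phi> (f1 n1, f2 n2) = f (n1 \<oplus>\<^bsub>N\<^esub> n2)) \<and>
       (\<forall>(y1, y2) \<in> carrier (fibre_product Y1 g1 Y2 g2). g (\<phi> (y1, y2)) = g1 y1))}"

definition split_extensions ::
  "('a, 'r) ring_scheme \<Rightarrow> ('a, 'u) module \<Rightarrow> ('a, 'u) module \<Rightarrow> ('a, 'u) extension set" where
  "split_extensions R M N = {(Y, f, g). (Y, f, g) \<in> extensions R M N \<and>
     (\<exists>\<sigma> \<in> mod_hom R M Y. compose (carrier M) g \<sigma> = mod_id M)}"

definition Ext1 ::
  "('a, 'r) ring_scheme \<Rightarrow> ('a, 'u) module \<Rightarrow> ('a, 'u) module \<Rightarrow>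
   ('a, ('a, 'u) extension set) module" where
  "Ext1 R M N =
     \<lparr>carrier = extensions R M N // yoneda_equiv R M N,
      monoid.mult = (\<lambda>_ _. undefined), monoid.one = undefined,
      ring.zero = split_extensions R M N,
      ring.add = baer_sum R M N,
      smult = (\<lambda>r. ext_push R M N N (\<lambda>n \<in> carrier N. r \<odot>\<^bsub>N\<^esub> n))\<rparr>"

definition Ext1_in ::
  "('a, 'r) ring_scheme \<Rightarrow> ('a, 'u) module set \<Rightarrow> ('a, 'u) module \<Rightarrow> ('a, 'u) module \<Rightarrow>
   ('a, ('a, 'u) extension set) module" where
  "Ext1_in R \<C> M N = (Ext1 R M N)
     \<lparr>carrier := {e \<in> carrier (Ext1 R M N). \<exists>(Y, f, g) \<in> e. Y \<in> \<C>}\<rparr>"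

text \<open>
  A functor \<open>\<C>\<^sup>o\<^sup>p \<times> \<C> \<rightarrow> mod R\<close> consists of modules \<open>F M N\<close> and maps
  \<open>\<Phi> M N M' N' k h : F M N \<rightarrow> F M' N'\<close> for \<open>k : M' \<rightarrow> M\<close> and \<open>h : N \<rightarrow> N'\<close>.
\<close>

type_synonym ('a, 'u, 'e) bifun_obj = "('a, 'u) module \<Rightarrow> ('a, 'u) module \<Rightarrow> ('a, 'e) module"

type_synonym ('a, 'u, 'e) bifun_map =
  "('a, 'u) module \<Rightarrow> ('a, 'u) module \<Rightarrow> ('a, 'u) module \<Rightarrow> ('a, 'u) module \<Rightarrow>
   ('u \<Rightarrow> 'u) \<Rightarrow> ('u \<Rightarrow> 'u) \<Rightarrow> 'e \<Rightarrow> 'e"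

definition bifunctor_to_mod ::
  "('a, 'r) ring_scheme \<Rightarrow> ('a, 'u) module set \<Rightarrow>
   ('a, 'u, 'e) bifun_obj \<Rightarrow> ('a, 'u, 'e) bifun_map \<Rightarrow> bool" where
  "bifunctor_to_mod R \<C> F \<Phi> \<longleftrightarrow>
     (\<forall>M \<in> \<C>. \<forall>N \<in> \<C>. F M N \<in> mod_cat R \<and> \<Phi> M N M N (mod_id M) (mod_id N) = mod_id (F M N)) \<and>
     (\<forall>M \<in> \<C>. \<forall>N \<in> \<C>. \<forall>M' \<in> \<C>. \<forall>N' \<in> \<C>. \<forall>k \<in> mod_hom R M' M. \<forall>h \<in> mod_hom R N N'.
        \<Phi> M N M' N' k h \<in> mod_hom R (F M N) (F M' N') \<and>
        (\<forall>M'' \<in> \<C>. \<forall>N'' \<in> \<C>. \<forall>k' \<in> mod_hom R M'' M'. \<forall>h' \<in> mod_hom R N' N''.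
           \<Phi> M N M'' N'' (compose (carrier M'') k k') (compose (carrier N) h' h) =
           compose (carrier (F M N)) (\<Phi> M' N' M'' N'' k' h') (\<Phi> M N M' N' k h)))"

definition Ext1_map ::
  "('a, 'r) ring_scheme \<Rightarrow> ('a, 'u, ('a, 'u) extension set) bifun_map" where
  "Ext1_map R M N M' N' k h =
     (\<lambda>e \<in> carrier (Ext1 R M N). ext_pull R M' M N' k (ext_push R M N N' h e))"

definition Ext1_in_map ::
  "('a, 'r) ring_scheme \<Rightarrow> ('a, 'u) module set \<Rightarrow> ('a, 'u, ('a, 'u) extension set) bifun_map" where
  "Ext1_in_map R \<C> M N M' N' k h = restrict (Ext1_map R M N M' N' k h) (carrier (Ext1_in R \<C> M N))"

text \<open>
  A subfunctor: each \<open>G M N\<close> is a submodule of \<open>F M N\<close>, and the inclusions are \<open>R\<close>-linear and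
  natural in both variables.
\<close>

definition subfunctor ::
  "('a, 'r) ring_scheme \<Rightarrow> ('a, 'u) module set \<Rightarrow>
   ('a, 'u, 'e) bifun_obj \<Rightarrow> ('a, 'u, 'e) bifun_map \<Rightarrow>
   ('a, 'u, 'e) bifun_obj \<Rightarrow> ('a, 'u, 'e) bifun_map \<Rightarrow> bool" where
  "subfunctor R \<C> G \<Gamma> F \<Phi> \<longleftrightarrow>
     bifunctor_to_mod R \<C> G \<Gamma> \<and> bifunctor_to_mod R \<C> F \<Phi> \<and>
     (\<forall>M \<in> \<C>. \<forall>N \<in> \<C>. submodule (carrier (G M N)) R (F M N) \<and>
        mod_id (G M N) \<in> mod_hom R (G M N) (F M N)) \<and>
     (\<forall>M \<in> \<C>. \<forall>N \<in> \<C>. \<forall>M' \<in> \<C>. \<forall>N' \<in> \<C>. \<forall>k \<in> mod_hom R M' M. \<forall>h \<in> mod_hom R N N'.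
        compose (carrier (G M N)) (\<Phi> M N M' N' k h) (mod_id (G M N)) =
        compose (carrier (G M N)) (mod_id (G M' N')) (\<Gamma> M N M' N' k h))"

end

(*
  On CM^s the multiplicity e(I, -) is additive on short exact sequences, by Hilbert-Serre, while the
  length of M / I M is only subadditive. Hence the defect length (M / I M) - e(I, M) is subadditive,
  and Ul^s consists of the modules of CM^s of defect 0. The pushout B' of 0 -> A -> B -> C -> 0 along
  A -> A' lies in the exact sequences 0 -> A' -> B' -> C -> 0 and 0 -> A -> B + A' -> B' -> 0: the
  first makes its defect nonpositive, the second nonnegative. Pullbacks, composites and Baer sums
  are treated in the same way, always comparing two sequences through the object in question.

  An extension of M by N is determined up to equivalence by the values in N that a set-theoretic
  section of Y -> M takes on the linear relations of M. The operations on Ext^1 are pointwise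
  operations on these values, so that the module axioms and functoriality are inherited from N.
  If M is finitely generated, finitely many relations decide whether an extension splits, which
  bounds Ext^1 by finitely many copies of N.
*)
theory Submission
  imports Defs Complex_Main
begin

section \<open>Submodules\<close>

text \<open>Passing to a quotient changes the type of the carrier, so an induction over M, M / a M,
  M / (a, b) M has no fixed type to run in. Hence a subquotient L / U is represented by two
  submodules U \<subseteq> L of one fixed module: length, annihilator, regularity and the
  Cohen-Macaulay condition are predicates of the pair, and dividing by a L means replacing U by U +
  a L. Associated graded modules and Rees modules likewise become sequences of pairs U n \<subseteq>
  L n, with the index as degree. One generation theorem for graded subfamilies yields both the
  Hilbert polynomial and the Artin-Rees lemma. The latter says that the filtrations of A \<subseteq>
  B by I^n A and by A \<inter> I^n B differ by a bounded shift, which is why e(I, -) is additive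
  although the length of M / I M is not. The same power n^s can serve for all of CM^s because a
  regular sequence of length s in a module of dimension at most s cuts it down to finite length,
  which bounds the growth of its Hilbert-Samuel function.\<close>

definition sub_prod ::
  "('a, 'r) ring_scheme => ('a, 'b) module => 'a set => 'b set => 'b set" where
  "sub_prod R M J L = mod_span R M {a \<odot>\<^bsub>M\<^esub> x | a x. a \<in> J \<and> x \<in> L}"

lemma ideal_smult_eq: "ideal_smult R J M = sub_prod R M J (carrier M)"
  by (simp add: ideal_smult_def sub_prod_def)

locale rmodule = module R M for R :: "('a, 'r) ring_scheme" and M :: "('a, 'c) module" (structure)
begin

abbreviation sm :: "'c set => bool" where
  "sm H \<equiv> submodule H R M"

abbreviation sm_sum :: "'c set => 'c set => 'c set" (infixl "+++" 65) where
  "A +++ B \<equiv> A <+>\<^bsub>M\<^esub> B"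

abbreviation iprod :: "'a set => 'c set => 'c set" where
  "iprod \<equiv> sub_prod R M"

abbreviation scale :: "'a => 'c set => 'c set" where
  "scale a L \<equiv> (\<lambda>x. a \<odot> x) ` L"

lemma sm_sub: "sm H ==> H \<subseteq> carrier M"
  by (rule submoduleE(1))

lemma sm_in: "sm H ==> x \<in> H ==> x \<in> carrier M"
  using sm_sub by blast

lemma sm_add: "sm H ==> x \<in> H ==> y \<in> H ==> x \<oplus> y \<in> H"
  by (rule submoduleE(5))

lemma sm_neg: "sm H ==> x \<in> H ==> \<ominus> x \<in> H"
  by (rule submoduleE(3))

lemma sm_minus: "sm H ==> x \<in> H ==> y \<in> H ==> x \<ominus> y \<in> H"
  by (simp add: a_minus_def sm_add sm_neg)

lemma sm_smult: "sm H ==> a \<in> carrier R ==> x \<in> H ==> a \<odot> x \<in> H"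
  by (rule submoduleE(4))

lemma sm_zero: "sm H ==> \<zero> \<in> H"
  using submoduleE(2) sm_smult[of H "\<zero>\<^bsub>R\<^esub>"] sm_in smult_l_null R.zero_closed by (metis ex_in_conv)

lemma smI:
  assumes "H \<subseteq> carrier M" "\<zero> \<in> H"
    and "!!x y. x \<in> H ==> y \<in> H ==> x \<oplus> y \<in> H"
    and "!!a x. a \<in> carrier R ==> x \<in> H ==> a \<odot> x \<in> H"
  shows "sm H"
proof (rule submoduleI)
  fix x assume "x \<in> H"
  then have "\<ominus> x = (\<ominus>\<^bsub>R\<^esub> \<one>\<^bsub>R\<^esub>) \<odot> x"
    using assms(1) by (subst smult_l_minus) auto
  then show "\<ominus> x \<in> H" using assms(4) \<open>x \<in> H\<close> by simp
qed (use assms in auto)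

lemma sm_add_iff: "sm H ==> x \<in> H ==> y \<in> carrier M ==> x \<oplus> y \<in> H \<longleftrightarrow> y \<in> H"
proof
  assume H: "sm H" "x \<in> H" "y \<in> carrier M" "x \<oplus> y \<in> H"
  then have "\<ominus> x \<oplus> (x \<oplus> y) \<in> H" by (meson sm_add sm_neg)
  moreover have "\<ominus> x \<oplus> (x \<oplus> y) = y"
    using H sm_in[OF H(1,2)] by (simp add: M.r_neg1)
  ultimately show "y \<in> H" by simp
qed (rule sm_add)

lemma sm_add_iff2: "sm H ==> x \<in> carrier M ==> y \<in> H ==> x \<oplus> y \<in> H \<longleftrightarrow> x \<in> H"
  using sm_add_iff[of H y x] sm_in[of H y] M.a_comm[of x y] by simp

lemma sm_carrier: "sm (carrier M)"
  by (rule carrier_is_submodule)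

lemma sm_null: "sm {\<zero>}"
  by (rule smI) auto

lemma sm_Int: "sm A ==> sm B ==> sm (A \<inter> B)"
  by (rule smI) (auto intro: sm_zero sm_add sm_smult dest: sm_in)

lemma sm_Inter: "\<A> \<noteq> {} ==> (!!A. A \<in> \<A> ==> sm A) ==> sm (\<Inter>\<A>)"
  by (rule smI) (auto intro: sm_zero sm_add sm_smult dest: sm_in)

lemma mem_sum: "x \<in> A +++ B \<longleftrightarrow> (\<exists>a\<in>A. \<exists>b\<in>B. x = a \<oplus> b)"
  by (auto simp: set_add_def')

lemma sm_sum: "sm A ==> sm B ==> sm (A +++ B)"
proof (rule smI)
  assume AB: "sm A" "sm B"
  note c = sm_in[OF AB(1)] sm_in[OF AB(2)]
  show "A +++ B \<subseteq> carrier M" using c by (auto simp: mem_sum)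
  show "\<zero> \<in> A +++ B"
    using sm_zero[OF AB(1)] sm_zero[OF AB(2)] by (force simp: mem_sum)
  fix x y assume "x \<in> A +++ B" "y \<in> A +++ B"
  then obtain a b a' b' where *: "a \<in> A" "b \<in> B" "a' \<in> A" "b' \<in> B"
    "x = a \<oplus> b" "y = a' \<oplus> b'" by (auto simp: mem_sum)
  then have "x \<oplus> y = (a \<oplus> a') \<oplus> (b \<oplus> b')"
    using c by (simp add: M.a_ac)
  then show "x \<oplus> y \<in> A +++ B" using * AB sm_add unfolding mem_sum by blast
next
  fix r x assume AB: "sm A" "sm B" and r: "r \<in> carrier R" "x \<in> A +++ B"
  note c = sm_in[OF AB(1)] sm_in[OF AB(2)]
  obtain a b where *: "a \<in> A" "b \<in> B" "x = a \<oplus> b" using r by (auto simp: mem_sum)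
  then have "r \<odot> x = r \<odot> a \<oplus> r \<odot> b" using c r by (simp add: smult_r_distr)
  then show "r \<odot> x \<in> A +++ B" using * AB r sm_smult unfolding mem_sum by blast
qed

lemma sum_upper1: "sm A ==> sm B ==> A \<subseteq> A +++ B"
  using sm_zero[of B] sm_in[of A] by (force simp: mem_sum)

lemma sum_upper2: "sm A ==> sm B ==> B \<subseteq> A +++ B"
  using sm_zero[of A] sm_in[of B] by (force simp: mem_sum)

lemma sum_least: "A \<subseteq> C ==> B \<subseteq> C ==> sm C ==> A +++ B \<subseteq> C"
  by (auto simp: mem_sum intro!: sm_add)

lemma sum_mono: "A \<subseteq> A' ==> B \<subseteq> B' ==> A +++ B \<subseteq> A' +++ B'"
  unfolding subset_iff mem_sum by blast

lemma sum_absorb1: "A \<subseteq> B ==> sm A ==> sm B ==> A +++ B = B"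
  using sum_upper2 sum_least by blast

lemma sum_absorb2: "B \<subseteq> A ==> sm A ==> sm B ==> A +++ B = A"
  using sum_upper1 sum_least by blast

lemma sum_commute: "sm A ==> sm B ==> A +++ B = B +++ A"
  by (intro equalityI sum_least sum_upper1 sum_upper2 sm_sum)

lemma sum_assoc:
  "sm A ==> sm B ==> sm C ==> (A +++ B) +++ C = A +++ (B +++ C)"
  by (intro equalityI sum_least sum_upper1 sum_upper2 sm_sum sum_mono order_refl
      order_trans[OF sum_upper1[of A B] sum_upper1[of "A +++ B" C]]
      order_trans[OF sum_upper2[of A B] sum_upper1[of "A +++ B" C]]
      order_trans[OF sum_upper1[of B C] sum_upper2[of A "B +++ C"]]
      order_trans[OF sum_upper2[of B C] sum_upper2[of A "B +++ C"]])

text \<open>Dedekind's law. It is what makes one of the two traces of a chain grow in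
  \<open>len_add\<close>, and it provides the inverse maps in \<open>len_second_iso\<close>.\<close>

lemma modular_law:
  assumes "sm A" "sm B" "sm C" "A \<subseteq> C"
  shows "(A +++ B) \<inter> C = A +++ (B \<inter> C)"
proof
  show "A +++ (B \<inter> C) \<subseteq> (A +++ B) \<inter> C"
    using assms sum_mono[of A A "B \<inter> C" B] sum_least[of A C "B \<inter> C"] by blast
  show "(A +++ B) \<inter> C \<subseteq> A +++ (B \<inter> C)"
  proof
    fix x assume "x \<in> (A +++ B) \<inter> C"
    then obtain a b where *: "a \<in> A" "b \<in> B" "x = a \<oplus> b" "x \<in> C" by (auto simp: mem_sum)
    then have "b \<in> C" using sm_add_iff[of C a b] assms sm_in[of B b] by auto
    then show "x \<in> A +++ (B \<inter> C)" using * by (auto simp: mem_sum)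
  qed
qed

lemma smult_comm:
  assumes "a \<in> carrier R" "b \<in> carrier R" "x \<in> carrier M"
  shows "a \<odot> (b \<odot> x) = b \<odot> (a \<odot> x)"
proof -
  have "(a \<otimes>\<^bsub>R\<^esub> b) \<odot> x = (b \<otimes>\<^bsub>R\<^esub> a) \<odot> x" using assms by (simp add: R.m_comm)
  then show ?thesis using assms by (simp add: smult_assoc1)
qed

lemma minus_eq_zero_iff:
  assumes "x \<in> carrier M" "y \<in> carrier M"
  shows "x \<ominus> y = \<zero> \<longleftrightarrow> x = y"
  using assms unfolding a_minus_def
  by (metis M.add.inv_closed M.add.inv_solve_right' M.l_zero M.r_neg M.zero_closed)

lemma add_minus_cancel:
  assumes "x \<in> carrier M" "y \<in> carrier M"
  shows "x \<oplus> (y \<ominus> x) = y"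
  using assms by (simp add: a_minus_def M.a_comm[of y] M.r_neg2)

lemma sm_scale: "a \<in> carrier R ==> sm L ==> sm (scale a L)"
proof (rule smI)
  assume a: "a \<in> carrier R" and L: "sm L"
  note c = sm_in[OF L]
  show "scale a L \<subseteq> carrier M" using a c by auto
  show "\<zero> \<in> scale a L" using sm_zero[OF L] a by (intro image_eqI[of _ _ "\<zero>"]) auto
  show "x \<oplus> y \<in> scale a L" if xy: "x \<in> scale a L" "y \<in> scale a L" for x y
  proof -
    obtain u v where "u \<in> L" "v \<in> L" "x = a \<odot> u" "y = a \<odot> v" using xy by blast
    then have "x \<oplus> y = a \<odot> (u \<oplus> v)" "u \<oplus> v \<in> L"
      using a c sm_add[OF L] by (simp_all add: smult_r_distr)
    then show ?thesis by blast
  qed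
  fix r x assume r: "r \<in> carrier R" "x \<in> scale a L"
  then obtain l where l: "l \<in> L" "x = a \<odot> l" by auto
  then have "r \<odot> x = a \<odot> (r \<odot> l)"
    using a r c smult_comm by simp
  then show "r \<odot> x \<in> scale a L" using l L r sm_smult by blast
qed

text \<open>The colon submodule of a and U inside L. Since it is a submodule, an inclusion of the
  form a (J L) \<subseteq> U can be checked on the generators of J L.\<close>

lemma sm_preimage:
  assumes "a \<in> carrier R" "sm L" "sm U"
  shows "sm {x \<in> L. a \<odot> x \<in> U}"
proof (rule smI)
  note c = sm_in[OF assms(2)]
  show "{x \<in> L. a \<odot> x \<in> U} \<subseteq> carrier M" using c by auto
  show "\<zero> \<in> {x \<in> L. a \<odot> x \<in> U}" using assms sm_zero by simp
  show "x \<oplus> y \<in> {x \<in> L. a \<odot> x \<in> U}"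
    if "x \<in> {x \<in> L. a \<odot> x \<in> U}" "y \<in> {x \<in> L. a \<odot> x \<in> U}" for x y
    using that assms c by (auto simp: smult_r_distr intro: sm_add)
  show "r \<odot> x \<in> {x \<in> L. a \<odot> x \<in> U}"
    if "r \<in> carrier R" "x \<in> {x \<in> L. a \<odot> x \<in> U}" for r x
  proof -
    have "a \<odot> (r \<odot> x) = r \<odot> (a \<odot> x)"
      using that assms c smult_comm by simp
    then show ?thesis using that assms by (auto intro: sm_smult)
  qed
qed

lemma sm_scale_subset: "a \<in> carrier R ==> sm L ==> scale a L \<subseteq> L"
  by (auto intro: sm_smult)

section \<open>Spans and products of scalars with submodules\<close>

lemma sm_span: "S \<subseteq> carrier M ==> sm (mod_span R M S)"
  unfolding mod_span_def by (rule sm_Inter) (use sm_carrier in auto)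

lemma span_incl: "S \<subseteq> mod_span R M S"
  unfolding mod_span_def by auto

lemma span_least: "S \<subseteq> H ==> sm H ==> mod_span R M S \<subseteq> H"
  unfolding mod_span_def by auto

lemma span_mono: "S \<subseteq> T ==> mod_span R M S \<subseteq> mod_span R M T"
  unfolding mod_span_def by auto

lemma span_insert:
  assumes "S \<subseteq> carrier M" "x \<in> carrier M"
  shows "mod_span R M (insert x S) = {r \<odot> x \<oplus> y | r y. r \<in> carrier R \<and> y \<in> mod_span R M S}"
    (is "_ = ?W")
proof
  note sp = sm_span[OF assms(1)]
  note c = sm_in[OF sp]
  have "sm ?W"
  proof (rule smI)
    show "?W \<subseteq> carrier M" using c assms by auto
    show "\<zero> \<in> ?W" using sm_zero[OF sp] assms by (force intro: exI[of _ "\<zero>\<^bsub>R\<^esub>"])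
    fix u v assume "u \<in> ?W" "v \<in> ?W"
    then obtain r y r' y' where *: "u = r \<odot> x \<oplus> y" "v = r' \<odot> x \<oplus> y'"
      "r \<in> carrier R" "r' \<in> carrier R" "y \<in> mod_span R M S" "y' \<in> mod_span R M S" by blast
    then have "u \<oplus> v = (r \<oplus>\<^bsub>R\<^esub> r') \<odot> x \<oplus> (y \<oplus> y')"
      using c assms by (simp add: smult_l_distr M.a_ac)
    then show "u \<oplus> v \<in> ?W" using * sm_add[OF sp] by blast
  next
    fix a u assume a: "a \<in> carrier R" "u \<in> ?W"
    then obtain r y where *: "u = r \<odot> x \<oplus> y" "r \<in> carrier R" "y \<in> mod_span R M S" by blast
    then have "a \<odot> u = (a \<otimes>\<^bsub>R\<^esub> r) \<odot> x \<oplus> a \<odot> y"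
      using a c assms by (simp add: smult_r_distr smult_assoc1)
    then show "a \<odot> u \<in> ?W" using * a sm_smult[OF sp] by blast
  qed
  moreover have "insert x S \<subseteq> ?W"
  proof
    fix z assume "z \<in> insert x S"
    then consider "z = x" | "z \<in> S" by auto
    then show "z \<in> ?W"
    proof cases
      case 1
      then have "z = \<one>\<^bsub>R\<^esub> \<odot> x \<oplus> \<zero>" using assms by simp
      then show ?thesis using sm_zero[OF sp] by blast
    next
      case 2
      then have "z = \<zero>\<^bsub>R\<^esub> \<odot> x \<oplus> z" "z \<in> mod_span R M S" using assms span_incl by auto
      then show ?thesis by blast
    qed
  qed
  ultimately show "mod_span R M (insert x S) \<subseteq> ?W" using span_least by blast
  have s: "sm (mod_span R M (insert x S))" using assms by (intro sm_span) auto
  have "x \<in> mod_span R M (insert x S)" using span_incl by blast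
  moreover have "mod_span R M S \<subseteq> mod_span R M (insert x S)" by (rule span_mono) auto
  ultimately show "?W \<subseteq> mod_span R M (insert x S)" using sm_smult[OF s] sm_add[OF s] by blast
qed

lemma sm_iprod: "J \<subseteq> carrier R ==> L \<subseteq> carrier M ==> sm (iprod J L)"
  unfolding sub_prod_def by (rule sm_span) auto

lemma iprod_mem: "a \<in> J ==> x \<in> L ==> a \<odot> x \<in> iprod J L"
  unfolding sub_prod_def by (rule subsetD[OF span_incl]) auto

lemma iprod_least:
  "(!!a x. a \<in> J ==> x \<in> L ==> a \<odot> x \<in> W) ==> sm W ==> iprod J L \<subseteq> W"
  unfolding sub_prod_def by (rule span_least) auto

lemma iprod_mono: "J \<subseteq> J' ==> L \<subseteq> L' ==> iprod J L \<subseteq> iprod J' L'"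
  unfolding sub_prod_def by (rule span_mono) auto

lemma iprod_subset: "J \<subseteq> carrier R ==> sm L ==> iprod J L \<subseteq> L"
  by (rule iprod_least) (auto intro: sm_smult)

lemma iprod_empty: "iprod {} L = {\<zero>}"
  unfolding sub_prod_def using span_least[of "{}" "{\<zero>}"] sm_null sm_zero[OF sm_span[of "{}"]] by auto

text \<open>Removes one element from a set of scalars; both the induction over graded families and
  the recursion along a regular sequence use it.\<close>

lemma iprod_insert:
  assumes "x \<in> carrier R" "X \<subseteq> carrier R" "sm L"
  shows "iprod (insert x X) L = scale x L +++ iprod X L"
proof
  have s: "sm (scale x L)" "sm (iprod X L)" "sm (iprod (insert x X) L)"
    using assms sm_sub by (auto intro!: sm_scale sm_iprod)
  show "iprod (insert x X) L \<subseteq> scale x L +++ iprod X L"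
  proof (rule iprod_least)
    show "sm (scale x L +++ iprod X L)" using s sm_sum by blast
    show "a \<odot> l \<in> scale x L +++ iprod X L" if "a \<in> insert x X" "l \<in> L" for a l
      using that sum_upper1[OF s(1,2)] sum_upper2[OF s(1,2)] iprod_mem[of a X l L] by auto
  qed
  show "scale x L +++ iprod X L \<subseteq> iprod (insert x X) L"
    using s by (intro sum_least iprod_mono) (auto intro: iprod_mem)
qed

text \<open>For fixed x the scalars a with a x \<in> X L form an ideal, which contains the ideal
  generated by X once it contains X. In this way an ideal acts through finitely many
  generators.\<close>

lemma iprod_idl:
  assumes "X \<subseteq> carrier R" "sm L"
  shows "iprod (Idl\<^bsub>R\<^esub> X) L = iprod X L"
proof
  have s: "sm (iprod X L)" using assms sm_sub by (intro sm_iprod) auto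
  show "iprod X L \<subseteq> iprod (Idl\<^bsub>R\<^esub> X) L"
    using assms by (intro iprod_mono R.genideal_self) auto
  show "iprod (Idl\<^bsub>R\<^esub> X) L \<subseteq> iprod X L"
  proof (rule iprod_least[OF _ s])
    fix a x assume a: "a \<in> Idl\<^bsub>R\<^esub> X" and x: "x \<in> L"
    have xc: "x \<in> carrier M" using x assms sm_in by blast
    have "ideal {a \<in> carrier R. a \<odot> x \<in> iprod X L} R"
    proof (rule idealI)
      show "ring R" ..
      show "subgroup {a \<in> carrier R. a \<odot> x \<in> iprod X L} (add_monoid R)"
        using xc sm_zero[OF s] sm_add[OF s] sm_neg[OF s]
        by (auto simp: subgroup_def smult_l_distr smult_l_minus a_inv_def[symmetric])
      fix a r assume "a \<in> {a \<in> carrier R. a \<odot> x \<in> iprod X L}" "r \<in> carrier R"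
      then show "r \<otimes>\<^bsub>R\<^esub> a \<in> {a \<in> carrier R. a \<odot> x \<in> iprod X L}"
        "a \<otimes>\<^bsub>R\<^esub> r \<in> {a \<in> carrier R. a \<odot> x \<in> iprod X L}"
        using xc sm_smult[OF s] by (auto simp: smult_assoc1 R.m_comm[of a r])
    qed
    moreover have "X \<subseteq> {a \<in> carrier R. a \<odot> x \<in> iprod X L}"
      using assms iprod_mem x by auto
    ultimately show "a \<odot> x \<in> iprod X L" using a R.genideal_minimal by blast
  qed
qed

text \<open>For a \<in> I the colon submodule of all x with a x \<in> (I J) L contains the products
  b y that generate J L. The opposite inclusion is an induction over the construction of
  \<open>ideal_prod\<close>.\<close>

lemma iprod_ideal_prod:
  assumes "ideal I R" "ideal J R" "sm L"
  shows "iprod (ideal_prod R I J) L = iprod I (iprod J L)"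
proof
  have c: "I \<subseteq> carrier R" "J \<subseteq> carrier R" "ideal_prod R I J \<subseteq> carrier R"
    using assms ideal.Icarr R.ideal_prod_in_carrier by fast+
  have s: "sm (iprod J L)" using assms c sm_sub by (intro sm_iprod) auto
  have s2: "sm (iprod I (iprod J L))" using c s sm_sub by (intro sm_iprod) auto
  have s3: "sm (iprod (ideal_prod R I J) L)" using c assms sm_sub by (intro sm_iprod) auto
  show "iprod (ideal_prod R I J) L \<subseteq> iprod I (iprod J L)"
  proof (rule iprod_least[OF _ s2])
    fix a x assume "a \<in> ideal_prod R I J" and x: "x \<in> L"
    then have "a \<in> carrier R \<and> a \<odot> x \<in> iprod I (iprod J L)"
    proof (induction a rule: ideal_prod.induct)
      case (prod i j)
      then have "i \<otimes>\<^bsub>R\<^esub> j \<odot> x = i \<odot> (j \<odot> x)"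
        using c sm_in[OF assms(3)] by (simp add: smult_assoc1 subsetD)
      then show ?case using prod c by (auto intro!: iprod_mem)
    next
      case (sum s1 s2)
      then show ?case using sm_in[OF assms(3)] by (auto simp: smult_l_distr intro: sm_add[OF s2])
    qed
    then show "a \<odot> x \<in> iprod I (iprod J L)" ..
  qed
  show "iprod I (iprod J L) \<subseteq> iprod (ideal_prod R I J) L"
  proof (rule iprod_least[OF _ s3])
    fix a x assume a: "a \<in> I" and x: "x \<in> iprod J L"
    have ac: "a \<in> carrier R" using a c by auto
    have "iprod J L \<subseteq> {x \<in> iprod J L. a \<odot> x \<in> iprod (ideal_prod R I J) L}"
    proof (rule iprod_least[OF _ sm_preimage[OF ac s s3]])
      fix b y assume b: "b \<in> J" and y: "y \<in> L"
      have "a \<odot> (b \<odot> y) = (a \<otimes>\<^bsub>R\<^esub> b) \<odot> y"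
        using a b y c sm_in[OF assms(3)] by (simp add: smult_assoc1 subsetD)
      also have "\<dots> \<in> iprod (ideal_prod R I J) L"
        using a b y by (intro iprod_mem ideal_prod.prod)
      finally show "b \<odot> y \<in> {x \<in> iprod J L. a \<odot> x \<in> iprod (ideal_prod R I J) L}"
        using b y iprod_mem by auto
    qed
    then show "a \<odot> x \<in> iprod (ideal_prod R I J) L" using x by auto
  qed
qed

lemma iprod_carrier: "sm L ==> iprod (carrier R) L = L"
  using iprod_subset[of "carrier R" L] iprod_mem[of "\<one>\<^bsub>R\<^esub>" "carrier R" _ L] sm_in[of L] by fastforce

lemma iprod_sum:
  assumes "J \<subseteq> carrier R" "sm A" "sm B"
  shows "iprod J (A +++ B) = iprod J A +++ iprod J B"
proof
  have s: "sm (iprod J A)" "sm (iprod J B)" "sm (iprod J (A +++ B))"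
    using assms sm_sub sm_sum[OF assms(2,3)] by (auto intro!: sm_iprod)
  show "iprod J (A +++ B) \<subseteq> iprod J A +++ iprod J B"
  proof (rule iprod_least[OF _ sm_sum[OF s(1,2)]])
    fix a x assume *: "a \<in> J" "x \<in> A +++ B"
    then obtain u v where "u \<in> A" "v \<in> B" "x = u \<oplus> v" by (auto simp: mem_sum)
    moreover from this have "a \<odot> x = a \<odot> u \<oplus> a \<odot> v"
      using * assms sm_in[of A] sm_in[of B] by (auto intro!: smult_r_distr)
    ultimately show "a \<odot> x \<in> iprod J A +++ iprod J B"
      using * unfolding mem_sum by (blast intro: iprod_mem)
  qed
  show "iprod J A +++ iprod J B \<subseteq> iprod J (A +++ B)"
    using s assms by (intro sum_least iprod_mono sum_upper1 sum_upper2 order_refl) auto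
qed

lemma scale_sum:
  assumes "a \<in> carrier R" "sm A" "sm B"
  shows "scale a (A +++ B) = scale a A +++ scale a B"
proof -
  have "a \<odot> (u \<oplus> v) = a \<odot> u \<oplus> a \<odot> v" if "u \<in> A" "v \<in> B" for u v
    using that assms sm_in[of A] sm_in[of B] by (auto intro!: smult_r_distr)
  then show ?thesis by (force simp: mem_sum image_iff)
qed

end

subsection \<open>Homomorphisms\<close>

lemma mod_homD:
  assumes "f \<in> mod_hom R M N"
  shows "x \<in> carrier M ==> f x \<in> carrier N"
    and "x \<in> carrier M ==> y \<in> carrier M ==> f (x \<oplus>\<^bsub>M\<^esub> y) = f x \<oplus>\<^bsub>N\<^esub> f y"
    and "r \<in> carrier R ==> x \<in> carrier M ==> f (r \<odot>\<^bsub>M\<^esub> x) = r \<odot>\<^bsub>N\<^esub> f x"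
    and "f \<in> extensional (carrier M)"
  using assms by (auto simp: mod_hom_def PiE_iff)

lemma mod_homI:
  assumes "!!x. x \<in> carrier M ==> f x \<in> carrier N" "f \<in> extensional (carrier M)"
    and "!!x y. x \<in> carrier M ==> y \<in> carrier M ==> f (x \<oplus>\<^bsub>M\<^esub> y) = f x \<oplus>\<^bsub>N\<^esub> f y"
    and "!!r x. r \<in> carrier R ==> x \<in> carrier M ==> f (r \<odot>\<^bsub>M\<^esub> x) = r \<odot>\<^bsub>N\<^esub> f x"
  shows "f \<in> mod_hom R M N"
  using assms by (auto simp: mod_hom_def PiE_iff)

lemma module_cring: "module R M ==> cring R"
  by (simp add: module_def)

lemma mod_hom_restrictI:
  assumes "module R M"
    and "!!x. x \<in> carrier M ==> f x \<in> carrier N"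
    and "!!x y. x \<in> carrier M ==> y \<in> carrier M ==> f (x \<oplus>\<^bsub>M\<^esub> y) = f x \<oplus>\<^bsub>N\<^esub> f y"
    and "!!r x. r \<in> carrier R ==> x \<in> carrier M ==> f (r \<odot>\<^bsub>M\<^esub> x) = r \<odot>\<^bsub>N\<^esub> f x"
  shows "(\<lambda>x \<in> carrier M. f x) \<in> mod_hom R M N"
proof -
  interpret M: rmodule R M by (rule rmodule.intro) fact
  show ?thesis by (rule mod_homI) (use assms in auto)
qed

lemma mod_hom_zero:
  assumes "module R M" "module R N" "f \<in> mod_hom R M N"
  shows "f \<zero>\<^bsub>M\<^esub> = \<zero>\<^bsub>N\<^esub>"
proof -
  interpret M: rmodule R M by (rule rmodule.intro) fact
  interpret N: rmodule R N by (rule rmodule.intro) fact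
  have "f (\<zero>\<^bsub>R\<^esub> \<odot>\<^bsub>M\<^esub> \<zero>\<^bsub>M\<^esub>) = \<zero>\<^bsub>R\<^esub> \<odot>\<^bsub>N\<^esub> f \<zero>\<^bsub>M\<^esub>"
    by (rule mod_homD(3)[OF assms(3)]) auto
  then show ?thesis using mod_homD(1)[OF assms(3)] by simp
qed

lemma mod_hom_neg:
  assumes "module R M" "module R N" "f \<in> mod_hom R M N" "x \<in> carrier M"
  shows "f (\<ominus>\<^bsub>M\<^esub> x) = \<ominus>\<^bsub>N\<^esub> f x"
proof -
  interpret M: rmodule R M by (rule rmodule.intro) fact
  interpret N: rmodule R N by (rule rmodule.intro) fact
  have "f ((\<ominus>\<^bsub>R\<^esub> \<one>\<^bsub>R\<^esub>) \<odot>\<^bsub>M\<^esub> x) = (\<ominus>\<^bsub>R\<^esub> \<one>\<^bsub>R\<^esub>) \<odot>\<^bsub>N\<^esub> f x"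
    by (rule mod_homD(3)[OF assms(3)]) (use assms in auto)
  then show ?thesis using mod_homD(1)[OF assms(3,4)] assms(4)
    by (simp add: M.smult_l_minus N.smult_l_minus)
qed

lemma mod_hom_minus:
  assumes "module R M" "module R N" "f \<in> mod_hom R M N" "x \<in> carrier M" "y \<in> carrier M"
  shows "f (x \<ominus>\<^bsub>M\<^esub> y) = f x \<ominus>\<^bsub>N\<^esub> f y"
proof -
  interpret M: rmodule R M by (rule rmodule.intro) fact
  show ?thesis
    using assms by (simp add: a_minus_def mod_homD(2)[OF assms(3)] mod_hom_neg)
qed

lemma mod_hom_inj_on:
  assumes "module R M" "module R N" "f \<in> mod_hom R M N"
    and "!!x. x \<in> carrier M ==> f x = \<zero>\<^bsub>N\<^esub> ==> x = \<zero>\<^bsub>M\<^esub>"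
  shows "inj_on f (carrier M)"
proof (rule inj_onI)
  interpret M: rmodule R M by (rule rmodule.intro) fact
  interpret N: rmodule R N by (rule rmodule.intro) fact
  fix x y assume *: "x \<in> carrier M" "y \<in> carrier M" "f x = f y"
  then have "f (x \<ominus>\<^bsub>M\<^esub> y) = \<zero>\<^bsub>N\<^esub>"
    using assms mod_homD(1)[OF assms(3)] by (simp add: mod_hom_minus[OF assms(1,2,3)] N.minus_eq_zero_iff)
  then show "x = y" using assms(4)[of "x \<ominus>\<^bsub>M\<^esub> y"] * M.minus_eq_zero_iff by simp
qed

lemma mod_hom_image_sm:
  assumes "module R M" "module R N" "f \<in> mod_hom R M N" "submodule H R M"
  shows "submodule (f ` H) R N"
proof -
  interpret M: rmodule R M by (rule rmodule.intro) fact
  interpret N: rmodule R N by (rule rmodule.intro) fact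
  note h = mod_homD[OF assms(3)] and c = M.sm_in[OF assms(4)]
  show ?thesis
  proof (rule N.smI)
    show "f ` H \<subseteq> carrier N" using c h by auto
    show "\<zero>\<^bsub>N\<^esub> \<in> f ` H"
      using mod_hom_zero[OF assms(1-3)] M.sm_zero[OF assms(4)] by force
    show "x \<oplus>\<^bsub>N\<^esub> y \<in> f ` H" if "x \<in> f ` H" "y \<in> f ` H" for x y
      using that c by (auto simp: h(2)[symmetric] M.sm_add[OF assms(4)])
    show "r \<odot>\<^bsub>N\<^esub> x \<in> f ` H" if "r \<in> carrier R" "x \<in> f ` H" for r x
      using that c by (auto simp: h(3)[symmetric] M.sm_smult[OF assms(4)])
  qed
qed

lemma mod_hom_preimage_sm:
  assumes "module R M" "module R N" "f \<in> mod_hom R M N" "submodule L R M" "submodule U R N"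
  shows "submodule {x \<in> L. f x \<in> U} R M"
proof -
  interpret M: rmodule R M by (rule rmodule.intro) fact
  interpret N: rmodule R N by (rule rmodule.intro) fact
  note h = mod_homD[OF assms(3)] and c = M.sm_in[OF assms(4)]
  show ?thesis
    by (rule M.smI)
      (use c h in \<open>auto intro: M.sm_add[OF assms(4)] N.sm_add[OF assms(5)] M.sm_smult[OF assms(4)]
        N.sm_smult[OF assms(5)] M.sm_zero[OF assms(4)]
        simp: mod_hom_zero[OF assms(1-3)] N.sm_zero[OF assms(5)]\<close>)
qed

lemma mod_hom_span:
  assumes "module R M" "module R N" "f \<in> mod_hom R M N" "S \<subseteq> carrier M"
  shows "f ` mod_span R M S = mod_span R N (f ` S)"
proof
  interpret M: rmodule R M by (rule rmodule.intro) fact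
  interpret N: rmodule R N by (rule rmodule.intro) fact
  have s: "submodule (mod_span R N (f ` S)) R N"
    using assms mod_homD(1)[OF assms(3)] by (intro N.sm_span) auto
  have "mod_span R M S \<subseteq> {x \<in> carrier M. f x \<in> mod_span R N (f ` S)}"
    using assms N.span_incl[of "f ` S"]
    by (intro M.span_least mod_hom_preimage_sm[OF assms(1-3) M.sm_carrier s]) auto
  then show "f ` mod_span R M S \<subseteq> mod_span R N (f ` S)" by auto
  show "mod_span R N (f ` S) \<subseteq> f ` mod_span R M S"
    using assms M.span_incl[of S]
    by (intro N.span_least mod_hom_image_sm[OF assms(1-3)] M.sm_span) auto
qed

lemma mod_hom_sub_prod:
  assumes "module R M" "module R N" "f \<in> mod_hom R M N" "J \<subseteq> carrier R" "L \<subseteq> carrier M"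
  shows "f ` sub_prod R M J L = sub_prod R N J (f ` L)"
proof -
  interpret M: rmodule R M by (rule rmodule.intro) fact
  have "f ` {a \<odot>\<^bsub>M\<^esub> x | a x. a \<in> J \<and> x \<in> L} = {a \<odot>\<^bsub>N\<^esub> x | a x. a \<in> J \<and> x \<in> f ` L}" (is "f ` ?A = ?B")
  proof
    show "f ` ?A \<subseteq> ?B" using assms mod_homD(3)[OF assms(3)] by blast
    show "?B \<subseteq> f ` ?A"
    proof
      fix z assume "z \<in> ?B"
      then obtain a x where "a \<in> J" "x \<in> L" "z = a \<odot>\<^bsub>N\<^esub> f x" by auto
      then have "z = f (a \<odot>\<^bsub>M\<^esub> x)" "a \<odot>\<^bsub>M\<^esub> x \<in> ?A" using assms(4,5) by (auto simp: mod_homD(3)[OF assms(3)] subset_iff)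
      then show "z \<in> f ` ?A" by blast
    qed
  qed
  moreover have "?A \<subseteq> carrier M" using assms by auto
  ultimately show ?thesis
    unfolding sub_prod_def by (simp add: mod_hom_span[OF assms(1-3)])
qed

subsection \<open>Noetherian modules\<close>

locale noetherian_module = rmodule +
  assumes sm_fin_gen: "submodule H R M ==> \<exists>S. finite S \<and> S \<subseteq> H \<and> mod_span R M S = H"
begin

text \<open>The union of a chain is a submodule whose finitely many generators lie in one member of
  the chain, so it is that member, and Zorn's lemma applies.\<close>

lemma sm_maximal:
  assumes "\<S> \<noteq> {}" "!!H. H \<in> \<S> ==> sm H"
  shows "\<exists>W\<in>\<S>. \<forall>V\<in>\<S>. W \<subseteq> V --> V = W"
proof (rule subset_Zorn)
  fix C assume C: "subset.chain \<S> C"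
  then have CS: "C \<subseteq> \<S>" and tot: "!!A B. A \<in> C ==> B \<in> C ==> A \<subseteq> B \<or> B \<subseteq> A"
    by (auto simp: subset_chain_def)
  show "\<exists>U\<in>\<S>. \<forall>X\<in>C. X \<subseteq> U"
  proof (cases "C = {}")
    case False
    have C_sm: "sm A" if "A \<in> C" for A using that CS assms(2) by auto
    have "sm (\<Union>C)"
    proof (rule smI)
      show "\<Union>C \<subseteq> carrier M" using C_sm sm_sub by blast
      show "\<zero> \<in> \<Union>C" using False C_sm sm_zero by blast
      fix x y assume "x \<in> \<Union>C" "y \<in> \<Union>C"
      then obtain A B where *: "A \<in> C" "B \<in> C" "x \<in> A" "y \<in> B" by auto
      with tot[of A B] obtain D where "D \<in> C" "x \<in> D" "y \<in> D" by blast
      then show "x \<oplus> y \<in> \<Union>C" using C_sm sm_add by blast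
    next
      fix r x assume "r \<in> carrier R" "x \<in> \<Union>C"
      then show "r \<odot> x \<in> \<Union>C" using sm_smult[OF C_sm] by (meson Union_iff)
    qed
    from sm_fin_gen[OF this] obtain S where S: "finite S" "S \<subseteq> \<Union>C" "mod_span R M S = \<Union>C"
      by blast
    then obtain W where W: "W \<in> C" "S \<subseteq> W"
      using finite_subset_Union_chain[OF S(1,2) False C] by blast
    then have "\<Union>C = W" using S(3) span_least[OF W(2) C_sm[OF W(1)]] by blast
    then show ?thesis using W CS by blast
  qed (use assms in auto)
qed

lemma sm_chain_stable:
  fixes H :: "nat => 'c set"
  assumes "!!n. sm (H n)" "!!n. H n \<subseteq> H (Suc n)"
  shows "\<exists>n. \<forall>m\<ge>n. H m = H n"
proof -
  obtain n where n: "\<forall>V\<in>range H. H n \<subseteq> V --> V = H n"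
    using sm_maximal[of "range H"] assms(1) by blast
  have "H m = H n" if "m \<ge> n" for m
    using n lift_Suc_mono_le[of H, OF assms(2) that] by blast
  then show ?thesis by blast
qed

end

text \<open>The argument of Hilbert's basis theorem, by induction on a finite set S whose span
  contains H. When x is added to S, the coefficients of x in the elements of H form an ideal of R;
  lifts of its generators, together with generators of the part of H in the span of S, generate
  H.\<close>

lemma noetherian_moduleI:
  fixes R :: "('a, 'r) ring_scheme" (structure) and M :: "('a, 'c) module"
  assumes N: "noetherian_ring R" and M: "module R M" and fg: "fin_gen R M"
  shows "noetherian_module R M"
proof -
  interpret rmodule R M by (rule rmodule.intro) fact
  interpret N: noetherian_ring R by fact
  have main: "\<exists>T. finite T \<and> T \<subseteq> H \<and> mod_span R M T = H"
    if "finite S" "S \<subseteq> carrier M" "sm H" "H \<subseteq> mod_span R M S" for S H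
    using that
  proof (induction S arbitrary: H rule: finite_induct)
    case empty
    then have "H = {\<zero>\<^bsub>M\<^esub>}" using span_least[of "{}", OF _ sm_null] sm_zero by blast
    then have "mod_span R M {} = H" using span_least[of "{}" H] empty sm_zero[OF sm_span[of "{}"]] by auto
    then show ?case by (intro exI[of _ "{}"]) auto
  next
    case (insert x S)
    have xS: "x \<in> carrier M" "S \<subseteq> carrier M" using insert by auto
    define K where "K = mod_span R M S"
    have K: "sm K" unfolding K_def using xS sm_span by blast
    \<comment> \<open>All possible coefficients are collected, because x may depend linearly on S
      and one element of W may then have several.\<close>
    define lead where "lead W = {r \<in> carrier R. \<exists>w\<in>W. \<exists>k\<in>K. w = r \<odot>\<^bsub>M\<^esub> x \<oplus>\<^bsub>M\<^esub> k}" for W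
    have lead: "ideal (lead W) R" if W: "sm W" for W
    proof (rule idealI)
      show "ring R" ..
      have add: "r \<oplus> s \<in> lead W" if rs: "r \<in> lead W" "s \<in> lead W" for r s
      proof -
        from rs obtain w k w' k' where *: "r \<in> carrier R" "w \<in> W" "k \<in> K" "w = r \<odot>\<^bsub>M\<^esub> x \<oplus>\<^bsub>M\<^esub> k"
          "s \<in> carrier R" "w' \<in> W" "k' \<in> K" "w' = s \<odot>\<^bsub>M\<^esub> x \<oplus>\<^bsub>M\<^esub> k'" unfolding lead_def by blast
        then have "w \<oplus>\<^bsub>M\<^esub> w' = (r \<oplus> s) \<odot>\<^bsub>M\<^esub> x \<oplus>\<^bsub>M\<^esub> (k \<oplus>\<^bsub>M\<^esub> k')"
          using xS sm_in[OF K] by (simp add: smult_l_distr M.a_ac)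
        then show ?thesis unfolding lead_def using * sm_add[OF W] sm_add[OF K] by blast
      qed
      have mult: "a \<otimes> r \<in> lead W" if ar: "a \<in> carrier R" "r \<in> lead W" for a r
      proof -
        from ar obtain w k where *: "r \<in> carrier R" "w \<in> W" "k \<in> K" "w = r \<odot>\<^bsub>M\<^esub> x \<oplus>\<^bsub>M\<^esub> k"
          unfolding lead_def by blast
        then have "a \<odot>\<^bsub>M\<^esub> w = (a \<otimes> r) \<odot>\<^bsub>M\<^esub> x \<oplus>\<^bsub>M\<^esub> a \<odot>\<^bsub>M\<^esub> k"
          using xS ar sm_in[OF K] by (simp add: smult_r_distr smult_assoc1)
        then show ?thesis unfolding lead_def using * ar sm_smult[OF W] sm_smult[OF K] by blast
      qed
      have zero: "\<zero> \<in> lead W"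
      proof -
        have "\<zero>\<^bsub>M\<^esub> = \<zero> \<odot>\<^bsub>M\<^esub> x \<oplus>\<^bsub>M\<^esub> \<zero>\<^bsub>M\<^esub>" using xS by simp
        then show ?thesis unfolding lead_def using sm_zero[OF W] sm_zero[OF K] R.zero_closed by blast
      qed
      have c: "lead W \<subseteq> carrier R" unfolding lead_def by auto
      have neg: "\<ominus> r \<in> lead W" if "r \<in> lead W" for r
        using mult[of "\<ominus> \<one>" r] that c by (simp add: R.l_minus subset_iff)
      show "subgroup (lead W) (add_monoid R)"
        using c zero add neg by (auto simp: subgroup_def a_inv_def[symmetric])
      fix a r assume "a \<in> lead W" "r \<in> carrier R"
      then show "r \<otimes> a \<in> lead W" "a \<otimes> r \<in> lead W"
        using mult[of r a] c by (auto simp: R.m_comm[of a r] subset_iff)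
    qed
    obtain A where A: "A \<subseteq> carrier R" "finite A" "lead H = Idl A"
      using N.finetely_gen[OF lead[OF insert(5)]] by blast
    then have "A \<subseteq> lead H" using R.genideal_self by blast
    then have "\<forall>r\<in>A. \<exists>h. h \<in> H \<and> (\<exists>k\<in>K. h = r \<odot>\<^bsub>M\<^esub> x \<oplus>\<^bsub>M\<^esub> k)" unfolding lead_def by blast
    then obtain h where h: "\<forall>r\<in>A. h r \<in> H \<and> (\<exists>k\<in>K. h r = r \<odot>\<^bsub>M\<^esub> x \<oplus>\<^bsub>M\<^esub> k)" by metis
    obtain T where T: "finite T" "T \<subseteq> H \<inter> K" "mod_span R M T = H \<inter> K"
      using insert.IH[OF xS(2), of "H \<inter> K"] sm_Int[OF insert(5) K] K_def by auto
    define W where "W = mod_span R M (T \<union> h ` A)"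
    have TA: "T \<union> h ` A \<subseteq> H" using T h by auto
    then have "T \<union> h ` A \<subseteq> carrier M" using sm_sub[OF insert(5)] by blast
    then have W: "sm W" "W \<subseteq> H"
      unfolding W_def using sm_span span_least[OF TA insert(5)] by blast+
    have "H \<inter> K \<subseteq> W" unfolding W_def T(3)[symmetric] by (rule span_mono) auto
    have "A \<subseteq> lead W"
      using h A(1) span_incl[of "T \<union> h ` A"] unfolding lead_def W_def by blast
    then have lead_sub: "lead H \<subseteq> lead W" using A(3) R.genideal_minimal[OF lead[OF W(1)]] by auto
    \<comment> \<open>By the inclusion of the coefficient ideals some w \<in> W has the same
      coefficient of x as y, so that y - w lies in H \<inter> K \<subseteq> W.\<close>
    have "H \<subseteq> W"
    proof
      fix y assume y: "y \<in> H"
      then obtain r k where rk: "r \<in> carrier R" "k \<in> K" "y = r \<odot>\<^bsub>M\<^esub> x \<oplus>\<^bsub>M\<^esub> k"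
        using insert(6) unfolding span_insert[OF xS(2,1)] K_def by blast
      then have "r \<in> lead W" using y lead_sub unfolding lead_def by blast
      then obtain w k' where w: "w \<in> W" "k' \<in> K" "w = r \<odot>\<^bsub>M\<^esub> x \<oplus>\<^bsub>M\<^esub> k'" unfolding lead_def by blast
      have yc: "y \<in> carrier M" "w \<in> carrier M" "k \<in> carrier M" "k' \<in> carrier M"
        using y w rk sm_in[OF insert(5)] sm_in[OF W(1)] sm_in[OF K] by auto
      have e: "y = w \<oplus>\<^bsub>M\<^esub> (k \<ominus>\<^bsub>M\<^esub> k')"
        unfolding rk(3) w(3) using yc \<open>r \<in> carrier R\<close> xS
        by (simp add: M.a_assoc add_minus_cancel M.minus_closed)
      have "k \<ominus>\<^bsub>M\<^esub> k' \<in> H" using e y w W sm_add_iff[OF insert(5), of w "k \<ominus>\<^bsub>M\<^esub> k'"] yc by auto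
      then have "k \<ominus>\<^bsub>M\<^esub> k' \<in> W" using sm_minus[OF K rk(2) w(2)] \<open>H \<inter> K \<subseteq> W\<close> by auto
      then show "y \<in> W" using e w sm_add[OF W(1)] by simp
    qed
    then have "mod_span R M (T \<union> h ` A) = H" using W unfolding W_def by blast
    then show ?case using T A TA by (intro exI[of _ "T \<union> h ` A"]) auto
  qed
  obtain S where S: "finite S" "S \<subseteq> carrier M" "mod_span R M S = carrier M"
    using fg unfolding fin_gen_def by blast
  show ?thesis
  proof unfold_locales
    fix H assume H: "sm H"
    then show "\<exists>S. finite S \<and> S \<subseteq> H \<and> mod_span R M S = H"
      using main[OF S(1,2) H] S(3) sm_sub[OF H] by simp
  qed
qed

section \<open>Length\<close>

definition sub_chain ::
  "('a, 'r) ring_scheme => ('a, 'b) module => 'b set => 'b set => nat => (nat => 'b set) => bool" where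
  "sub_chain R M U L n H \<longleftrightarrow>
     (\<forall>i\<le>n. submodule (H i) R M \<and> U \<subseteq> H i \<and> H i \<subseteq> L) \<and> (\<forall>i<n. H i \<subset> H (Suc i))"

text \<open>The length of L / U for submodules U \<subseteq> L. It takes values in
  \<open>enat\<close>, so that additivity can be proved before any finiteness is known.\<close>

definition sub_len :: "('a, 'r) ring_scheme => ('a, 'b) module => 'b set => 'b set => enat" where
  "sub_len R M U L = Sup {enat n | n. \<exists>H. sub_chain R M U L n H}"

lemma sub_chain_ge: "sub_chain R M U L n H ==> enat n \<le> sub_len R M U L"
  unfolding sub_len_def by (rule Sup_upper) auto

lemma sub_chain_restrict: "sub_chain R M U L n H ==> m \<le> n ==> sub_chain R M U L m H"
  unfolding sub_chain_def by auto

text \<open>For n = 0 a chain may fail to exist: if U is not contained in L, the set of lengths is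
  empty and its supremum is still 0.\<close>

lemma sub_len_geE:
  assumes "enat n \<le> sub_len R M U L" "n > 0"
  obtains H where "sub_chain R M U L n H"
proof -
  have "\<exists>m\<ge>n. \<exists>H. sub_chain R M U L m H"
  proof (rule ccontr)
    assume *: "\<not> ?thesis"
    have "sub_len R M U L \<le> enat (n - 1)"
      unfolding sub_len_def
    proof (rule Sup_least)
      fix x assume "x \<in> {enat n | n. \<exists>H. sub_chain R M U L n H}"
      then obtain m where "x = enat m" "\<not> m \<ge> n" using * by auto
      then show "x \<le> enat (n - 1)" by simp
    qed
    then show False using assms by (metis enat_ord_simps(1) order_trans diff_less not_le zero_less_one)
  qed
  then show ?thesis using sub_chain_restrict that by blast
qed

text \<open>Lets an inequality of lengths be tested on chains of finite positive length, whether or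
  not the lengths themselves are finite.\<close>

lemma enat_leI: "(!!n. enat n \<le> a ==> n > 0 ==> enat n \<le> b) ==> a \<le> b"
proof (cases a)
  case (enat n)
  then show "(!!n. enat n \<le> a ==> n > 0 ==> enat n \<le> b) ==> a \<le> b"
    by (cases "n = 0") (auto simp: zero_enat_def[symmetric])
next
  case infinity
  assume *: "!!n. enat n \<le> a ==> n > 0 ==> enat n \<le> b"
  show "a \<le> b"
  proof (cases b)
    case (enat m)
    then show ?thesis using *[of "Suc m"] infinity by simp
  qed auto
qed

text \<open>A strictly monotone map between intervals of submodules carries chains to chains of the
  same length.\<close>

lemma sub_len_map_le:
  assumes "!!W. submodule W R M ==> U \<subseteq> W ==> W \<subseteq> L ==>
      submodule (\<phi> W) R N \<and> U' \<subseteq> \<phi> W \<and> \<phi> W \<subseteq> L'"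
    and "!!V W. submodule V R M ==> submodule W R M ==> U \<subseteq> V ==> V \<subset> W ==> W \<subseteq> L ==> \<phi> V \<subset> \<phi> W"
  shows "sub_len R M U L \<le> sub_len R N U' L'"
proof (rule enat_leI)
  fix n :: nat assume "enat n \<le> sub_len R M U L" "n > 0"
  then obtain H where H: "sub_chain R M U L n H" by (rule sub_len_geE)
  have "sub_chain R N U' L' n (\<lambda>i. \<phi> (H i))"
    unfolding sub_chain_def
  proof (intro conjI allI impI)
    fix i assume "i \<le> n"
    then show "submodule (\<phi> (H i)) R N" "U' \<subseteq> \<phi> (H i)" "\<phi> (H i) \<subseteq> L'"
      using assms(1)[of "H i"] H unfolding sub_chain_def by auto
  next
    fix i assume "i < n"
    then show "\<phi> (H i) \<subset> \<phi> (H (Suc i))"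
      using assms(2)[of "H i" "H (Suc i)"] H unfolding sub_chain_def by auto
  qed
  then show "enat n \<le> sub_len R N U' L'" by (rule sub_chain_ge)
qed

lemma sub_len_mono: "U' \<subseteq> U ==> L \<subseteq> L' ==> sub_len R M U L \<le> sub_len R M U' L'"
  by (rule sub_len_map_le[where \<phi> = "\<lambda>W. W"]) auto

context rmodule
begin

abbreviation len :: "'c set => 'c set => enat" where
  "len \<equiv> sub_len R M"

lemma len_strict:
  assumes "sm U" "sm W'" "U \<subseteq> W" "W \<subset> W'" "enat n \<le> len U W" "sm W"
  shows "enat (Suc n) \<le> len U W'"
proof -
  obtain H where H: "sub_chain R M U W n H"
  proof (cases "n = 0")
    case True
    then have "sub_chain R M U W n (\<lambda>_. U)" using assms by (auto simp: sub_chain_def)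
    then show ?thesis by (rule that)
  qed (use assms sub_len_geE that in blast)
  have "sub_chain R M U W' (Suc n) (\<lambda>i. if i \<le> n then H i else W')"
    unfolding sub_chain_def
  proof (intro conjI allI impI)
    fix i assume "i \<le> Suc n"
    have "i \<le> n ==> sm (H i) \<and> U \<subseteq> H i \<and> H i \<subseteq> W" using H unfolding sub_chain_def by blast
    then show "sm (if i \<le> n then H i else W')" "U \<subseteq> (if i \<le> n then H i else W')"
      "(if i \<le> n then H i else W') \<subseteq> W'" using assms by auto
  next
    fix i assume "i < Suc n"
    moreover have "i < n ==> H i \<subset> H (Suc i)" "H n \<subseteq> W" using H unfolding sub_chain_def by blast+
    ultimately show "(if i \<le> n then H i else W') \<subset> (if Suc i \<le> n then H (Suc i) else W')"
      using assms(4) by (cases "i = n") auto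
  qed
  then show ?thesis by (rule sub_chain_ge)
qed

lemma len_eSuc:
  assumes "sm U" "sm W'" "U \<subseteq> W" "W \<subset> W'" "sm W"
  shows "eSuc (len U W) \<le> len U W'"
proof (rule enat_leI)
  fix n assume n: "enat n \<le> eSuc (len U W)" "n > 0"
  then obtain m where m: "n = Suc m" by (cases n) auto
  then have "enat m \<le> len U W" using n by (metis eSuc_enat eSuc_ile_mono)
  then show "enat n \<le> len U W'" using len_strict assms m by blast
qed

text \<open>Along a chain H from U to L at least one of H k \<inter> V and H k + V grows strictly at
  each step: if both stayed the same, the modular law would give H (Suc k) = H k. Conversely, a
  chain from U to V and one from V to L can be concatenated.\<close>

lemma len_add:
  assumes "sm U" "sm V" "sm L" "U \<subseteq> V" "V \<subseteq> L"
  shows "len U L = len U V + len V L"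
proof (rule antisym)
  show "len U L \<le> len U V + len V L"
  proof (rule enat_leI)
    fix n assume "enat n \<le> len U L" "n > 0"
    then obtain H where H: "sub_chain R M U L n H" by (rule sub_len_geE)
    have "enat k \<le> len U (H k \<inter> V) + len V (H k +++ V)" if "k \<le> n" for k
      using that
    proof (induction k)
      case (Suc k)
      have h: "sm (H k)" "sm (H (Suc k))" "U \<subseteq> H k" "U \<subseteq> H (Suc k)" "H k \<subset> H (Suc k)"
        using H Suc.prems unfolding sub_chain_def by auto
      have IH: "enat k \<le> len U (H k \<inter> V) + len V (H k +++ V)" using Suc by simp
      note s = sm_Int[OF h(1) assms(2)] sm_Int[OF h(2) assms(2)] sm_sum[OF h(1) assms(2)] sm_sum[OF h(2) assms(2)]
      have sub: "H k \<inter> V \<subseteq> H (Suc k) \<inter> V" "H k +++ V \<subseteq> H (Suc k) +++ V"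
        using h(5) sum_mono[of "H k" "H (Suc k)" V V] by blast+
      have Uk: "U \<subseteq> H k \<inter> V" using h assms by auto
      have Vk: "V \<subseteq> H k +++ V" using h assms sum_upper2 by blast
      show ?case
      proof (cases "H k \<inter> V = H (Suc k) \<inter> V")
        case False
        then have "eSuc (len U (H k \<inter> V)) \<le> len U (H (Suc k) \<inter> V)"
          using sub s Uk assms by (intro len_eSuc) auto
        then have "eSuc (len U (H k \<inter> V)) + len V (H k +++ V)
            \<le> len U (H (Suc k) \<inter> V) + len V (H (Suc k) +++ V)"
          using sub by (intro add_mono sub_len_mono) auto
        moreover have "enat (Suc k) \<le> eSuc (len U (H k \<inter> V)) + len V (H k +++ V)"
          using IH by (metis eSuc_enat eSuc_ile_mono iadd_Suc)
        ultimately show ?thesis by (rule order_trans[rotated])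
      next
        case True
        have "H k +++ V \<noteq> H (Suc k) +++ V"
        proof
          assume eq: "H k +++ V = H (Suc k) +++ V"
          have "H (Suc k) = (H (Suc k) +++ V) \<inter> H (Suc k)"
            using sum_upper1[OF h(2) assms(2)] by blast
          also have "\<dots> = (H k +++ V) \<inter> H (Suc k)" by (simp add: eq)
          also have "\<dots> = H k +++ (V \<inter> H (Suc k))" using h assms by (intro modular_law) auto
          also have "\<dots> = H k +++ (V \<inter> H k)" using True by (simp add: Int_commute)
          also have "\<dots> = H k" using h s assms by (intro sum_absorb2) (auto simp: Int_commute)
          finally show False using h by simp
        qed
        then have "eSuc (len V (H k +++ V)) \<le> len V (H (Suc k) +++ V)"
          using sub s Vk assms by (intro len_eSuc) auto
        then have "len U (H k \<inter> V) + eSuc (len V (H k +++ V))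
            \<le> len U (H (Suc k) \<inter> V) + len V (H (Suc k) +++ V)"
          using sub by (intro add_mono sub_len_mono) auto
        moreover have "enat (Suc k) \<le> len U (H k \<inter> V) + eSuc (len V (H k +++ V))"
          using IH by (metis eSuc_enat eSuc_ile_mono iadd_Suc_right)
        ultimately show ?thesis by (rule order_trans[rotated])
      qed
    qed (simp add: zero_enat_def[symmetric])
    from this[of n] have "enat n \<le> len U (H n \<inter> V) + len V (H n +++ V)" by simp
    also have "\<dots> \<le> len U V + len V L"
    proof (intro add_mono sub_len_mono order_refl)
      show "H n +++ V \<subseteq> L" using H assms by (intro sum_least) (auto simp: sub_chain_def)
    qed auto
    finally show "enat n \<le> len U V + len V L" .
  qed
  show "len U V + len V L \<le> len U L"
  proof (rule enat_leI)
    fix n assume n: "enat n \<le> len U V + len V L" "n > 0"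
    have concat: "enat (i + j) \<le> len U L" if ij: "enat i \<le> len U V" "enat j \<le> len V L" for i j
    proof (cases "j = 0")
      case True
      then show ?thesis using ij sub_len_mono[of U U V L R M] assms by (auto intro: order_trans)
    next
      case False
      then obtain G where G: "sub_chain R M V L j G" using ij(2) by (metis sub_len_geE gr0I)
      have "enat (i + k) \<le> len U (G k)" if "k \<le> j" for k
        using that
      proof (induction k)
        case 0
        have "V \<subseteq> G 0" using G unfolding sub_chain_def by auto
        then show ?case using ij sub_len_mono[of U U V "G 0" R M] by (auto intro: order_trans)
      next
        case (Suc k)
        have "sm (G k)" "sm (G (Suc k))" "V \<subseteq> G k" "G k \<subset> G (Suc k)"
          using G Suc.prems unfolding sub_chain_def by auto
        then show ?case using len_strict[of U "G (Suc k)" "G k" "i + k"] Suc assms by auto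
      qed
      then have "enat (i + j) \<le> len U (G j)" by simp
      moreover have "len U (G j) \<le> len U L" using G by (intro sub_len_mono) (auto simp: sub_chain_def)
      ultimately show ?thesis by (rule order_trans)
    qed
    \<comment> \<open>Divides n between the two lengths: an infinite one can take all of n,
      otherwise the first takes min n a.\<close>
    obtain i j where "n = i + j" "enat i \<le> len U V" "enat j \<le> len V L"
    proof (cases "len U V")
      case infinity
      then show ?thesis using that[of n 0] by (auto simp: zero_enat_def[symmetric])
    next
      case (enat a)
      show ?thesis
      proof (cases "len V L")
        case infinity
        then show ?thesis using that[of 0 n] by (auto simp: zero_enat_def[symmetric])
      next
        case (enat b)
        then show ?thesis using \<open>len U V = enat a\<close> n that[of "min n a" "n - min n a"] by auto
      qed
    qed
    then show "enat n \<le> len U L" using concat by blast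
  qed
qed

lemma len_refl: "len U U = 0"
proof -
  have "len U U \<le> 0"
  proof (rule enat_leI)
    fix n assume "enat n \<le> len U U" "n > 0"
    then obtain H where H: "sub_chain R M U U n H" by (rule sub_len_geE)
    then have "H 0 = U" "H (Suc 0) = U" "H 0 \<subset> H (Suc 0)"
      using \<open>n > 0\<close> unfolding sub_chain_def by (metis Suc_leI antisym le0, metis Suc_leI antisym, metis)
    then show "enat n \<le> 0" by simp
  qed
  then show ?thesis by simp
qed

text \<open>By the modular law W \<mapsto> W + B and W \<mapsto> W \<inter> A are mutually inverse
  between the two intervals.\<close>

lemma len_second_iso:
  assumes "sm A" "sm B"
  shows "len (A \<inter> B) A = len B (A +++ B)"
proof (rule antisym)
  note sAB = sm_Int[OF assms] sm_sum[OF assms]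
  have inv1: "(W +++ B) \<inter> A = W" if "sm W" "A \<inter> B \<subseteq> W" "W \<subseteq> A" for W
  proof -
    have "(W +++ B) \<inter> A = W +++ (B \<inter> A)" using that assms by (intro modular_law) auto
    also have "\<dots> = W" using that sAB by (intro sum_absorb2) (auto simp: Int_commute)
    finally show ?thesis .
  qed
  have inv2: "(W \<inter> A) +++ B = W" if "sm W" "B \<subseteq> W" "W \<subseteq> A +++ B" for W
  proof -
    have "W = (B +++ A) \<inter> W" using that sum_commute[OF assms] by auto
    also have "\<dots> = B +++ (A \<inter> W)" using that assms by (intro modular_law) auto
    also have "\<dots> = (W \<inter> A) +++ B" using that assms sum_commute sm_Int by (simp add: Int_commute)
    finally show ?thesis by simp
  qed
  show "len (A \<inter> B) A \<le> len B (A +++ B)"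
  proof (rule sub_len_map_le[where \<phi> = "\<lambda>W. W +++ B"])
    fix W assume W: "sm W" "A \<inter> B \<subseteq> W" "W \<subseteq> A"
    then show "sm (W +++ B) \<and> B \<subseteq> W +++ B \<and> W +++ B \<subseteq> A +++ B"
      using assms sm_sum sum_upper2 sum_mono[of W A B B] by auto
  next
    fix V W assume *: "sm V" "sm W" "A \<inter> B \<subseteq> V" "V \<subset> W" "W \<subseteq> A"
    have "(V +++ B) \<inter> A = V" "(W +++ B) \<inter> A = W" by (rule inv1; use * in blast)+
    then have "V +++ B \<noteq> W +++ B" using *(4) by (metis less_irrefl)
    then show "V +++ B \<subset> W +++ B" using sum_mono[of V W B B] * by auto
  qed
  show "len B (A +++ B) \<le> len (A \<inter> B) A"
  proof (rule sub_len_map_le[where \<phi> = "\<lambda>W. W \<inter> A"])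
    fix W assume W: "sm W" "B \<subseteq> W" "W \<subseteq> A +++ B"
    then show "sm (W \<inter> A) \<and> A \<inter> B \<subseteq> W \<inter> A \<and> W \<inter> A \<subseteq> A"
      using assms sm_Int by auto
  next
    fix V W assume *: "sm V" "sm W" "B \<subseteq> V" "V \<subset> W" "W \<subseteq> A +++ B"
    have "(V \<inter> A) +++ B = V" "(W \<inter> A) +++ B = W" by (rule inv2; use * in blast)+
    then have "V \<inter> A \<noteq> W \<inter> A" using *(4) by (metis less_irrefl)
    then show "V \<inter> A \<subset> W \<inter> A" using * by auto
  qed
qed

end

text \<open>Image and preimage under f are strictly monotone between the intervals belonging to L
  and to f L. The second isomorphism theorem then allows for a U' that is not contained in f
  L.\<close>

lemma sub_len_hom:
  assumes M: "module R M" and N: "module R N" and f: "f \<in> mod_hom R M N"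
    and L: "submodule L R M" and U: "submodule U' R N"
  shows "sub_len R M {x \<in> L. f x \<in> U'} L = sub_len R N U' (f ` L <+>\<^bsub>N\<^esub> U')"
proof -
  interpret M: rmodule R M by (rule rmodule.intro) fact
  interpret N: rmodule R N by (rule rmodule.intro) fact
  note h = mod_homD[OF f] and c = M.sm_in[OF L]
  have fL: "submodule (f ` L) R N" by (rule mod_hom_image_sm[OF M N f L])
  have UU: "submodule (f ` L \<inter> U') R N" using N.sm_Int[OF fL U] .
  have "sub_len R M {x \<in> L. f x \<in> U'} L = sub_len R N (f ` L \<inter> U') (f ` L)"
  proof (rule antisym)
    show "sub_len R M {x \<in> L. f x \<in> U'} L \<le> sub_len R N (f ` L \<inter> U') (f ` L)"
    proof (rule sub_len_map_le[where \<phi> = "\<lambda>W. f ` W"])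
      fix W assume W: "submodule W R M" "{x \<in> L. f x \<in> U'} \<subseteq> W" "W \<subseteq> L"
      show "submodule (f ` W) R N \<and> f ` L \<inter> U' \<subseteq> f ` W \<and> f ` W \<subseteq> f ` L"
        using mod_hom_image_sm[OF M N f W(1)] W by auto
    next
      fix V W assume *: "submodule V R M" "submodule W R M" "{x \<in> L. f x \<in> U'} \<subseteq> V" "V \<subset> W" "W \<subseteq> L"
      have "f ` W \<noteq> f ` V"
      proof
        assume eq: "f ` W = f ` V"
        obtain w where w: "w \<in> W" "w \<notin> V" using * by auto
        then obtain v where v: "v \<in> V" "f w = f v" using eq by (metis imageE imageI)
        have cc: "w \<in> carrier M" "v \<in> carrier M" "w \<in> L" "v \<in> L" using w v * c by auto
        have "f (w \<ominus>\<^bsub>M\<^esub> v) = \<zero>\<^bsub>N\<^esub>"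
          using cc v h(1) by (simp add: mod_hom_minus[OF M N f] N.minus_eq_zero_iff)
        then have "w \<ominus>\<^bsub>M\<^esub> v \<in> V"
          using *(3) M.sm_minus[OF L cc(3,4)] N.sm_zero[OF U] by auto
        then have "v \<oplus>\<^bsub>M\<^esub> (w \<ominus>\<^bsub>M\<^esub> v) \<in> V" using v M.sm_add[OF *(1)] by auto
        then show False using w cc by (simp add: M.add_minus_cancel)
      qed
      then show "f ` V \<subset> f ` W" using * by auto
    qed
    show "sub_len R N (f ` L \<inter> U') (f ` L) \<le> sub_len R M {x \<in> L. f x \<in> U'} L"
    proof (rule sub_len_map_le[where \<phi> = "\<lambda>W. {x \<in> L. f x \<in> W}"])
      fix W assume W: "submodule W R N" "f ` L \<inter> U' \<subseteq> W" "W \<subseteq> f ` L"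
      then show "submodule {x \<in> L. f x \<in> W} R M \<and> {x \<in> L. f x \<in> U'} \<subseteq> {x \<in> L. f x \<in> W} \<and>
          {x \<in> L. f x \<in> W} \<subseteq> L"
        using mod_hom_preimage_sm[OF M N f L W(1)] by auto
    qed auto
  qed
  then show ?thesis using N.len_second_iso[OF fL U] by simp
qed

context rmodule
begin

lemma scale_hom: "a \<in> carrier R ==> (\<lambda>x\<in>carrier M. a \<odot> x) \<in> mod_hom R M M"
  by (rule mod_hom_restrictI[OF module_axioms]) (auto simp: smult_r_distr smult_comm)

text \<open>Multiplication by a from L to M / U has image (a L + U) / U, and its kernel is the colon
  submodule. The Hilbert-Serre recursion and the growth estimate both rest on this equality.\<close>

lemma len_scale:
  assumes "a \<in> carrier R" "sm L" "sm U"
  shows "len {x \<in> L. a \<odot> x \<in> U} L = len U (scale a L +++ U)"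
proof -
  let ?f = "\<lambda>x\<in>carrier M. a \<odot> x"
  have "{x \<in> L. ?f x \<in> U} = {x \<in> L. a \<odot> x \<in> U}" "?f ` L = scale a L"
    using sm_in[OF assms(2)] by (auto intro!: image_cong)
  then show ?thesis
    using sub_len_hom[OF module_axioms module_axioms scale_hom[OF assms(1)] assms(2,3)] by simp
qed

end

section \<open>Graded families of submodules\<close>

context rmodule
begin

text \<open>Such a sequence is a graded module over the polynomial ring in the variables X, where x
  \<in> X acts as multiplication by x together with a shift of the degree.\<close>

definition graded :: "'a set => (nat => 'c set) => bool" where
  "graded X L \<longleftrightarrow> (\<forall>n. sm (L n)) \<and> (\<forall>n. \<forall>x\<in>X. \<forall>l\<in>L n. x \<odot> l \<in> L (Suc n))"

text \<open>Finite generation of L / U over the polynomial ring: in a Noetherian module each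
  component is finitely generated, so only a bound on the degrees of generators is left to
  require.\<close>

definition eventually_generated :: "'a set => (nat => 'c set) => (nat => 'c set) => bool" where
  "eventually_generated X U L \<longleftrightarrow> (\<exists>n0. \<forall>n\<ge>n0. L (Suc n) \<subseteq> iprod X (L n) +++ U (Suc n))"

text \<open>The graded submodule U + x L. Multiplication by x raises the degree, so nothing is added
  in degree 0.\<close>

definition add_shift :: "'a => (nat => 'c set) => (nat => 'c set) => nat => 'c set" where
  "add_shift x U L n = (case n of 0 => U 0 | Suc m => U (Suc m) +++ scale x (L m))"

lemma gradedD: "graded X L ==> sm (L n)" "graded X L ==> x \<in> X ==> l \<in> L n ==> x \<odot> l \<in> L (Suc n)"
  by (auto simp: graded_def)

lemma graded_subset: "graded X L ==> Y \<subseteq> X ==> graded Y L"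
  by (auto simp: graded_def)

lemma graded_iprod: "graded X L ==> iprod X (L n) \<subseteq> L (Suc n)"
  by (rule iprod_least) (auto simp: graded_def)

lemma add_shift:
  assumes "graded (insert x X) U" "graded (insert x X) L" "!!n. U n \<subseteq> L n" "insert x X \<subseteq> carrier R"
  shows "graded X (add_shift x U L)" "U n \<subseteq> add_shift x U L n" "add_shift x U L n \<subseteq> L n"
proof -
  have s: "sm (scale x (L n))" "sm (U n)" "sm (L n)" for n
    using assms by (auto intro: sm_scale gradedD)
  have sm: "sm (add_shift x U L n)" for n
    using s by (auto simp: add_shift_def intro!: sm_sum split: nat.split)
  show "U n \<subseteq> add_shift x U L n"
    using s by (auto simp: add_shift_def split: nat.split intro: subsetD[OF sum_upper1])
  show "add_shift x U L n \<subseteq> L n"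
  proof (cases n)
    case (Suc m)
    have "scale x (L m) \<subseteq> L n" using gradedD(2)[OF assms(2)] Suc by auto
    then show ?thesis
      using Suc assms(3) s sum_least[of "U n" "L n" "scale x (L m)"] by (simp add: add_shift_def)
  qed (use assms(3) in \<open>simp add: add_shift_def\<close>)
  show "graded X (add_shift x U L)"
    unfolding graded_def
  proof (intro conjI allI ballI)
    fix n y l assume y: "y \<in> X" and l: "l \<in> add_shift x U L n"
    have yc: "y \<in> carrier R" "x \<in> carrier R" using y assms by auto
    have U: "u \<in> U n ==> y \<odot> u \<in> U (Suc n)" for u n using gradedD(2)[OF assms(1)] y by auto
    have L: "u \<in> L n ==> y \<odot> u \<in> L (Suc n)" for u n using gradedD(2)[OF assms(2)] y by auto
    have up: "U (Suc n) \<subseteq> add_shift x U L (Suc n)" for n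
      using s sum_upper1 by (auto simp: add_shift_def)
    show "y \<odot> l \<in> add_shift x U L (Suc n)"
    proof (cases n)
      case 0
      then show ?thesis using l U up by (auto simp: add_shift_def)
    next
      case (Suc m)
      then obtain u k where uk: "u \<in> U n" "k \<in> L m" "l = u \<oplus> x \<odot> k"
        using l by (auto simp: add_shift_def mem_sum)
      have c: "u \<in> carrier M" "k \<in> carrier M" using uk s sm_in by blast+
      have "y \<odot> l = y \<odot> u \<oplus> x \<odot> (y \<odot> k)"
        using uk c yc by (simp add: smult_r_distr smult_comm)
      moreover have "y \<odot> u \<in> U (Suc n)" "y \<odot> k \<in> L n" using uk U L Suc by auto
      ultimately show ?thesis by (auto simp: add_shift_def mem_sum)
    qed
  qed (rule sm)
qed

lemma add_shift_generated:
  assumes "graded (insert x X) U" "graded (insert x X) L" "!!n. U n \<subseteq> L n" "insert x X \<subseteq> carrier R"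
    and "eventually_generated (insert x X) U L"
  shows "eventually_generated X (add_shift x U L) L"
proof -
  obtain n0 where n0: "!!n. n \<ge> n0 ==> L (Suc n) \<subseteq> iprod (insert x X) (L n) +++ U (Suc n)"
    using assms(5) by (auto simp: eventually_generated_def)
  have "L (Suc n) \<subseteq> iprod X (L n) +++ add_shift x U L (Suc n)" if "n \<ge> n0" for n
  proof -
    have s: "sm (scale x (L n))" "sm (U (Suc n))" "sm (L n)" "sm (iprod X (L n))"
      using assms sm_sub by (auto intro!: sm_scale sm_iprod intro: gradedD)
    have "L (Suc n) \<subseteq> (scale x (L n) +++ iprod X (L n)) +++ U (Suc n)"
      using n0[OF that] assms s by (simp add: iprod_insert)
    also have "\<dots> = iprod X (L n) +++ (U (Suc n) +++ scale x (L n))"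
      using sum_commute[OF s(1,4)] sum_assoc[OF s(4,1,2)] sum_commute[OF s(1,2)] by metis
    finally show ?thesis by (simp add: add_shift_def)
  qed
  then show ?thesis by (auto simp: eventually_generated_def)
qed

end

text \<open>
  The graded version of Hilbert's basis theorem: with \<open>t\<^sup>n\<close> marking degrees, \<open>L / U\<close> is a finitely
  generated graded module over the polynomial ring in the variables \<open>X\<close>, and \<open>K / U\<close> is a graded
  submodule. The induction removes the variable \<open>x\<close> by passing to \<open>L / (U + x L)\<close> and to the images
  there of the submodules \<open>K : x\<^sup>j\<close>.
\<close>

theorem (in noetherian_module) graded_submodule_generated:
  assumes "finite X" "X \<subseteq> carrier R" "graded X U" "graded X L" "graded X K"
    and "!!n. U n \<subseteq> K n" "!!n. K n \<subseteq> L n" "eventually_generated X U L"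
  shows "eventually_generated X U K"
  using assms
proof (induction X arbitrary: U L K rule: finite_induct)
  case empty
  obtain n0 where "!!n. n \<ge> n0 ==> L (Suc n) \<subseteq> iprod {} (L n) +++ U (Suc n)"
    using empty by (auto simp: eventually_generated_def)
  then show ?case
    using empty by (fastforce simp: eventually_generated_def iprod_empty)
next
  case (insert x X)
  note gU = insert.prems(2) and gL = insert.prems(3) and gK = insert.prems(4)
  note UK = insert.prems(5) and KL = insert.prems(6)
  have xc: "x \<in> carrier R" "X \<subseteq> carrier R" using insert by auto
  have UL: "U n \<subseteq> L n" for n using UK KL by blast
  define V where "V = add_shift x U L"
  note as = add_shift[OF gU gL UL insert.prems(1), folded V_def]
  have egV: "eventually_generated X V L"
    unfolding V_def using add_shift_generated[OF gU gL UL insert.prems(1,7)] .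
  have sU: "sm (U n)" and sL: "sm (L n)" and sK: "sm (K n)" and sV: "sm (V n)" for n
    using gU gL gK as(1) gradedD(1) by blast+
  define xp where "xp j = x [^]\<^bsub>R\<^esub> j" for j :: nat
  have xp: "xp j \<in> carrier R" "xp 0 = \<one>\<^bsub>R\<^esub>" for j using xc by (auto simp: xp_def)
  \<comment> \<open>The elements of degree n that x^j moves into K; the product has degree n + j.
    Raising j enlarges C j.\<close>
  define C where "C j n = {m \<in> L n. xp j \<odot> m \<in> K (n + j)}" for j :: nat and n
  have sC: "sm (C j n)" for j n unfolding C_def using xp sL sK by (intro sm_preimage) auto
  have CL: "C j n \<subseteq> L n" for j n unfolding C_def by auto
  have Lc: "l \<in> L n ==> l \<in> carrier M" for l n using sL sm_in by blast
  have powS: "xp (Suc j) \<odot> m = xp j \<odot> (x \<odot> m)" if "m \<in> carrier M" for j :: nat and m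
    using that xc by (simp add: smult_assoc1 xp_def)
  have powS': "xp (Suc j) \<odot> m = x \<odot> (xp j \<odot> m)" if "m \<in> carrier M" for j :: nat and m
    using that xc xp powS[OF that] by (simp add: smult_comm)
  have CLd: "l \<in> C j n ==> l \<in> L n" and Cc: "l \<in> C j n ==> l \<in> carrier M" for l j n
    using CL Lc by blast+
  have C_mono: "C j n \<subseteq> C (Suc j) n" for j n
    using gradedD(2)[OF gK, of x] Lc by (auto simp: C_def powS')
  have gC: "graded X (C j)" for j
    unfolding graded_def
  proof (intro conjI allI ballI)
    fix n y l assume y: "y \<in> X" and l: "l \<in> C j n"
    have "xp j \<odot> (y \<odot> l) = y \<odot> (xp j \<odot> l)"
      using y l xp xc Cc by (intro smult_comm) auto
    moreover have "y \<odot> (xp j \<odot> l) \<in> K (Suc (n + j))"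
      using gradedD(2)[OF gK] y l by (auto simp: C_def)
    ultimately show "y \<odot> l \<in> C j (Suc n)"
      using gradedD(2)[OF gL] y l by (auto simp: C_def)
  qed (rule sC)
  \<comment> \<open>The image of C j in L / V, where V = U + x L. There x acts as zero, so the
    induction hypothesis for X applies to each Q j and to their union J.\<close>
  define Q where "Q j n = C j n +++ V n" for j n
  have sQ: "sm (Q j n)" for j n unfolding Q_def using sC sV sm_sum by blast
  have Q_mono: "Q j n \<subseteq> Q (Suc j) n" for j n unfolding Q_def using C_mono by (intro sum_mono) auto
  have Q_mono': "i \<le> j ==> Q i n \<subseteq> Q j n" for i j n by (rule lift_Suc_mono_le[of "\<lambda>j. Q j n", OF Q_mono])
  have gQ: "y \<odot> l \<in> Q j (Suc n)" if y: "y \<in> X" and l: "l \<in> Q j n" for y l j n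
  proof -
    obtain a b where ab: "a \<in> C j n" "b \<in> V n" "l = a \<oplus> b" using l unfolding Q_def mem_sum by blast
    then have "y \<odot> l = y \<odot> a \<oplus> y \<odot> b"
      using y xc sm_in[OF sC] sm_in[OF sV] by (auto intro!: smult_r_distr)
    then show ?thesis
      unfolding Q_def mem_sum using gradedD(2)[OF gC y ab(1)] gradedD(2)[OF as(1) y ab(2)] by blast
  qed
  have QL: "Q j n \<subseteq> L n" for j n unfolding Q_def using CL as(3) sL by (intro sum_least) auto
  have VQ: "V n \<subseteq> Q j n" for j n unfolding Q_def using sC sV sum_upper2 by blast
  have egQ: "eventually_generated X V (Q j)" for j
  proof (rule insert.IH[OF xc(2) as(1) graded_subset[OF gL] _ VQ QL egV])
    show "graded X (Q j)" unfolding graded_def using sQ gQ by blast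
  qed auto
  define J where "J n = (\<Union>j. Q j n)" for n
  have "\<exists>j. \<forall>i\<ge>j. Q i n = Q j n" for n by (rule sm_chain_stable[of "\<lambda>j. Q j n", OF sQ Q_mono])
  then obtain jn where jn: "!!n i. i \<ge> jn n ==> Q i n = Q (jn n) n" by metis
  have Jn: "J n = Q i n" if "i \<ge> jn n" for i n
  proof -
    have "Q k n \<subseteq> Q i n" for k
      using Q_mono'[of k "max k i" n] jn[of n "max k i"] jn[OF that] that by auto
    then show ?thesis unfolding J_def by blast
  qed
  have sJ: "sm (J n)" for n using Jn[of n "jn n"] sQ by simp
  have "eventually_generated X V J"
  proof (rule insert.IH[OF xc(2) as(1) graded_subset[OF gL] _ _ _ egV])
    show "graded X J" unfolding graded_def using sJ gQ unfolding J_def by blast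
    show "V n \<subseteq> J n" "J n \<subseteq> L n" for n using VQ QL unfolding J_def by blast+
  qed auto
  then obtain n1 where n1: "!!n. n \<ge> n1 ==> J (Suc n) \<subseteq> iprod X (J n) +++ V (Suc n)"
    by (auto simp: eventually_generated_def)
  \<comment> \<open>The stage at which Q j n becomes constant depends on n. Since J is generated
    from degrees up to n1, the maximum over these degrees is a uniform stage.\<close>
  define j0 where "j0 = Max (jn ` {..n1})"
  have J_eq: "J n = Q j0 n" for n
  proof (induction n)
    case (Suc n)
    show ?case
    proof (cases "Suc n \<le> n1")
      case False
      then have "J (Suc n) \<subseteq> iprod X (Q j0 n) +++ V (Suc n)" using n1[of n] Suc by simp
      also have "\<dots> \<subseteq> Q j0 (Suc n)"
        using gQ VQ sQ by (intro sum_least iprod_least) auto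
      finally show ?thesis by (auto simp: J_def)
    qed (rule Jn, auto simp: j0_def)
  qed (rule Jn, auto simp: j0_def)
  have "\<exists>n0. \<forall>n\<ge>n0. Q j (Suc n) \<subseteq> iprod X (Q j n) +++ V (Suc n)" for j
    using egQ[of j] by (simp add: eventually_generated_def)
  then obtain nj where nj: "!!j n. n \<ge> nj j ==> Q j (Suc n) \<subseteq> iprod X (Q j n) +++ V (Suc n)"
    by metis
  define N where "N = Max (nj ` {..j0})"
  have N: "nj j \<le> N" if "j \<le> j0" for j using that by (auto simp: N_def)
  \<comment> \<open>The part of degree Suc k of (x, X) K + U; the claim is K (Suc k) \<subseteq> G k
    for all large k.\<close>
  define G where "G k = iprod (insert x X) (K k) +++ U (Suc k)" for k
  have sKc: "K k \<subseteq> carrier M" for k using sK sm_sub by blast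
  have siK: "sm (iprod (insert x X) (K k))" for k using insert.prems(1) sKc by (intro sm_iprod)
  have sG: "sm (G k)" for k unfolding G_def using siK sU sm_sum by blast
  have G1: "iprod (insert x X) (K k) \<subseteq> G k" and G2: "U (Suc k) \<subseteq> G k" for k
    unfolding G_def using siK sU sum_upper1 sum_upper2 by blast+
  have G3: "iprod X (K k) \<subseteq> G k" for k
    using G1 iprod_mono[of X "insert x X" "K k" "K k"] by blast
  have powU: "u \<in> U n ==> xp j \<odot> u \<in> U (n + j)" for u j n
  proof (induction j)
    case 0 then show ?case using sm_in[OF sU] xp by simp
  next
    case (Suc j)
    then show ?case
      using gradedD(2)[OF gU, of x "xp j \<odot> u" "n + j"] sm_in[OF sU, of u n] by (simp add: powS')
  qed
  \<comment> \<open>Division with remainder by x: modulo X C j and U, an element of C j is x times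
    an element l. Multiplication by x^j shows that l lies in C (Suc j), because the other summands
    are moved into K.\<close>
  have decomp: "\<exists>p u l. p \<in> iprod X (C j n) \<and> u \<in> U (Suc n) \<and> l \<in> C (Suc j) n \<and> m = p \<oplus> (u \<oplus> x \<odot> l)
      \<and> xp j \<odot> p \<in> iprod X (K (n + j))"
    if m: "m \<in> C j (Suc n)" and j: "n \<ge> nj j" for j n m
  proof -
    have "m \<in> Q j (Suc n)" using m sC sV sum_upper1 unfolding Q_def by blast
    also have "\<dots> \<subseteq> iprod X (Q j n) +++ V (Suc n)" using nj[OF j] .
    also have "\<dots> \<subseteq> iprod X (C j n) +++ V (Suc n)"
    proof -
      have s: "sm (iprod X (C j n))" using xc sC sm_sub by (intro sm_iprod) auto
      have "iprod X (Q j n) = iprod X (C j n) +++ iprod X (V n)"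
        unfolding Q_def using xc sC sV by (intro iprod_sum)
      also have "\<dots> \<subseteq> iprod X (C j n) +++ V (Suc n)" using graded_iprod[OF as(1)] by (intro sum_mono) auto
      finally show ?thesis using s sV sum_upper2 sm_sum by (intro sum_least) auto
    qed
    finally obtain p v where pv: "p \<in> iprod X (C j n)" "v \<in> V (Suc n)" "m = p \<oplus> v" by (auto simp: mem_sum)
    then obtain u l where ul: "u \<in> U (Suc n)" "l \<in> L n" "v = u \<oplus> x \<odot> l"
      unfolding V_def add_shift_def by (auto simp: mem_sum)
    have siX: "sm (iprod X (K (n + j)))" using xc sKc by (intro sm_iprod)
    have "iprod X (C j n) \<subseteq> {p \<in> L (Suc n). xp j \<odot> p \<in> iprod X (K (n + j))}"
    proof (rule iprod_least)
      fix y c assume y: "y \<in> X" and c: "c \<in> C j n"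
      have "xp j \<odot> (y \<odot> c) = y \<odot> (xp j \<odot> c)"
        using y c xp xc Cc by (intro smult_comm) auto
      also have "\<dots> \<in> iprod X (K (n + j))" using y c by (intro iprod_mem) (auto simp: C_def)
      finally show "y \<odot> c \<in> {p \<in> L (Suc n). xp j \<odot> p \<in> iprod X (K (n + j))}"
        using gradedD(2)[OF gL, of y c n] y c CLd by auto
    qed (intro sm_preimage sL siX, use xp in simp)
    then have p: "p \<in> L (Suc n)" "xp j \<odot> p \<in> iprod X (K (n + j))" using pv by auto
    have cc: "p \<in> carrier M" "u \<in> carrier M" "l \<in> carrier M" "x \<odot> l \<in> carrier M"
      using p ul Lc sm_in[OF sU] xc by auto
    note xj = xp(1)[of j]
    have "xp j \<odot> m = xp j \<odot> p \<oplus> (xp j \<odot> u \<oplus> xp j \<odot> (x \<odot> l))"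
      using cc xj pv ul by (simp add: smult_r_distr)
    moreover have "xp j \<odot> m \<in> K (Suc n + j)" using m by (simp add: C_def)
    moreover have "xp j \<odot> p \<in> K (Suc n + j)"
      using p graded_iprod[OF graded_subset[OF gK], of X] by auto
    moreover have "xp j \<odot> u \<in> K (Suc n + j)" using powU[OF ul(1)] UK by blast
    ultimately have "xp j \<odot> (x \<odot> l) \<in> K (Suc n + j)"
      using sm_add_iff[OF sK] cc xj by simp
    then have "l \<in> C (Suc j) n" using ul cc by (simp add: C_def powS)
    then show ?thesis using pv ul p by blast
  qed
  \<comment> \<open>For j \<ge> j0 the images of C (Suc j) and C j in L / V agree, so l is an
    element c of C j, for which x^(j+1) c \<in> x K, plus an element of V. The V-part contributes an
    l' of smaller degree with a larger exponent, whence the induction on n.\<close>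
  have A: "xp (Suc j) \<odot> l \<in> G (n + j)" if "j \<ge> j0" "l \<in> C (Suc j) n" for j l n
    using that
  proof (induction n arbitrary: j l rule: less_induct)
    case (less n)
    have "l \<in> Q (Suc j) n" using less sC sV sum_upper1 unfolding Q_def by blast
    then have "l \<in> Q j0 n" using J_eq by (auto simp: J_def)
    then have "l \<in> Q j n" using Q_mono' less by blast
    then obtain c v where cv: "c \<in> C j n" "v \<in> V n" "l = c \<oplus> v" by (auto simp: Q_def mem_sum)
    have cc: "c \<in> carrier M" "v \<in> carrier M" using cv sm_in sC sV by blast+
    have xj: "xp (Suc j) \<in> carrier R" using xp by simp
    have eq: "xp (Suc j) \<odot> l = xp (Suc j) \<odot> c \<oplus> xp (Suc j) \<odot> v"
      using cv cc xj by (simp add: smult_r_distr)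
    have 1: "xp (Suc j) \<odot> c \<in> G (n + j)"
      unfolding powS'[OF cc(1)] using cv by (intro subsetD[OF G1] iprod_mem) (auto simp: C_def)
    have c2: "xp (Suc j) \<odot> c \<in> K (n + Suc j)"
      using C_mono cv(1) by (auto simp: C_def)
    have "xp (Suc j) \<odot> l \<in> K (n + Suc j)" using less by (auto simp: C_def)
    then have v2: "xp (Suc j) \<odot> v \<in> K (n + Suc j)"
      using eq sm_add_iff[OF sK c2] cc xj by (simp)
    have "xp (Suc j) \<odot> v \<in> G (n + j)"
    proof (cases n)
      case 0
      then have "v \<in> U 0" using cv by (simp add: V_def add_shift_def)
      then show ?thesis using powU[of v 0 "Suc j"] G2[of j] 0 by auto
    next
      case (Suc k)
      then obtain u l' where ul: "u \<in> U n" "l' \<in> L k" "v = u \<oplus> x \<odot> l'"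
        using cv by (auto simp: V_def add_shift_def mem_sum)
      have c3: "u \<in> carrier M" "l' \<in> carrier M" "x \<odot> l' \<in> carrier M" using ul sm_in[OF sU] Lc xc by auto
      have eq2: "xp (Suc j) \<odot> v = xp (Suc j) \<odot> u \<oplus> xp (Suc (Suc j)) \<odot> l'"
        unfolding powS[OF c3(2)] ul(3) using c3 xj by (simp add: smult_r_distr)
      have u2: "xp (Suc j) \<odot> u \<in> U (n + Suc j)" by (rule powU[OF ul(1)])
      have xj': "xp (Suc (Suc j)) \<in> carrier R" using xp by simp
      have "xp (Suc (Suc j)) \<odot> l' \<in> K (n + Suc j)"
        using v2 sm_add_iff[OF sK subsetD[OF UK u2] smult_closed[OF xj' c3(2)]] unfolding eq2 by blast
      then have "l' \<in> C (Suc (Suc j)) k" using ul Suc by (simp add: C_def)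
      then have "xp (Suc (Suc j)) \<odot> l' \<in> G (k + Suc j)" using less.IH[of k "Suc j" l'] less.prems(1) Suc by simp
      then show ?thesis unfolding eq2 using u2 G2[of "n + j"] Suc sm_add[OF sG] by auto
    qed
    then show ?case unfolding eq using 1 sm_add[OF sG] by blast
  qed
  \<comment> \<open>Descending induction on the exponent j0 - i. Each division by x lowers the
    degree by one, which is why the bound on n grows with i. For i = j0 the exponent is 0, and C 0
    is K.\<close>
  have B: "xp (j0 - i) \<odot> m \<in> G (n + (j0 - i))"
    if "i \<le> j0" "n \<ge> N + i" "m \<in> C (j0 - i) (Suc n)" for i n m
    using that
  proof (induction i arbitrary: n m)
    case 0
    obtain p u l where pul: "p \<in> iprod X (C j0 n)" "u \<in> U (Suc n)" "l \<in> C (Suc j0) n"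
      "m = p \<oplus> (u \<oplus> x \<odot> l)" "xp j0 \<odot> p \<in> iprod X (K (n + j0))"
      using decomp[of m j0 n] 0 N[of j0] by auto
    have siC: "sm (iprod X (C j0 n))" using xc sC sm_sub by (intro sm_iprod) auto
    have cc: "p \<in> carrier M" "u \<in> carrier M" "l \<in> carrier M" "x \<odot> l \<in> carrier M" "xp j0 \<in> carrier R"
      using xp pul sm_in[OF siC] sm_in[OF sU] sm_in[OF sC] xc by auto
    have "xp j0 \<odot> m = xp j0 \<odot> p \<oplus> (xp j0 \<odot> u \<oplus> xp (Suc j0) \<odot> l)"
      using cc pul by (simp add: smult_r_distr powS)
    moreover have "xp j0 \<odot> p \<in> G (n + j0)" using pul(5) G3 by blast
    moreover have "xp j0 \<odot> u \<in> G (n + j0)" using powU[OF pul(2), of j0] G2[of "n + j0"] by auto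
    moreover have "xp (Suc j0) \<odot> l \<in> G (n + j0)" using A pul by blast
    ultimately show ?case using sm_add[OF sG] by simp
  next
    case (Suc i)
    define j where "j = j0 - Suc i"
    have ji: "j0 - i = Suc j" using Suc.prems by (simp add: j_def)
    obtain k where k: "n = Suc k" "k \<ge> N + i" using Suc.prems(2) by (cases n) auto
    have mj: "m \<in> C j (Suc n)" using Suc.prems j_def by simp
    have "nj j \<le> n" using N[of j] Suc.prems(2) by (simp add: j_def)
    from decomp[OF mj this] obtain p u l where pul: "p \<in> iprod X (C j n)" "u \<in> U (Suc n)" "l \<in> C (Suc j) n"
      "m = p \<oplus> (u \<oplus> x \<odot> l)" "xp j \<odot> p \<in> iprod X (K (n + j))"
      by blast
    have siC: "sm (iprod X (C j n))" using xc sC sm_sub by (intro sm_iprod) auto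
    have cc: "p \<in> carrier M" "u \<in> carrier M" "l \<in> carrier M" "x \<odot> l \<in> carrier M" "xp j \<in> carrier R"
      using xp pul sm_in[OF siC] sm_in[OF sU] sm_in[OF sC] xc by auto
    have "xp j \<odot> m = xp j \<odot> p \<oplus> (xp j \<odot> u \<oplus> xp (Suc j) \<odot> l)"
      using cc pul by (simp add: smult_r_distr powS)
    moreover have "xp j \<odot> p \<in> G (n + j)" using pul(5) G3 by blast
    moreover have "xp j \<odot> u \<in> G (n + j)" using powU[OF pul(2), of j] G2[of "n + j"] by auto
    moreover have "xp (Suc j) \<odot> l \<in> G (n + j)"
      using Suc.IH[of k l] Suc.prems pul(3) k ji by (simp)
    ultimately show ?case using sm_add[OF sG] j_def by simp
  qed
  have "K (Suc n) \<subseteq> G n" if "n \<ge> N + j0" for n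
  proof
    fix m assume m: "m \<in> K (Suc n)"
    then have "m \<in> L (Suc n)" "m \<in> carrier M" using KL Lc by blast+
    then have "m \<in> C 0 (Suc n)" "m \<in> carrier M" using m xp(2) by (simp_all add: C_def)
    then show "m \<in> G n" using B[of j0 n m] that xp by simp
  qed
  then show ?case unfolding eventually_generated_def G_def by blast
qed

section \<open>Hilbert functions\<close>

text \<open>The r-th difference of f vanishes eventually; equivalently, f agrees for large n with a
  polynomial of degree less than r.\<close>

primrec diff_zero :: "nat => (nat => real) => bool" where
  "diff_zero 0 f \<longleftrightarrow> (\<forall>\<^sub>F n in sequentially. f n = 0)"
| "diff_zero (Suc r) f \<longleftrightarrow> diff_zero r (\<lambda>n. f (Suc n) - f n)"

lemma diff_zero_diff: "diff_zero r f ==> diff_zero r g ==> diff_zero r (\<lambda>n. f n - g n)"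
proof (induction r arbitrary: f g)
  case 0
  then show ?case by (auto elim: eventually_elim2)
next
  case (Suc r)
  have "(\<lambda>n. (f (Suc n) - f n) - (g (Suc n) - g n)) = (\<lambda>n. (f (Suc n) - g (Suc n)) - (f n - g n))"
    by (auto simp: algebra_simps)
  then show ?case using Suc.IH[of "\<lambda>n. f (Suc n) - f n" "\<lambda>n. g (Suc n) - g n"] Suc.prems by simp
qed

lemma diff_zero_Suc: "diff_zero r f ==> diff_zero r (\<lambda>n. f (Suc n))"
proof (induction r arbitrary: f)
  case 0
  then show ?case using eventually_sequentially_Suc[of "\<lambda>n. f n = 0"] by simp
next
  case (Suc r)
  then show ?case using Suc.IH[of "\<lambda>n. f (Suc n) - f n"] by simp
qed

text \<open>Newton's expansion. Since n choose Suc i has the difference n choose i, the coefficients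
  found for the difference of f move up by one place, and the constant that is left over becomes the
  coefficient of n choose 0.\<close>

lemma diff_zero_binomial:
  "diff_zero r f ==> \<exists>c. \<forall>\<^sub>F n in sequentially. f n = (\<Sum>i<r. c i * real (n choose i))"
proof (induction r arbitrary: f)
  case 0
  then show ?case by simp
next
  case (Suc r)
  from Suc.IH[of "\<lambda>n. f (Suc n) - f n"] Suc.prems
  obtain c where "\<forall>\<^sub>F n in sequentially. f (Suc n) - f n = (\<Sum>i<r. c i * real (n choose i))" by auto
  then obtain N where c: "!!n. n \<ge> N ==> f (Suc n) - f n = (\<Sum>i<r. c i * real (n choose i))"
    by (auto simp: eventually_sequentially)
  define g where "g n = f n - (\<Sum>i<r. c i * real (n choose Suc i))" for n
  have step: "g (Suc n) = g n" if "n \<ge> N" for n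
  proof -
    have "(\<Sum>i<r. c i * real (Suc n choose Suc i)) =
        (\<Sum>i<r. c i * real (n choose Suc i)) + (\<Sum>i<r. c i * real (n choose i))"
      by (simp add: algebra_simps sum.distrib)
    then show ?thesis using c[OF that] by (simp add: g_def)
  qed
  have "g n = g N" if "n \<ge> N" for n
    using that by (induction n rule: dec_induct) (auto simp: step)
  then have "f n = (\<Sum>i<Suc r. (case i of 0 => g N | Suc j => c j) * real (n choose i))"
    if "n \<ge> N" for n
    using that unfolding sum.lessThan_Suc_shift by (simp add: g_def algebra_simps)
  then show ?case
    by (intro exI[of _ "\<lambda>i. case i of 0 => g N | Suc j => c j"] eventually_sequentiallyI[of N])
qed

text \<open>Induction through (i + 1) (n choose i + 1) = (n choose i) (n - i), where (n - i) / n
  tends to 1.\<close>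

lemma binomial_over_power:
  "(\<lambda>n. real (n choose i) / real n ^ i) \<longlonglongrightarrow> 1 / fact i"
proof (induction i)
  case (Suc i)
  have "(\<lambda>n. 1 - real i / real n) \<longlonglongrightarrow> 1 - 0" by (intro tendsto_intros lim_const_over_n)
  then have "(\<lambda>n. real (n choose i) / real n ^ i * (1 - real i / real n) / real (Suc i))
      \<longlonglongrightarrow> (1 / fact i) * (1 - 0) / real (Suc i)"
    by (intro tendsto_divide[OF tendsto_mult[OF Suc] tendsto_const]) auto
  moreover have "\<forall>\<^sub>F n in sequentially. real (n choose i) / real n ^ i * (1 - real i / real n) / real (Suc i)
      = real (n choose Suc i) / real n ^ Suc i"
    using eventually_gt_at_top[of 0]
  proof eventually_elim
    case (elim n)
    have "real (n choose i) * (real n - real i) = real (Suc i) * real (n choose Suc i)"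
      using gbinomial_mult_1[of "real n" i] by (simp add: binomial_gbinomial algebra_simps)
    then have "real (n choose Suc i) = real (n choose i) * (real n - real i) / real (Suc i)"
      by (simp add: field_simps)
    moreover have "1 - real i / real n = (real n - real i) / real n"
      using elim by (simp add: diff_divide_distrib)
    ultimately show ?case by simp
  qed
  ultimately have "(\<lambda>n. real (n choose Suc i) / real n ^ Suc i) \<longlonglongrightarrow> (1 / fact i) * (1 - 0) / real (Suc i)"
    by (rule Lim_transform_eventually)
  then show ?case by (simp add: field_simps)
qed simp

lemma binomial_over_higher_power:
  assumes "i \<le> s"
  shows "(\<lambda>n. real (n choose i) / real n ^ s) \<longlonglongrightarrow> (if i = s then 1 / fact i else 0)"
proof (cases "i = s")
  case False
  define k where "k = s - Suc i"
  have k: "s = i + Suc k" using False assms by (simp add: k_def)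
  have "(\<lambda>n. real (n choose i) / real n ^ i * (1 / real n) ^ Suc k) \<longlonglongrightarrow> (1 / fact i) * 0 ^ Suc k"
    by (intro tendsto_intros binomial_over_power lim_1_over_n)
  moreover have "real (n choose i) / real n ^ i * (1 / real n) ^ Suc k = real (n choose i) / real n ^ s" for n
    unfolding k by (simp add: power_add power_one_over field_simps)
  ultimately show ?thesis using False by simp
qed (use binomial_over_power in simp)

text \<open>If the top index r exceeds s, then f n / n^r tends both to c r / r! and to 0, so that c
  r = 0 and the sum can be shortened. Once r \<le> s, the terms converge one by one.\<close>

lemma binomial_sum_convergent:
  fixes f :: "nat => real"
  assumes "\<forall>\<^sub>F n in sequentially. f n = (\<Sum>i<r. c i * real (n choose i))"
    and bound: "!!n. \<bar>f n\<bar> \<le> C * (real n + 1) ^ s"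
  shows "convergent (\<lambda>n. f n / real n ^ s)"
  using assms(1)
proof (induction r)
  case 0
  then have "\<forall>\<^sub>F n in sequentially. 0 = f n / real n ^ s" by (auto elim: eventually_mono)
  then have "(\<lambda>n. f n / real n ^ s) \<longlonglongrightarrow> 0" by (rule Lim_transform_eventually[rotated]) simp
  then show ?case by (auto simp: convergent_def)
next
  case (Suc r)
  have lim: "(\<lambda>n. f n / real n ^ t) \<longlonglongrightarrow> (\<Sum>i<Suc r. c i * (if i = t then 1 / fact i else 0))"
    if "r \<le> t" for t
  proof -
    have "(\<lambda>n. \<Sum>i<Suc r. c i * (real (n choose i) / real n ^ t))
        \<longlonglongrightarrow> (\<Sum>i<Suc r. c i * (if i = t then 1 / fact i else 0))"
      using that by (intro tendsto_sum tendsto_mult tendsto_const binomial_over_higher_power) auto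
    moreover have "\<forall>\<^sub>F n in sequentially.
        (\<Sum>i<Suc r. c i * (real (n choose i) / real n ^ t)) = f n / real n ^ t"
      using Suc.prems by eventually_elim (simp add: sum_divide_distrib add_divide_distrib)
    ultimately show ?thesis by (rule Lim_transform_eventually)
  qed
  show ?case
  proof (cases "r \<le> s")
    case True
    then show ?thesis using lim by (auto simp: convergent_def)
  next
    case False
    define k where "k = r - Suc s"
    have k: "r = s + Suc k" using False by (simp add: k_def)
    have "(\<lambda>n. C * 2 ^ s * (1 / real n) ^ Suc k) \<longlonglongrightarrow> C * 2 ^ s * 0 ^ Suc k"
      by (intro tendsto_intros lim_1_over_n)
    then have "(\<lambda>n. C * 2 ^ s * (1 / real n) ^ Suc k) \<longlonglongrightarrow> 0" by simp
    moreover have "\<forall>\<^sub>F n in sequentially. norm (f n / real n ^ r) \<le> norm (C * 2 ^ s * (1 / real n) ^ Suc k) * 1"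
      using eventually_gt_at_top[of 0]
    proof eventually_elim
      case (elim n)
      have "0 \<le> C * (real n + 1) ^ s" using bound[of n] by linarith
      moreover have "(real n + 1) ^ s > 0" by (intro zero_less_power) linarith
      ultimately have C: "C \<ge> 0" by (simp add: zero_le_mult_iff)
      have "\<bar>f n\<bar> \<le> C * (2 * real n) ^ s"
        using elim C by (intro order_trans[OF bound] mult_left_mono power_mono) auto
      then have "norm (f n / real n ^ r) \<le> C * 2 ^ s * (1 / real n) ^ Suc k"
        using elim by (simp add: k field_simps power_add)
      then show ?case
        using abs_ge_self[of "C * 2 ^ s * (1 / real n) ^ Suc k"] unfolding real_norm_def by linarith
    qed
    ultimately have "(\<lambda>n. f n / real n ^ r) \<longlonglongrightarrow> 0" by (rule tendsto_0_le)
    then have "(\<Sum>i<Suc r. c i * (if i = r then 1 / fact i else 0)) = 0"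
      using lim[of r] LIMSEQ_unique by blast
    moreover have "(\<Sum>i<r. c i * (if i = r then 1 / fact i else 0)) = 0" by (intro sum.neutral) auto
    ultimately have "c r = 0" by simp
    then show ?thesis using Suc by simp
  qed
qed

section \<open>Finite lengths and the Hilbert-Serre theorem\<close>

context rmodule
begin

text \<open>To be read for finite length: \<open>the_enat\<close> is unspecified at
  infinity.\<close>

definition rlen :: "'c set => 'c set => real" where
  "rlen U L = real (the_enat (len U L))"

lemma len_split:
  assumes "sm U" "sm V" "sm L" "U \<subseteq> V" "V \<subseteq> L" "len U L \<noteq> \<infinity>"
  shows "len U V \<noteq> \<infinity>" "len V L \<noteq> \<infinity>" "rlen U L = rlen U V + rlen V L"
  using len_add[OF assms(1-5)] assms(6)
  by (cases "len U V"; cases "len V L"; auto simp: rlen_def)+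

lemma len_infinite_split:
  assumes "sm U" "sm V" "sm L" "U \<subseteq> V" "V \<subseteq> L" "len U V \<noteq> \<infinity>" "len V L \<noteq> \<infinity>"
  shows "len U L \<noteq> \<infinity>"
  using len_add[OF assms(1-5)] assms(6,7) by auto

lemma rlen_nonneg: "rlen U L \<ge> 0"
  by (simp add: rlen_def)

lemma rlen_mono: "len U L \<le> len U' L' ==> len U' L' \<noteq> \<infinity> ==> rlen U L \<le> rlen U' L'"
  by (cases "len U L"; cases "len U' L'") (auto simp: rlen_def)

end

text \<open>Multiplication by x from degree n to degree n + 1 of L / U has kernel K / U and cokernel
  L / V with V = U + x L. Both are annihilated by x, hence finitely generated over one variable
  less, and the difference of the Hilbert function of L / U is that of L / V, shifted by one, minus
  that of K / U.\<close>

theorem (in noetherian_module) hilbert_serre: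
  assumes "finite X" "X \<subseteq> carrier R" "graded X U" "graded X L" "!!n. U n \<subseteq> L n"
    and "eventually_generated X U L" "!!n. len (U n) (L n) \<noteq> \<infinity>"
  shows "diff_zero (card X) (\<lambda>n. rlen (U n) (L n))"
  using assms
proof (induction X arbitrary: U L rule: finite_induct)
  case empty
  then obtain n0 where "!!n. n \<ge> n0 ==> L (Suc n) \<subseteq> iprod {} (L n) +++ U (Suc n)"
    by (auto simp: eventually_generated_def)
  moreover have "iprod {} (L n) +++ U (Suc n) \<subseteq> U (Suc n)" for n
    using gradedD(1)[OF empty(2)] sm_null sm_zero by (intro sum_least) (auto simp: iprod_empty)
  ultimately have LU: "!!n. n \<ge> n0 ==> L (Suc n) = U (Suc n)" using empty(4) by blast
  have "rlen (U n) (L n) = 0" if n: "n \<ge> Suc n0" for n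
  proof -
    obtain m where "n = Suc m" "m \<ge> n0" using n by (cases n) auto
    then show ?thesis using LU by (simp add: rlen_def len_refl zero_enat_def)
  qed
  then show ?case by (auto simp: eventually_sequentially)
next
  case (insert x X)
  note gU = insert.prems(2) and gL = insert.prems(3) and UL = insert.prems(4)
  have xc: "x \<in> carrier R" "X \<subseteq> carrier R" using insert by auto
  have sU: "sm (U n)" and sL: "sm (L n)" for n using gU gL gradedD(1) by blast+
  define K where "K n = {l \<in> L n. x \<odot> l \<in> U (Suc n)}" for n
  have sK: "sm (K n)" for n unfolding K_def using xc sL sU by (intro sm_preimage)
  have KL: "K n \<subseteq> L n" for n by (auto simp: K_def)
  have UK: "U n \<subseteq> K n" for n using UL gradedD(2)[OF gU] by (auto simp: K_def)
  have gK: "graded (insert x X) K"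
    unfolding graded_def
  proof (intro conjI allI ballI)
    fix n y l assume y: "y \<in> insert x X" and l: "l \<in> K n"
    have "x \<odot> (y \<odot> l) = y \<odot> (x \<odot> l)"
      using y xc sm_in[OF sK l] by (intro smult_comm) auto
    then show "y \<odot> l \<in> K (Suc n)"
      using y l gradedD(2)[OF gU y] gradedD(2)[OF gL y] by (simp add: K_def)
  qed (rule sK)
  \<comment> \<open>The kernel K is known only as a graded submodule, so its generation is where the
    graded basis theorem enters.\<close>
  have "eventually_generated (insert x X) U K"
    by (rule graded_submodule_generated[OF _ insert.prems(1) gU gL gK UK KL insert.prems(5)])
      (use insert in auto)
  then obtain n0 where n0: "!!n. n \<ge> n0 ==> K (Suc n) \<subseteq> iprod (insert x X) (K n) +++ U (Suc n)"
    by (auto simp: eventually_generated_def)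
  have "K (Suc n) \<subseteq> iprod X (K n) +++ U (Suc n)" if "n \<ge> n0" for n
  proof -
    have s: "sm (scale x (K n))" "sm (iprod X (K n))"
      using sm_scale[OF xc(1) sK] sm_iprod[OF xc(2) sm_sub[OF sK]] by blast+
    have "scale x (K n) \<subseteq> U (Suc n)" by (auto simp: K_def)
    then have "scale x (K n) \<subseteq> iprod X (K n) +++ U (Suc n)" using sum_upper2[OF s(2) sU] by blast
    then have "iprod (insert x X) (K n) +++ U (Suc n) \<subseteq> iprod X (K n) +++ U (Suc n)"
      unfolding iprod_insert[OF xc sK]
      by (intro sum_least sum_upper1 sum_upper2 sm_sum s sU)
    then show ?thesis using n0[OF that] by blast
  qed
  then have egK: "eventually_generated X U K" by (auto simp: eventually_generated_def)
  define V where "V = add_shift x U L"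
  note V = add_shift[OF gU gL UL insert.prems(1), folded V_def]
  have sV: "sm (V n)" for n using V(1) gradedD(1) by blast
  have "len (U n) (K n) \<noteq> \<infinity>" "len (V n) (L n) \<noteq> \<infinity>" for n
    using len_split[OF sU sK sL UK KL insert.prems(6)] len_split[OF sU sV sL V(2,3) insert.prems(6)] by blast+
  then have "diff_zero (card X) (\<lambda>n. rlen (U n) (K n))" "diff_zero (card X) (\<lambda>n. rlen (V n) (L n))"
    using insert.IH[OF xc(2) graded_subset[OF gU] graded_subset[OF gK] UK egK]
      insert.IH[OF xc(2) V(1) graded_subset[OF gL] V(3)
        add_shift_generated[OF gU gL UL insert.prems(1,5), folded V_def]] by auto
  then have "diff_zero (card X) (\<lambda>n. rlen (V (Suc n)) (L (Suc n)) - rlen (U n) (K n))"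
    using diff_zero_diff diff_zero_Suc by blast
  moreover have "rlen (V (Suc n)) (L (Suc n)) - rlen (U n) (K n) =
      rlen (U (Suc n)) (L (Suc n)) - rlen (U n) (L n)" for n
  proof -
    have "len (K n) (L n) = len (U (Suc n)) (scale x (L n) +++ U (Suc n))"
      unfolding K_def using xc sL sU by (intro len_scale)
    also have "scale x (L n) +++ U (Suc n) = V (Suc n)"
      using sum_commute[OF sm_scale[OF xc(1) sL] sU] by (simp add: V_def add_shift_def)
    finally have "rlen (K n) (L n) = rlen (U (Suc n)) (V (Suc n))" by (simp add: rlen_def)
    then show ?thesis
      using len_split(3)[OF sU sK sL UK KL insert.prems(6), of n]
        len_split(3)[OF sU sV sL V(2,3) insert.prems(6), of "Suc n"] by simp
  qed
  ultimately show ?case using insert by simp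
qed

section \<open>Ideals of noetherian local rings\<close>

lemma (in noetherian_ring) ideal_maximal:
  assumes "\<S> \<noteq> {}" "!!J. J \<in> \<S> ==> ideal J R"
  shows "\<exists>P\<in>\<S>. \<forall>Q\<in>\<S>. P \<subseteq> Q --> Q = P"
proof (rule subset_Zorn)
  fix C assume C: "subset.chain \<S> C"
  show "\<exists>U\<in>\<S>. \<forall>X\<in>C. X \<subseteq> U"
  proof (cases "C = {}")
    case False
    have "subset.chain {I. ideal I R} C" using C assms(2) unfolding subset_chain_def by blast
    from ideal_chain_is_trivial[OF False this] have "\<Union>C \<in> C" .
    moreover have "C \<subseteq> \<S>" using C by (simp add: subset_chain_def)
    ultimately show ?thesis by blast
  qed (use assms(1) in blast)
qed

lemma (in cring) ideal_add_cgenideal: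
  assumes "ideal P R" "a \<in> carrier R"
  shows "ideal (P <+> PIdl a) R" "P \<subseteq> P <+> PIdl a" "a \<in> P <+> PIdl a"
proof -
  have i: "ideal (PIdl a) R" by (rule cgenideal_ideal[OF assms(2)])
  show "ideal (P <+> PIdl a) R" by (rule add_ideals[OF assms(1) i])
  have z: "\<zero> \<in> P" "\<zero> \<in> PIdl a" using assms(1) i additive_subgroup.zero_closed ideal.axioms(1) by metis+
  show "P \<subseteq> P <+> PIdl a"
  proof
    fix x assume "x \<in> P"
    then show "x \<in> P <+> PIdl a"
      unfolding set_add_def' using z(2) ideal.Icarr[OF assms(1)] by force
  qed
  have "a \<in> PIdl a" by (rule cgenideal_self[OF assms(2)])
  then show "a \<in> P <+> PIdl a"
    unfolding set_add_def' using z(1) assms(2) by force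
qed

text \<open>An ideal P maximal among those that contain J and miss S is prime: for a, b outside P
  both P + (a) and P + (b) meet S, and the product of two such elements of S lies in P + (a
  b).\<close>

lemma (in noetherian_ring) prime_disjoint:
  assumes "cring R" "ideal J R" "S \<subseteq> carrier R" "\<one> \<in> S" "!!s t. s \<in> S ==> t \<in> S ==> s \<otimes> t \<in> S"
    and "J \<inter> S = {}"
  shows "\<exists>P. primeideal P R \<and> J \<subseteq> P \<and> P \<inter> S = {}"
proof -
  interpret cring R by fact
  let ?S = "{Q. ideal Q R \<and> J \<subseteq> Q \<and> Q \<inter> S = {}}"
  have "\<exists>P\<in>?S. \<forall>Q\<in>?S. P \<subseteq> Q --> Q = P"
    by (rule ideal_maximal) (use assms(2,6) in auto)
  then obtain P where P: "P \<in> ?S" "\<forall>Q\<in>?S. P \<subseteq> Q --> Q = P" by (rule bexE)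
  then have max: "!!Q. ideal Q R ==> J \<subseteq> Q ==> Q \<inter> S = {} ==> P \<subseteq> Q ==> Q = P" by simp
  have P: "ideal P R" "J \<subseteq> P" "P \<inter> S = {}" using P(1) by simp_all
  note PI = ideal.Icarr[OF P(1)] ideal.I_l_closed[OF P(1)] ideal.I_r_closed[OF P(1)]
    additive_subgroup.a_closed[OF ideal.axioms(1)[OF P(1)]]
  have meet: "\<exists>s\<in>S. \<exists>p\<in>P. \<exists>r\<in>carrier R. s = p \<oplus> r \<otimes> a" if a: "a \<in> carrier R" "a \<notin> P" for a
  proof -
    note A = ideal_add_cgenideal[OF P(1) a(1)]
    have "(P <+> PIdl a) \<inter> S \<noteq> {}"
    proof
      assume "(P <+> PIdl a) \<inter> S = {}"
      then have "P <+> PIdl a = P" using max[OF A(1)] A(2) P(2) by blast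
      then show False using A(3) a by blast
    qed
    then show ?thesis unfolding set_add_def' cgenideal_def by blast
  qed
  have "primeideal P R"
  proof (rule primeidealI[OF P(1) assms(1)])
    show "carrier R \<noteq> P" using P(3) assms(4) by auto
    fix a b assume ab: "a \<in> carrier R" "b \<in> carrier R" "a \<otimes> b \<in> P"
    show "a \<in> P \<or> b \<in> P"
    proof (rule ccontr)
      assume "\<not> ?thesis"
      then obtain s p r s' p' r' where *: "s \<in> S" "p \<in> P" "r \<in> carrier R" "s = p \<oplus> r \<otimes> a"
        "s' \<in> S" "p' \<in> P" "r' \<in> carrier R" "s' = p' \<oplus> r' \<otimes> b"
        using meet ab(1,2) by metis
      have pc: "p \<in> carrier R" "p' \<in> carrier R" using * PI(1) by auto
      have rc: "r \<otimes> a \<in> carrier R" "r' \<otimes> b \<in> carrier R" using * ab by auto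
      have "(r \<otimes> a) \<otimes> (r' \<otimes> b) = (r \<otimes> r') \<otimes> (a \<otimes> b)" using * ab by (simp add: m_ac)
      then have "(r \<otimes> a) \<otimes> (r' \<otimes> b) \<in> P" using PI(2)[OF ab(3), of "r \<otimes> r'"] * by simp
      moreover have "s \<otimes> s' = p \<otimes> s' \<oplus> ((r \<otimes> a) \<otimes> p' \<oplus> (r \<otimes> a) \<otimes> (r' \<otimes> b))"
        unfolding *(4) *(8) using pc rc by (simp add: l_distr r_distr a_ac)
      moreover have "p \<otimes> s' \<in> P" using PI(3) * assms(3) by auto
      moreover have "(r \<otimes> a) \<otimes> p' \<in> P" using PI(2) * rc by auto
      ultimately have "s \<otimes> s' \<in> P" using PI(4) by simp
      then show False using assms(5)[OF *(1,5)] P(3) by blast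
    qed
  qed
  then show ?thesis using P by blast
qed

text \<open>Elements of the members of F that lie outside I multiply to an element of the
  intersection outside I. The intersection with \<open>carrier R\<close> is for F = {}, where
  \<Inter>F is the whole type.\<close>

lemma (in primeideal) prime_contains_finite_Inter:
  assumes "finite F" "!!J. J \<in> F ==> ideal J R" "carrier R \<inter> \<Inter>F \<subseteq> I"
  shows "\<exists>J\<in>F. J \<subseteq> I"
proof (rule ccontr)
  assume neg: "\<not> ?thesis"
  have "\<exists>a\<in>carrier R. a \<notin> I \<and> (\<forall>J\<in>F. a \<in> J)"
    using assms(1,2) neg
  proof (induction F rule: finite_induct)
    case empty
    then show ?case using I_notcarr one_imp_carrier by (intro bexI[of _ \<one>]) auto
  next
    case (insert J F)
    then obtain a where a: "a \<in> carrier R" "a \<notin> I" "\<forall>J\<in>F. a \<in> J" by auto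
    obtain b where b: "b \<in> J" "b \<notin> I" using insert by auto
    have bc: "b \<in> carrier R" using ideal.Icarr[of J R b] b insert by auto
    have "a \<otimes> b \<notin> I" using I_prime[OF a(1) bc] a b by blast
    moreover have "a \<otimes> b \<in> J" using ideal.I_l_closed[of J R b a] b a insert by auto
    moreover have "\<forall>K\<in>F. a \<otimes> b \<in> K" using ideal.I_r_closed[of _ R a b] bc a insert by auto
    ultimately show ?case using a bc by (intro bexI[of _ "a \<otimes> b"]) auto
  qed
  then show False using assms(3) by blast
qed

text \<open>Induction on the number of primes. If another member Q lies in P, drop Q. Otherwise take
  a \<in> J outside all members but P; if a \<in> P, then some b in J and in all other members is
  outside P, because P is prime, and a + b avoids every member.\<close>

lemma prime_avoidance:
  assumes "finite F" "!!P. P \<in> F ==> primeideal P R" "ideal J R" "!!P. P \<in> F ==> \<not> J \<subseteq> P"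
  shows "\<exists>a\<in>J. \<forall>P\<in>F. a \<notin> P"
  using assms(1,2,4)
proof (induction "card F" arbitrary: F rule: less_induct)
  case less
  interpret J: ideal J R by fact
  have id: "ideal P R" if "P \<in> F" for P using less(3)[OF that] by (simp add: primeideal_def)
  show ?case
  proof (cases "F = {}")
    case True
    then show ?thesis using J.zero_closed by (intro bexI[of _ "\<zero>\<^bsub>R\<^esub>"]) auto
  next
    case False
    then obtain P where P: "P \<in> F" by (meson ex_in_conv)
    interpret P: primeideal P R using less(3)[OF P] .
    have cF: "card (F - {Q}) < card F" "finite (F - {Q})" if "Q \<in> F" for Q
      by (rule card_Diff1_less[OF less(2) that], rule finite_Diff[OF less(2)])
    show ?thesis
    proof (cases "\<exists>Q\<in>F. Q \<noteq> P \<and> Q \<subseteq> P")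
      case True
      then obtain Q where Q: "Q \<in> F" "Q \<noteq> P" "Q \<subseteq> P" by blast
      obtain a where "a \<in> J" "\<forall>P\<in>F - {Q}. a \<notin> P"
        using less(1)[OF cF(1)[OF Q(1)] cF(2)[OF Q(1)]] less(3,4) by blast
      then show ?thesis using Q P by blast
    next
      case anti: False
      obtain a where a: "a \<in> J" "\<forall>Q\<in>F - {P}. a \<notin> Q"
        using less(1)[OF cF(1)[OF P] cF(2)[OF P]] less(3,4) by blast
      show ?thesis
      proof (cases "a \<in> P")
        case aP: True
        have "\<not> (\<exists>K\<in>insert J (F - {P}). K \<subseteq> P)" using anti less(4)[OF P] by blast
        then have "\<not> carrier R \<inter> \<Inter>(insert J (F - {P})) \<subseteq> P"
          using P.prime_contains_finite_Inter[of "insert J (F - {P})"] id assms(3) less(2) by blast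
        then obtain b where b: "b \<in> J" "\<forall>Q\<in>F - {P}. b \<in> Q" "b \<notin> P" by blast
        have bc: "b \<in> carrier R" "a \<in> carrier R" using a b J.Icarr by auto
        have "a \<oplus>\<^bsub>R\<^esub> b \<notin> Q" if Q: "Q \<in> F" for Q
        proof
          assume s: "a \<oplus>\<^bsub>R\<^esub> b \<in> Q"
          interpret Q: ideal Q R by (rule id[OF Q])
          have "b = \<ominus>\<^bsub>R\<^esub> a \<oplus>\<^bsub>R\<^esub> (a \<oplus>\<^bsub>R\<^esub> b)" "a = (a \<oplus>\<^bsub>R\<^esub> b) \<oplus>\<^bsub>R\<^esub> \<ominus>\<^bsub>R\<^esub> b"
            using bc by (simp_all add: J.r_neg1 J.a_assoc J.r_neg)
          then have "b \<in> Q \<longleftrightarrow> a \<in> Q"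
            using s Q.a_closed Q.a_inv_closed by metis
          then show False using a b aP Q by blast
        qed
        then show ?thesis using a b J.a_closed by blast
      qed (use a P in blast)
    qed
  qed
qed

locale noetherian_local = noetherian_ring R + cring R for R :: "('a, 'r) ring_scheme" (structure) +
  fixes \<mm> :: "'a set"
  assumes max_unique: "{J. maximalideal J R} = {\<mm>}"
begin

lemma max_ideal: "maximalideal \<mm> R"
  using max_unique by blast

lemma max_prime: "primeideal \<mm> R"
  by (rule maximalideal_prime[OF max_ideal])

lemma max_is_ideal: "ideal \<mm> R"
  using max_ideal by (simp add: maximalideal_def)

lemma max_sub: "\<mm> \<subseteq> carrier R"
  using ideal.Icarr[OF max_is_ideal] by blast

lemma one_notin_max: "\<one> \<notin> \<mm>"
  using ideal.one_imp_carrier[OF max_is_ideal] maximalideal.I_notcarr[OF max_ideal] by blast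

lemma proper_ideal_sub_max:
  assumes "ideal J R" "\<one> \<notin> J"
  shows "J \<subseteq> \<mm>"
proof -
  let ?S = "{Q. ideal Q R \<and> J \<subseteq> Q \<and> \<one> \<notin> Q}"
  have "\<exists>P\<in>?S. \<forall>Q\<in>?S. P \<subseteq> Q --> Q = P"
    by (rule ideal_maximal) (use assms in auto)
  then obtain P where P: "P \<in> ?S" "\<forall>Q\<in>?S. P \<subseteq> Q --> Q = P" by (rule bexE)
  then have max: "!!Q. ideal Q R ==> J \<subseteq> Q ==> \<one> \<notin> Q ==> P \<subseteq> Q ==> Q = P" by simp
  have P: "ideal P R" "J \<subseteq> P" "\<one> \<notin> P" using P(1) by simp_all
  have "maximalideal P R"
  proof (rule maximalidealI[OF P(1)])
    show "carrier R \<noteq> P" using P(3) by auto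
    fix Q assume Q: "ideal Q R" "P \<subseteq> Q" "Q \<subseteq> carrier R"
    show "Q = P \<or> Q = carrier R"
    proof (cases "\<one> \<in> Q")
      case True
      then show ?thesis using ideal.one_imp_carrier[OF Q(1)] by blast
    next
      case False
      then show ?thesis using max[OF Q(1) _ _ Q(2)] P(2) Q(2) by blast
    qed
  qed
  then show ?thesis using max_unique P(2) by blast
qed

lemma prime_sub_max: "primeideal P R ==> P \<subseteq> \<mm>"
  using proper_ideal_sub_max[of P] primeideal.I_notcarr[of P R] ideal.one_imp_carrier[of P R]
  by (auto simp: primeideal_def)

lemma unit_outside_max:
  assumes "a \<in> carrier R" "a \<notin> \<mm>"
  shows "\<exists>b\<in>carrier R. b \<otimes> a = \<one>"
proof -
  have "\<one> \<in> PIdl a"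
    using proper_ideal_sub_max[OF cgenideal_ideal[OF assms(1)]] cgenideal_self[OF assms(1)] assms(2) by blast
  then show ?thesis unfolding cgenideal_def by force
qed

end

section \<open>Annihilators and zero divisors\<close>

text \<open>The annihilator of the image of L in M / U. Here L may be any set; L = {x} gives the
  annihilator of the class of x, the form in which associated primes occur.\<close>

definition sub_ann ::
  "('a, 'r) ring_scheme => ('a, 'b) module => 'b set => 'b set => 'a set" where
  "sub_ann R M U L = {r \<in> carrier R. \<forall>x\<in>L. r \<odot>\<^bsub>M\<^esub> x \<in> U}"

definition nonzerodivisor_mod :: "('a, 'b) module => 'b set => 'b set => 'a => bool" where
  "nonzerodivisor_mod M U L a \<longleftrightarrow> (\<forall>x\<in>L. a \<odot>\<^bsub>M\<^esub> x \<in> U --> x \<in> U)"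

lemma (in rmodule) sub_ann_ideal:
  assumes "sm U" "L \<subseteq> carrier M"
  shows "ideal (sub_ann R M U L) R"
proof (rule idealI)
  show "ring R" ..
  have add: "a \<oplus>\<^bsub>R\<^esub> b \<in> sub_ann R M U L" if ab: "a \<in> sub_ann R M U L" "b \<in> sub_ann R M U L" for a b
    using ab assms(2) sm_add[OF assms(1)] by (auto simp: sub_ann_def smult_l_distr subset_iff)
  have neg: "\<ominus>\<^bsub>R\<^esub> a \<in> sub_ann R M U L" if a: "a \<in> sub_ann R M U L" for a
    using a assms(2) sm_neg[OF assms(1)] by (auto simp: sub_ann_def smult_l_minus subset_iff)
  have zero: "\<zero>\<^bsub>R\<^esub> \<in> sub_ann R M U L"
    using assms(2) sm_zero[OF assms(1)] by (auto simp: sub_ann_def subset_iff)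
  have car: "sub_ann R M U L \<subseteq> carrier R" by (auto simp: sub_ann_def)
  show "subgroup (sub_ann R M U L) (add_monoid R)"
    using add neg zero car by (auto simp: subgroup_def a_inv_def[symmetric])
  fix a r assume a: "a \<in> sub_ann R M U L" and r: "r \<in> carrier R"
  have "r \<otimes>\<^bsub>R\<^esub> a \<in> sub_ann R M U L"
    using a r assms(2) sm_smult[OF assms(1) r] by (auto simp: sub_ann_def smult_assoc1 subset_iff)
  then show "r \<otimes>\<^bsub>R\<^esub> a \<in> sub_ann R M U L" "a \<otimes>\<^bsub>R\<^esub> r \<in> sub_ann R M U L"
    using a r by (auto simp: sub_ann_def R.m_comm)
qed

lemma (in rmodule) span_single: "x \<in> carrier M ==> mod_span R M {x} = {r \<odot> x | r. r \<in> carrier R}"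
proof -
  assume x: "x \<in> carrier M"
  have "mod_span R M {} = {\<zero>}"
    using span_least[of "{}" "{\<zero>}"] sm_null sm_zero[OF sm_span[of "{}"]] by auto
  moreover have "r \<odot> x \<oplus> \<zero> = r \<odot> x" if "r \<in> carrier R" for r
    using that x by simp
  ultimately show ?thesis
    unfolding span_insert[of "{}" x, OF empty_subsetI x]
    by (intro Collect_cong) (metis (no_types, lifting) singleton_iff)
qed

locale local_module = noetherian_module R M + noetherian_local R \<mm>
  for R :: "('a, 'r) ring_scheme" and M :: "('a, 'c) module" (structure) and \<mm>
begin

abbreviation nzd :: "'c set => 'c set => 'a => bool" where
  "nzd \<equiv> nonzerodivisor_mod M"

lemma nzdD: "nzd U L a ==> x \<in> L ==> a \<odot> x \<in> U ==> x \<in> U"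
  by (auto simp: nonzerodivisor_mod_def)

lemma unit_smult_mem:
  assumes "sm W" "a \<in> carrier R" "a \<notin> \<mm>" "x \<in> carrier M" "a \<odot> x \<in> W"
  shows "x \<in> W"
proof -
  obtain b where b: "b \<in> carrier R" "b \<otimes>\<^bsub>R\<^esub> a = \<one>\<^bsub>R\<^esub>" using unit_outside_max[OF assms(2,3)] by blast
  have "b \<odot> (a \<odot> x) = (b \<otimes>\<^bsub>R\<^esub> a) \<odot> x" by (rule smult_assoc1[OF b(1) assms(2,4), symmetric])
  also have "\<dots> = x" using assms(4) b(2) by simp
  finally show ?thesis using sm_smult[OF assms(1) b(1) assms(5)] by simp
qed

text \<open>Take W maximal among the submodules with U \<subseteq> W \<subset> K. If t x with t
  \<in> \<mm> and x \<in> K were outside W, then K = W + R t x, so x = w + r t x; as 1 - r t is a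
  unit, x \<in> W after all. Hence \<mm> K \<subseteq> W, against K \<subseteq> U + \<mm> K.\<close>

lemma nakayama:
  assumes "sm U" "sm K" "U \<subseteq> K" "K \<subseteq> U +++ iprod \<mm> K"
  shows "K = U"
proof (rule ccontr)
  assume "K \<noteq> U"
  then have "U \<in> {W. sm W \<and> U \<subseteq> W \<and> W \<subset> K}" using assms by blast
  then have "\<exists>W\<in>{W. sm W \<and> U \<subseteq> W \<and> W \<subset> K}. \<forall>V\<in>{W. sm W \<and> U \<subseteq> W \<and> W \<subset> K}. W \<subseteq> V --> V = W"
    by (intro sm_maximal) auto
  then obtain W where W: "W \<in> {W. sm W \<and> U \<subseteq> W \<and> W \<subset> K}"
    "\<forall>V\<in>{W. sm W \<and> U \<subseteq> W \<and> W \<subset> K}. W \<subseteq> V --> V = W" by (rule bexE)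
  then have max: "!!V. sm V ==> U \<subseteq> V ==> V \<subset> K ==> W \<subseteq> V ==> V = W" by simp
  have W: "sm W" "U \<subseteq> W" "W \<subset> K" using W(1) by simp_all
  have "iprod \<mm> K \<subseteq> W"
  proof (rule iprod_least[OF _ W(1)])
    fix t x assume t: "t \<in> \<mm>" and x: "x \<in> K"
    have tc: "t \<in> carrier R" and xc: "x \<in> carrier M" using t max_sub sm_in[OF assms(2) x] by auto
    define y where "y = t \<odot> x"
    have yc: "y \<in> carrier M" and yK: "y \<in> K" using tc xc sm_smult[OF assms(2) tc x] by (auto simp: y_def)
    show "t \<odot> x \<in> W"
    proof (rule ccontr)
      assume yW: "t \<odot> x \<notin> W"
      define V where "V = W +++ mod_span R M {y}"
      have sp: "sm (mod_span R M {y})" using yc by (intro sm_span) auto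
      have V: "sm V" "W \<subseteq> V" unfolding V_def using sm_sum[OF W(1) sp] sum_upper1[OF W(1) sp] by auto
      have "y \<in> V" unfolding V_def using sum_upper2[OF W(1) sp] span_incl[of "{y}"] by blast
      then have "V \<noteq> W" using yW y_def by blast
      have "V \<subseteq> K" unfolding V_def using W(3) span_least[OF _ assms(2), of "{y}"] yK assms(2)
        by (intro sum_least) auto
      then have "V = K" using max[OF V(1)] V(2) W(2) \<open>V \<noteq> W\<close> by blast
      then have "x \<in> W +++ mod_span R M {y}" using x by (simp add: V_def)
      then obtain w r where wr: "w \<in> W" "r \<in> carrier R" "x = w \<oplus> r \<odot> y"
        unfolding span_single[OF yc] mem_sum by blast
      have wc: "w \<in> carrier M" by (rule sm_in[OF W(1) wr(1)])
      define a where "a = \<one>\<^bsub>R\<^esub> \<ominus>\<^bsub>R\<^esub> r \<otimes>\<^bsub>R\<^esub> t"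
      have rt: "r \<otimes>\<^bsub>R\<^esub> t \<in> \<mm>" "r \<otimes>\<^bsub>R\<^esub> t \<in> carrier R"
        using ideal.I_l_closed[OF max_is_ideal t wr(2)] wr(2) tc by auto
      have ac: "a \<in> carrier R" unfolding a_def using rt by simp
      have "a \<notin> \<mm>"
      proof
        assume "a \<in> \<mm>"
        then have "a \<oplus>\<^bsub>R\<^esub> r \<otimes>\<^bsub>R\<^esub> t \<in> \<mm>"
          using rt additive_subgroup.a_closed[OF ideal.axioms(1)[OF max_is_ideal]] by blast
        moreover have "a \<oplus>\<^bsub>R\<^esub> r \<otimes>\<^bsub>R\<^esub> t = \<one>\<^bsub>R\<^esub>" unfolding a_def using rt by (simp add: a_minus_def R.a_assoc R.l_neg)
        ultimately show False using one_notin_max by simp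
      qed
      have "a \<odot> x = x \<ominus> r \<odot> y"
        unfolding a_def y_def using rt xc wr tc
        by (simp add: a_minus_def smult_l_distr smult_l_minus smult_assoc1)
      also have "\<dots> = w"
      proof -
        have "r \<odot> y \<in> carrier M" using wr yc by simp
        then show ?thesis using wc unfolding wr(3) a_minus_def by (simp add: M.a_assoc M.r_neg)
      qed
      finally have "x \<in> W" using unit_smult_mem[OF W(1) ac \<open>a \<notin> \<mm>\<close> xc] wr(1) by simp
      then show False using yW sm_smult[OF W(1) tc] by blast
    qed
  qed
  then have "K \<subseteq> W" using assms(4) sum_least[OF W(2) _ W(1)] by blast
  then show False using W(3) by blast
qed

text \<open>F consists of the maximal ones among the annihilators of nonzero elements of L / U,
  which are associated primes and cover all zero divisors. They are finitely many: the annihilator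
  of x \<in> X contains the intersection of those of a finite spanning set S \<subseteq> X, hence
  one of them, and equals it by maximality.\<close>

lemma ann_primes:
  assumes U: "sm U" and L: "sm L"
  shows "\<exists>F. finite F \<and> (\<forall>P\<in>F. primeideal P R \<and> (\<exists>x\<in>L - U. P = sub_ann R M U {x})) \<and>
    (\<forall>x\<in>L - U. \<exists>P\<in>F. sub_ann R M U {x} \<subseteq> P)"
proof -
  define ann where "ann x = sub_ann R M U {x}" for x
  have ann: "ideal (ann x) R" if "x \<in> L" for x
    unfolding ann_def using sm_in[OF L that] by (intro sub_ann_ideal[OF U]) auto
  define X where "X = {x \<in> L - U. \<forall>y\<in>L - U. ann x \<subseteq> ann y --> ann y = ann x}"
  have XL: "X \<subseteq> L - U" by (auto simp: X_def)
  have above: "\<exists>y\<in>X. ann x \<subseteq> ann y" if x: "x \<in> L - U" for x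
  proof -
    let ?S = "{Q. ann x \<subseteq> Q \<and> (\<exists>y\<in>L - U. Q = ann y)}"
    have "?S \<noteq> {}" using x by blast
    moreover have "ideal Q R" if "Q \<in> ?S" for Q using that ann by blast
    ultimately have "\<exists>P\<in>?S. \<forall>Q\<in>?S. P \<subseteq> Q --> Q = P" by (rule ideal_maximal)
    then obtain P where P: "P \<in> ?S" "\<forall>Q\<in>?S. P \<subseteq> Q --> Q = P" by (rule bexE)
    then obtain y where y: "y \<in> L - U" "P = ann y" "ann x \<subseteq> ann y" by blast
    have "y \<in> X" unfolding X_def
    proof (intro CollectI conjI ballI impI y(1))
      fix z assume "z \<in> L - U" "ann y \<subseteq> ann z"
      then show "ann z = ann y" using P(2) y by blast
    qed
    then show ?thesis using y by blast
  qed
  have prime: "primeideal (ann x) R" if x: "x \<in> X" for x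
  proof (rule primeidealI)
    have xL: "x \<in> L" "x \<notin> U" using x XL by auto
    note xc = sm_in[OF L xL(1)]
    show "ideal (ann x) R" "cring R" using ann[OF xL(1)] R.is_cring by auto
    have "\<one>\<^bsub>R\<^esub> \<notin> ann x" using xL xc by (auto simp: ann_def sub_ann_def)
    then show "carrier R \<noteq> ann x" by auto
    fix a b assume ab: "a \<in> carrier R" "b \<in> carrier R" "a \<otimes>\<^bsub>R\<^esub> b \<in> ann x"
    show "a \<in> ann x \<or> b \<in> ann x"
    proof (cases "b \<in> ann x")
      case False
      then have "b \<odot> x \<in> L - U" using ab sm_smult[OF L ab(2) xL(1)] by (auto simp: ann_def sub_ann_def)
      moreover have "ann x \<subseteq> ann (b \<odot> x)"
      proof
        fix r assume r: "r \<in> ann x"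
        then have "r \<odot> (b \<odot> x) = b \<odot> (r \<odot> x)"
          using ab xc by (intro smult_comm) (auto simp: ann_def sub_ann_def)
        then show "r \<in> ann (b \<odot> x)" using r sm_smult[OF U ab(2)] by (auto simp: ann_def sub_ann_def)
      qed
      ultimately have "ann (b \<odot> x) = ann x" using x unfolding X_def by blast
      moreover have "a \<in> ann (b \<odot> x)" using ab xc by (auto simp: ann_def sub_ann_def smult_assoc1)
      ultimately show ?thesis by blast
    qed blast
  qed
  \<comment> \<open>A maximal span of a finite subset of X contains all of X; this is where the
    module has to be Noetherian.\<close>
  let ?T = "{mod_span R M S | S. finite S \<and> S \<subseteq> X}"
  have "?T \<noteq> {}" by blast
  moreover have Xc: "X \<subseteq> carrier M" using XL sm_sub[OF L] by blast
  then have "sm H" if "H \<in> ?T" for H using that sm_span by blast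
  ultimately have "\<exists>W\<in>?T. \<forall>V\<in>?T. W \<subseteq> V --> V = W" by (rule sm_maximal)
  then obtain W where "W \<in> ?T" and max: "\<forall>V\<in>?T. W \<subseteq> V --> V = W" by (rule bexE)
  then obtain S where S: "finite S" "S \<subseteq> X" "W = mod_span R M S" by blast
  have "ann x \<in> ann ` S" if x: "x \<in> X" for x
  proof -
    have "mod_span R M (insert x S) \<in> ?T" using S x by blast
    moreover have "W \<subseteq> mod_span R M (insert x S)" unfolding S(3) by (rule span_mono) auto
    ultimately have "mod_span R M (insert x S) = W" using max by blast
    then have xW: "x \<in> mod_span R M S" using span_incl[of "insert x S"] S(3) by blast
    have "carrier R \<inter> \<Inter>(ann ` S) \<subseteq> ann x"
    proof
      fix r assume r: "r \<in> carrier R \<inter> \<Inter>(ann ` S)"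
      have "S \<subseteq> {y \<in> L. r \<odot> y \<in> U}" using r S(2) XL by (auto simp: ann_def sub_ann_def)
      then have "mod_span R M S \<subseteq> {y \<in> L. r \<odot> y \<in> U}"
        using r by (intro span_least sm_preimage L U) auto
      then show "r \<in> ann x" using xW r by (auto simp: ann_def sub_ann_def)
    qed
    moreover have "ideal J R" if "J \<in> ann ` S" for J using that S(2) XL ann by auto
    ultimately have "\<exists>J\<in>ann ` S. J \<subseteq> ann x"
      using primeideal.prime_contains_finite_Inter[OF prime[OF x], of "ann ` S"] S(1) by simp
    then obtain y where y: "y \<in> S" "ann y \<subseteq> ann x" by auto
    then have "ann x = ann y" using S(2) x XL unfolding X_def by blast
    then show ?thesis using y by blast
  qed
  then have "ann ` X \<subseteq> ann ` S" by (rule image_subsetI)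
  then have fin: "finite (ann ` X)" using S(1) finite_subset by blast
  show ?thesis
  proof (intro exI[of _ "ann ` X"] conjI ballI fin)
    fix P assume "P \<in> ann ` X"
    then obtain x where "x \<in> X" "P = ann x" by auto
    then show "primeideal P R" "\<exists>x\<in>L - U. P = sub_ann R M U {x}"
      using prime XL by (auto simp: ann_def)
  next
    fix x assume "x \<in> L - U"
    from above[OF this] show "\<exists>P\<in>ann ` X. sub_ann R M U {x} \<subseteq> P"
      unfolding ann_def by blast
  qed
qed

text \<open>The vanishing of Hom(k, L / U) for the residue field k. By \<open>common_nzd\<close> and
  \<open>nzd_socle_free\<close> it amounts, for submodules, to the existence of an element of \<mm>
  that is regular on L / U.\<close>

definition socle_free :: "'c set => 'c set => bool" where
  "socle_free U L \<longleftrightarrow> (\<forall>x\<in>L. (\<forall>t\<in>\<mm>. t \<odot> x \<in> U) --> x \<in> U)"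

lemma nzd_socle_free: "a \<in> \<mm> ==> nzd U L a ==> socle_free U L"
  by (auto simp: socle_free_def nonzerodivisor_mod_def)

lemma max_not_sub_ann:
  assumes "socle_free U L" "x \<in> L - U"
  shows "\<not> \<mm> \<subseteq> sub_ann R M U {x}"
proof
  assume "\<mm> \<subseteq> sub_ann R M U {x}"
  then have "\<forall>t\<in>\<mm>. t \<odot> x \<in> U" by (auto simp: sub_ann_def)
  then show False using assms by (auto simp: socle_free_def)
qed

lemma avoiding_nzd:
  assumes "\<forall>x\<in>L - U. \<exists>P\<in>F. sub_ann R M U {x} \<subseteq> P" "a \<in> carrier R" "\<forall>P\<in>F. a \<notin> P"
  shows "nzd U L a"
  unfolding nonzerodivisor_mod_def
proof (intro ballI impI, rule ccontr)
  fix x assume x: "x \<in> L" "a \<odot> x \<in> U" "x \<notin> U"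
  then obtain P where "P \<in> F" "sub_ann R M U {x} \<subseteq> P" using assms(1) by auto
  moreover have "a \<in> sub_ann R M U {x}" using x assms(2) by (simp add: sub_ann_def)
  ultimately show False using assms(3) by auto
qed

text \<open>Prime avoidance for the primes of \<open>ann_primes\<close> of both subquotients
  together, none of which contains \<mm>. The exchange of regular sequences and their lifting to
  extensions both ask for one element that is regular on two subquotients.\<close>

lemma common_nzd:
  assumes "sm U" "sm L" "socle_free U L" "sm U'" "sm L'" "socle_free U' L'"
  shows "\<exists>a\<in>\<mm>. nzd U L a \<and> nzd U' L' a"
proof -
  obtain F where F: "finite F" "\<forall>P\<in>F. primeideal P R \<and> (\<exists>x\<in>L - U. P = sub_ann R M U {x})"
    "\<forall>x\<in>L - U. \<exists>P\<in>F. sub_ann R M U {x} \<subseteq> P" using ann_primes[OF assms(1,2)] by (elim exE conjE)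
  obtain G where G: "finite G" "\<forall>P\<in>G. primeideal P R \<and> (\<exists>x\<in>L' - U'. P = sub_ann R M U' {x})"
    "\<forall>x\<in>L' - U'. \<exists>P\<in>G. sub_ann R M U' {x} \<subseteq> P" using ann_primes[OF assms(4,5)] by (elim exE conjE)
  have "\<not> \<mm> \<subseteq> P" if "P \<in> F \<union> G" for P
    using that F(2) G(2) max_not_sub_ann[OF assms(3)] max_not_sub_ann[OF assms(6)]
    by (elim UnE) (metis)+
  then have "\<exists>a\<in>\<mm>. \<forall>P\<in>F \<union> G. a \<notin> P"
    using F(1,2) G(1,2) by (intro prime_avoidance[of "F \<union> G" R \<mm>] max_is_ideal) auto
  then obtain a where a: "a \<in> \<mm>" "\<forall>P\<in>F. a \<notin> P" "\<forall>P\<in>G. a \<notin> P" by auto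
  have ac: "a \<in> carrier R" using a max_sub by auto
  show ?thesis using a(1) avoiding_nzd[OF F(3) ac a(2)] avoiding_nzd[OF G(3) ac a(3)] by auto
qed

end

section \<open>Quotient modules\<close>

text \<open>The axioms are inherited by the image of a map that preserves the operations; this
  serves for coset modules and for copies in another type.\<close>

lemma module_of_surj:
  fixes R :: "('a, 'r) ring_scheme" and M :: "('a, 'b) module" and Q :: "('a, 'c) module"
  assumes M: "module R M" and surj: "\<pi> ` carrier M = carrier Q"
    and add: "!!x y. x \<in> carrier M ==> y \<in> carrier M ==> \<pi> (x \<oplus>\<^bsub>M\<^esub> y) = \<pi> x \<oplus>\<^bsub>Q\<^esub> \<pi> y"
    and smult: "!!r x. r \<in> carrier R ==> x \<in> carrier M ==> \<pi> (r \<odot>\<^bsub>M\<^esub> x) = r \<odot>\<^bsub>Q\<^esub> \<pi> x"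
    and zero: "\<pi> \<zero>\<^bsub>M\<^esub> = \<zero>\<^bsub>Q\<^esub>"
  shows "module R Q"
proof -
  interpret M: rmodule R M by (rule rmodule.intro) fact
  have ex: "\<exists>x\<in>carrier M. z = \<pi> x" if "z \<in> carrier Q" for z using that surj by auto
  have in_Q: "\<pi> x \<in> carrier Q" if "x \<in> carrier M" for x using that surj by auto
  note rw = add[symmetric] smult[symmetric]
  show ?thesis
  proof (rule moduleI)
    show "cring R" by (rule module_cring[OF M])
    show "abelian_group Q"
    proof (rule abelian_groupI)
      fix x y assume "x \<in> carrier Q" "y \<in> carrier Q"
      then obtain u v where "u \<in> carrier M" "v \<in> carrier M" "x = \<pi> u" "y = \<pi> v" using ex by meson
      then show "x \<oplus>\<^bsub>Q\<^esub> y \<in> carrier Q" "x \<oplus>\<^bsub>Q\<^esub> y = y \<oplus>\<^bsub>Q\<^esub> x"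
        by (simp_all add: rw in_Q M.a_comm)
    next
      show "\<zero>\<^bsub>Q\<^esub> \<in> carrier Q" using in_Q[of "\<zero>\<^bsub>M\<^esub>"] zero by simp
    next
      fix x y z assume "x \<in> carrier Q" "y \<in> carrier Q" "z \<in> carrier Q"
      then obtain u v w where "u \<in> carrier M" "v \<in> carrier M" "w \<in> carrier M" "x = \<pi> u" "y = \<pi> v" "z = \<pi> w"
        using ex by meson
      then show "(x \<oplus>\<^bsub>Q\<^esub> y) \<oplus>\<^bsub>Q\<^esub> z = x \<oplus>\<^bsub>Q\<^esub> (y \<oplus>\<^bsub>Q\<^esub> z)" by (simp add: rw M.a_assoc)
    next
      fix x assume "x \<in> carrier Q"
      then obtain u where u: "u \<in> carrier M" "x = \<pi> u" using ex by meson
      then show "\<zero>\<^bsub>Q\<^esub> \<oplus>\<^bsub>Q\<^esub> x = x" by (simp add: zero[symmetric] rw)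
      show "\<exists>y\<in>carrier Q. y \<oplus>\<^bsub>Q\<^esub> x = \<zero>\<^bsub>Q\<^esub>"
        using u by (intro bexI[of _ "\<pi> (\<ominus>\<^bsub>M\<^esub> u)"] in_Q) (simp_all add: rw M.l_neg zero)
    qed
  next
    fix a b x y assume ab: "a \<in> carrier R" "b \<in> carrier R" "x \<in> carrier Q" "y \<in> carrier Q"
    then obtain u v where "u \<in> carrier M" "v \<in> carrier M" "x = \<pi> u" "y = \<pi> v" using ex by meson
    then show "(a \<oplus>\<^bsub>R\<^esub> b) \<odot>\<^bsub>Q\<^esub> x = a \<odot>\<^bsub>Q\<^esub> x \<oplus>\<^bsub>Q\<^esub> b \<odot>\<^bsub>Q\<^esub> x"
      "a \<odot>\<^bsub>Q\<^esub> (x \<oplus>\<^bsub>Q\<^esub> y) = a \<odot>\<^bsub>Q\<^esub> x \<oplus>\<^bsub>Q\<^esub> a \<odot>\<^bsub>Q\<^esub> y"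
      "a \<otimes>\<^bsub>R\<^esub> b \<odot>\<^bsub>Q\<^esub> x = a \<odot>\<^bsub>Q\<^esub> (b \<odot>\<^bsub>Q\<^esub> x)"
      using ab by (simp_all add: rw M.smult_l_distr M.smult_r_distr M.smult_assoc1)
  next
    fix a x assume ab: "a \<in> carrier R" "x \<in> carrier Q"
    then obtain u where "u \<in> carrier M" "x = \<pi> u" using ex by meson
    then show "a \<odot>\<^bsub>Q\<^esub> x \<in> carrier Q" using ab by (simp add: rw in_Q)
  next
    fix x assume ab: "x \<in> carrier Q"
    then obtain u where "u \<in> carrier M" "x = \<pi> u" using ex by meson
    then show "\<one>\<^bsub>R\<^esub> \<odot>\<^bsub>Q\<^esub> x = x" by (simp add: rw)
  qed
qed

definition quot_proj :: "('a, 'b) module => 'b set => 'b => 'b set" where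
  "quot_proj M H = (\<lambda>x\<in>carrier M. H +>\<^bsub>M\<^esub> x)"

lemma quot_mod_module:
  fixes R :: "('a, 'r) ring_scheme" and M :: "('a, 'b) module"
  assumes M: "module R M" and H: "submodule H R M"
  shows "module R (quot_mod M H)" "quot_proj M H \<in> mod_hom R M (quot_mod M H)"
    "quot_proj M H ` carrier M = carrier (quot_mod M H)"
    "x \<in> carrier M ==> quot_proj M H x = \<zero>\<^bsub>quot_mod M H\<^esub> \<longleftrightarrow> x \<in> H"
proof -
  interpret M: rmodule R M by (rule rmodule.intro) fact
  have sg: "subgroup H (add_monoid M)" using H by (simp add: submodule_def)
  have "abelian_group M" using M by (simp add: module_def)
  then interpret H: abelian_subgroup H M
    by (rule abelian_subgroupI3[OF additive_subgroupI[OF sg]])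
  have surj: "(\<lambda>x. H +>\<^bsub>M\<^esub> x) ` carrier M = carrier (quot_mod M H)"
    by (auto simp: quot_mod_def A_RCOSETS_def')
  have add: "H +>\<^bsub>M\<^esub> (x \<oplus>\<^bsub>M\<^esub> y) = (H +>\<^bsub>M\<^esub> x) \<oplus>\<^bsub>quot_mod M H\<^esub> (H +>\<^bsub>M\<^esub> y)"
    if "x \<in> carrier M" "y \<in> carrier M" for x y
    using that by (simp add: quot_mod_def H.a_rcos_sum)
  have smult: "H +>\<^bsub>M\<^esub> (r \<odot>\<^bsub>M\<^esub> x) = r \<odot>\<^bsub>quot_mod M H\<^esub> (H +>\<^bsub>M\<^esub> x)"
    if rx: "r \<in> carrier R" "x \<in> carrier M" for r x
  proof -
    \<comment> \<open>The scalar multiple of a coset is a union over its representatives, all of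
      which give the same coset.\<close>
    have eq: "H +>\<^bsub>M\<^esub> (r \<odot>\<^bsub>M\<^esub> y) = H +>\<^bsub>M\<^esub> (r \<odot>\<^bsub>M\<^esub> x)" if y: "y \<in> H +>\<^bsub>M\<^esub> x" for y
    proof -
      obtain h where h: "h \<in> H" "y = h \<oplus>\<^bsub>M\<^esub> x" using y by (auto simp: a_r_coset_def')
      then have "r \<odot>\<^bsub>M\<^esub> y = r \<odot>\<^bsub>M\<^esub> h \<oplus>\<^bsub>M\<^esub> r \<odot>\<^bsub>M\<^esub> x"
        using rx M.sm_in[OF H] by (simp add: M.smult_r_distr)
      then have "r \<odot>\<^bsub>M\<^esub> y \<in> H +>\<^bsub>M\<^esub> (r \<odot>\<^bsub>M\<^esub> x)"
        using M.sm_smult[OF H rx(1) h(1)] by (auto simp: a_r_coset_def')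
      then show ?thesis using M.a_repr_independence[OF _ _ sg] rx by simp
    qed
    have "(\<Union>y\<in>H +>\<^bsub>M\<^esub> x. H +>\<^bsub>M\<^esub> (r \<odot>\<^bsub>M\<^esub> y)) = H +>\<^bsub>M\<^esub> (r \<odot>\<^bsub>M\<^esub> x)"
      using eq by (intro UN_constant_eq[OF H.a_rcos_self[OF rx(2)]] ballI)
    then show ?thesis by (simp add: quot_mod_def)
  qed
  have z: "H +>\<^bsub>M\<^esub> \<zero>\<^bsub>M\<^esub> = \<zero>\<^bsub>quot_mod M H\<^esub>"
    using M.a_coset_join2[OF _ sg] M.sm_zero[OF H] by (simp add: quot_mod_def)
  show mq: "module R (quot_mod M H)" by (rule module_of_surj[OF M surj add smult z])
  show "quot_proj M H ` carrier M = carrier (quot_mod M H)"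
    using surj by (simp add: quot_proj_def)
  show "quot_proj M H \<in> mod_hom R M (quot_mod M H)"
    unfolding quot_proj_def using surj by (intro mod_hom_restrictI[OF M] add smult) auto
  show "quot_proj M H x = \<zero>\<^bsub>quot_mod M H\<^esub> \<longleftrightarrow> x \<in> H" if x: "x \<in> carrier M"
    using x M.a_coset_join1[of H x] M.a_coset_join2[of x H] sg by (auto simp: quot_proj_def quot_mod_def)
qed

lemma mod_length_eq:
  fixes R :: "('a, 'r) ring_scheme" and M :: "('a, 'b) module"
  assumes M: "module R M"
  shows "mod_length R M = sub_len R M {\<zero>\<^bsub>M\<^esub>} (carrier M)"
proof -
  interpret M: rmodule R M by (rule rmodule.intro) fact
  have "sub_chain R M {\<zero>\<^bsub>M\<^esub>} (carrier M) n H \<longleftrightarrow>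
      (\<forall>i\<le>n. submodule (H i) R M) \<and> (\<forall>i<n. H i \<subset> H (Suc i))" for n H
    unfolding sub_chain_def using M.sm_zero M.sm_sub by (metis empty_subsetI insert_subset)
  then show ?thesis by (simp add: mod_length_def sub_len_def)
qed

lemma mod_length_quot:
  fixes R :: "('a, 'r) ring_scheme" and M :: "('a, 'b) module"
  assumes M: "module R M" and H: "submodule H R M"
  shows "mod_length R (quot_mod M H) = sub_len R M H (carrier M)"
proof -
  interpret M: rmodule R M by (rule rmodule.intro) fact
  note q = quot_mod_module[OF M H]
  interpret Q: rmodule R "quot_mod M H" by (rule rmodule.intro) (rule q(1))
  let ?Q = "quot_mod M H"
  have "{x \<in> carrier M. quot_proj M H x \<in> {\<zero>\<^bsub>?Q\<^esub>}} = H" using q(4) M.sm_sub[OF H] by auto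
  moreover have "carrier ?Q <+>\<^bsub>?Q\<^esub> {\<zero>\<^bsub>?Q\<^esub>} = carrier ?Q"
    by (intro Q.sum_absorb2 Q.sm_carrier Q.sm_null) auto
  ultimately show ?thesis
    using sub_len_hom[OF M q(1,2) M.sm_carrier Q.sm_null] q(3) mod_length_eq[OF q(1)] by simp
qed

lemma nonzerodivisor_on_quot:
  fixes R :: "('a, 'r) ring_scheme" and M :: "('a, 'b) module"
  assumes M: "module R M" and H: "submodule H R M" and a: "a \<in> carrier R"
  shows "nonzerodivisor_on (quot_mod M H) a \<longleftrightarrow> nonzerodivisor_mod M H (carrier M) a"
proof -
  interpret M: rmodule R M by (rule rmodule.intro) fact
  note q = quot_mod_module[OF M H]
  have "(\<forall>z\<in>carrier (quot_mod M H). P z) \<longleftrightarrow> (\<forall>x\<in>carrier M. P (quot_proj M H x))" for P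
    unfolding q(3)[symmetric] by simp
  then show ?thesis
    using a q(4) unfolding nonzerodivisor_on_def nonzerodivisor_mod_def
    by (simp add: mod_homD(3)[OF q(2), symmetric])
qed

section \<open>Regular sequences\<close>

text \<open>Recursive, because dividing L / U by a only enlarges U. That the sequence generates a
  proper submodule is a separate matter, settled by \<open>iprod_proper\<close>.\<close>

primrec regular_on :: "('a, 'b) module => 'b set => 'b set => 'a list => bool" where
  "regular_on M U L [] \<longleftrightarrow> True"
| "regular_on M U L (a # as) \<longleftrightarrow>
    nonzerodivisor_mod M U L a \<and> regular_on M (U <+>\<^bsub>M\<^esub> (\<lambda>x. a \<odot>\<^bsub>M\<^esub> x) ` L) L as"

context rmodule
begin

lemma regular_on_nth:
  assumes "sm U" "sm L" "set as \<subseteq> carrier R"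
  shows "regular_on M U L as \<longleftrightarrow>
    (\<forall>i<length as. nonzerodivisor_mod M (U +++ iprod (set (take i as)) L) L (as ! i))"
  using assms
proof (induction as arbitrary: U)
  case (Cons a as)
  have a: "a \<in> carrier R" and as: "set as \<subseteq> carrier R" using Cons.prems by auto
  have sa: "sm (scale a L)" by (rule sm_scale[OF a Cons.prems(2)])
  have s: "sm (U +++ scale a L)" by (rule sm_sum[OF Cons.prems(1) sa])
  have "U +++ iprod (set (take (Suc i) (a # as))) L = (U +++ scale a L) +++ iprod (set (take i as)) L" for i
  proof -
    have t: "set (take i as) \<subseteq> carrier R" using as set_take_subset[of i as] by blast
    have "sm (iprod (set (take i as)) L)" by (rule sm_iprod[OF t sm_sub[OF Cons.prems(2)]])
    then show ?thesis
      using iprod_insert[OF a t Cons.prems(2)] sum_assoc[OF Cons.prems(1) sa] by simp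
  qed
  moreover have "U +++ iprod {} L = U"
    unfolding iprod_empty by (rule sum_absorb2) (use Cons.prems(1) sm_null sm_zero in auto)
  ultimately show ?case
    using Cons.IH[OF s Cons.prems(2) as] by (simp add: All_less_Suc2)
qed simp

lemma regular_sequence_iff:
  "regular_sequence R M as \<longleftrightarrow> set as \<subseteq> carrier R \<and> regular_on M {\<zero>} (carrier M) as \<and>
     iprod (set as) (carrier M) \<noteq> carrier M"
proof (cases "set as \<subseteq> carrier R")
  case True
  have e: "ideal_smult R (Idl\<^bsub>R\<^esub> J) M = iprod J (carrier M)" if "J \<subseteq> carrier R" for J
    unfolding ideal_smult_eq by (rule iprod_idl[OF that sm_carrier])
  have t: "set (take i as) \<subseteq> carrier R" for i using True set_take_subset[of i as] by blast
  have s: "sm (iprod (set (take i as)) (carrier M))" for i by (rule sm_iprod[OF t order_refl])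
  have z: "{\<zero>} +++ iprod (set (take i as)) (carrier M) = iprod (set (take i as)) (carrier M)" for i
    by (rule sum_absorb1) (use s sm_null sm_zero in auto)
  have "nonzerodivisor_on (quot_mod M (ideal_smult R (Idl\<^bsub>R\<^esub> (set (take i as))) M)) (as ! i) \<longleftrightarrow>
    nonzerodivisor_mod M ({\<zero>} +++ iprod (set (take i as)) (carrier M)) (carrier M) (as ! i)"
    if "i < length as" for i
    unfolding z e[OF t] using nonzerodivisor_on_quot[OF module_axioms s subsetD[OF True nth_mem[OF that]]] .
  then show ?thesis
    unfolding regular_sequence_def using regular_on_nth[OF sm_null sm_carrier True] e[OF True] True by simp
qed (auto simp: regular_sequence_def)

text \<open>Transport along V / (V \<inter> W) \<cong> (V + W) / W. Dividing both sides by a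
  replaces W by W + a V, and the modular law gives V \<inter> W + a V = V \<inter> (W + a V), so the
  induction is over all W.\<close>

lemma regular_on_second_iso:
  assumes "sm V" "sm W" "set as \<subseteq> carrier R"
  shows "regular_on M (V \<inter> W) V as \<longleftrightarrow> regular_on M W (V +++ W) as"
  using assms
proof (induction as arbitrary: W)
  case (Cons a as)
  have a: "a \<in> carrier R" and as: "set as \<subseteq> carrier R" using Cons.prems by auto
  note V = Cons.prems(1) and W = Cons.prems(2)
  have sa: "sm (scale a V)" "sm (scale a W)" using sm_scale[OF a V] sm_scale[OF a W] .
  have s: "sm (W +++ scale a V)" by (rule sm_sum[OF W sa(1)])
  have aV: "scale a V \<subseteq> V" "scale a W \<subseteq> W" using sm_scale_subset[OF a V] sm_scale_subset[OF a W] .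
  have 1: "V \<inter> W +++ scale a V = V \<inter> (W +++ scale a V)"
    using modular_law[OF sa(1) W V aV(1)] sum_commute[OF sa(1) W] sum_commute[OF sa(1) sm_Int[OF W V]]
    by (simp add: Int_commute)
  have "W +++ scale a (V +++ W) = (W +++ scale a W) +++ scale a V"
    using scale_sum[OF a V W] sum_commute[OF sa] sum_assoc[OF W sa(2,1)] by simp
  then have 2: "W +++ scale a (V +++ W) = W +++ scale a V"
    using sum_absorb2[OF aV(2) W sa(2)] by simp
  have 3: "V +++ (W +++ scale a V) = V +++ W"
    using sum_assoc[OF V sa(1) W] sum_commute[OF W sa(1)] sum_absorb2[OF aV(1) V sa(1)] by simp
  have "nonzerodivisor_mod M (V \<inter> W) V a \<longleftrightarrow> nonzerodivisor_mod M W (V +++ W) a"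
    unfolding nonzerodivisor_mod_def
  proof (intro iffI ballI impI)
    fix x assume *: "\<forall>x\<in>V. a \<odot> x \<in> V \<inter> W --> x \<in> V \<inter> W" and x: "x \<in> V +++ W" "a \<odot> x \<in> W"
    obtain v w where vw: "v \<in> V" "w \<in> W" "x = v \<oplus> w" using x(1) unfolding mem_sum by auto
    have c: "v \<in> carrier M" "w \<in> carrier M" using sm_in[OF V vw(1)] sm_in[OF W vw(2)] .
    have "a \<odot> v \<in> W"
      using x(2) sm_add_iff2[OF W, of "a \<odot> v" "a \<odot> w"] c a sm_smult[OF W a vw(2)]
      unfolding vw(3) by (simp add: smult_r_distr)
    then have "v \<in> W" using * vw(1) sm_smult[OF V a vw(1)] by auto
    then show "x \<in> W" using vw sm_add[OF W] by auto
  next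
    fix x assume *: "\<forall>x\<in>V +++ W. a \<odot> x \<in> W --> x \<in> W" and x: "x \<in> V" "a \<odot> x \<in> V \<inter> W"
    show "x \<in> V \<inter> W" using * x sum_upper1[OF V W] by auto
  qed
  then show ?case
    using Cons.IH[OF V s as] by (simp add: 1 2 3)
qed simp

end

text \<open>Division by a commutes with taking the preimage of U. In this way regularity on the ends
  of an exact sequence becomes regularity on subquotients of its middle term.\<close>

lemma regular_on_hom:
  fixes R :: "('a, 'r) ring_scheme" and M :: "('a, 'b) module" and N :: "('a, 'c) module"
  assumes M: "module R M" and N: "module R N" and f: "f \<in> mod_hom R M N"
    and L: "submodule L R M" and U: "submodule U R N" "U \<subseteq> f ` L" and as: "set as \<subseteq> carrier R"
  shows "regular_on M {x \<in> L. f x \<in> U} L as \<longleftrightarrow> regular_on N U (f ` L) as"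
  using U as
proof (induction as arbitrary: U)
  case (Cons a as)
  interpret M: rmodule R M by (rule rmodule.intro) fact
  interpret N: rmodule R N by (rule rmodule.intro) fact
  note h = mod_homD[OF f] and c = M.sm_in[OF L]
  have a: "a \<in> carrier R" and as: "set as \<subseteq> carrier R" using Cons.prems by auto
  have fL: "submodule (f ` L) R N" by (rule mod_hom_image_sm[OF M N f L])
  have fa: "f (a \<odot>\<^bsub>M\<^esub> x) = a \<odot>\<^bsub>N\<^esub> f x" if "x \<in> L" for x using h(3)[OF a c[OF that]] .
  have s: "submodule (U <+>\<^bsub>N\<^esub> N.scale a (f ` L)) R N"
    by (rule N.sm_sum[OF Cons.prems(1) N.sm_scale[OF a fL]])
  have sub: "U <+>\<^bsub>N\<^esub> N.scale a (f ` L) \<subseteq> f ` L"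
    by (rule N.sum_least[OF Cons.prems(2) N.sm_scale_subset[OF a fL] fL])
  have "nonzerodivisor_mod M {x \<in> L. f x \<in> U} L a \<longleftrightarrow> nonzerodivisor_mod N U (f ` L) a"
    unfolding nonzerodivisor_mod_def using fa M.sm_smult[OF L a] by simp
  moreover have "{x \<in> L. f x \<in> U} <+>\<^bsub>M\<^esub> M.scale a L = {x \<in> L. f x \<in> U <+>\<^bsub>N\<^esub> N.scale a (f ` L)}"
  proof (intro equalityI subsetI)
    fix x assume "x \<in> {x \<in> L. f x \<in> U} <+>\<^bsub>M\<^esub> M.scale a L"
    then obtain y l where yl: "y \<in> L" "f y \<in> U" "l \<in> L" "x = y \<oplus>\<^bsub>M\<^esub> a \<odot>\<^bsub>M\<^esub> l"
      unfolding M.mem_sum by auto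
    then have "f x = f y \<oplus>\<^bsub>N\<^esub> a \<odot>\<^bsub>N\<^esub> f l" using h(2) c a fa by simp
    then show "x \<in> {x \<in> L. f x \<in> U <+>\<^bsub>N\<^esub> N.scale a (f ` L)}"
      using yl M.sm_add[OF L] M.sm_smult[OF L a] by (auto simp: N.mem_sum)
  next
    fix x assume "x \<in> {x \<in> L. f x \<in> U <+>\<^bsub>N\<^esub> N.scale a (f ` L)}"
    then obtain u l where ul: "x \<in> L" "u \<in> U" "l \<in> L" "f x = u \<oplus>\<^bsub>N\<^esub> a \<odot>\<^bsub>N\<^esub> f l"
      unfolding N.mem_sum by auto
    have cc: "x \<in> carrier M" "l \<in> carrier M" "a \<odot>\<^bsub>M\<^esub> l \<in> carrier M" "u \<in> carrier N"
      "a \<odot>\<^bsub>N\<^esub> f l \<in> carrier N"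
      using ul c a h(1) N.sm_in[OF Cons.prems(1)] by auto
    have "f (x \<ominus>\<^bsub>M\<^esub> a \<odot>\<^bsub>M\<^esub> l) = u"
      unfolding mod_hom_minus[OF M N f cc(1,3)] fa[OF ul(3)] ul(4)
      using cc by (simp add: a_minus_def N.a_assoc N.r_neg)
    moreover have "x \<ominus>\<^bsub>M\<^esub> a \<odot>\<^bsub>M\<^esub> l \<in> L" by (rule M.sm_minus[OF L ul(1) M.sm_smult[OF L a ul(3)]])
    moreover have "x = (x \<ominus>\<^bsub>M\<^esub> a \<odot>\<^bsub>M\<^esub> l) \<oplus>\<^bsub>M\<^esub> a \<odot>\<^bsub>M\<^esub> l"
      using cc M.add_minus_cancel[OF cc(3,1)] M.a_comm[of "x \<ominus>\<^bsub>M\<^esub> a \<odot>\<^bsub>M\<^esub> l" "a \<odot>\<^bsub>M\<^esub> l"] by simp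
    ultimately show "x \<in> {x \<in> L. f x \<in> U} <+>\<^bsub>M\<^esub> M.scale a L"
      unfolding M.mem_sum using ul(2,3) by blast
  qed
  ultimately show ?case using Cons.IH[OF s sub as] by simp
qed simp

section \<open>Depth of a subquotient\<close>

context local_module
begin

text \<open>Depth of L / U at least n, stated by existence of a sequence rather than through a
  supremum, so that induction on n is possible.\<close>

definition dep :: "nat => 'c set => 'c set => bool" where
  "dep n U L \<longleftrightarrow> (\<exists>as. set as \<subseteq> \<mm> \<and> length as = n \<and> regular_on M U L as)"

lemma dep_0: "dep 0 U L"
  by (auto simp: dep_def)

lemma dep_Suc: "dep (Suc n) U L \<longleftrightarrow> (\<exists>a\<in>\<mm>. nzd U L a \<and> dep n (U +++ scale a L) L)"
proof
  assume "dep (Suc n) U L"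
  then obtain a as where "set (a # as) \<subseteq> \<mm>" "length as = n" "regular_on M U L (a # as)"
    unfolding dep_def by (metis length_Suc_conv)
  then show "\<exists>a\<in>\<mm>. nzd U L a \<and> dep n (U +++ scale a L) L" by (auto simp: dep_def)
next
  assume "\<exists>a\<in>\<mm>. nzd U L a \<and> dep n (U +++ scale a L) L"
  then obtain a as where "a \<in> \<mm>" "nzd U L a" "set as \<subseteq> \<mm>" "length as = n"
    "regular_on M (U +++ scale a L) L as" by (auto simp: dep_def)
  then show "dep (Suc n) U L" unfolding dep_def by (intro exI[of _ "a # as"]) auto
qed

lemma dep_socle_free: "dep (Suc n) U L ==> socle_free U L"
  unfolding dep_Suc using nzd_socle_free by blast

lemma sm_add_scale:
  assumes "a \<in> \<mm>" "sm U" "sm L"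
  shows "sm (U +++ scale a L)" "U \<subseteq> L ==> U +++ scale a L \<subseteq> L" "U \<subseteq> U +++ scale a L"
proof -
  have a: "a \<in> carrier R" using assms max_sub by auto
  note s = sm_scale[OF a assms(3)]
  show "sm (U +++ scale a L)" by (rule sm_sum[OF assms(2) s])
  show "U \<subseteq> L ==> U +++ scale a L \<subseteq> L" by (rule sum_least[OF _ sm_scale_subset[OF a assms(3)] assms(3)])
  show "U \<subseteq> U +++ scale a L" by (rule sum_upper1[OF assms(2) s])
qed

lemma diff_eq_diff:
  assumes "x \<in> carrier M" "x' \<in> carrier M" "y \<in> carrier M" "y' \<in> carrier M" "x \<oplus> x' = y \<oplus> y'"
  shows "x' \<ominus> y' = y \<ominus> x"
proof -
  have "x' = \<ominus> x \<oplus> (y \<oplus> y')" using assms M.r_neg1[of x x'] by simp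
  then have "x' \<ominus> y' = \<ominus> x \<oplus> (y \<oplus> (y' \<oplus> \<ominus> y'))"
    using assms(1-4) by (simp add: a_minus_def M.a_assoc)
  then show ?thesis using assms(1-4) by (simp add: a_minus_def M.r_neg M.a_comm)
qed

lemma smult_minus:
  assumes "a \<in> carrier R" "x \<in> carrier M" "y \<in> carrier M"
  shows "a \<odot> (x \<ominus> y) = a \<odot> x \<ominus> a \<odot> y"
  using assms by (simp add: a_minus_def smult_r_distr smult_r_minus)

lemma mem_sum_of_minus:
  assumes "x \<in> carrier M" "y \<in> B" "sm B" "x \<ominus> y \<in> A" "sm A"
  shows "x \<in> A +++ B"
proof -
  have y: "y \<in> carrier M" by (rule sm_in[OF assms(3,2)])
  have "x = (x \<ominus> y) \<oplus> y"
    using y add_minus_cancel[OF y assms(1)] M.a_comm[of "x \<ominus> y" y] sm_in[OF assms(5,4)] by simp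
  then show ?thesis using assms(2,4) unfolding mem_sum by blast
qed

text \<open>
  The exchange argument behind this lemma and \<open>dep_exchange\<close> replaces the isomorphism
  \<open>Hom(k, M/aM) \<cong> Ext\<^sup>1(k, M) \<cong> Hom(k, M/bM)\<close>.
\<close>

lemma socle_free_exchange:
  assumes U: "sm U" and L: "sm L" and UL: "U \<subseteq> L" and a: "a \<in> \<mm>" "nzd U L a" and b: "b \<in> \<mm>" "nzd U L b"
    and soc: "socle_free (U +++ scale b L) L"
  shows "socle_free (U +++ scale a L) L"
  unfolding socle_free_def
proof (intro ballI impI)
  have ac: "a \<in> carrier R" and bc: "b \<in> carrier R" using a b max_sub by auto
  note Uc = sm_in[OF U] and Lc = sm_in[OF L]
  have sa: "sm (scale a L)" "sm (scale b L)" using sm_scale[OF ac L] sm_scale[OF bc L] .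
  fix z assume z: "z \<in> L" and *: "\<forall>t\<in>\<mm>. t \<odot> z \<in> U +++ scale a L"
  note zc = Lc[OF z]
  \<comment> \<open>For a socle element z modulo U + a L, the element y with b z = a y modulo U is a
    socle element modulo U + b L. As that socle vanishes, y = b w modulo U, and cancelling b gives z
    = a w modulo U.\<close>
  obtain u y where uy: "u \<in> U" "y \<in> L" "b \<odot> z = u \<oplus> a \<odot> y"
    using bspec[OF * b(1)] unfolding mem_sum by auto
  note uc = Uc[OF uy(1)] and yc = Lc[OF uy(2)]
  have "t \<odot> y \<in> U +++ scale b L" if t: "t \<in> \<mm>" for t
  proof -
    have tc: "t \<in> carrier R" using t max_sub by auto
    obtain u' w where uw: "u' \<in> U" "w \<in> L" "t \<odot> z = u' \<oplus> a \<odot> w"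
      using bspec[OF * t] unfolding mem_sum by auto
    note uc' = Uc[OF uw(1)] and wc = Lc[OF uw(2)]
    have "t \<odot> (b \<odot> z) = b \<odot> (t \<odot> z)" by (rule smult_comm[OF tc bc zc])
    then have "t \<odot> u \<oplus> a \<odot> (t \<odot> y) = b \<odot> u' \<oplus> a \<odot> (b \<odot> w)"
      unfolding uy(3) uw(3) using uc yc uc' wc tc bc ac smult_comm[OF tc ac yc] smult_comm[OF bc ac wc]
      by (simp add: smult_r_distr)
    then have "a \<odot> (t \<odot> y) \<ominus> a \<odot> (b \<odot> w) = b \<odot> u' \<ominus> t \<odot> u"
      using uc yc uc' wc tc bc ac by (intro diff_eq_diff) auto
    then have "a \<odot> (t \<odot> y \<ominus> b \<odot> w) = b \<odot> u' \<ominus> t \<odot> u"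
      using yc wc tc bc ac by (simp add: smult_minus)
    then have "a \<odot> (t \<odot> y \<ominus> b \<odot> w) \<in> U"
      using sm_minus[OF U sm_smult[OF U bc uw(1)] sm_smult[OF U tc uy(1)]] by simp
    then have "t \<odot> y \<ominus> b \<odot> w \<in> U"
      by (rule nzdD[OF a(2) sm_minus[OF L sm_smult[OF L tc uy(2)] sm_smult[OF L bc uw(2)]]])
    then show ?thesis using mem_sum_of_minus[OF _ _ sa(2) _ U, of "t \<odot> y" "b \<odot> w"] tc yc uw(2) by auto
  qed
  then have "y \<in> U +++ scale b L" using soc uy(2) unfolding socle_free_def by blast
  then obtain v w where vw: "v \<in> U" "w \<in> L" "y = v \<oplus> b \<odot> w" unfolding mem_sum by auto
  note vc = Uc[OF vw(1)] and wc = Lc[OF vw(2)]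
  have "b \<odot> z = (u \<oplus> a \<odot> v) \<oplus> b \<odot> (a \<odot> w)"
    unfolding uy(3) vw(3) using uc vc wc ac bc smult_comm[OF bc ac wc] by (simp add: smult_r_distr M.a_assoc)
  then have "b \<odot> z \<ominus> b \<odot> (a \<odot> w) = u \<oplus> a \<odot> v"
    using uc vc wc ac bc by (simp add: a_minus_def M.a_assoc M.r_neg)
  then have "b \<odot> (z \<ominus> a \<odot> w) \<in> U"
    using zc wc ac bc sm_add[OF U uy(1) sm_smult[OF U ac vw(1)]] by (simp add: smult_minus)
  then have "z \<ominus> a \<odot> w \<in> U"
    by (rule nzdD[OF b(2) sm_minus[OF L z sm_smult[OF L ac vw(2)]]])
  then show "z \<in> U +++ scale a L"
    using mem_sum_of_minus[OF zc _ sa(1) _ U, of "a \<odot> w"] vw(2) by auto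
qed

text \<open>If c x \<in> U, then x = u + b y, and regularity of b gives c y \<in> U; so the colon
  submodule K of U by c satisfies K \<subseteq> U + b K, and Nakayama's lemma yields K = U. The
  second claim follows by cancelling c modulo U + b L and then b modulo U.\<close>

lemma nzd_swap:
  assumes U: "sm U" and L: "sm L" and UL: "U \<subseteq> L" and b: "b \<in> \<mm>" "nzd U L b"
    and c: "c \<in> \<mm>" "nzd (U +++ scale b L) L c"
  shows "nzd U L c" "nzd (U +++ scale c L) L b"
proof -
  have cc: "c \<in> carrier R" and bc: "b \<in> carrier R" using c b max_sub by auto
  note Uc = sm_in[OF U] and Lc = sm_in[OF L]
  have sc: "sm (scale c L)" "sm (scale b L)" using sm_scale[OF cc L] sm_scale[OF bc L] .
  note Ub = sum_upper1[OF U sc(2)]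
  define K where "K = {x \<in> L. c \<odot> x \<in> U}"
  have K: "sm K" unfolding K_def by (rule sm_preimage[OF cc L U])
  have UK: "U \<subseteq> K" unfolding K_def using UL sm_smult[OF U cc] by auto
  have "K \<subseteq> U +++ iprod \<mm> K"
  proof
    fix x assume x: "x \<in> K"
    then have xL: "x \<in> L" "c \<odot> x \<in> U" by (auto simp: K_def)
    then have "x \<in> U +++ scale b L" using nzdD[OF c(2) xL(1)] Ub by blast
    then obtain u y where uy: "u \<in> U" "y \<in> L" "x = u \<oplus> b \<odot> y" unfolding mem_sum by auto
    note uc = Uc[OF uy(1)] and yc = Lc[OF uy(2)]
    have "c \<odot> x = c \<odot> u \<oplus> b \<odot> (c \<odot> y)"
      unfolding uy(3) using uc yc cc bc smult_comm[OF cc bc yc] by (simp add: smult_r_distr)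
    then have "b \<odot> (c \<odot> y) \<in> U"
      using xL(2) sm_add_iff[OF U sm_smult[OF U cc uy(1)], of "b \<odot> (c \<odot> y)"] bc cc yc by simp
    then have "c \<odot> y \<in> U" by (rule nzdD[OF b(2) sm_smult[OF L cc uy(2)]])
    then have "y \<in> K" using uy by (simp add: K_def)
    then have "b \<odot> y \<in> iprod \<mm> K" using b(1) iprod_mem by blast
    then show "x \<in> U +++ iprod \<mm> K" using uy unfolding mem_sum by blast
  qed
  then have "K = U" by (rule nakayama[OF U K UK])
  then show "nzd U L c" by (auto simp: nonzerodivisor_mod_def K_def)
  show "nzd (U +++ scale c L) L b"
    unfolding nonzerodivisor_mod_def
  proof (intro ballI impI)
    fix x assume x: "x \<in> L" and "b \<odot> x \<in> U +++ scale c L"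
    then obtain u y where uy: "u \<in> U" "y \<in> L" "b \<odot> x = u \<oplus> c \<odot> y" unfolding mem_sum by auto
    note uc = Uc[OF uy(1)] and yc = Lc[OF uy(2)] and xc = Lc[OF x]
    have "u \<oplus> c \<odot> y \<in> U +++ scale b L"
      unfolding uy(3)[symmetric] using x sum_upper2[OF U sc(2)] by blast
    then have "c \<odot> y \<in> U +++ scale b L"
      using sm_add_iff[OF sm_sum[OF U sc(2)] subsetD[OF Ub uy(1)], of "c \<odot> y"] cc yc by simp
    then have "y \<in> U +++ scale b L" by (rule nzdD[OF c(2) uy(2)])
    then obtain v z where vz: "v \<in> U" "z \<in> L" "y = v \<oplus> b \<odot> z" unfolding mem_sum by auto
    note vc = Uc[OF vz(1)] and zc = Lc[OF vz(2)]
    have "b \<odot> x = (u \<oplus> c \<odot> v) \<oplus> b \<odot> (c \<odot> z)"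
      unfolding uy(3) vz(3) using uc vc zc cc bc smult_comm[OF cc bc zc] by (simp add: smult_r_distr M.a_assoc)
    then have "b \<odot> x \<ominus> b \<odot> (c \<odot> z) = u \<oplus> c \<odot> v"
      using uc vc zc cc bc by (simp add: a_minus_def M.a_assoc M.r_neg)
    then have "b \<odot> (x \<ominus> c \<odot> z) \<in> U"
      using xc zc cc bc sm_add[OF U uy(1) sm_smult[OF U cc vz(1)]] by (simp add: smult_minus)
    then have "x \<ominus> c \<odot> z \<in> U"
      by (rule nzdD[OF b(2) sm_minus[OF L x sm_smult[OF L cc vz(2)]]])
    then show "x \<in> U +++ scale c L"
      using mem_sum_of_minus[OF xc _ sc(1) _ U, of "c \<odot> z"] vz(2) by auto
  qed
qed

lemma sum_swap:
  assumes "sm A" "sm B" "sm C"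
  shows "(A +++ B) +++ C = (A +++ C) +++ B"
  using sum_assoc[OF assms] sum_assoc[OF assms(1,3,2)] sum_commute[OF assms(2,3)] by simp

text \<open>Let b begin a long regular sequence and take c regular modulo both U + a L and U + b L.
  The induction hypothesis lets c follow b, \<open>nzd_swap\<close> turns (b, c) into (c, b), the
  induction hypothesis replaces b by a after c, and (c, a) is swapped to (a, c).\<close>

theorem dep_exchange:
  assumes "sm U" "sm L" "U \<subseteq> L" "dep (Suc n) U L" "a \<in> \<mm>" "nzd U L a"
  shows "dep n (U +++ scale a L) L"
  using assms
proof (induction n arbitrary: U a)
  case (Suc n)
  note U = Suc.prems(1) and L = Suc.prems(2) and UL = Suc.prems(3) and a = Suc.prems(5,6)
  obtain b where b: "b \<in> \<mm>" "nzd U L b" "dep (Suc n) (U +++ scale b L) L"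
    using Suc.prems(4) unfolding dep_Suc[of "Suc n" U L] by (elim bexE conjE)
  have car: "a \<in> carrier R" "b \<in> carrier R" using a b max_sub by auto
  note sU = sm_add_scale[OF _ U L]
  note sb = dep_socle_free[OF b(3)]
  have sa: "socle_free (U +++ scale a L) L" by (rule socle_free_exchange[OF U L UL a b(1,2) sb])
  obtain c where c: "c \<in> \<mm>" "nzd (U +++ scale a L) L c" "nzd (U +++ scale b L) L c"
    using common_nzd[OF sU(1)[OF a(1)] L sa sU(1)[OF b(1)] L sb] by (elim bexE conjE)
  have cc: "c \<in> carrier R" using c max_sub by auto
  note ca = nzd_swap[OF U L UL a c(1,2)] and cb = nzd_swap[OF U L UL b(1,2) c(1,3)]
  note sc = sm_scale[OF cc L] sm_scale[OF car(1) L] sm_scale[OF car(2) L]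
  have "dep n ((U +++ scale b L) +++ scale c L) L"
    by (rule Suc.IH[OF sU(1)[OF b(1)] L sU(2)[OF b(1) UL] b(3) c(1,3)])
  then have "dep n ((U +++ scale c L) +++ scale b L) L" by (simp only: sum_swap[OF U sc(3,1)])
  then have "dep (Suc n) (U +++ scale c L) L" unfolding dep_Suc using b(1) cb(2) by blast
  then have "dep n ((U +++ scale c L) +++ scale a L) L"
    by (rule Suc.IH[OF sU(1)[OF c(1)] L sU(2)[OF c(1) UL] _ a(1) ca(2)])
  then have "dep n ((U +++ scale a L) +++ scale c L) L" by (simp only: sum_swap[OF U sc(2,1)])
  then show ?case unfolding dep_Suc using c(1,2) by blast
qed (rule dep_0)

text \<open>An element a that is regular on V / U and on L / V is regular on L / U, and reduction by
  a keeps the sequence of the three exact. By \<open>dep_exchange\<close> the depth of the ends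
  drops by only one, although a was not chosen from given regular sequences.\<close>

theorem dep_extension:
  assumes "sm U" "sm V" "sm L" "U \<subseteq> V" "V \<subseteq> L" "dep n U V" "dep n V L"
  shows "dep n U L"
  using assms
proof (induction n arbitrary: U V)
  case (Suc n)
  note U = Suc.prems(1) and V = Suc.prems(2) and L = Suc.prems(3) and UV = Suc.prems(4) and VL = Suc.prems(5)
  obtain a where a: "a \<in> \<mm>" "nzd U V a" "nzd V L a"
    using common_nzd[OF U V dep_socle_free[OF Suc.prems(6)] V L dep_socle_free[OF Suc.prems(7)]]
    by (elim bexE conjE)
  have ac: "a \<in> carrier R" using a max_sub by auto
  note s = sm_scale[OF ac V] sm_scale[OF ac L]
  have nU: "nzd U L a"
    unfolding nonzerodivisor_mod_def using nzdD[OF a(3)] nzdD[OF a(2)] UV by blast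
  have d1: "dep n (U +++ scale a V) V" by (rule dep_exchange[OF U V UV Suc.prems(6) a(1,2)])
  have d2: "dep n (V +++ scale a L) L" by (rule dep_exchange[OF V L VL Suc.prems(7) a(1,3)])
  have UL: "U \<subseteq> L" using UV VL by blast
  note W = sm_add_scale[OF a(1) U L]
  \<comment> \<open>Exactness on the left after reduction: a l \<in> V forces l \<in> V by
    regularity on L / V. The second isomorphism theorem then moves V / (U + a V) to (V + a L) / (U +
    a L).\<close>
  have int: "U +++ scale a V = V \<inter> (U +++ scale a L)"
  proof
    show "U +++ scale a V \<subseteq> V \<inter> (U +++ scale a L)"
      using sum_least[OF UV sm_scale_subset[OF ac V] V] sum_mono[OF order_refl image_mono[OF VL]] by blast
    show "V \<inter> (U +++ scale a L) \<subseteq> U +++ scale a V"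
    proof
      fix x assume x: "x \<in> V \<inter> (U +++ scale a L)"
      then have "x \<in> U +++ scale a L" by blast
      then obtain u l where ul: "u \<in> U" "l \<in> L" "x = u \<oplus> a \<odot> l" unfolding mem_sum by auto
      have "a \<odot> l \<in> V"
        using x sm_add_iff[OF V subsetD[OF UV ul(1)], of "a \<odot> l"] ul sm_in[OF L ul(2)] ac by auto
      then have "l \<in> V" by (rule nzdD[OF a(3) ul(2)])
      then show "x \<in> U +++ scale a V" using ul unfolding mem_sum by blast
    qed
  qed
  have sum: "V +++ (U +++ scale a L) = V +++ scale a L"
    using sum_assoc[OF V U s(2)] sum_absorb2[OF UV V U] by simp
  obtain as where as: "set as \<subseteq> \<mm>" "length as = n" "regular_on M (V \<inter> (U +++ scale a L)) V as"
    using d1 unfolding int dep_def by (elim exE conjE)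
  have "set as \<subseteq> carrier R" using as(1) max_sub by blast
  then have "regular_on M (U +++ scale a L) (V +++ scale a L) as"
    using regular_on_second_iso[OF V W(1)] as(3) sum by simp
  then have "dep n (U +++ scale a L) (V +++ scale a L)" using as(1,2) unfolding dep_def by blast
  then have "dep n (U +++ scale a L) L"
    using Suc.IH[OF W(1) sm_sum[OF V s(2)] L _ sum_least[OF VL sm_scale_subset[OF ac L] L] _ d2]
      sum_mono[OF UV order_refl] by blast
  then show ?case unfolding dep_Suc using a(1) nU by blast
qed (rule dep_0)

end

section \<open>Dimension and depth\<close>

definition prime_chain :: "('a, 'r) ring_scheme => 'a set => nat => (nat => 'a set) => bool" where
  "prime_chain R J n P \<longleftrightarrow>
     (\<forall>i\<le>n. primeideal (P i) R \<and> J \<subseteq> P i) \<and> (\<forall>i<n. P i \<subset> P (Suc i))"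

text \<open>The assumption C k keeps the set nonempty; the supremum 0 of the empty set would be
  mistaken for s = 0.\<close>

lemma Sup_enat_eq_iff:
  assumes down: "!!n. C (Suc n) ==> C n" and "C k"
  shows "Sup {enat n | n. C n} = enat s \<longleftrightarrow> C s \<and> \<not> C (Suc s)"
proof -
  have mono: "C n" if "n \<le> m" "C m" for n m
    using that by (induction rule: inc_induct) (auto intro: down)
  show ?thesis
  proof
    assume sup: "Sup {enat n | n. C n} = enat s"
    have le: "n \<le> s" if "C n" for n
      using Sup_upper[of "enat n" "{enat n | n. C n}"] that sup by auto
    have "C s"
    proof (rule ccontr)
      assume "\<not> C s"
      then have lt: "n < s" if "C n" for n using mono[of s n] that by (meson not_le)
      have "Sup {enat n | n. C n} \<le> enat (s - 1)" using lt by (intro Sup_least) fastforce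
      then show False using sup lt[OF assms(2)] by simp
    qed
    then show "C s \<and> \<not> C (Suc s)" using le[of "Suc s"] by auto
  next
    assume C: "C s \<and> \<not> C (Suc s)"
    have "n \<le> s" if "C n" for n using mono[of "Suc s" n] that C by (meson not_less_eq_eq)
    then have "Sup {enat n | n. C n} \<le> enat s" by (intro Sup_least) auto
    moreover have "enat s \<le> Sup {enat n | n. C n}" using C by (intro Sup_upper) auto
    ultimately show "Sup {enat n | n. C n} = enat s" by (rule antisym)
  qed
qed

lemma prime_chain_down: "prime_chain R J (Suc n) P ==> prime_chain R J n P"
  by (auto simp: prime_chain_def)

lemma prime_pow:
  fixes n :: nat
  assumes "primeideal P R" "x \<in> carrier R" "x [^]\<^bsub>R\<^esub> n \<in> P"
  shows "x \<in> P"
proof -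
  interpret P: primeideal P R by fact
  show ?thesis using assms(3)
  proof (induction n)
    case 0
    then show ?case using P.one_imp_carrier P.I_notcarr by auto
  next
    case (Suc n)
    have "x [^]\<^bsub>R\<^esub> n \<in> P \<or> x \<in> P" using Suc.prems P.I_prime[of "x [^]\<^bsub>R\<^esub> n" x] assms(2) by simp
    then show ?case using Suc.IH by blast
  qed
qed

section \<open>Regular sequences and chains of primes\<close>

context local_module
begin

text \<open>A regular element lies in no minimal prime of the annihilator. The multiplicative set S
  of all t a^k with t outside P misses the annihilator: by regularity t a^k L \<subseteq> U implies
  t L \<subseteq> U, hence t \<in> P. A prime over the annihilator that misses S lies in P and does
  not contain a.\<close>

lemma prime_below:
  assumes U: "sm U" and L: "sm L" and a: "a \<in> carrier R" "nzd U L a"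
    and P: "primeideal P R" "sub_ann R M U L \<subseteq> P" "a \<in> P"
  shows "\<exists>Q. primeideal Q R \<and> sub_ann R M U L \<subseteq> Q \<and> Q \<subset> P"
proof -
  interpret P: primeideal P R by fact
  define S where "S = {t \<otimes>\<^bsub>R\<^esub> a [^]\<^bsub>R\<^esub> k | t (k::nat). t \<in> carrier R - P}"
  have SI: "t \<otimes>\<^bsub>R\<^esub> a [^]\<^bsub>R\<^esub> k \<in> S" if "t \<in> carrier R - P" for t and k :: nat using that unfolding S_def by blast
  have one: "\<one>\<^bsub>R\<^esub> \<in> carrier R - P" using P.one_imp_carrier P.I_notcarr by auto
  have "sub_ann R M U L \<inter> S = {}"
  proof (rule ccontr)
    assume "sub_ann R M U L \<inter> S \<noteq> {}"
    then obtain t k where t: "t \<in> carrier R" "t \<notin> P" "t \<otimes>\<^bsub>R\<^esub> a [^]\<^bsub>R\<^esub> (k::nat) \<in> sub_ann R M U L"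
      unfolding S_def by auto
    have "t \<otimes>\<^bsub>R\<^esub> a [^]\<^bsub>R\<^esub> j \<in> sub_ann R M U L ==> t \<in> sub_ann R M U L" for j :: nat
    proof (induction j)
      case 0
      then show ?case using t by simp
    next
      case (Suc j)
      have tc: "t \<otimes>\<^bsub>R\<^esub> a [^]\<^bsub>R\<^esub> j \<in> carrier R" using t a by simp
      have "t \<otimes>\<^bsub>R\<^esub> a [^]\<^bsub>R\<^esub> j \<odot> x \<in> U" if x: "x \<in> L" for x
      proof -
        have "a \<odot> (t \<otimes>\<^bsub>R\<^esub> a [^]\<^bsub>R\<^esub> j \<odot> x) = (a \<otimes>\<^bsub>R\<^esub> (t \<otimes>\<^bsub>R\<^esub> a [^]\<^bsub>R\<^esub> j)) \<odot> x"
          by (rule smult_assoc1[OF a(1) tc sm_in[OF L x], symmetric])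
        also have "a \<otimes>\<^bsub>R\<^esub> (t \<otimes>\<^bsub>R\<^esub> a [^]\<^bsub>R\<^esub> j) = t \<otimes>\<^bsub>R\<^esub> a [^]\<^bsub>R\<^esub> Suc j" using a t by (simp add: m_ac)
        finally have "a \<odot> (t \<otimes>\<^bsub>R\<^esub> a [^]\<^bsub>R\<^esub> j \<odot> x) \<in> U" using Suc.prems x by (simp add: sub_ann_def)
        then show ?thesis by (rule nzdD[OF a(2) sm_smult[OF L tc x]])
      qed
      then show ?case using Suc.IH tc by (simp add: sub_ann_def)
    qed
    then show False using t P(2) by blast
  qed
  moreover have "S \<subseteq> carrier R" unfolding S_def using a by auto
  moreover have "\<one>\<^bsub>R\<^esub> \<in> S" using SI[OF one, of 0] by simp
  moreover have "x \<otimes>\<^bsub>R\<^esub> y \<in> S" if xy: "x \<in> S" "y \<in> S" for x y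
  proof -
    obtain t j u k where *: "t \<in> carrier R - P" "u \<in> carrier R - P" "x = t \<otimes>\<^bsub>R\<^esub> a [^]\<^bsub>R\<^esub> (j::nat)"
      "y = u \<otimes>\<^bsub>R\<^esub> a [^]\<^bsub>R\<^esub> (k::nat)" using xy unfolding S_def by blast
    have "x \<otimes>\<^bsub>R\<^esub> y = (t \<otimes>\<^bsub>R\<^esub> u) \<otimes>\<^bsub>R\<^esub> a [^]\<^bsub>R\<^esub> (j + k)" using * a by (simp add: m_ac nat_pow_mult[symmetric])
    moreover have "t \<otimes>\<^bsub>R\<^esub> u \<in> carrier R - P" using * P.I_prime by auto
    ultimately show ?thesis using SI by simp
  qed
  ultimately obtain Q where Q: "primeideal Q R" "sub_ann R M U L \<subseteq> Q" "Q \<inter> S = {}"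
    using prime_disjoint[OF R.is_cring sub_ann_ideal[OF U sm_sub[OF L]], of S] by blast
  have "Q \<subseteq> P"
  proof
    fix t assume t: "t \<in> Q"
    then have tc: "t \<in> carrier R" using ideal.Icarr[of Q R t] Q(1) by (simp add: primeideal_def)
    show "t \<in> P"
    proof (rule ccontr)
      assume "t \<notin> P"
      then have "t \<in> S" using SI[of t 0] tc by simp
      then show False using t Q(3) by blast
    qed
  qed
  moreover have "a \<in> S" using SI[OF one, of 1] a by simp
  then have "a \<notin> Q" using Q(3) by blast
  ultimately show ?thesis using Q P(3) by blast
qed

text \<open>The first prime of the given chain contains the regular element a, so a smaller prime
  can be put in front.\<close>

lemma prime_chain_extend:
  assumes U: "sm U" and L: "sm L" and UL: "U \<subseteq> L" and a: "a \<in> carrier R" "nzd U L a"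
    and P: "prime_chain R (sub_ann R M (U +++ scale a L) L) n P"
  shows "\<exists>Q. prime_chain R (sub_ann R M U L) (Suc n) Q"
proof -
  let ?V = "U +++ scale a L"
  note s = sm_scale[OF a(1) L]
  have sub: "sub_ann R M U L \<subseteq> sub_ann R M ?V L"
    using sum_upper1[OF U s] unfolding sub_ann_def by blast
  have "a \<in> sub_ann R M ?V L" using sum_upper2[OF U s] a(1) unfolding sub_ann_def by blast
  moreover have P0: "primeideal (P 0) R" "sub_ann R M ?V L \<subseteq> P 0"
    using P unfolding prime_chain_def by simp_all
  ultimately have aP: "a \<in> P 0" by blast
  obtain Q where Q: "primeideal Q R" "sub_ann R M U L \<subseteq> Q" "Q \<subset> P 0"
    using prime_below[OF U L a P0(1) order_trans[OF sub P0(2)] aP] by (elim exE conjE)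
  have "prime_chain R (sub_ann R M U L) (Suc n) (case_nat Q P)"
    unfolding prime_chain_def
  proof (intro conjI allI impI)
    fix i assume "i \<le> Suc n"
    then show "primeideal (case_nat Q P i) R" "sub_ann R M U L \<subseteq> case_nat Q P i"
      using P Q sub unfolding prime_chain_def by (cases i; force)+
  next
    fix i assume "i < Suc n"
    then show "case_nat Q P i \<subset> case_nat Q P (Suc i)"
      using P Q unfolding prime_chain_def by (cases i) auto
  qed
  then show ?thesis by blast
qed

text \<open>The inequality dim L / U \<ge> dim L / (U + (as) L) + length as, one element at a time.
  It gives depth \<le> dim, and it shows that a regular sequence as long as the dimension leaves no
  chain of positive length.\<close>

lemma regular_prime_chain:
  assumes "sm U" "sm L" "U \<subseteq> L" "set as \<subseteq> carrier R" "regular_on M U L as"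
    and "prime_chain R (sub_ann R M (U +++ iprod (set as) L) L) n P"
  shows "\<exists>Q. prime_chain R (sub_ann R M U L) (n + length as) Q"
  using assms
proof (induction as arbitrary: U)
  case Nil
  have "U +++ iprod {} L = U"
    unfolding iprod_empty by (rule sum_absorb2) (use Nil.prems(1) sm_null sm_zero in auto)
  then show ?case using Nil by auto
next
  case (Cons a as)
  note U = Cons.prems(1) and L = Cons.prems(2)
  have a: "a \<in> carrier R" "set as \<subseteq> carrier R" "nzd U L a" using Cons.prems by auto
  note s = sm_scale[OF a(1) L]
  have si: "sm (iprod (set as) L)" by (rule sm_iprod[OF a(2) sm_sub[OF L]])
  have "U +++ iprod (set (a # as)) L = (U +++ scale a L) +++ iprod (set as) L"
    using iprod_insert[OF a(1,2) L] sum_assoc[OF U s si] by simp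
  then have "prime_chain R (sub_ann R M ((U +++ scale a L) +++ iprod (set as) L) L) n P"
    using Cons.prems(6) by simp
  then obtain Q where "prime_chain R (sub_ann R M (U +++ scale a L) L) (n + length as) Q"
    using Cons.IH[OF sm_sum[OF U s] L sum_least[OF Cons.prems(3) sm_scale_subset[OF a(1) L] L] a(2)]
      Cons.prems(5) by auto
  from prime_chain_extend[OF U L Cons.prems(3) a(1,3) this] show ?case by simp
qed

lemma iprod_proper:
  assumes "sm L" "J \<subseteq> \<mm>" "L \<noteq> {\<zero>}"
  shows "iprod J L \<noteq> L"
proof
  assume e: "iprod J L = L"
  have s: "sm (iprod \<mm> L)" by (rule sm_iprod[OF max_sub sm_sub[OF assms(1)]])
  have "L \<subseteq> iprod \<mm> L" using iprod_mono[OF assms(2) order_refl, of L] e by simp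
  then have "L \<subseteq> {\<zero>} +++ iprod \<mm> L" using sum_upper2[OF sm_null s] by blast
  then have "L = {\<zero>}"
    by (intro nakayama[OF sm_null assms(1)]) (use sm_zero[OF assms(1)] in auto)
  then show False using assms(3) by blast
qed

text \<open>Depth is at most dimension: the chain consisting of \<mm> alone, taken over the
  annihilator of M modulo the sequence, is prolonged downwards. By Nakayama's lemma that annihilator
  is proper, hence contained in \<mm>.\<close>

lemma dep_prime_chain:
  assumes "dep n {\<zero>} (carrier M)" "carrier M \<noteq> {\<zero>}"
  shows "\<exists>P. prime_chain R (sub_ann R M {\<zero>} (carrier M)) n P"
proof -
  obtain as where as: "set as \<subseteq> \<mm>" "length as = n" "regular_on M {\<zero>} (carrier M) as"
    using assms(1) unfolding dep_def by (elim exE conjE)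
  have asc: "set as \<subseteq> carrier R" using as(1) max_sub by blast
  have si: "sm (iprod (set as) (carrier M))" by (rule sm_iprod[OF asc order_refl])
  have e: "{\<zero>} +++ iprod (set as) (carrier M) = iprod (set as) (carrier M)"
    by (rule sum_absorb1) (use si sm_null sm_zero in auto)
  have ne: "iprod (set as) (carrier M) \<noteq> carrier M" by (rule iprod_proper[OF sm_carrier as(1) assms(2)])
  have "\<one>\<^bsub>R\<^esub> \<notin> sub_ann R M (iprod (set as) (carrier M)) (carrier M)"
  proof
    assume "\<one>\<^bsub>R\<^esub> \<in> sub_ann R M (iprod (set as) (carrier M)) (carrier M)"
    then have "carrier M \<subseteq> iprod (set as) (carrier M)" by (auto simp: sub_ann_def)
    then show False using ne sm_sub[OF si] by blast
  qed
  then have "sub_ann R M (iprod (set as) (carrier M)) (carrier M) \<subseteq> \<mm>"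
    by (rule proper_ideal_sub_max[OF sub_ann_ideal[OF si order_refl]])
  then have "prime_chain R (sub_ann R M ({\<zero>} +++ iprod (set as) (carrier M)) (carrier M)) 0 (\<lambda>_. \<mm>)"
    unfolding e prime_chain_def using max_prime by simp
  moreover have "{\<zero>} \<subseteq> carrier M" by auto
  ultimately show ?thesis
    using regular_prime_chain[OF sm_null sm_carrier _ asc as(3), of 0 "\<lambda>_. \<mm>"] as(2) by simp
qed

text \<open>Depth at least s and dimension at most s. Each half passes to extensions on its own, and
  for a nonzero module M and the pair ({0}, M) the two halves force depth and dimension to equal s
  by \<open>dep_prime_chain\<close>.\<close>

definition cm :: "nat => 'c set => 'c set => bool" where
  "cm s U L \<longleftrightarrow> dep s U L \<and> \<not> (\<exists>P. prime_chain R (sub_ann R M U L) (Suc s) P)"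

lemma dep_down: "dep (Suc n) U L ==> dep n U L"
proof (induction n arbitrary: U)
  case (Suc n)
  then show ?case unfolding dep_Suc[of "Suc n" U L] dep_Suc[of n U L] by blast
qed (rule dep_0)

lemma depth_eq_iff:
  assumes "carrier M \<noteq> {\<zero>}"
  shows "depth R \<mm> M = enat s \<longleftrightarrow> dep s {\<zero>} (carrier M) \<and> \<not> dep (Suc s) {\<zero>} (carrier M)"
proof -
  have rs: "regular_sequence R M as \<longleftrightarrow> regular_on M {\<zero>} (carrier M) as" if "set as \<subseteq> \<mm>" for as
    unfolding regular_sequence_iff using iprod_proper[OF sm_carrier that assms] order_trans[OF that max_sub] by simp
  have eq: "{enat (length as) | as. set as \<subseteq> \<mm> \<and> regular_sequence R M as} =
      {enat n | n. dep n {\<zero>} (carrier M)}"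
    by (intro equalityI subsetI) (auto simp: dep_def rs, blast)
  show ?thesis
    unfolding depth_def eq
    by (rule Sup_enat_eq_iff[of "\<lambda>n. dep n {\<zero>} (carrier M)" 0, OF dep_down dep_0])
qed

lemma mod_dim_eq_iff:
  assumes "carrier M \<noteq> {\<zero>}"
  shows "mod_dim R M = enat s \<longleftrightarrow> (\<exists>P. prime_chain R (sub_ann R M {\<zero>} (carrier M)) s P) \<and>
    \<not> (\<exists>P. prime_chain R (sub_ann R M {\<zero>} (carrier M)) (Suc s) P)"
proof -
  have "annihilator R M = sub_ann R M {\<zero>} (carrier M)" by (auto simp: annihilator_def sub_ann_def)
  then have eq: "mod_dim R M = Sup {enat n | n. \<exists>P. prime_chain R (sub_ann R M {\<zero>} (carrier M)) n P}"
    by (simp add: mod_dim_def prime_chain_def)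
  have "\<exists>P. prime_chain R (sub_ann R M {\<zero>} (carrier M)) n P"
    if "\<exists>P. prime_chain R (sub_ann R M {\<zero>} (carrier M)) (Suc n) P" for n
    using that prime_chain_down by (elim exE) (rule exI)
  then show ?thesis
    unfolding eq using dep_prime_chain[OF dep_0 assms]
    by (rule Sup_enat_eq_iff[of "\<lambda>n. \<exists>P. prime_chain R (sub_ann R M {\<zero>} (carrier M)) n P" 0])
qed

text \<open>For the zero module every list is regular on \<open>(0, 0)\<close> and no prime contains the annihilator.\<close>

lemma CM_iff:
  assumes "fin_gen R M"
  shows "M \<in> CM R \<mm> s \<longleftrightarrow> cm s {\<zero>} (carrier M)"
proof (cases "carrier M = {\<zero>}")
  case True
  have "regular_on M {\<zero>} (carrier M) as" if "set as \<subseteq> carrier R" for as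
  proof -
    have "{\<zero>} +++ iprod (set (take i as)) (carrier M) = {\<zero>}" for i
    proof -
      have "sm (iprod (set (take i as)) (carrier M))"
        using that set_take_subset[of i as] by (intro sm_iprod) auto
      moreover from this have "iprod (set (take i as)) (carrier M) = {\<zero>}"
        using sm_sub[of "iprod (set (take i as)) (carrier M)"] sm_zero True by auto
      ultimately show ?thesis using sum_absorb1[OF order_refl sm_null sm_null] by simp
    qed
    then show ?thesis using regular_on_nth[OF sm_null sm_carrier that] True
      by (simp add: nonzerodivisor_mod_def)
  qed
  then have "dep s {\<zero>} (carrier M)"
    unfolding dep_def using additive_subgroup.zero_closed[OF ideal.axioms(1)[OF max_is_ideal]]
    by (intro exI[of _ "replicate s \<zero>\<^bsub>R\<^esub>"]) (simp add: set_replicate_conv_if)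
  moreover have "\<not> (\<exists>P. prime_chain R (sub_ann R M {\<zero>} (carrier M)) (Suc s) P)"
  proof
    assume "\<exists>P. prime_chain R (sub_ann R M {\<zero>} (carrier M)) (Suc s) P"
    then obtain P where "prime_chain R (sub_ann R M {\<zero>} (carrier M)) (Suc s) P" ..
    then have "primeideal (P 0) R" "sub_ann R M {\<zero>} (carrier M) \<subseteq> P 0"
      by (auto simp: prime_chain_def)
    moreover have "\<one>\<^bsub>R\<^esub> \<in> sub_ann R M {\<zero>} (carrier M)" using True by (auto simp: sub_ann_def)
    ultimately show False using prime_sub_max one_notin_max by blast
  qed
  ultimately show ?thesis
    using True assms module_axioms by (simp add: CM_def mod_cat_def cm_def)
next
  case False
  have "dep s {\<zero>} (carrier M) ==> \<exists>P. prime_chain R (sub_ann R M {\<zero>} (carrier M)) s P"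
    "dep (Suc s) {\<zero>} (carrier M) ==> \<exists>P. prime_chain R (sub_ann R M {\<zero>} (carrier M)) (Suc s) P"
    by (rule dep_prime_chain[OF _ False], assumption)+
  then have "cohen_macaulay R \<mm> M \<and> mod_dim R M = enat s \<longleftrightarrow> cm s {\<zero>} (carrier M)"
    using False assms module_axioms depth_eq_iff[OF False, of s] mod_dim_eq_iff[OF False, of s]
    by (cases "mod_dim R M = enat s") (simp_all add: cohen_macaulay_def cm_def, blast+)
  then show ?thesis using False assms module_axioms by (simp add: CM_def mod_cat_def)
qed

text \<open>The product of the annihilators of V / U and L / V annihilates L / U, so the smallest
  prime of a chain over the annihilator of L / U contains one of the two. The depth is
  \<open>dep_extension\<close>.\<close>

lemma cm_extension:
  assumes "sm U" "sm V" "sm L" "U \<subseteq> V" "V \<subseteq> L" "cm s U V" "cm s V L"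
  shows "cm s U L"
proof -
  have "\<not> (\<exists>P. prime_chain R (sub_ann R M U L) (Suc s) P)"
  proof
    assume "\<exists>P. prime_chain R (sub_ann R M U L) (Suc s) P"
    then obtain P where P: "prime_chain R (sub_ann R M U L) (Suc s) P" ..
    then have P0: "primeideal (P 0) R" "sub_ann R M U L \<subseteq> P 0" by (auto simp: prime_chain_def)
    have "sub_ann R M U V \<subseteq> P 0 \<or> sub_ann R M V L \<subseteq> P 0"
    proof (rule ccontr)
      assume "\<not> ?thesis"
      then obtain r r' where r: "r \<in> sub_ann R M U V" "r \<notin> P 0" "r' \<in> sub_ann R M V L" "r' \<notin> P 0" by blast
      have rc: "r \<in> carrier R" "r' \<in> carrier R" using r by (auto simp: sub_ann_def)
      have "r \<otimes>\<^bsub>R\<^esub> r' \<in> sub_ann R M U L"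
        using r rc sm_in[OF assms(3)] by (simp add: sub_ann_def smult_assoc1)
      then show False using primeideal.I_prime[OF P0(1) rc] P0(2) r by blast
    qed
    moreover have "J \<subseteq> P i" if "J \<subseteq> P 0" "i \<le> Suc s" for J i
    proof -
      have "P 0 \<subseteq> P i" using that(2)
      proof (induction i)
        case (Suc i)
        then have "P i \<subset> P (Suc i)" using P unfolding prime_chain_def by simp
        then show ?case using Suc by auto
      qed simp
      then show ?thesis using that(1) by blast
    qed
    ultimately have "prime_chain R (sub_ann R M U V) (Suc s) P \<or> prime_chain R (sub_ann R M V L) (Suc s) P"
      using P unfolding prime_chain_def by meson
    then show False using assms(6,7) unfolding cm_def by blast
  qed
  then show ?thesis using dep_extension[OF assms(1-5)] assms(6,7) by (simp add: cm_def)
qed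

section \<open>Modules of finite length\<close>

text \<open>Otherwise take W maximal with L / W of infinite length. Some x outside W has a prime
  annihilator modulo W, which can only be \<mm>; then (W + R x) / W is simple, while L / (W + R x)
  has finite length by maximality of W, a contradiction.\<close>

lemma finite_length:
  assumes U: "sm U" and L: "sm L" and UL: "U \<subseteq> L"
    and primes: "!!P. primeideal P R ==> sub_ann R M U L \<subseteq> P ==> P = \<mm>"
  shows "len U L \<noteq> \<infinity>"
proof
  assume inf: "len U L = \<infinity>"
  let ?S = "{W. sm W \<and> U \<subseteq> W \<and> W \<subseteq> L \<and> len W L = \<infinity>}"
  have "\<exists>W\<in>?S. \<forall>V\<in>?S. W \<subseteq> V --> V = W" by (rule sm_maximal) (use U UL inf in auto)
  then obtain W where W1: "W \<in> ?S" "\<forall>V\<in>?S. W \<subseteq> V --> V = W" by (rule bexE)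
  then have W: "sm W" "U \<subseteq> W" "W \<subseteq> L" "len W L = \<infinity>" by simp_all
  have "W \<noteq> L" using W(4) len_refl by auto
  then obtain x0 where x0: "x0 \<in> L - W" using W(3) by blast
  obtain F where F: "\<forall>P\<in>F. primeideal P R \<and> (\<exists>x\<in>L - W. P = sub_ann R M W {x})"
    "\<forall>x\<in>L - W. \<exists>P\<in>F. sub_ann R M W {x} \<subseteq> P" using ann_primes[OF W(1) L] by (elim exE conjE)
  obtain P where "P \<in> F" using bspec[OF F(2) x0] by (elim bexE)
  then obtain x where x: "x \<in> L" "x \<notin> W" "primeideal (sub_ann R M W {x}) R" using F(1) by auto
  have "sub_ann R M U L \<subseteq> sub_ann R M W {x}" using x(1) W(2) by (auto simp: sub_ann_def)
  then have max: "sub_ann R M W {x} = \<mm>" by (rule primes[OF x(3)])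
  note xc = sm_in[OF L x(1)]
  have sp: "sm (mod_span R M {x})" using xc by (intro sm_span) auto
  define V where "V = W +++ mod_span R M {x}"
  have V: "sm V" "W \<subseteq> V" "x \<in> V" "V \<subseteq> L"
    unfolding V_def using sm_sum[OF W(1) sp] sum_upper1[OF W(1) sp] sum_upper2[OF W(1) sp]
      span_incl[of "{x}"] sum_least[OF W(3) span_least[OF _ L] L, of "{x}"] x(1) by auto
  have VL: "len V L \<noteq> \<infinity>"
  proof
    assume "len V L = \<infinity>"
    then have "V = W" using W1(2) V W(2) by auto
    then show False using V(3) x(2) by simp
  qed
  \<comment> \<open>An element y = w + r x outside W has r outside \<mm>, so r is invertible, and a
    submodule over W that contains y contains x as well.\<close>
  have "\<not> enat 2 \<le> len W V"
  proof
    assume "enat 2 \<le> len W V"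
    then obtain H where H: "sub_chain R M W V 2 H" by (rule sub_len_geE) simp
    then have h: "sm (H 1)" "W \<subseteq> H 0" "H 0 \<subset> H 1" "H 1 \<subset> H 2" "H 2 \<subseteq> V"
      unfolding sub_chain_def by (simp_all add: numeral_2_eq_2)
    then obtain y where y: "y \<in> H 1" "y \<notin> W" "y \<in> V" by blast
    then obtain w r where wr: "w \<in> W" "r \<in> carrier R" "y = w \<oplus> r \<odot> x"
      unfolding V_def span_single[OF xc] mem_sum by blast
    have rx: "r \<odot> x \<in> carrier M" using wr xc by simp
    have "r \<notin> \<mm>"
    proof
      assume "r \<in> \<mm>"
      then have "r \<odot> x \<in> W" unfolding max[symmetric] by (simp add: sub_ann_def)
      then show False using y(2) wr sm_add[OF W(1)] by auto
    qed
    moreover have "r \<odot> x \<in> H 1"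
      using y(1) wr(1) h sm_add_iff[OF h(1) _ rx, of w] unfolding wr(3) by blast
    ultimately have "x \<in> H 1" using unit_smult_mem[OF h(1) wr(2) _ xc] by blast
    then have "V \<subseteq> H 1"
      unfolding V_def using h by (intro sum_least span_least) auto
    then show False using h by blast
  qed
  then have "len W V \<noteq> \<infinity>" by (cases "len W V") auto
  then show False using len_infinite_split[OF W(1) V(1) L V(2,4)] VL W(4) by blast
qed

abbreviation ipow :: "'a set => nat => 'c set => 'c set" where
  "ipow I n L \<equiv> iprod (ideal_power R I n) L"

end

section \<open>Powers of an ideal and growth of lengths\<close>

context cring
begin

lemma ideal_power_ideal: "ideal I R ==> ideal (ideal_power R I n) R"
  by (induction n) (auto intro: oneideal ideal_prod_is_ideal)

lemma pow_in_ideal_power: "ideal I R ==> x \<in> I ==> x [^] (n::nat) \<in> ideal_power R I n"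
proof (induction n)
  case (Suc n)
  have x: "x \<in> carrier R" using ideal.Icarr Suc by fast
  have "x \<otimes> x [^] n \<in> ideal_power R I (Suc n)" using Suc by (auto intro: ideal_prod.prod)
  then show ?case using x by (simp add: m_comm)
qed auto

end

context local_module
begin

lemma ideal_power_sub: "ideal I R ==> ideal_power R I n \<subseteq> carrier R"
  using ideal.Icarr[OF R.ideal_power_ideal] by blast

lemma sm_ipow: "ideal I R ==> sm L ==> sm (ipow I n L)"
  by (rule sm_iprod[OF ideal_power_sub sm_sub])

lemma ipow_Suc: "ideal I R ==> sm L ==> ipow I (Suc n) L = iprod I (ipow I n L)"
  using iprod_ideal_prod[OF _ R.ideal_power_ideal] by simp

lemma ipow_0: "sm L ==> ipow I 0 L = L"
  using iprod_carrier by simp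

lemma ipow_subset: "ideal I R ==> sm L ==> ipow I n L \<subseteq> L"
  by (rule iprod_subset[OF ideal_power_sub])

text \<open>The Hilbert--Samuel function grows at most like \<open>n\<^sup>s\<close> if \<open>s\<close> elements of \<open>\<mm>\<close> cut down to finite length.\<close>

lemma growth:
  assumes I: "ideal I R" and rad: "!!t. t \<in> \<mm> ==> \<exists>k::nat. t [^]\<^bsub>R\<^esub> k \<in> I"
    and fin: "!!n. len (ipow I n (carrier M)) (carrier M) \<noteq> \<infinity>"
    and "sm U" "set as \<subseteq> \<mm>" "len (U +++ iprod (set as) (carrier M)) (carrier M) \<noteq> \<infinity>"
  shows "\<exists>C\<ge>0. \<forall>n. rlen (U +++ ipow I n (carrier M)) (carrier M) \<le> C * (real n + 1) ^ length as"
  using assms(4-6)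
proof (induction as arbitrary: U)
  case Nil
  note U = Nil.prems(1)
  have e: "U +++ iprod {} (carrier M) = U"
    unfolding iprod_empty by (rule sum_absorb2) (use U sm_null sm_zero in auto)
  have "rlen (U +++ ipow I n (carrier M)) (carrier M) \<le> rlen U (carrier M)" for n
    using Nil.prems(3) sum_upper1[OF U sm_ipow[OF I sm_carrier]] unfolding e list.set
    by (intro rlen_mono sub_len_mono) auto
  then show ?case by (intro exI[of _ "rlen U (carrier M)"]) (auto simp: rlen_nonneg)
next
  case (Cons a as)
  note U = Cons.prems(1)
  have a: "a \<in> \<mm>" "set as \<subseteq> \<mm>" using Cons.prems by auto
  have ac: "a \<in> carrier R" "set as \<subseteq> carrier R" using a max_sub by auto
  note sa = sm_scale[OF ac(1) sm_carrier]
  have si: "sm (iprod (set as) (carrier M))" by (rule sm_iprod[OF ac(2) order_refl])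
  have U': "sm (U +++ scale a (carrier M))" by (rule sm_sum[OF U sa])
  have "U +++ iprod (set (a # as)) (carrier M) =
      (U +++ scale a (carrier M)) +++ iprod (set as) (carrier M)"
    using iprod_insert[OF ac sm_carrier] sum_assoc[OF U sa si] by simp
  then obtain C where C: "C \<ge> 0" "!!n. rlen ((U +++ scale a (carrier M)) +++ ipow I n (carrier M)) (carrier M)
      \<le> C * (real n + 1) ^ length as"
    using Cons.IH[OF U' a(2)] Cons.prems(3) by auto
  obtain k :: nat where k: "a [^]\<^bsub>R\<^esub> k \<in> I" using rad[OF a(1)] by (elim exE)
  define f where "f n = rlen (U +++ ipow I n (carrier M)) (carrier M)" for n
  have sI: "sm (ipow I n (carrier M))" for n by (rule sm_ipow[OF I sm_carrier])
  have finU: "len V (carrier M) \<noteq> \<infinity>" if "ipow I n (carrier M) \<subseteq> V" for V n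
    using sub_len_mono[OF that order_refl, of R M "carrier M"] fin[of n]
    by (cases "len V (carrier M)") auto
  \<comment> \<open>With W = U + I^(n+1) M, the length of M / W splits at W + a^k M, where a^k \<in>
    I. The upper part is bounded by k times the length of M / (W + a M), known by induction; the
    lower part (W + a^k M) / W is an image of M / (U + I^n M) under a^k.\<close>
  have step: "f (Suc n) \<le> real k * (C * (real (Suc n) + 1) ^ length as) + f n" for n
  proof -
    define W where "W = U +++ ipow I (Suc n) (carrier M)"
    have W: "sm W" "ipow I (Suc n) (carrier M) \<subseteq> W" "U \<subseteq> W"
      unfolding W_def using sm_sum[OF U sI] sum_upper2[OF U sI] sum_upper1[OF U sI] by blast+
    have sp: "sm (scale (a [^]\<^bsub>R\<^esub> j) (carrier M))" for j :: nat using ac by (intro sm_scale sm_carrier) simp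
    define T where "T j = W +++ scale (a [^]\<^bsub>R\<^esub> j) (carrier M)" for j :: nat
    have T: "sm (T j)" "W \<subseteq> T j" "T j \<subseteq> carrier M" for j
      unfolding T_def using sm_sum[OF W(1) sp] sum_upper1[OF W(1) sp] sm_sub[OF sm_sum[OF W(1) sp]] by blast+
    have TS: "T (Suc j) \<subseteq> T j" for j
    proof -
      have "scale (a [^]\<^bsub>R\<^esub> Suc j) (carrier M) \<subseteq> scale (a [^]\<^bsub>R\<^esub> j) (carrier M)"
        using ac by (auto simp: smult_assoc1)
      then show ?thesis unfolding T_def by (intro sum_mono order_refl)
    qed
    have finT: "len (T j) (carrier M) \<noteq> \<infinity>" "len W (carrier M) \<noteq> \<infinity>" for j
      using finU[of "Suc n"] W(2) T(2) by blast+
    have T1: "rlen (T (Suc 0)) (carrier M) \<le> C * (real (Suc n) + 1) ^ length as"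
    proof -
      have "T (Suc 0) = (U +++ scale a (carrier M)) +++ ipow I (Suc n) (carrier M)"
        unfolding T_def W_def nat_pow_Suc nat_pow_0 l_one[OF ac(1)] by (rule sum_swap[OF U sI sa])
      then show ?thesis using C(2)[of "Suc n"] by (simp only:)
    qed
    have "rlen (T j) (carrier M) \<le> real j * rlen (T (Suc 0)) (carrier M)" for j
    proof (induction j)
      case 0
      have "scale (a [^]\<^bsub>R\<^esub> (0::nat)) (carrier M) = carrier M" by (force simp: image_iff)
      then have "T 0 = carrier M" unfolding T_def using sum_absorb1[OF sm_sub[OF W(1)] W(1) sm_carrier] by simp
      then show ?case by (simp add: rlen_def len_refl zero_enat_def)
    next
      case (Suc j)
      have aj: "a [^]\<^bsub>R\<^esub> j \<in> carrier R" using ac by simp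
      have "scale (a [^]\<^bsub>R\<^esub> j) (carrier M) +++ T (Suc j) = T j"
      proof -
        have "scale (a [^]\<^bsub>R\<^esub> j) (carrier M) +++ T (Suc j) \<subseteq> T j"
          using sum_least[OF _ TS T(1)] sum_upper2[OF W(1) sp] unfolding T_def by blast
        moreover have "T j \<subseteq> scale (a [^]\<^bsub>R\<^esub> j) (carrier M) +++ T (Suc j)"
          unfolding T_def[of j]
          using sum_least[OF order_trans[OF T(2) sum_upper2[OF sp T(1)]] sum_upper1[OF sp T(1)] sm_sum[OF sp T(1)]] .
        ultimately show ?thesis by blast
      qed
      then have l: "len {x \<in> carrier M. (a [^]\<^bsub>R\<^esub> j) \<odot> x \<in> T (Suc j)} (carrier M) = len (T (Suc j)) (T j)"
        using len_scale[OF aj sm_carrier T(1)] by simp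
      \<comment> \<open>Multiplication by a^j maps M onto T j modulo T (Suc j) and sends T 1 into T
        (Suc j), so each layer has at most the length of M / T 1.\<close>
      have "T (Suc 0) \<subseteq> {x \<in> carrier M. (a [^]\<^bsub>R\<^esub> j) \<odot> x \<in> T (Suc j)}"
        unfolding T_def[of "Suc 0"]
      proof (rule sum_least[OF _ _ sm_preimage[OF aj sm_carrier T(1)]])
        show "W \<subseteq> {x \<in> carrier M. (a [^]\<^bsub>R\<^esub> j) \<odot> x \<in> T (Suc j)}"
          using sm_smult[OF W(1) aj] T(2) sm_sub[OF W(1)] by auto
        have "scale (a [^]\<^bsub>R\<^esub> Suc j) (carrier M) \<subseteq> T (Suc j)" unfolding T_def by (rule sum_upper2[OF W(1) sp])
        then show "scale (a [^]\<^bsub>R\<^esub> Suc 0) (carrier M) \<subseteq> {x \<in> carrier M. (a [^]\<^bsub>R\<^esub> j) \<odot> x \<in> T (Suc j)}"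
          using ac aj by (auto simp: smult_assoc1 image_subset_iff)
      qed
      then have "len (T (Suc j)) (T j) \<le> len (T (Suc 0)) (carrier M)"
        unfolding l[symmetric] by (intro sub_len_mono order_refl)
      then have "rlen (T (Suc j)) (T j) \<le> rlen (T (Suc 0)) (carrier M)" using finT by (intro rlen_mono) auto
      moreover have "rlen (T (Suc j)) (carrier M) = rlen (T (Suc j)) (T j) + rlen (T j) (carrier M)"
        by (rule len_split(3)[OF T(1) T(1) sm_carrier TS T(3) finT(1)])
      ultimately show ?case using Suc by (simp add: algebra_simps)
    qed
    then have A: "rlen (T k) (carrier M) \<le> real k * (C * (real (Suc n) + 1) ^ length as)"
      using T1 by (meson mult_left_mono of_nat_0_le_iff order_trans)
    have ak: "a [^]\<^bsub>R\<^esub> k \<in> carrier R" using ac by simp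
    have "scale (a [^]\<^bsub>R\<^esub> k) (carrier M) +++ W = T k" unfolding T_def by (rule sum_commute[OF sp W(1)])
    then have l: "len {x \<in> carrier M. (a [^]\<^bsub>R\<^esub> k) \<odot> x \<in> W} (carrier M) = len W (T k)"
      using len_scale[OF ak sm_carrier W(1)] by simp
    have "U +++ ipow I n (carrier M) \<subseteq> {x \<in> carrier M. (a [^]\<^bsub>R\<^esub> k) \<odot> x \<in> W}"
    proof (rule sum_least[OF _ _ sm_preimage[OF ak sm_carrier W(1)]])
      show "U \<subseteq> {x \<in> carrier M. (a [^]\<^bsub>R\<^esub> k) \<odot> x \<in> W}"
        using sm_smult[OF U ak] W(3) sm_sub[OF U] by auto
      show "ipow I n (carrier M) \<subseteq> {x \<in> carrier M. (a [^]\<^bsub>R\<^esub> k) \<odot> x \<in> W}"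
        using iprod_mem[OF k, of _ "ipow I n (carrier M)"] sm_sub[OF sI] W(2)
        unfolding ipow_Suc[OF I sm_carrier] by auto
    qed
    then have "len W (T k) \<le> len (U +++ ipow I n (carrier M)) (carrier M)"
      unfolding l[symmetric] by (intro sub_len_mono order_refl)
    then have "rlen W (T k) \<le> f n"
      unfolding f_def using finU[OF sum_upper2[OF U sI]] by (intro rlen_mono)
    moreover have "f (Suc n) = rlen W (T k) + rlen (T k) (carrier M)"
      unfolding f_def W_def[symmetric] by (rule len_split(3)[OF W(1) T(1) sm_carrier T(2,3) finT(2)])
    ultimately show ?thesis using A by simp
  qed
  \<comment> \<open>Summation of \<open>step\<close> from f 0 = 0, with each of the n increments
    bounded by the last one.\<close>
  have "f n \<le> real n * (real k * C * (real n + 1) ^ length as)" for n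
  proof (induction n)
    case 0
    have "U +++ ipow I 0 (carrier M) = carrier M"
      unfolding ipow_0[OF sm_carrier] by (rule sum_absorb1[OF sm_sub[OF U] U sm_carrier])
    then show ?case by (simp add: f_def rlen_def len_refl zero_enat_def)
  next
    case (Suc n)
    have "(real n + 1) ^ length as \<le> (real (Suc n) + 1) ^ length as" by (intro power_mono) auto
    then have "real n * (real k * C * (real n + 1) ^ length as) \<le> real n * (real k * C * (real (Suc n) + 1) ^ length as)"
      using C(1) by (intro mult_left_mono) auto
    then show ?case using step[of n] Suc by (simp add: algebra_simps)
  qed
  moreover have "real n * (real k * C * (real n + 1) ^ length as) \<le> real k * C * (real n + 1) ^ length (a # as)" for n
  proof -
    have "0 \<le> real k * C * (real n + 1) ^ length as" using C(1) by simp
    then show ?thesis by (simp add: algebra_simps)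
  qed
  ultimately have "f n \<le> real k * C * (real n + 1) ^ length (a # as)" for n by (meson order_trans)
  then show ?case unfolding f_def using C(1) by (intro exI[of _ "real k * C"]) auto
qed

end

section \<open>Short exact sequences\<close>

text \<open>The three carriers may have different types, unlike in \<open>short_exact\<close>; fibre
  products and the zero module on \<open>unit\<close> enter sequences in this way.\<close>

definition exact_seq ::
  "('a, 'r) ring_scheme => ('a, 'b) module => ('b => 'c) => ('a, 'c) module => ('c => 'd) =>
   ('a, 'd) module => bool" where
  "exact_seq R A f B g C \<longleftrightarrow> module R A \<and> module R B \<and> module R C \<and> f \<in> mod_hom R A B \<and>
     g \<in> mod_hom R B C \<and> inj_on f (carrier A) \<and>
     f ` carrier A = {x \<in> carrier B. g x = \<zero>\<^bsub>C\<^esub>} \<and> g ` carrier B = carrier C"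

lemma exact_seqD:
  assumes "exact_seq R A f B g C"
  shows "module R A" "module R B" "module R C" "f \<in> mod_hom R A B" "g \<in> mod_hom R B C"
    "inj_on f (carrier A)" "f ` carrier A = {x \<in> carrier B. g x = \<zero>\<^bsub>C\<^esub>}" "g ` carrier B = carrier C"
  using assms by (auto simp: exact_seq_def)

definition quot_len :: "('a, 'r) ring_scheme => 'a set => ('a, 'b) module => enat" where
  "quot_len R J M = sub_len R M (sub_prod R M J (carrier M)) (carrier M)"

lemma mod_length_quot_smult:
  fixes R :: "('a, 'r) ring_scheme" and M :: "('a, 'b) module"
  assumes "module R M" "J \<subseteq> carrier R"
  shows "mod_length R (quot_mod M (ideal_smult R J M)) = quot_len R J M"
proof -
  interpret M: rmodule R M by (rule rmodule.intro) fact
  show ?thesis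
    unfolding quot_len_def ideal_smult_eq
    by (rule mod_length_quot[OF assms(1) M.sm_iprod[OF assms(2) order_refl]])
qed

text \<open>Images of generators of A together with lifts of generators of C.\<close>

lemma fin_gen_exact_middle:
  assumes e: "exact_seq R A f B g C" and "fin_gen R A" "fin_gen R C"
  shows "fin_gen R B"
proof -
  note x = exact_seqD[OF e]
  interpret A: rmodule R A by (rule rmodule.intro) (rule x(1))
  interpret B: rmodule R B by (rule rmodule.intro) (rule x(2))
  interpret C: rmodule R C by (rule rmodule.intro) (rule x(3))
  obtain S where S: "finite S" "S \<subseteq> carrier A" "mod_span R A S = carrier A"
    using assms(2) unfolding fin_gen_def by auto
  obtain T where T: "finite T" "T \<subseteq> carrier C" "mod_span R C T = carrier C"
    using assms(3) unfolding fin_gen_def by auto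
  have "T \<subseteq> g ` carrier B" using T(2) x(8) by simp
  from finite_subset_image[OF T(1) this] obtain T' where T': "finite T'" "T' \<subseteq> carrier B" "g ` T' = T"
    by auto
  define G where "G = f ` S \<union> T'"
  have G: "finite G" "G \<subseteq> carrier B"
    unfolding G_def using S(1,2) T'(1,2) mod_homD(1)[OF x(4)] by auto
  define W where "W = mod_span R B G"
  have W: "submodule W R B" unfolding W_def by (rule B.sm_span[OF G(2)])
  have "f ` carrier A \<subseteq> W"
    unfolding S(3)[symmetric] mod_hom_span[OF x(1,2,4) S(2)] W_def G_def by (rule B.span_mono) simp
  moreover have "carrier C \<subseteq> g ` W"
    unfolding T(3)[symmetric] T'(3)[symmetric] mod_hom_span[OF x(2,3,5) T'(2), symmetric] W_def G_def
    by (intro image_mono B.span_mono) simp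
  ultimately have "carrier B \<subseteq> W"
  proof (intro subsetI)
    fix b assume fA: "f ` carrier A \<subseteq> W" and gW: "carrier C \<subseteq> g ` W" and b: "b \<in> carrier B"
    then obtain w where w: "w \<in> W" "g b = g w" using mod_homD(1)[OF x(5) b] by auto
    have wc: "w \<in> carrier B" by (rule B.sm_in[OF W w(1)])
    have "g (b \<ominus>\<^bsub>B\<^esub> w) = \<zero>\<^bsub>C\<^esub>"
      using w b wc mod_homD(1)[OF x(5) wc] by (simp add: mod_hom_minus[OF x(2,3,5)] C.minus_eq_zero_iff)
    then have "b \<ominus>\<^bsub>B\<^esub> w \<in> W" using fA b wc unfolding x(7) by auto
    then have "w \<oplus>\<^bsub>B\<^esub> (b \<ominus>\<^bsub>B\<^esub> w) \<in> W" by (rule B.sm_add[OF W w(1)])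
    then show "b \<in> W" using b wc by (simp add: B.add_minus_cancel)
  qed
  then show ?thesis
    unfolding fin_gen_def using G B.sm_sub[OF W] W_def by (intro exI[of _ G]) auto
qed

lemma fin_gen_submodule:
  fixes R :: "('a, 'r) ring_scheme" and M :: "('a, 'b) module" and N :: "('a, 'c) module"
  assumes "module R M" "module R N" "f \<in> mod_hom R M N" "inj_on f (carrier M)" "noetherian_ring R" "fin_gen R N"
  shows "fin_gen R M"
proof -
  interpret M: rmodule R M by (rule rmodule.intro) fact
  interpret N: noetherian_module R N by (rule noetherian_moduleI[OF assms(5,2,6)])
  obtain S where S: "finite S" "S \<subseteq> f ` carrier M" "mod_span R N S = f ` carrier M"
    using N.sm_fin_gen[OF mod_hom_image_sm[OF assms(1-3) M.sm_carrier]] by auto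
  obtain T where T: "finite T" "T \<subseteq> carrier M" "S = f ` T"
    using finite_subset_image[OF S(1,2)] by auto
  have sT: "submodule (mod_span R M T) R M" by (rule M.sm_span[OF T(2)])
  have "f ` mod_span R M T = f ` carrier M"
    using mod_hom_span[OF assms(1-3) T(2)] S(3) T(3) by simp
  then have "mod_span R M T = carrier M"
    using inj_on_image_eq_iff[OF assms(4) M.sm_sub[OF sT] order_refl] by simp
  then show ?thesis unfolding fin_gen_def using T by auto
qed

text \<open>The image of A in B / J B is A / (A \<inter> J B), with cokernel C / J C, and J A
  \<subseteq> A \<inter> J B. So additivity fails by the gap between J A and A \<inter> J B.
  Everything is computed inside B, with f A in place of A.\<close>

lemma exact_quot_len:
  assumes e: "exact_seq R A f B g C" and J: "J \<subseteq> carrier R"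
  shows "quot_len R J A = sub_len R B (sub_prod R B J (f ` carrier A)) (f ` carrier A)"
    "quot_len R J B = sub_len R B (f ` carrier A \<inter> sub_prod R B J (carrier B)) (f ` carrier A) + quot_len R J C"
    "sub_len R B (f ` carrier A \<inter> sub_prod R B J (carrier B)) (f ` carrier A) \<le> quot_len R J A"
proof -
  note x = exact_seqD[OF e]
  interpret A: rmodule R A by (rule rmodule.intro) (rule x(1))
  interpret B: rmodule R B by (rule rmodule.intro) (rule x(2))
  interpret C: rmodule R C by (rule rmodule.intro) (rule x(3))
  let ?V = "f ` carrier A"
  have V: "B.sm ?V" by (rule mod_hom_image_sm[OF x(1,2,4) A.sm_carrier])
  have sA: "A.sm (A.iprod J (carrier A))" by (rule A.sm_iprod[OF J order_refl])
  have sB: "B.sm (B.iprod J (carrier B))" by (rule B.sm_iprod[OF J order_refl])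
  have sV: "B.sm (B.iprod J ?V)" by (rule B.sm_iprod[OF J B.sm_sub[OF V]])
  have sC: "C.sm (C.iprod J (carrier C))" by (rule C.sm_iprod[OF J order_refl])
  have fJ: "f ` A.iprod J (carrier A) = B.iprod J ?V" by (rule mod_hom_sub_prod[OF x(1,2,4) J order_refl])
  have gJ: "g ` B.iprod J (carrier B) = C.iprod J (carrier C)"
    using mod_hom_sub_prod[OF x(2,3,5) J order_refl] x(8) by simp
  have "{y \<in> carrier A. f y \<in> B.iprod J ?V} = A.iprod J (carrier A)"
  proof
    show "{y \<in> carrier A. f y \<in> B.iprod J ?V} \<subseteq> A.iprod J (carrier A)"
      unfolding fJ[symmetric] using inj_on_image_mem_iff[OF x(6) _ A.sm_sub[OF sA]] by auto
    show "A.iprod J (carrier A) \<subseteq> {y \<in> carrier A. f y \<in> B.iprod J ?V}"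
      unfolding fJ[symmetric] using A.sm_sub[OF sA] by auto
  qed
  moreover have "?V <+>\<^bsub>B\<^esub> B.iprod J ?V = ?V" by (rule B.sum_absorb2[OF B.iprod_subset[OF J V] V sV])
  ultimately show 1: "quot_len R J A = B.len (B.iprod J ?V) ?V"
    using sub_len_hom[OF x(1,2,4) A.sm_carrier sV] by (simp add: quot_len_def)
  have "{y \<in> carrier B. g y \<in> C.iprod J (carrier C)} = ?V <+>\<^bsub>B\<^esub> B.iprod J (carrier B)"
  proof (intro equalityI subsetI)
    fix y assume "y \<in> {y \<in> carrier B. g y \<in> C.iprod J (carrier C)}"
    then have y: "y \<in> carrier B" "g y \<in> g ` B.iprod J (carrier B)" unfolding gJ by auto
    then obtain z where z: "z \<in> B.iprod J (carrier B)" "g y = g z" by auto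
    have zc: "z \<in> carrier B" by (rule B.sm_in[OF sB z(1)])
    have "g (y \<ominus>\<^bsub>B\<^esub> z) = \<zero>\<^bsub>C\<^esub>"
      using z y zc mod_homD(1)[OF x(5) zc] by (simp add: mod_hom_minus[OF x(2,3,5)] C.minus_eq_zero_iff)
    then have v: "y \<ominus>\<^bsub>B\<^esub> z \<in> ?V" unfolding x(7) using y zc by simp
    have "y = (y \<ominus>\<^bsub>B\<^esub> z) \<oplus>\<^bsub>B\<^esub> z"
      using B.add_minus_cancel[OF zc y(1)] B.M.a_comm[of "y \<ominus>\<^bsub>B\<^esub> z" z] zc y by simp
    then show "y \<in> ?V <+>\<^bsub>B\<^esub> B.iprod J (carrier B)" unfolding B.mem_sum using v z(1) by blast
  next
    fix y assume "y \<in> ?V <+>\<^bsub>B\<^esub> B.iprod J (carrier B)"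
    then obtain v z where vz: "v \<in> ?V" "z \<in> B.iprod J (carrier B)" "y = v \<oplus>\<^bsub>B\<^esub> z" unfolding B.mem_sum by auto
    have c: "v \<in> carrier B" "z \<in> carrier B" "g v = \<zero>\<^bsub>C\<^esub>" "g z \<in> carrier C"
      using vz(1) B.sm_in[OF sB vz(2)] mod_homD(1)[OF x(5)] unfolding x(7) by auto
    have "g y = g z" unfolding vz(3) mod_homD(2)[OF x(5) c(1,2)] c(3) using c(4) by simp
    then show "y \<in> {y \<in> carrier B. g y \<in> C.iprod J (carrier C)}"
      using vz c unfolding gJ[symmetric] by auto
  qed
  moreover have "carrier C <+>\<^bsub>C\<^esub> C.iprod J (carrier C) = carrier C"
    by (rule C.sum_absorb2[OF C.sm_sub[OF sC] C.sm_carrier sC])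
  ultimately have "B.len (?V <+>\<^bsub>B\<^esub> B.iprod J (carrier B)) (carrier B) = quot_len R J C"
    using sub_len_hom[OF x(2,3,5) B.sm_carrier sC] x(8) by (simp add: quot_len_def)
  moreover have "quot_len R J B = B.len (B.iprod J (carrier B)) (?V <+>\<^bsub>B\<^esub> B.iprod J (carrier B)) +
      B.len (?V <+>\<^bsub>B\<^esub> B.iprod J (carrier B)) (carrier B)"
    unfolding quot_len_def
    by (rule B.len_add[OF sB B.sm_sum[OF V sB] B.sm_carrier B.sum_upper2[OF V sB] B.sm_sub[OF B.sm_sum[OF V sB]]])
  moreover have "B.len (?V \<inter> B.iprod J (carrier B)) ?V = B.len (B.iprod J (carrier B)) (?V <+>\<^bsub>B\<^esub> B.iprod J (carrier B))"
    by (rule B.len_second_iso[OF V sB])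
  ultimately show "quot_len R J B = B.len (?V \<inter> B.iprod J (carrier B)) ?V + quot_len R J C" by simp
  show "B.len (?V \<inter> B.iprod J (carrier B)) ?V \<le> quot_len R J A"
    unfolding 1 using B.iprod_subset[OF J V] B.iprod_mono[OF order_refl B.sm_sub[OF V]]
    by (intro sub_len_mono) auto
qed

text \<open>A retraction r of f maps f A \<inter> J B into J A, which closes the gap between the two
  submodules.\<close>

lemma exact_quot_len_split:
  assumes e: "exact_seq R A f B g C" and J: "J \<subseteq> carrier R"
    and r: "r \<in> mod_hom R B A" "!!a. a \<in> carrier A ==> r (f a) = a"
  shows "quot_len R J B = quot_len R J A + quot_len R J C"
proof -
  note x = exact_seqD[OF e]
  interpret A: rmodule R A by (rule rmodule.intro) (rule x(1))
  interpret B: rmodule R B by (rule rmodule.intro) (rule x(2))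
  have "f ` carrier A \<inter> B.iprod J (carrier B) = B.iprod J (f ` carrier A)"
  proof
    show "B.iprod J (f ` carrier A) \<subseteq> f ` carrier A \<inter> B.iprod J (carrier B)"
      using B.iprod_subset[OF J mod_hom_image_sm[OF x(1,2,4) A.sm_carrier]] mod_homD(1)[OF x(4)]
        B.iprod_mono[OF order_refl, of "f ` carrier A" "carrier B" J] by auto
    show "f ` carrier A \<inter> B.iprod J (carrier B) \<subseteq> B.iprod J (f ` carrier A)"
    proof
      fix y assume y: "y \<in> f ` carrier A \<inter> B.iprod J (carrier B)"
      then obtain a where a: "a \<in> carrier A" "y = f a" by auto
      have "r y \<in> r ` B.iprod J (carrier B)" using y by blast
      also have "\<dots> = A.iprod J (r ` carrier B)" by (rule mod_hom_sub_prod[OF x(2,1) r(1) J order_refl])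
      also have "\<dots> \<subseteq> A.iprod J (carrier A)"
        using mod_homD(1)[OF r(1)] by (intro A.iprod_mono) auto
      finally have "a \<in> A.iprod J (carrier A)" using a r(2) by simp
      then have "f a \<in> f ` A.iprod J (carrier A)" by blast
      then show "y \<in> B.iprod J (f ` carrier A)"
        unfolding mod_hom_sub_prod[OF x(1,2,4) J order_refl] a(2) .
    qed
  qed
  then show ?thesis using exact_quot_len(1,2)[OF e J] by simp
qed

section \<open>Multiplicity\<close>

text \<open>In the application t n is the length of A / (A \<inter> I^(n+1) B), and the third bound
  is the Artin-Rees lemma. The fixed shift k does not affect the limit, because ((n + k) / n)^s
  tends to 1.\<close>

lemma squeeze_additive:
  fixes hA hB hC t :: "nat => real"
  assumes "!!n. hB n = t n + hC n" "!!n. t n \<le> hA n" "!!n. hA n \<le> t (n + k)"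
    and lim: "(\<lambda>n. hA n / real n ^ s) \<longlonglongrightarrow> a" "(\<lambda>n. hB n / real n ^ s) \<longlonglongrightarrow> b" "(\<lambda>n. hC n / real n ^ s) \<longlonglongrightarrow> c"
  shows "b = a + c"
proof -
  have "(\<lambda>n. hB n / real n ^ s - hC n / real n ^ s) \<longlonglongrightarrow> b - c" by (intro tendsto_diff lim)
  moreover have "hB n / real n ^ s - hC n / real n ^ s = t n / real n ^ s" for n
    using assms(1)[of n] by (simp add: add_divide_distrib)
  ultimately have t: "(\<lambda>n. t n / real n ^ s) \<longlonglongrightarrow> b - c" by simp
  have "b - c \<le> a"
    by (rule LIMSEQ_le[OF t lim(1)]) (auto intro!: divide_right_mono assms(2))
  moreover have "a \<le> b - c"
  proof -
    have "(\<lambda>n. (1 + real k / real n) ^ s) \<longlonglongrightarrow> (1 + 0) ^ s" by (intro tendsto_intros lim_const_over_n)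
    then have "(\<lambda>n. t (n + k) / real (n + k) ^ s * (1 + real k / real n) ^ s) \<longlonglongrightarrow> (b - c) * (1 + 0) ^ s"
      by (intro tendsto_mult LIMSEQ_ignore_initial_segment[OF t, of k])
    moreover have "\<forall>\<^sub>F n in sequentially. t (n + k) / real (n + k) ^ s * (1 + real k / real n) ^ s = t (n + k) / real n ^ s"
      using eventually_gt_at_top[of 0]
    proof eventually_elim
      case (elim n)
      then have "1 + real k / real n = real (n + k) / real n" by (simp add: field_simps)
      then show ?case using elim by (simp add: power_divide)
    qed
    ultimately have "(\<lambda>n. t (n + k) / real n ^ s) \<longlonglongrightarrow> (b - c) * (1 + 0) ^ s" by (rule Lim_transform_eventually)
    then have "(\<lambda>n. t (n + k) / real n ^ s) \<longlonglongrightarrow> b - c" by simp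
    then show ?thesis
      by (rule LIMSEQ_le[OF lim(1)]) (auto intro!: divide_right_mono assms(3))
  qed
  ultimately show ?thesis by simp
qed

section \<open>The Hilbert-Samuel function of an \<mm>-primary ideal\<close>

locale primary_local = noetherian_local R \<mm> for R :: "('a, 'r) ring_scheme" (structure) and \<mm> +
  fixes I :: "'a set"
  assumes I_primary: "m_primary R \<mm> I"
begin

lemma I_ideal: "ideal I R"
  using I_primary by (simp add: m_primary_def primary_ideal_def)

lemma I_radical: "t \<in> \<mm> ==> \<exists>k::nat. t [^] k \<in> I"
  using I_primary by (auto simp: m_primary_def radical_def)

lemma power_sub: "ideal_power R I n \<subseteq> carrier R"
  using ideal.Icarr[OF ideal_power_ideal[OF I_ideal]] by blast

text \<open>Every element of \<mm> has a power in I, hence one in I^n.\<close>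

lemma prime_over_power:
  assumes P: "primeideal P R" "ideal_power R I n \<subseteq> P"
  shows "P = \<mm>"
proof -
  have "x \<in> P" if x: "x \<in> \<mm>" for x
  proof -
    have xc: "x \<in> carrier R" using x max_sub by auto
    obtain k :: nat where k: "x [^] k \<in> I" using I_radical[OF x] by (elim exE)
    have "(x [^] k) [^] n \<in> P" using pow_in_ideal_power[OF I_ideal k] P(2) by blast
    then have "x [^] k \<in> P" using prime_pow[OF P(1)] xc by simp
    then show ?thesis by (rule prime_pow[OF P(1) xc])
  qed
  then show ?thesis using prime_sub_max[OF P(1)] by blast
qed

lemma local_moduleI:
  assumes "module R M" "fin_gen R M"
  shows "local_module R M \<mm>"
  by (intro local_module.intro noetherian_moduleI[OF noetherian_ring_axioms assms] noetherian_local_axioms)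

text \<open>I^n annihilates M / I^n M, and \<mm> is the only prime over I^n.\<close>

lemma quot_len_finite:
  fixes M :: "('a, 'b) module"
  assumes "module R M" "fin_gen R M"
  shows "quot_len R (ideal_power R I n) M \<noteq> \<infinity>"
proof -
  interpret M: local_module R M \<mm> by (rule local_moduleI[OF assms])
  have sub: "ideal_power R I n \<subseteq> sub_ann R M (M.ipow I n (carrier M)) (carrier M)"
  proof
    fix r assume "r \<in> ideal_power R I n"
    then show "r \<in> sub_ann R M (M.ipow I n (carrier M)) (carrier M)"
      using power_sub[of n] M.iprod_mem[of r "ideal_power R I n" _ "carrier M"] by (auto simp: sub_ann_def)
  qed
  show ?thesis
    unfolding quot_len_def
  proof (rule M.finite_length[OF M.sm_ipow[OF I_ideal M.sm_carrier] M.sm_carrier M.ipow_subset[OF I_ideal M.sm_carrier]])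
    fix P assume "primeideal P R" "sub_ann R M (M.ipow I n (carrier M)) (carrier M) \<subseteq> P"
    then show "P = \<mm>" using prime_over_power[OF _ order_trans[OF sub]] by blast
  qed
qed

text \<open>Indexed by the exponent of I; the sequence in the definition of the multiplicity is
  \<open>hs M (Suc n)\<close>.\<close>

definition hs :: "('a, 'b) module => nat => real" where
  "hs M n = real (the_enat (quot_len R (ideal_power R I n) M))"

text \<open>The differences are the lengths of I^n M / I^(n+1) M, that is, the Hilbert function of
  the associated graded module, which is generated in degree 0 over a finite generating set X of
  I.\<close>

lemma hs_diff_zero:
  fixes M :: "('a, 'b) module"
  assumes "module R M" "fin_gen R M"
  shows "\<exists>r. diff_zero r (hs M)"
proof -
  interpret M: local_module R M \<mm> by (rule local_moduleI[OF assms])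
  obtain X where X: "X \<subseteq> carrier R" "finite X" "I = Idl X" using finetely_gen[OF I_ideal] by auto
  define L where "L n = M.ipow I n (carrier M)" for n
  have sL: "M.sm (L n)" for n unfolding L_def by (rule M.sm_ipow[OF I_ideal M.sm_carrier])
  have LS: "L (Suc n) = M.iprod X (L n)" for n
  proof -
    have "L (Suc n) = M.iprod I (L n)" unfolding L_def by (rule M.ipow_Suc[OF I_ideal M.sm_carrier])
    also have "\<dots> = M.iprod (Idl X) (L n)" by (simp add: X(3)[symmetric])
    also have "\<dots> = M.iprod X (L n)" by (rule M.iprod_idl[OF X(1) sL])
    finally show ?thesis .
  qed
  have sub: "L (Suc n) \<subseteq> L n" for n unfolding LS by (rule M.iprod_subset[OF X(1) sL])
  have gr: "M.graded X L" unfolding M.graded_def using sL LS M.iprod_mem by auto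
  then have gr': "M.graded X (\<lambda>n. L (Suc n))" by (auto simp: M.graded_def)
  have "M.eventually_generated X (\<lambda>n. L (Suc n)) L"
    unfolding M.eventually_generated_def using M.sum_upper1[OF sL sL] LS by metis
  moreover have fin: "M.len (L n) (carrier M) \<noteq> \<infinity>" for n
    using quot_len_finite[OF assms, of n] by (simp add: quot_len_def L_def)
  have spl: "M.len (L (Suc n)) (L n) \<noteq> \<infinity>"
    "M.rlen (L (Suc n)) (carrier M) = M.rlen (L (Suc n)) (L n) + M.rlen (L n) (carrier M)" for n
    using M.len_split[OF sL sL M.sm_carrier sub M.sm_sub[OF sL] fin] by blast+
  ultimately have "diff_zero (card X) (\<lambda>n. M.rlen (L (Suc n)) (L n))"
    by (intro M.hilbert_serre[OF X(2,1) gr' gr sub])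
  moreover have "M.rlen (L (Suc n)) (L n) = hs M (Suc n) - hs M n" for n
    using spl(2)[of n] by (simp add: hs_def quot_len_def L_def M.rlen_def del: ideal_power.simps)
  ultimately have "diff_zero (Suc (card X)) (hs M)" by simp
  then show ?thesis ..
qed

text \<open>Modulo a regular sequence of length s the only prime over the annihilator is \<mm>: a
  prime strictly below \<mm> would give, by \<open>regular_prime_chain\<close>, a chain of length s
  + 1 for M. So the quotient has finite length, and \<open>growth\<close> applies.\<close>

lemma hs_growth:
  fixes M :: "('a, 'b) module"
  assumes "module R M" "fin_gen R M" "M \<in> CM R \<mm> s"
  shows "\<exists>C\<ge>0. \<forall>n. hs M n \<le> C * (real n + 1) ^ s"
proof -
  interpret M: local_module R M \<mm> by (rule local_moduleI[OF assms(1,2)])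
  have cm: "M.cm s {\<zero>\<^bsub>M\<^esub>} (carrier M)" using M.CM_iff[OF assms(2)] assms(3) by simp
  then obtain as where as: "set as \<subseteq> \<mm>" "length as = s" "regular_on M {\<zero>\<^bsub>M\<^esub>} (carrier M) as"
    unfolding M.cm_def M.dep_def by auto
  have asc: "set as \<subseteq> carrier R" using as(1) max_sub by blast
  have z: "{\<zero>\<^bsub>M\<^esub>} \<subseteq> carrier M" by simp
  define V where "V = {\<zero>\<^bsub>M\<^esub>} <+>\<^bsub>M\<^esub> M.iprod (set as) (carrier M)"
  have V: "M.sm V" unfolding V_def by (intro M.sm_sum M.sm_null M.sm_iprod[OF asc order_refl])
  have "P = \<mm>" if P: "primeideal P R" "sub_ann R M V (carrier M) \<subseteq> P" for P
  proof (rule ccontr)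
    assume "P \<noteq> \<mm>"
    then have "P \<subset> \<mm>" using prime_sub_max[OF P(1)] by blast
    then have "prime_chain R (sub_ann R M V (carrier M)) (Suc 0) (\<lambda>i. if i = 0 then P else \<mm>)"
      unfolding prime_chain_def using P max_prime by (auto simp: le_Suc_eq)
    then have "\<exists>Q. prime_chain R (sub_ann R M {\<zero>\<^bsub>M\<^esub>} (carrier M)) (Suc 0 + length as) Q"
      unfolding V_def by (rule M.regular_prime_chain[OF M.sm_null M.sm_carrier z asc as(3)])
    then show False using cm as(2) unfolding M.cm_def by simp
  qed
  then have "M.len V (carrier M) \<noteq> \<infinity>"
    by (rule M.finite_length[OF V M.sm_carrier M.sm_sub[OF V]])
  moreover have "M.len (M.ipow I n (carrier M)) (carrier M) \<noteq> \<infinity>" for n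
    using quot_len_finite[OF assms(1,2), of n] by (simp add: quot_len_def)
  ultimately have "\<exists>C\<ge>0. \<forall>n. M.rlen ({\<zero>\<^bsub>M\<^esub>} <+>\<^bsub>M\<^esub> M.ipow I n (carrier M)) (carrier M) \<le> C * (real n + 1) ^ length as"
    unfolding V_def by (intro M.growth[OF I_ideal I_radical _ M.sm_null as(1)])
  moreover have "{\<zero>\<^bsub>M\<^esub>} <+>\<^bsub>M\<^esub> M.ipow I n (carrier M) = M.ipow I n (carrier M)" for n
    using M.sm_ipow[OF I_ideal M.sm_carrier, of n] M.sm_zero by (intro M.sum_absorb1 M.sm_null) auto
  ultimately show ?thesis using as(2) by (simp add: hs_def quot_len_def M.rlen_def)
qed

text \<open>Polynomiality and the growth bound give convergence after division by n^s. For nonzero M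
  the exponent in \<open>multiplicity\<close> is dim M = s; for M = 0 both sides vanish.\<close>

lemma multiplicity_limit:
  fixes M :: "('a, 'b) module"
  assumes "M \<in> CM R \<mm> s"
  shows "(\<lambda>n. hs M (Suc n) / real n ^ s) \<longlonglongrightarrow> multiplicity R I M / fact s"
proof -
  have M: "module R M" "fin_gen R M" using assms by (auto simp: CM_def mod_cat_def)
  obtain r where r: "diff_zero r (hs M)" using hs_diff_zero[OF M] by (elim exE)
  obtain C where C: "C \<ge> 0" "!!n. hs M n \<le> C * (real n + 1) ^ s" using hs_growth[OF M assms] by auto
  \<comment> \<open>The factor 2^s comes from n + 2 \<le> 2 (n + 1).\<close>
  have bound: "\<bar>hs M (Suc n)\<bar> \<le> C * 2 ^ s * (real n + 1) ^ s" for n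
  proof -
    have "hs M (Suc n) \<le> C * (real (Suc n) + 1) ^ s" by (rule C(2))
    also have "\<dots> \<le> C * (2 * (real n + 1)) ^ s" using C(1) by (intro mult_left_mono power_mono) auto
    finally have "hs M (Suc n) \<le> C * 2 ^ s * (real n + 1) ^ s" by (simp only: power_mult_distrib mult.assoc)
    moreover have "0 \<le> hs M (Suc n)" by (simp add: hs_def)
    ultimately show ?thesis by simp
  qed
  obtain c where "\<forall>\<^sub>F n in sequentially. hs M (Suc n) = (\<Sum>i<r. c i * real (n choose i))"
    using diff_zero_binomial[OF diff_zero_Suc[OF r]] by (elim exE)
  then have conv: "convergent (\<lambda>n. hs M (Suc n) / real n ^ s)"
    by (rule binomial_sum_convergent[OF _ bound])
  then obtain l where l: "(\<lambda>n. hs M (Suc n) / real n ^ s) \<longlonglongrightarrow> l" by (auto simp: convergent_def)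
  have ml: "mod_length R (quot_mod M (ideal_smult R (ideal_power R I (n + 1)) M)) =
      quot_len R (ideal_power R I (Suc n)) M" for n
    using mod_length_quot_smult[OF M(1) power_sub[of "Suc n"]] by simp
  show ?thesis
  proof (cases "carrier M = {\<zero>\<^bsub>M\<^esub>}")
    case True
    interpret M: local_module R M \<mm> by (rule local_moduleI[OF M])
    have "M.ipow I (Suc n) (carrier M) = carrier M" for n
      using M.sm_zero[OF M.sm_ipow[OF I_ideal M.sm_carrier, of "Suc n"]]
        M.ipow_subset[OF I_ideal M.sm_carrier, of "Suc n"] True by (simp del: ideal_power.simps) blast
    then have "hs M (Suc n) = 0" for n
      by (simp add: hs_def quot_len_def M.len_refl zero_enat_def del: ideal_power.simps)
    then show ?thesis using True by (simp add: multiplicity_def)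
  next
    case False
    then have "mod_dim R M = enat s" using assms by (simp add: CM_def)
    then have "multiplicity R I M = lim (\<lambda>n. fact s / real n ^ s * hs M (Suc n))"
      using False unfolding multiplicity_def ml hs_def by simp
    moreover have "(\<lambda>n. fact s / real n ^ s * hs M (Suc n)) \<longlonglongrightarrow> fact s * l"
      using tendsto_mult[OF tendsto_const l, of "fact s"] by (simp add: field_simps)
    ultimately have "multiplicity R I M = fact s * l" by (simp add: limI)
    then show ?thesis using l by simp
  qed
qed

text \<open>The submodules V \<inter> I^n M form a graded subfamily of the Rees family I^n M, taken
  over U = 0. Hence V \<inter> I^(n+1) M \<subseteq> I (V \<inter> I^n M) from some degree k on, and
  this is iterated n times.\<close>

lemma artin_rees:
  fixes M :: "('a, 'b) module"
  assumes "module R M" "fin_gen R M" "submodule V R M"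
  shows "\<exists>k. \<forall>n. V \<inter> sub_prod R M (ideal_power R I (k + n)) (carrier M) \<subseteq> sub_prod R M (ideal_power R I n) V"
proof -
  interpret M: local_module R M \<mm> by (rule local_moduleI[OF assms(1,2)])
  note V = assms(3)
  obtain X where X: "X \<subseteq> carrier R" "finite X" "I = Idl X" using finetely_gen[OF I_ideal] by auto
  define L where "L n = M.ipow I n (carrier M)" for n
  have sL: "M.sm (L n)" for n unfolding L_def by (rule M.sm_ipow[OF I_ideal M.sm_carrier])
  have LS: "L (Suc n) = M.iprod X (L n)" for n
  proof -
    have "L (Suc n) = M.iprod I (L n)" unfolding L_def by (rule M.ipow_Suc[OF I_ideal M.sm_carrier])
    also have "\<dots> = M.iprod (Idl X) (L n)" by (simp add: X(3)[symmetric])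
    also have "\<dots> = M.iprod X (L n)" by (rule M.iprod_idl[OF X(1) sL])
    finally show ?thesis .
  qed
  have gL: "M.graded X L" unfolding M.graded_def using sL LS M.iprod_mem by auto
  have gK: "M.graded X (\<lambda>n. V \<inter> L n)"
    using gL M.sm_Int[OF V sL] X(1) M.sm_smult[OF V] unfolding M.graded_def by auto
  have g0: "M.graded X (\<lambda>n. {\<zero>\<^bsub>M\<^esub>})"
    using M.sm_null X(1) unfolding M.graded_def by auto
  have eL: "M.eventually_generated X (\<lambda>n. {\<zero>\<^bsub>M\<^esub>}) L"
    unfolding M.eventually_generated_def using M.sum_upper1[OF sL M.sm_null] LS by metis
  have z: "{\<zero>\<^bsub>M\<^esub>} \<subseteq> V \<inter> L n" for n using M.sm_zero[OF V] M.sm_zero[OF sL] by simp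
  obtain k where k: "!!n. n \<ge> k ==> V \<inter> L (Suc n) \<subseteq> M.iprod X (V \<inter> L n) <+>\<^bsub>M\<^esub> {\<zero>\<^bsub>M\<^esub>}"
    using M.graded_submodule_generated[OF X(2,1) g0 gL gK z _ eL] unfolding M.eventually_generated_def by auto
  have "V \<inter> L (k + n) \<subseteq> M.ipow I n V" for n
  proof (induction n)
    case 0
    then show ?case by (simp only: M.ipow_0[OF V]) blast
  next
    case (Suc n)
    have sK: "M.sm (V \<inter> L (k + n))" by (rule M.sm_Int[OF V sL])
    have sX: "M.sm (M.iprod X (V \<inter> L (k + n)))" by (rule M.sm_iprod[OF X(1) M.sm_sub[OF sK]])
    have "V \<inter> L (k + Suc n) \<subseteq> M.iprod X (V \<inter> L (k + n)) <+>\<^bsub>M\<^esub> {\<zero>\<^bsub>M\<^esub>}" using k[of "k + n"] by simp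
    also have "\<dots> = M.iprod X (V \<inter> L (k + n))"
      by (rule M.sum_absorb2[OF _ sX M.sm_null]) (use M.sm_zero[OF sX] in simp)
    also have "\<dots> \<subseteq> M.iprod I (M.ipow I n V)"
      using Suc genideal_self[OF X(1)] X(3) by (intro M.iprod_mono) simp_all
    finally show ?case unfolding M.ipow_Suc[OF I_ideal V] .
  qed
  then show ?thesis unfolding L_def by blast
qed

section \<open>Ulrich modules\<close>

lemma CMD: "M \<in> CM R \<mm> s ==> module R M \<and> fin_gen R M"
  by (auto simp: CM_def mod_cat_def)

text \<open>f identifies A with the submodule f A of B, and g identifies B / f A with C, preserving
  regular sequences and annihilators; so \<open>cm_extension\<close> can be applied inside
  B.\<close>

lemma CM_extension:
  assumes e: "exact_seq R A f B g C" and A: "A \<in> CM R \<mm> s" and C: "C \<in> CM R \<mm> s"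
  shows "B \<in> CM R \<mm> s"
proof -
  note x = exact_seqD[OF e]
  have fgA: "fin_gen R A" and fgC: "fin_gen R C" using CMD A C by auto
  have fgB: "fin_gen R B" by (rule fin_gen_exact_middle[OF e fgA fgC])
  interpret A: local_module R A \<mm> by (rule local_moduleI[OF x(1) fgA])
  interpret B: local_module R B \<mm> by (rule local_moduleI[OF x(2) fgB])
  interpret C: local_module R C \<mm> by (rule local_moduleI[OF x(3) fgC])
  let ?V = "f ` carrier A"
  have V: "B.sm ?V" by (rule mod_hom_image_sm[OF x(1,2,4) A.sm_carrier])
  have zV: "{\<zero>\<^bsub>B\<^esub>} \<subseteq> ?V" using B.sm_zero[OF V] by simp
  have f0: "f y = \<zero>\<^bsub>B\<^esub> \<longleftrightarrow> y = \<zero>\<^bsub>A\<^esub>" if "y \<in> carrier A" for y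
    using mod_hom_zero[OF x(1,2,4)] inj_onD[OF x(6), of y "\<zero>\<^bsub>A\<^esub>"] that by auto
  have pA: "{y \<in> carrier A. f y \<in> {\<zero>\<^bsub>B\<^esub>}} = {\<zero>\<^bsub>A\<^esub>}" using f0 by auto
  have pC: "{y \<in> carrier B. g y \<in> {\<zero>\<^bsub>C\<^esub>}} = ?V" using x(7) by auto
  have zC: "{\<zero>\<^bsub>C\<^esub>} \<subseteq> g ` carrier B" unfolding x(8) by simp
  have mR: "set as \<subseteq> carrier R" if "set as \<subseteq> \<mm>" for as using that max_sub by blast
  have "B.dep n {\<zero>\<^bsub>B\<^esub>} ?V \<longleftrightarrow> A.dep n {\<zero>\<^bsub>A\<^esub>} (carrier A)" for n
    unfolding A.dep_def B.dep_def
    using regular_on_hom[OF x(1,2,4) A.sm_carrier B.sm_null zV mR] unfolding pA by (simp cong: conj_cong)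
  moreover have "sub_ann R B {\<zero>\<^bsub>B\<^esub>} ?V = sub_ann R A {\<zero>\<^bsub>A\<^esub>} (carrier A)"
    unfolding sub_ann_def using mod_homD(3)[OF x(4)] f0 by (auto simp flip: mod_homD(3)[OF x(4)])
  ultimately have "B.cm s {\<zero>\<^bsub>B\<^esub>} ?V" using A.CM_iff[OF fgA] A by (simp add: A.cm_def B.cm_def)
  moreover have "B.dep n ?V (carrier B) \<longleftrightarrow> C.dep n {\<zero>\<^bsub>C\<^esub>} (carrier C)" for n
    unfolding C.dep_def B.dep_def
    using regular_on_hom[OF x(2,3,5) B.sm_carrier C.sm_null zC mR] unfolding pC x(8) by (simp cong: conj_cong)
  moreover have "sub_ann R B ?V (carrier B) = sub_ann R C {\<zero>\<^bsub>C\<^esub>} (carrier C)"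
    unfolding sub_ann_def x(7) x(8)[symmetric] by (auto simp flip: mod_homD(3)[OF x(5)])
  ultimately have "B.cm s {\<zero>\<^bsub>B\<^esub>} ?V" "B.cm s ?V (carrier B)"
    using C.CM_iff[OF fgC] C by (simp_all add: C.cm_def B.cm_def)
  then have "B.cm s {\<zero>\<^bsub>B\<^esub>} (carrier B)"
    by (rule B.cm_extension[OF B.sm_null V B.sm_carrier zV B.sm_sub[OF V]])
  then show ?thesis using B.CM_iff[OF fgB] by simp
qed

text \<open>Additivity of length is exact with A \<inter> I^(n+1) B in place of I^(n+1) A, and the
  Artin-Rees lemma shows that this replacement does not change the limit.\<close>

lemma multiplicity_additive:
  assumes e: "exact_seq R A f B g C" and A: "A \<in> CM R \<mm> s" and C: "C \<in> CM R \<mm> s"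
  shows "multiplicity R I B = multiplicity R I A + multiplicity R I C"
proof -
  note x = exact_seqD[OF e]
  have B: "B \<in> CM R \<mm> s" by (rule CM_extension[OF e A C])
  have fgA: "fin_gen R A" and fgB: "fin_gen R B" and fgC: "fin_gen R C" using CMD A B C by auto
  interpret A: rmodule R A by (rule rmodule.intro[OF x(1)])
  let ?V = "f ` carrier A"
  have V: "submodule ?V R B" by (rule mod_hom_image_sm[OF x(1,2,4) A.sm_carrier])
  let ?t = "\<lambda>n. sub_len R B (?V \<inter> sub_prod R B (ideal_power R I (Suc n)) (carrier B)) ?V"
  note q = exact_quot_len[OF e power_sub]
  note fA = quot_len_finite[OF x(1) fgA] and fC = quot_len_finite[OF x(3) fgC]
  have tfin: "?t n \<noteq> \<infinity>" for n
    using q(3)[of "Suc n"] fA[of "Suc n"] by (cases "?t n") auto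
  define t where "t n = real (the_enat (?t n))" for n
  obtain k where k: "!!n. ?V \<inter> sub_prod R B (ideal_power R I (k + n)) (carrier B) \<subseteq> sub_prod R B (ideal_power R I n) ?V"
    using artin_rees[OF x(2) fgB V] by (elim exE) blast
  have "multiplicity R I B / fact s = multiplicity R I A / fact s + multiplicity R I C / fact s"
  proof (rule squeeze_additive[OF _ _ _ multiplicity_limit[OF A] multiplicity_limit[OF B] multiplicity_limit[OF C]])
    fix n
    show "hs B (Suc n) = t n + hs C (Suc n)"
      using q(2)[of "Suc n"] tfin[of n] fC[of "Suc n"] unfolding hs_def t_def
      by (cases "?t n"; cases "quot_len R (ideal_power R I (Suc n)) C") (simp_all del: ideal_power.simps)
    show "t n \<le> hs A (Suc n)"
      using q(3)[of "Suc n"] fA[of "Suc n"] tfin[of n] unfolding hs_def t_def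
      by (cases "?t n"; cases "quot_len R (ideal_power R I (Suc n)) A") (simp_all del: ideal_power.simps)
    have "quot_len R (ideal_power R I (Suc n)) A \<le> ?t (n + k)"
      unfolding q(1) using k[of "Suc n"] by (intro sub_len_mono) (simp_all add: add.commute del: ideal_power.simps)
    then show "hs A (Suc n) \<le> t (n + k)"
      using fA[of "Suc n"] tfin[of "n + k"] unfolding hs_def t_def
      by (cases "?t (n + k)"; cases "quot_len R (ideal_power R I (Suc n)) A") (simp_all del: ideal_power.simps)
  qed
  then show ?thesis by (simp add: field_simps)
qed

section \<open>The defect and modules squeezed between Ulrich modules\<close>

definition defect :: "('a, 'b) module => real" where
  "defect M = real (the_enat (quot_len R I M)) - multiplicity R I M"

text \<open>\<open>ideal_power\<close> starts from the whole ring, so its first power is the product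
  I R.\<close>

lemma ideal_power_1: "ideal_power R I (Suc 0) = I"
proof -
  have "I \<cdot> carrier R = I"
  proof
    show "I \<cdot> carrier R \<subseteq> I" using ideal_prod_inter[OF I_ideal oneideal] by blast
    show "I \<subseteq> I \<cdot> carrier R"
    proof
      fix i assume i: "i \<in> I"
      then have "i \<otimes> \<one> \<in> I \<cdot> carrier R" by (intro ideal_prod.prod) auto
      then show "i \<in> I \<cdot> carrier R" using ideal.Icarr[OF I_ideal i] by simp
    qed
  qed
  then show ?thesis by simp
qed

lemma I_sub: "I \<subseteq> carrier R"
  using ideal.Icarr[OF I_ideal] by blast

lemma quot_len_finite1:
  fixes M :: "('a, 'b) module"
  assumes "M \<in> CM R \<mm> s"
  shows "quot_len R I M \<noteq> \<infinity>"
  using quot_len_finite[of M "Suc 0"] CMD[OF assms] unfolding ideal_power_1 by blast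

text \<open>The length is finite, so the equation in \<open>ereal\<close> is one between real
  numbers.\<close>

lemma Ul_iff: "M \<in> Ul R \<mm> I s \<longleftrightarrow> M \<in> CM R \<mm> s \<and> defect M = 0"
proof (cases "M \<in> CM R \<mm> s")
  case True
  obtain n where n: "quot_len R I M = enat n" using quot_len_finite1[OF True] by auto
  have "mod_length R (quot_mod M (ideal_smult R I M)) = enat n"
    using mod_length_quot_smult[OF conjunct1[OF CMD[OF True]] I_sub] n by simp
  then show ?thesis using True n by (auto simp: Ul_def defect_def)
qed (simp add: Ul_def)

lemma UlD: "M \<in> Ul R \<mm> I s ==> M \<in> CM R \<mm> s" "M \<in> Ul R \<mm> I s ==> defect M = 0"
  "M \<in> Ul R \<mm> I s ==> module R M" "M \<in> Ul R \<mm> I s ==> fin_gen R M"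
  using Ul_iff CMD by blast+

lemma defect_subadditive:
  assumes e: "exact_seq R A f B g C" and A: "A \<in> CM R \<mm> s" and C: "C \<in> CM R \<mm> s"
  shows "defect B \<le> defect A + defect C"
proof -
  note q = exact_quot_len[OF e I_sub]
  have "quot_len R I B \<le> quot_len R I A + quot_len R I C" unfolding q(2) by (intro add_mono q(3)) simp
  then show ?thesis
    using multiplicity_additive[OF e A C] quot_len_finite1[OF A] quot_len_finite1[OF C]
      quot_len_finite1[OF CM_extension[OF e A C]]
    by (auto simp: defect_def)
qed

lemma defect_split:
  assumes e: "exact_seq R A f B g C" and A: "A \<in> CM R \<mm> s" and C: "C \<in> CM R \<mm> s"
    and r: "r \<in> mod_hom R B A" "!!a. a \<in> carrier A ==> r (f a) = a"
  shows "defect B = defect A + defect C"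
  using exact_quot_len_split[OF e I_sub r] multiplicity_additive[OF e A C] quot_len_finite1[OF A]
    quot_len_finite1[OF C] by (auto simp: defect_def)

lemma Ul_split:
  assumes "exact_seq R A f B g C" "A \<in> Ul R \<mm> I s" "C \<in> Ul R \<mm> I s"
    and "r \<in> mod_hom R B A" "!!a. a \<in> carrier A ==> r (f a) = a"
  shows "B \<in> Ul R \<mm> I s"
  using CM_extension[OF assms(1) UlD(1)[OF assms(2)] UlD(1)[OF assms(3)]]
    defect_split[OF assms(1) UlD(1)[OF assms(2)] UlD(1)[OF assms(3)] assms(4,5)]
    UlD(2)[OF assms(2)] UlD(2)[OF assms(3)] by (simp add: Ul_iff)

text \<open>That D lies in CM^s must come from the second sequence, since a cokernel of
  Cohen-Macaulay modules of dimension s need not be one. The lemma serves for pushouts, composites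
  of admissible monomorphisms and Baer sums.\<close>

lemma Ul_cokernel:
  assumes e: "exact_seq R A f B g D" and A: "A \<in> Ul R \<mm> I s" and B: "B \<in> Ul R \<mm> I s"
    and e': "exact_seq R C i D p C'" and C: "C \<in> Ul R \<mm> I s" and C': "C' \<in> Ul R \<mm> I s"
  shows "D \<in> Ul R \<mm> I s"
proof -
  have D: "D \<in> CM R \<mm> s" by (rule CM_extension[OF e' UlD(1)[OF C] UlD(1)[OF C']])
  have "defect D \<le> 0" using defect_subadditive[OF e' UlD(1)[OF C] UlD(1)[OF C']] UlD(2)[OF C] UlD(2)[OF C'] by simp
  moreover have "defect D \<ge> 0" using defect_subadditive[OF e UlD(1)[OF A] D] UlD(2)[OF A] UlD(2)[OF B] by simp
  ultimately show ?thesis using D Ul_iff by auto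
qed

text \<open>The dual form, for fibre products and composites of admissible epimorphisms.\<close>

lemma Ul_kernel:
  assumes e: "exact_seq R K f B g D" and B: "B \<in> Ul R \<mm> I s" and D: "D \<in> Ul R \<mm> I s"
    and e': "exact_seq R A i K p A'" and A: "A \<in> Ul R \<mm> I s" and A': "A' \<in> Ul R \<mm> I s"
  shows "K \<in> Ul R \<mm> I s"
proof -
  have K: "K \<in> CM R \<mm> s" by (rule CM_extension[OF e' UlD(1)[OF A] UlD(1)[OF A']])
  have "defect K \<le> 0" using defect_subadditive[OF e' UlD(1)[OF A] UlD(1)[OF A']] UlD(2)[OF A] UlD(2)[OF A'] by simp
  moreover have "defect K \<ge> 0" using defect_subadditive[OF e K UlD(1)[OF D]] UlD(2)[OF D] UlD(2)[OF B] by simp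
  ultimately show ?thesis using K Ul_iff by auto
qed

lemma Ul_zero:
  fixes Z :: "('a, 'b) module"
  assumes Z: "module R Z" "carrier Z = {\<zero>\<^bsub>Z\<^esub>}"
  shows "Z \<in> Ul R \<mm> I s"
proof -
  interpret Z: rmodule R Z by (rule rmodule.intro[OF Z(1)])
  have "mod_span R Z {} = carrier Z"
    using Z.sm_zero[OF Z.sm_span[of "{}"]] Z.sm_sub[OF Z.sm_span[of "{}"]] Z(2) by auto
  then have "fin_gen R Z" unfolding fin_gen_def by blast
  then have "Z \<in> CM R \<mm> s" using Z by (simp add: CM_def mod_cat_def)
  moreover have "Z.iprod I (carrier Z) = carrier Z"
    using Z.sm_zero[OF Z.sm_iprod[OF I_sub order_refl]] Z.sm_sub[OF Z.sm_iprod[OF I_sub order_refl]] Z(2) by auto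
  then have "defect Z = 0"
    using Z(2) by (simp add: defect_def quot_len_def Z.len_refl zero_enat_def multiplicity_def)
  ultimately show ?thesis using Ul_iff by blast
qed

end

section \<open>Constructions with modules\<close>

lemma mod_hom_ext:
  assumes "f \<in> mod_hom R M N" "g \<in> mod_hom R M N" "!!x. x \<in> carrier M ==> f x = g x"
  shows "f = g"
  by (rule extensionalityI[OF mod_homD(4)[OF assms(1)] mod_homD(4)[OF assms(2)] assms(3)])

lemma mod_hom_compose:
  assumes "module R A" "f \<in> mod_hom R A B" "g \<in> mod_hom R B C"
  shows "compose (carrier A) g f \<in> mod_hom R A C"
proof -
  interpret A: rmodule R A by (rule rmodule.intro) fact
  show ?thesis
    unfolding compose_def
    using mod_homD[OF assms(2)] mod_homD[OF assms(3)] by (intro mod_hom_restrictI[OF assms(1)]) auto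
qed

lemma mod_id_hom: "module R A ==> mod_id A \<in> mod_hom R A A"
  unfolding mod_id_def by (rule mod_hom_restrictI) auto

lemma zero_hom_hom: "module R A ==> module R B ==> zero_hom A B \<in> mod_hom R A B"
proof -
  assume A: "module R A" and B: "module R B"
  interpret B: rmodule R B by (rule rmodule.intro[OF B])
  show ?thesis unfolding zero_hom_def by (rule mod_hom_restrictI[OF A]) auto
qed

lemma compose_eq_iff:
  assumes "w \<in> extensional S"
  shows "compose S g f = w \<longleftrightarrow> (\<forall>x\<in>S. g (f x) = w x)"
  using assms by (auto simp: compose_def fun_eq_iff extensional_def restrict_def)

lemma compose_eq_compose_iff: "compose S g f = compose S g' f' \<longleftrightarrow> (\<forall>x\<in>S. g (f x) = g' (f' x))"
  by (auto simp: compose_def fun_eq_iff restrict_def)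

lemma compose_zero_iff: "compose (carrier A) g f = zero_hom A C \<longleftrightarrow> (\<forall>x\<in>carrier A. g (f x) = \<zero>\<^bsub>C\<^esub>)"
  by (auto simp: compose_def zero_hom_def fun_eq_iff restrict_def)

lemma mod_iso_inverse:
  fixes R :: "('a, 'r) ring_scheme" and M :: "('a, 'b) module" and N :: "('a, 'c) module"
  assumes "module R M" "module R N" "\<phi> \<in> mod_iso R M N"
  obtains \<psi> where "\<psi> \<in> mod_iso R N M" "!!x. x \<in> carrier M ==> \<psi> (\<phi> x) = x"
    "!!y. y \<in> carrier N ==> \<phi> (\<psi> y) = y"
proof -
  interpret M: rmodule R M by (rule rmodule.intro) fact
  interpret N: rmodule R N by (rule rmodule.intro) fact
  have \<phi>: "\<phi> \<in> mod_hom R M N" "bij_betw \<phi> (carrier M) (carrier N)" using assms(3) by (auto simp: mod_iso_def)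
  note h = mod_homD[OF \<phi>(1)]
  define \<psi> where "\<psi> = (\<lambda>y\<in>carrier N. inv_into (carrier M) \<phi> y)"
  have 1: "\<psi> (\<phi> x) = x" if "x \<in> carrier M" for x
    using that h(1) bij_betw_inv_into_left[OF \<phi>(2)] by (simp add: \<psi>_def)
  have 2: "\<psi> y \<in> carrier M" "\<phi> (\<psi> y) = y" if "y \<in> carrier N" for y
    using that bij_betw_inv_into_right[OF \<phi>(2)] bij_betwE[OF bij_betw_inv_into[OF \<phi>(2)]] by (simp_all add: \<psi>_def)
  have "\<psi> \<in> mod_hom R N M"
  proof (rule mod_homI)
    show "\<psi> \<in> extensional (carrier N)" by (simp add: \<psi>_def)
    fix x y assume xy: "x \<in> carrier N" "y \<in> carrier N"
    have "\<psi> (x \<oplus>\<^bsub>N\<^esub> y) = \<psi> (\<phi> (\<psi> x \<oplus>\<^bsub>M\<^esub> \<psi> y))" using xy 2 by (simp add: h(2))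
    then show "\<psi> (x \<oplus>\<^bsub>N\<^esub> y) = \<psi> x \<oplus>\<^bsub>M\<^esub> \<psi> y" using xy 2(1) by (simp add: 1)
  next
    fix r x assume xy: "r \<in> carrier R" "x \<in> carrier N"
    have "\<psi> (r \<odot>\<^bsub>N\<^esub> x) = \<psi> (\<phi> (r \<odot>\<^bsub>M\<^esub> \<psi> x))" using xy 2 by (simp add: h(3))
    then show "\<psi> (r \<odot>\<^bsub>N\<^esub> x) = r \<odot>\<^bsub>M\<^esub> \<psi> x" using xy 2(1) by (simp add: 1)
  qed (rule 2)
  moreover have "bij_betw \<psi> (carrier N) (carrier M)"
    unfolding \<psi>_def using bij_betw_inv_into[OF \<phi>(2)] by simp
  ultimately show ?thesis using that[of \<psi>] 1 2 by (simp add: mod_iso_def)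
qed

lemma lift_mono:
  fixes R :: "('a, 'r) ring_scheme" and A :: "('a, 'b) module" and B :: "('a, 'c) module"
    and C :: "('a, 'd) module" and T :: "('a, 'e) module"
  assumes e: "exact_seq R A f B g C" and T: "module R T" and u: "u \<in> mod_hom R T B"
    and z: "!!t. t \<in> carrier T ==> g (u t) = \<zero>\<^bsub>C\<^esub>"
  obtains v where "v \<in> mod_hom R T A" "!!t. t \<in> carrier T ==> f (v t) = u t"
proof -
  note x = exact_seqD[OF e] and hu = mod_homD[OF u]
  interpret A: rmodule R A by (rule rmodule.intro) (rule x(1))
  interpret B: rmodule R B by (rule rmodule.intro) (rule x(2))
  interpret T: rmodule R T by (rule rmodule.intro) (rule T)
  note hf = mod_homD[OF x(4)]
  define v where "v = (\<lambda>t\<in>carrier T. inv_into (carrier A) f (u t))"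
  have im: "u t \<in> f ` carrier A" if "t \<in> carrier T" for t using z hu(1) that unfolding x(7) by auto
  have v: "v t \<in> carrier A" "f (v t) = u t" if "t \<in> carrier T" for t
    using inv_into_into[OF im[OF that]] f_inv_into_f[OF im[OF that]] that by (simp_all add: v_def)
  have "v \<in> mod_hom R T A"
  proof (rule mod_homI)
    show "v \<in> extensional (carrier T)" by (simp add: v_def)
    fix a b assume "a \<in> carrier T" "b \<in> carrier T"
    then show "v (a \<oplus>\<^bsub>T\<^esub> b) = v a \<oplus>\<^bsub>A\<^esub> v b" by (intro inj_onD[OF x(6)]) (simp_all add: v hf(2) hu(2))
  next
    fix r a assume "r \<in> carrier R" "a \<in> carrier T"
    then show "v (r \<odot>\<^bsub>T\<^esub> a) = r \<odot>\<^bsub>A\<^esub> v a" by (intro inj_onD[OF x(6)]) (simp_all add: v hf(3) hu(3))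
  qed (rule v)
  then show ?thesis using that v(2) by blast
qed

lemma factor_epi:
  fixes R :: "('a, 'r) ring_scheme" and B :: "('a, 'c) module"
    and C :: "('a, 'd) module" and T :: "('a, 'e) module"
  assumes B: "module R B" and C: "module R C" and T: "module R T"
    and q: "q \<in> mod_hom R B C" "q ` carrier B = carrier C" and u: "u \<in> mod_hom R B T"
    and z: "!!b. b \<in> carrier B ==> q b = \<zero>\<^bsub>C\<^esub> ==> u b = \<zero>\<^bsub>T\<^esub>"
  obtains v where "v \<in> mod_hom R C T" "!!b. b \<in> carrier B ==> v (q b) = u b"
proof -
  interpret B: rmodule R B by (rule rmodule.intro) fact
  interpret C: rmodule R C by (rule rmodule.intro) fact
  interpret T: rmodule R T by (rule rmodule.intro) fact
  note hu = mod_homD[OF u] and hq = mod_homD[OF q(1)]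
  have eq: "u b = u b'" if b: "b \<in> carrier B" "b' \<in> carrier B" "q b = q b'" for b b'
  proof -
    have "q (b \<ominus>\<^bsub>B\<^esub> b') = \<zero>\<^bsub>C\<^esub>"
      using b hq(1) by (simp add: mod_hom_minus[OF B C q(1)] C.minus_eq_zero_iff)
    then have "u (b \<ominus>\<^bsub>B\<^esub> b') = \<zero>\<^bsub>T\<^esub>" using z b by simp
    then show ?thesis using b hu(1) by (simp add: mod_hom_minus[OF B T u] T.minus_eq_zero_iff)
  qed
  define v where "v = (\<lambda>c\<in>carrier C. u (inv_into (carrier B) q c))"
  have vq: "v (q b) = u b" if b: "b \<in> carrier B" for b
  proof -
    have im: "q b \<in> q ` carrier B" using b by blast
    show ?thesis
      using eq[OF inv_into_into[OF im] b f_inv_into_f[OF im]] hq(1)[OF b] by (simp add: v_def)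
  qed
  have ex: "\<exists>b\<in>carrier B. c = q b" if "c \<in> carrier C" for c using that q(2) by auto
  have "v \<in> mod_hom R C T"
  proof (rule mod_homI)
    show "v \<in> extensional (carrier C)" by (simp add: v_def)
    fix c d assume cd: "c \<in> carrier C" "d \<in> carrier C"
    obtain b where b: "b \<in> carrier B" "c = q b" using ex[OF cd(1)] by auto
    obtain b' where b': "b' \<in> carrier B" "d = q b'" using ex[OF cd(2)] by auto
    show "v c \<in> carrier T" using b vq hu(1) by simp
    have "v (q (b \<oplus>\<^bsub>B\<^esub> b')) = v (q b) \<oplus>\<^bsub>T\<^esub> v (q b')" using b b' by (simp add: vq hu(2))
    then show "v (c \<oplus>\<^bsub>C\<^esub> d) = v c \<oplus>\<^bsub>T\<^esub> v d" using b b' by (simp add: hq(2))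
  next
    fix r c assume rc: "r \<in> carrier R" "c \<in> carrier C"
    obtain b where b: "b \<in> carrier B" "c = q b" using ex[OF rc(2)] by auto
    have "v (q (r \<odot>\<^bsub>B\<^esub> b)) = r \<odot>\<^bsub>T\<^esub> v (q b)" using b rc by (simp add: vq hu(3))
    then show "v (r \<odot>\<^bsub>C\<^esub> c) = r \<odot>\<^bsub>T\<^esub> v c" using b rc by (simp add: hq(3))
  qed
  then show ?thesis using that vq by blast
qed

text \<open>Fibre products, cosets and the zero module on \<open>unit\<close> have carriers in other
  types; an injection into \<open>'u\<close> brings an isomorphic copy into the category.\<close>

lemma copy_exists:
  fixes R :: "('a, 'r) ring_scheme" and N :: "('a, 'b) module" and \<iota> :: "'b => 'u"
  assumes N: "module R N" and inj: "inj_on \<iota> (carrier N)"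
  obtains N' :: "('a, 'u) module" and \<phi> where "module R N'" "\<phi> \<in> mod_iso R N N'"
proof -
  interpret N: rmodule R N by (rule rmodule.intro) fact
  define k where "k = inv_into (carrier N) \<iota>"
  define N' :: "('a, 'u) module" where "N' = \<lparr>carrier = \<iota> ` carrier N, monoid.mult = (\<lambda>_ _. undefined),
    monoid.one = undefined, ring.zero = \<iota> \<zero>\<^bsub>N\<^esub>, ring.add = (\<lambda>x y. \<iota> (k x \<oplus>\<^bsub>N\<^esub> k y)),
    smult = (\<lambda>r x. \<iota> (r \<odot>\<^bsub>N\<^esub> k x))\<rparr>"
  have k: "k (\<iota> x) = x" if "x \<in> carrier N" for x unfolding k_def using inv_into_f_f[OF inj that] .
  have c: "\<iota> ` carrier N = carrier N'" by (simp add: N'_def)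
  have a: "\<iota> (x \<oplus>\<^bsub>N\<^esub> y) = \<iota> x \<oplus>\<^bsub>N'\<^esub> \<iota> y" if "x \<in> carrier N" "y \<in> carrier N" for x y
    using that by (simp add: N'_def k)
  have s: "\<iota> (r \<odot>\<^bsub>N\<^esub> x) = r \<odot>\<^bsub>N'\<^esub> \<iota> x" if "r \<in> carrier R" "x \<in> carrier N" for r x
    using that by (simp add: N'_def k)
  have m: "module R N'" by (rule module_of_surj[OF N c a s]) (simp_all add: N'_def)
  have "(\<lambda>x\<in>carrier N. \<iota> x) \<in> mod_hom R N N'"
    using c by (intro mod_hom_restrictI[OF N] a s) auto
  moreover have "bij_betw (\<lambda>x\<in>carrier N. \<iota> x) (carrier N) (carrier N')"
    using inj c by (simp add: bij_betw_def inj_on_def)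
  ultimately show ?thesis using that[OF m, of "\<lambda>x\<in>carrier N. \<iota> x"] unfolding mod_iso_def by blast
qed

text \<open>Cosets are embedded through chosen representatives, so an injection of M itself into
  \<open>'u\<close> leaves enough room for the quotient.\<close>

lemma quotient_exists:
  fixes R :: "('a, 'r) ring_scheme" and M :: "('a, 'b) module" and \<iota> :: "'b => 'u"
  assumes M: "module R M" and H: "submodule H R M" and inj: "inj_on \<iota> (carrier M)"
  obtains Q :: "('a, 'u) module" and q where "module R Q" "q \<in> mod_hom R M Q" "q ` carrier M = carrier Q"
    "!!x. x \<in> carrier M ==> q x = \<zero>\<^bsub>Q\<^esub> \<longleftrightarrow> x \<in> H"
proof -
  note q = quot_mod_module[OF M H]
  let ?s = "inv_into (carrier M) (quot_proj M H)"
  have "inj_on ?s (carrier (quot_mod M H))" using inj_on_inv_into[of "carrier (quot_mod M H)" "quot_proj M H" "carrier M"] q(3) by simp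
  moreover have "?s ` carrier (quot_mod M H) \<subseteq> carrier M"
    using inv_into_into[of _ "quot_proj M H" "carrier M"] q(3) by auto
  ultimately have "inj_on (\<iota> \<circ> ?s) (carrier (quot_mod M H))"
    by (rule comp_inj_on[OF _ inj_on_subset[OF inj]])
  from copy_exists[OF q(1) this] obtain Q :: "('a, 'u) module" and \<phi>
    where Q: "module R Q" "\<phi> \<in> mod_iso R (quot_mod M H) Q" .
  have \<phi>: "\<phi> \<in> mod_hom R (quot_mod M H) Q" "bij_betw \<phi> (carrier (quot_mod M H)) (carrier Q)"
    using Q(2) by (auto simp: mod_iso_def)
  interpret Qm: rmodule R "quot_mod M H" by (rule rmodule.intro) (rule q(1))
  have z: "\<phi> z = \<zero>\<^bsub>Q\<^esub> \<longleftrightarrow> z = \<zero>\<^bsub>quot_mod M H\<^esub>" if "z \<in> carrier (quot_mod M H)" for z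
    using mod_hom_zero[OF q(1) Q(1) \<phi>(1)] inj_onD[OF bij_betw_imp_inj_on[OF \<phi>(2)], of z "\<zero>\<^bsub>quot_mod M H\<^esub>"] that
    by auto
  show ?thesis
  proof (rule that[OF Q(1) mod_hom_compose[OF M q(2) \<phi>(1)]])
    show "compose (carrier M) \<phi> (quot_proj M H) ` carrier M = carrier Q"
      using q(3) \<phi>(2) by (auto simp: compose_def bij_betw_def image_image[symmetric])
    show "compose (carrier M) \<phi> (quot_proj M H) x = \<zero>\<^bsub>Q\<^esub> \<longleftrightarrow> x \<in> H" if "x \<in> carrier M" for x
      using that z q(4)[OF that] mod_homD(1)[OF q(2) that] by (simp add: compose_def)
  qed
qed

lemma fibre_product_module:
  fixes R :: "('a, 'r) ring_scheme" and Y :: "('a, 'b) module" and Y' :: "('a, 'c) module" and M :: "('a, 'd) module"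
  assumes Y: "module R Y" and Y': "module R Y'" and M: "module R M"
    and g: "g \<in> mod_hom R Y M" and g': "g' \<in> mod_hom R Y' M"
  shows "module R (fibre_product Y g Y' g')"
    "(\<lambda>z\<in>carrier (fibre_product Y g Y' g'). fst z) \<in> mod_hom R (fibre_product Y g Y' g') Y"
    "(\<lambda>z\<in>carrier (fibre_product Y g Y' g'). snd z) \<in> mod_hom R (fibre_product Y g Y' g') Y'"
proof -
  interpret Y: rmodule R Y by (rule rmodule.intro) fact
  interpret Y': rmodule R Y' by (rule rmodule.intro) fact
  interpret M: rmodule R M by (rule rmodule.intro) fact
  note h = mod_homD[OF g] and h' = mod_homD[OF g']
  let ?P = "fibre_product Y g Y' g'"
  have neg: "(\<ominus>\<^bsub>Y\<^esub> a, \<ominus>\<^bsub>Y'\<^esub> b) \<in> carrier ?P" if "(a, b) \<in> carrier ?P" for a b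
    using that by (auto simp: fibre_product_def mod_hom_neg[OF Y M g] mod_hom_neg[OF Y' M g'])
  show m: "module R ?P"
  proof (rule moduleI)
    show "cring R" by (rule module_cring[OF Y])
    show "abelian_group ?P"
    proof (rule abelian_groupI)
      fix x assume x: "x \<in> carrier ?P"
      show "\<exists>y\<in>carrier ?P. y \<oplus>\<^bsub>?P\<^esub> x = \<zero>\<^bsub>?P\<^esub>"
        using x neg[of "fst x" "snd x"]
        by (intro bexI[of _ "(\<ominus>\<^bsub>Y\<^esub> fst x, \<ominus>\<^bsub>Y'\<^esub> snd x)"]) (auto simp: fibre_product_def Y.M.l_neg Y'.M.l_neg)
    qed (auto simp: fibre_product_def h(2) h'(2) mod_hom_zero[OF Y M g] mod_hom_zero[OF Y' M g']
        Y.M.a_ac Y'.M.a_ac)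
  qed (auto simp: fibre_product_def h(3) h'(3) Y.smult_l_distr Y'.smult_l_distr Y.smult_r_distr
      Y'.smult_r_distr Y.smult_assoc1 Y'.smult_assoc1)
  show "(\<lambda>z\<in>carrier ?P. fst z) \<in> mod_hom R ?P Y" "(\<lambda>z\<in>carrier ?P. snd z) \<in> mod_hom R ?P Y'"
    by (rule mod_hom_restrictI[OF m]; auto simp: fibre_product_def)+
qed

text \<open>Direct sums are fibre products over this zero module, and an isomorphism is an exact
  sequence that ends in it.\<close>

definition triv_mod :: "('a, unit) module" where
  "triv_mod = \<lparr>carrier = UNIV, monoid.mult = (\<lambda>_ _. ()), monoid.one = (), ring.zero = (), ring.add = (\<lambda>_ _. ()),
    smult = (\<lambda>_ _. ())\<rparr>"

lemma triv_module: "cring R ==> module R triv_mod"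
  by (intro moduleI abelian_groupI) (auto simp: triv_mod_def)

lemma inj_prod_infinite:
  assumes "infinite (UNIV :: 'u set)"
  obtains \<iota> :: "'u \<times> 'u => 'u" where "inj \<iota>"
proof -
  obtain \<iota> where "bij_betw \<iota> ((UNIV :: 'u set) \<times> (UNIV :: 'u set)) (UNIV :: 'u set)"
    using card_of_Times_same_infinite[OF assms] unfolding card_of_ordIso[symmetric] by auto
  then show ?thesis using that by (auto simp: bij_betw_def)
qed

text \<open>The elementwise form of \<open>is_biproduct\<close>, with the four maps as parameters
  because later constructions compose with them.\<close>

definition direct_sum :: "('a, 'r) ring_scheme => ('a, 'b) module => ('a, 'c) module => ('a, 'd) module =>
    ('b => 'd) => ('c => 'd) => ('d => 'b) => ('d => 'c) => bool" where
  "direct_sum R A B P i j p q \<longleftrightarrow> module R P \<and> i \<in> mod_hom R A P \<and> j \<in> mod_hom R B P \<and>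
    p \<in> mod_hom R P A \<and> q \<in> mod_hom R P B \<and>
    (\<forall>a\<in>carrier A. p (i a) = a \<and> q (i a) = \<zero>\<^bsub>B\<^esub>) \<and> (\<forall>b\<in>carrier B. q (j b) = b \<and> p (j b) = \<zero>\<^bsub>A\<^esub>) \<and>
    (\<forall>x\<in>carrier P. i (p x) \<oplus>\<^bsub>P\<^esub> j (q x) = x)"

lemma direct_sumD:
  assumes "direct_sum R A B P i j p q"
  shows "module R P" "i \<in> mod_hom R A P" "j \<in> mod_hom R B P"
    "p \<in> mod_hom R P A" "q \<in> mod_hom R P B"
    "!!a. a \<in> carrier A ==> p (i a) = a" "!!b. b \<in> carrier B ==> q (j b) = b"
    "!!a. a \<in> carrier A ==> q (i a) = \<zero>\<^bsub>B\<^esub>" "!!b. b \<in> carrier B ==> p (j b) = \<zero>\<^bsub>A\<^esub>"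
    "!!x. x \<in> carrier P ==> i (p x) \<oplus>\<^bsub>P\<^esub> j (q x) = x"
  using assms unfolding direct_sum_def by auto

lemma direct_sum_exists:
  fixes R :: "('a, 'r) ring_scheme" and A B :: "('a, 'u) module"
  assumes inf: "infinite (UNIV :: 'u set)" and A: "module R A" and B: "module R B"
  obtains P :: "('a, 'u) module" and i j p q where "direct_sum R A B P i j p q"
proof -
  interpret A: rmodule R A by (rule rmodule.intro) fact
  interpret B: rmodule R B by (rule rmodule.intro) fact
  have T: "module R triv_mod" by (rule triv_module[OF module_cring[OF A]])
  let ?D = "fibre_product A (zero_hom A triv_mod) B (zero_hom B triv_mod)"
  note D = fibre_product_module[OF A B T zero_hom_hom[OF A T] zero_hom_hom[OF B T]]
  have cD: "carrier ?D = carrier A \<times> carrier B" by (auto simp: fibre_product_def zero_hom_def)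
  obtain \<iota> :: "'u \<times> 'u => 'u" where "inj \<iota>" by (rule inj_prod_infinite[OF inf])
  then have "inj_on \<iota> (carrier ?D)" by (rule inj_on_subset) simp
  from copy_exists[OF D(1) this] obtain P :: "('a, 'u) module" and \<phi>
    where P: "module R P" "\<phi> \<in> mod_iso R ?D P" .
  obtain \<psi> where \<psi>: "\<psi> \<in> mod_iso R P ?D" "!!x. x \<in> carrier ?D ==> \<psi> (\<phi> x) = x"
    "!!y. y \<in> carrier P ==> \<phi> (\<psi> y) = y"
    by (rule mod_iso_inverse[OF D(1) P]) (rule that)
  have h: "\<phi> \<in> mod_hom R ?D P" "\<psi> \<in> mod_hom R P ?D" using P(2) \<psi>(1) by (auto simp: mod_iso_def)
  have i: "(\<lambda>a\<in>carrier A. (a, \<zero>\<^bsub>B\<^esub>)) \<in> mod_hom R A ?D"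
    by (rule mod_hom_restrictI[OF A]) (auto simp: cD, auto simp: fibre_product_def)
  have j: "(\<lambda>b\<in>carrier B. (\<zero>\<^bsub>A\<^esub>, b)) \<in> mod_hom R B ?D"
    by (rule mod_hom_restrictI[OF B]) (auto simp: cD, auto simp: fibre_product_def)
  have add: "(a, \<zero>\<^bsub>B\<^esub>) \<oplus>\<^bsub>?D\<^esub> (\<zero>\<^bsub>A\<^esub>, b) = (a, b)" if "a \<in> carrier A" "b \<in> carrier B" for a b
    using that by (simp add: fibre_product_def)
  define i where "i = compose (carrier A) \<phi> (\<lambda>a\<in>carrier A. (a, \<zero>\<^bsub>B\<^esub>))"
  define j where "j = compose (carrier B) \<phi> (\<lambda>b\<in>carrier B. (\<zero>\<^bsub>A\<^esub>, b))"
  define p where "p = compose (carrier P) (\<lambda>z\<in>carrier ?D. fst z) \<psi>"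
  define q where "q = compose (carrier P) (\<lambda>z\<in>carrier ?D. snd z) \<psi>"
  have homs: "i \<in> mod_hom R A P" "j \<in> mod_hom R B P" "p \<in> mod_hom R P A" "q \<in> mod_hom R P B"
    unfolding i_def j_def p_def q_def using mod_hom_compose[OF A i h(1)] mod_hom_compose[OF B j h(1)]
      mod_hom_compose[OF P(1) h(2) D(2)] mod_hom_compose[OF P(1) h(2) D(3)] .
  have sum: "i (p x) \<oplus>\<^bsub>P\<^esub> j (q x) = x" if x: "x \<in> carrier P" for x
  proof -
    obtain a b where ab: "\<psi> x = (a, b)" "a \<in> carrier A" "b \<in> carrier B"
      using mod_homD(1)[OF h(2) x] unfolding cD by auto
    have "\<phi> (a, \<zero>\<^bsub>B\<^esub>) \<oplus>\<^bsub>P\<^esub> \<phi> (\<zero>\<^bsub>A\<^esub>, b) = \<phi> ((a, \<zero>\<^bsub>B\<^esub>) \<oplus>\<^bsub>?D\<^esub> (\<zero>\<^bsub>A\<^esub>, b))"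
      using ab by (intro mod_homD(2)[OF h(1), symmetric]) (auto simp: cD)
    also have "\<dots> = x" using add[OF ab(2,3)] \<psi>(3)[OF x] ab(1) by simp
    finally show ?thesis using x ab by (simp add: compose_def cD i_def j_def p_def q_def)
  qed
  have "\<forall>a\<in>carrier A. p (i a) = a \<and> q (i a) = \<zero>\<^bsub>B\<^esub>" "\<forall>b\<in>carrier B. q (j b) = b \<and> p (j b) = \<zero>\<^bsub>A\<^esub>"
    using mod_homD(1)[OF h(1)] \<psi>(2) by (auto simp: compose_def cD i_def j_def p_def q_def)
  then show ?thesis using that[of P i j p q] P(1) homs sum unfolding direct_sum_def by blast
qed

lemma direct_sum_exact:
  assumes A: "module R A" and B: "module R B" and d: "direct_sum R A B P i j p q"
  shows "exact_seq R A i P q B"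
proof -
  note P = direct_sumD[OF d]
  interpret P: rmodule R P by (rule rmodule.intro) (rule P)
  have "x \<in> i ` carrier A" if x: "x \<in> carrier P" "q x = \<zero>\<^bsub>B\<^esub>" for x
  proof -
    have "i (p x) = x"
      using P(10)[OF x(1)] mod_hom_zero[OF B P(1,3)] x(2) mod_homD(1)[OF P(2) mod_homD(1)[OF P(4) x(1)]] by simp
    then show ?thesis using mod_homD(1)[OF P(4) x(1)] by (metis imageI)
  qed
  then have im: "i ` carrier A = {x \<in> carrier P. q x = \<zero>\<^bsub>B\<^esub>}"
    using P(8) mod_homD(1)[OF P(2)] by auto
  have inj: "inj_on i (carrier A)" by (rule inj_on_inverseI) (rule P(6))
  have surj: "q ` carrier P = carrier B"
  proof
    show "q ` carrier P \<subseteq> carrier B" using mod_homD(1)[OF P(5)] by auto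
    show "carrier B \<subseteq> q ` carrier P"
    proof
      fix b assume b: "b \<in> carrier B"
      show "b \<in> q ` carrier P" using P(7)[OF b] mod_homD(1)[OF P(3) b] by (metis imageI)
    qed
  qed
  show ?thesis unfolding exact_seq_def using A P(1) B P(2,5) inj im surj by simp
qed

section \<open>The exact structure\<close>

lemma short_exact_iff: "(A, f, B, g, C) \<in> short_exact R \<longleftrightarrow> exact_seq R A f B g C"
  by (simp add: short_exact_def exact_seq_def)

lemma short_exact_in_iff:
  "(A, f, B, g, C) \<in> short_exact_in R \<C> \<longleftrightarrow> exact_seq R A f B g C \<and> A \<in> \<C> \<and> B \<in> \<C> \<and> C \<in> \<C>"
  by (simp add: short_exact_in_def short_exact_iff)

lemma exact_seq_iso:
  assumes e: "exact_seq R A f B g C" and m: "module R A'" "module R B'" "module R C'"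
    and h: "f' \<in> mod_hom R A' B'" "g' \<in> mod_hom R B' C'"
    and iso: "\<alpha> \<in> mod_iso R A A'" "\<beta> \<in> mod_iso R B B'" "\<gamma> \<in> mod_iso R C C'"
    and c1: "!!a. a \<in> carrier A ==> \<beta> (f a) = f' (\<alpha> a)" and c2: "!!b. b \<in> carrier B ==> \<gamma> (g b) = g' (\<beta> b)"
  shows "exact_seq R A' f' B' g' C'"
proof -
  note x = exact_seqD[OF e]
  interpret C: rmodule R C by (rule rmodule.intro) (rule x(3))
  have bij: "bij_betw \<alpha> (carrier A) (carrier A')" "bij_betw \<beta> (carrier B) (carrier B')"
    "bij_betw \<gamma> (carrier C) (carrier C')" and \<gamma>: "\<gamma> \<in> mod_hom R C C'" and \<beta>: "\<beta> \<in> mod_hom R B B'"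
    using iso by (auto simp: mod_iso_def)
  have im: "\<alpha> ` carrier A = carrier A'" "\<beta> ` carrier B = carrier B'" "\<gamma> ` carrier C = carrier C'"
    using bij by (auto simp: bij_betw_def)
  have fc: "f a \<in> carrier B" if "a \<in> carrier A" for a using mod_homD(1)[OF x(4) that] .
  have gc: "g b \<in> carrier C" if "b \<in> carrier B" for b using mod_homD(1)[OF x(5) that] .
  have inj: "inj_on f' (\<alpha> ` carrier A)"
  proof (rule inj_onI)
    fix y z assume "y \<in> \<alpha> ` carrier A" "z \<in> \<alpha> ` carrier A" "f' y = f' z"
    then obtain a b where ab: "a \<in> carrier A" "b \<in> carrier A" "y = \<alpha> a" "z = \<alpha> b" "\<beta> (f a) = \<beta> (f b)"
      using c1 by auto
    then have "f a = f b" using inj_onD[OF bij_betw_imp_inj_on[OF bij(2)]] fc by blast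
    then show "y = z" using inj_onD[OF x(6)] ab by auto
  qed
  have zero: "\<gamma> c = \<zero>\<^bsub>C'\<^esub> \<longleftrightarrow> c = \<zero>\<^bsub>C\<^esub>" if "c \<in> carrier C" for c
    using mod_hom_zero[OF x(3) m(3) \<gamma>] inj_onD[OF bij_betw_imp_inj_on[OF bij(3)], of c "\<zero>\<^bsub>C\<^esub>"] that by auto
  have "f' ` carrier A' = \<beta> ` (f ` carrier A)"
    unfolding im(1)[symmetric] image_image using c1 by (intro image_cong) auto
  also have "\<dots> = {y \<in> \<beta> ` carrier B. g' y = \<zero>\<^bsub>C'\<^esub>}"
    unfolding x(7) using c2 zero gc by (auto simp: image_iff) (metis)+
  finally have ker: "f' ` carrier A' = {y \<in> carrier B'. g' y = \<zero>\<^bsub>C'\<^esub>}" unfolding im(2) .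
  have "g' ` carrier B' = \<gamma> ` (g ` carrier B)"
    unfolding im(2)[symmetric] image_image using c2 by (intro image_cong) auto
  then have "g' ` carrier B' = carrier C'" unfolding x(8) im(3) .
  then show ?thesis unfolding exact_seq_def using m h im(1) inj ker by simp
qed

lemma exact_kernel:
  assumes e: "exact_seq R A f B g C" and \<C>: "!!T. T \<in> \<C> ==> module R T"
  shows "is_kernel_in R \<C> (A, f, B, g, C)"
  unfolding is_kernel_in_def prod.case compose_zero_iff
proof (intro conjI ballI impI)
  note x = exact_seqD[OF e]
  show "g (f a) = \<zero>\<^bsub>C\<^esub>" if "a \<in> carrier A" for a using that x(7) by blast
  fix T u assume T: "T \<in> \<C>" and u: "u \<in> mod_hom R T B" and z: "\<forall>t\<in>carrier T. g (u t) = \<zero>\<^bsub>C\<^esub>"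
  obtain v where v: "v \<in> mod_hom R T A" "!!t. t \<in> carrier T ==> f (v t) = u t"
    using lift_mono[OF e \<C>[OF T] u] z by auto
  show "\<exists>!v. v \<in> mod_hom R T A \<and> compose (carrier T) f v = u"
    unfolding compose_eq_iff[OF mod_homD(4)[OF u]]
  proof (rule ex1I[of _ v])
    fix w assume w: "w \<in> mod_hom R T A \<and> (\<forall>t\<in>carrier T. f (w t) = u t)"
    show "w = v"
    proof (rule mod_hom_ext)
      fix t assume t: "t \<in> carrier T"
      show "w t = v t"
        using inj_onD[OF x(6), of "w t" "v t"] w v t mod_homD(1)[of w R T A t] mod_homD(1)[OF v(1) t] by simp
    qed (use w v in auto)
  qed (use v in auto)
qed

lemma exact_cokernel:
  assumes e: "exact_seq R A f B g C" and \<C>: "!!T. T \<in> \<C> ==> module R T"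
  shows "is_cokernel_in R \<C> (A, f, B, g, C)"
  unfolding is_cokernel_in_def prod.case compose_zero_iff
proof (intro conjI ballI impI)
  note x = exact_seqD[OF e]
  show "g (f a) = \<zero>\<^bsub>C\<^esub>" if "a \<in> carrier A" for a using that x(7) by blast
  fix T u assume T: "T \<in> \<C>" and u: "u \<in> mod_hom R B T" and z: "\<forall>a\<in>carrier A. u (f a) = \<zero>\<^bsub>T\<^esub>"
  have "u b = \<zero>\<^bsub>T\<^esub>" if b: "b \<in> carrier B" "g b = \<zero>\<^bsub>C\<^esub>" for b
  proof -
    have "b \<in> f ` carrier A" using b x(7) by blast
    then show ?thesis using z by auto
  qed
  then obtain v where v: "v \<in> mod_hom R C T" "!!b. b \<in> carrier B ==> v (g b) = u b"
    using factor_epi[OF x(2,3) \<C>[OF T] x(5,8) u] by auto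
  show "\<exists>!v. v \<in> mod_hom R C T \<and> compose (carrier B) v g = u"
    unfolding compose_eq_iff[OF mod_homD(4)[OF u]]
  proof (rule ex1I[of _ v])
    fix w assume w: "w \<in> mod_hom R C T \<and> (\<forall>b\<in>carrier B. w (g b) = u b)"
    show "w = v"
    proof (rule mod_hom_ext)
      fix c assume "c \<in> carrier C"
      then have "c \<in> g ` carrier B" using x(8) by simp
      then show "w c = v c" using w v by auto
    qed (use w v in auto)
  qed (use v in auto)
qed

context primary_local
begin

text \<open>An isomorphism is a split exact sequence with third term 0, so \<open>Ul_split\<close>
  transports dimension, depth, length and multiplicity at once.\<close>

lemma Ul_iso:
  fixes M :: "('a, 'b) module" and N :: "('a, 'c) module"
  assumes "M \<in> Ul R \<mm> I s" "\<phi> \<in> mod_iso R M N" "module R N"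
  shows "N \<in> Ul R \<mm> I s"
proof -
  have M: "module R M" using UlD assms(1) by blast
  obtain \<psi> where \<psi>: "\<psi> \<in> mod_iso R N M" "!!x. x \<in> carrier M ==> \<psi> (\<phi> x) = x"
    by (rule mod_iso_inverse[OF M assms(3,2)]) (rule that)
  have T: "module R triv_mod" by (rule triv_module[OF is_cring])
  have "exact_seq R M \<phi> N (zero_hom N triv_mod) triv_mod"
    unfolding exact_seq_def using M assms(2,3) T zero_hom_hom[OF assms(3) T] rmodule.sm_zero[OF rmodule.intro[OF assms(3)] rmodule.sm_carrier[OF rmodule.intro[OF assms(3)]]]
    by (auto simp: mod_iso_def bij_betw_def triv_mod_def zero_hom_def)
  moreover have "triv_mod \<in> Ul R \<mm> I s" by (rule Ul_zero[OF T]) (auto simp: triv_mod_def)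
  ultimately show ?thesis
    using \<psi> assms(1) by (intro Ul_split[of M \<phi> N _ triv_mod s \<psi>]) (auto simp: mod_iso_def)
qed

lemma direct_sum_Ul:
  assumes "A \<in> Ul R \<mm> I s" "B \<in> Ul R \<mm> I s" and d: "direct_sum R A B P i j p q"
  shows "P \<in> Ul R \<mm> I s"
  by (rule Ul_split[OF direct_sum_exact[OF UlD(3)[OF assms(1)] UlD(3)[OF assms(2)] d] assms(1,2) direct_sumD(4,6)[OF d]])

end

lemma compose_hom_apply: "x \<in> carrier A ==> compose (carrier A) g f x = g (f x)"
  by (simp add: compose_def)

lemma fibre_product_exact:
  assumes e: "exact_seq R A f B g C" and C': "module R C'" and k: "k \<in> mod_hom R C' C"
  shows "exact_seq R A (\<lambda>a\<in>carrier A. (f a, \<zero>\<^bsub>C'\<^esub>)) (fibre_product B g C' k)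
    (\<lambda>z\<in>carrier (fibre_product B g C' k). snd z) C'"
proof -
  note x = exact_seqD[OF e]
  interpret A: rmodule R A by (rule rmodule.intro) (rule x(1))
  interpret B: rmodule R B by (rule rmodule.intro) (rule x(2))
  interpret C: rmodule R C by (rule rmodule.intro) (rule x(3))
  interpret C': rmodule R C' by (rule rmodule.intro) (rule C')
  let ?P = "fibre_product B g C' k"
  note P = fibre_product_module[OF x(2) C' x(3,5) k]
  have cP: "carrier ?P = {(b, c). b \<in> carrier B \<and> c \<in> carrier C' \<and> g b = k c}" by (simp add: fibre_product_def)
  note k0 = mod_hom_zero[OF C' x(3) k]
  have gf: "g (f a) = \<zero>\<^bsub>C\<^esub>" if "a \<in> carrier A" for a using that x(7) by auto
  have hom: "(\<lambda>a\<in>carrier A. (f a, \<zero>\<^bsub>C'\<^esub>)) \<in> mod_hom R A ?P"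
    by (rule mod_hom_restrictI[OF x(1)])
      (auto simp: cP k0 gf mod_homD[OF x(4)], auto simp: fibre_product_def mod_homD[OF x(4)])
  have "inj_on (\<lambda>a\<in>carrier A. (f a, \<zero>\<^bsub>C'\<^esub>)) (carrier A)"
    using x(6) by (auto simp: inj_on_def)
  moreover have "(\<lambda>a\<in>carrier A. (f a, \<zero>\<^bsub>C'\<^esub>)) ` carrier A =
      {z \<in> carrier ?P. (\<lambda>z\<in>carrier ?P. snd z) z = \<zero>\<^bsub>C'\<^esub>}"
  proof (intro equalityI subsetI)
    fix z assume "z \<in> {z \<in> carrier ?P. (\<lambda>z\<in>carrier ?P. snd z) z = \<zero>\<^bsub>C'\<^esub>}"
    then obtain b where b: "b \<in> carrier B" "z = (b, \<zero>\<^bsub>C'\<^esub>)" "g b = k \<zero>\<^bsub>C'\<^esub>" by (auto simp: cP)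
    then have "b \<in> f ` carrier A" using x(7) k0 by simp
    then show "z \<in> (\<lambda>a\<in>carrier A. (f a, \<zero>\<^bsub>C'\<^esub>)) ` carrier A" using b(2) by auto
  qed (auto simp: cP gf k0 mod_homD(1)[OF x(4)])
  moreover have "(\<lambda>z\<in>carrier ?P. snd z) ` carrier ?P = carrier C'"
  proof (intro equalityI subsetI)
    fix c assume c: "c \<in> carrier C'"
    then have "k c \<in> g ` carrier B" using mod_homD(1)[OF k c] x(8) by simp
    then obtain b where "b \<in> carrier B" "k c = g b" by auto
    then have "(b, c) \<in> carrier ?P" using c by (simp add: cP)
    then show "c \<in> (\<lambda>z\<in>carrier ?P. snd z) ` carrier ?P" by (intro image_eqI[of _ _ "(b, c)"]) auto
  qed (auto simp: cP)
  ultimately show ?thesis unfolding exact_seq_def using x(1) P(1,3) C' hom by simp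
qed

section \<open>Pullbacks, pushouts and composites of Ulrich modules\<close>

context primary_local
begin

text \<open>The two sequences through the fibre product P are 0 \<rightarrow> P \<rightarrow> B
  \<oplus> C' \<rightarrow> C \<rightarrow> 0, with (b, c) \<mapsto> g b - k c, and 0 \<rightarrow>
  A \<rightarrow> P \<rightarrow> C' \<rightarrow> 0.\<close>

lemma fibre_product_Ul:
  fixes A B C C' :: "('a, 'u) module"
  assumes inf: "infinite (UNIV :: 'u set)" and e: "exact_seq R A f B g C" and k: "k \<in> mod_hom R C' C"
    and U: "A \<in> Ul R \<mm> I s" "B \<in> Ul R \<mm> I s" "C \<in> Ul R \<mm> I s" "C' \<in> Ul R \<mm> I s"
  shows "fibre_product B g C' k \<in> Ul R \<mm> I s"
proof -
  note x = exact_seqD[OF e]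
  have C': "module R C'" using UlD(3)[OF U(4)] .
  interpret B: rmodule R B by (rule rmodule.intro) (rule x(2))
  interpret C: rmodule R C by (rule rmodule.intro) (rule x(3))
  interpret C': rmodule R C' by (rule rmodule.intro) (rule C')
  let ?P = "fibre_product B g C' k"
  have cP: "carrier ?P = {(b, c). b \<in> carrier B \<and> c \<in> carrier C' \<and> g b = k c}" by (simp add: fibre_product_def)
  note P = fibre_product_module[OF x(2) C' x(3,5) k]
  note hg = mod_homD[OF x(5)] and hk = mod_homD[OF k]
  obtain D :: "('a, 'u) module" and i j p q where ds: "direct_sum R B C' D i j p q"
    by (rule direct_sum_exists[OF inf x(2) C'])
  note D = direct_sumD[OF ds]
  interpret D: rmodule R D by (rule rmodule.intro) (rule D(1))
  note hi = mod_homD[OF D(2)] and hj = mod_homD[OF D(3)] and hp = mod_homD[OF D(4)] and hq = mod_homD[OF D(5)]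
  define u where "u = (\<lambda>z\<in>carrier ?P. i (fst z) \<oplus>\<^bsub>D\<^esub> j (snd z))"
  define d where "d = (\<lambda>x\<in>carrier D. g (p x) \<ominus>\<^bsub>C\<^esub> k (q x))"
  have pu: "p (u z) = fst z" "q (u z) = snd z" "u z \<in> carrier D" if "z \<in> carrier ?P" for z
    using that D(6-9) hi(1) hj(1) by (auto simp: u_def cP hp(2) hq(2))
  have uh: "u \<in> mod_hom R ?P D"
    unfolding u_def
  proof (rule mod_hom_restrictI[OF P(1)])
    fix z w assume "z \<in> carrier ?P" "w \<in> carrier ?P"
    then show "i (fst (z \<oplus>\<^bsub>?P\<^esub> w)) \<oplus>\<^bsub>D\<^esub> j (snd (z \<oplus>\<^bsub>?P\<^esub> w)) =
        i (fst z) \<oplus>\<^bsub>D\<^esub> j (snd z) \<oplus>\<^bsub>D\<^esub> (i (fst w) \<oplus>\<^bsub>D\<^esub> j (snd w))"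
      using hi(1) hj(1) by (auto simp: fibre_product_def hi(2) hj(2) D.M.a_ac)
  next
    fix r z assume "r \<in> carrier R" "z \<in> carrier ?P"
    then show "i (fst (r \<odot>\<^bsub>?P\<^esub> z)) \<oplus>\<^bsub>D\<^esub> j (snd (r \<odot>\<^bsub>?P\<^esub> z)) = r \<odot>\<^bsub>D\<^esub> (i (fst z) \<oplus>\<^bsub>D\<^esub> j (snd z))"
      using hi(1) hj(1) by (auto simp: fibre_product_def hi(3) hj(3) D.smult_r_distr)
  qed (use hi(1) hj(1) in \<open>auto simp: cP\<close>)
  have dh: "d \<in> mod_hom R D C"
    unfolding d_def
  proof (rule mod_hom_restrictI[OF D(1)])
    fix y z assume yz: "y \<in> carrier D" "z \<in> carrier D"
    have "k (q (y \<oplus>\<^bsub>D\<^esub> z)) = k (q y) \<oplus>\<^bsub>C\<^esub> k (q z)" "g (p (y \<oplus>\<^bsub>D\<^esub> z)) = g (p y) \<oplus>\<^bsub>C\<^esub> g (p z)"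
      using yz hp(1) hq(1) by (simp_all add: hp(2) hq(2) hg(2) hk(2))
    moreover have "k (q y) \<in> carrier C" "k (q z) \<in> carrier C" "g (p y) \<in> carrier C" "g (p z) \<in> carrier C"
      using yz hp(1) hq(1) hg(1) hk(1) by auto
    ultimately show "g (p (y \<oplus>\<^bsub>D\<^esub> z)) \<ominus>\<^bsub>C\<^esub> k (q (y \<oplus>\<^bsub>D\<^esub> z)) =
        g (p y) \<ominus>\<^bsub>C\<^esub> k (q y) \<oplus>\<^bsub>C\<^esub> (g (p z) \<ominus>\<^bsub>C\<^esub> k (q z))"
      by (simp add: a_minus_def C.M.minus_add C.M.a_ac)
  next
    fix r y assume ry: "r \<in> carrier R" "y \<in> carrier D"
    then show "g (p (r \<odot>\<^bsub>D\<^esub> y)) \<ominus>\<^bsub>C\<^esub> k (q (r \<odot>\<^bsub>D\<^esub> y)) = r \<odot>\<^bsub>C\<^esub> (g (p y) \<ominus>\<^bsub>C\<^esub> k (q y))"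
      using hp(1) hq(1) hg(1) hk(1)
      by (simp add: hp(3) hq(3) hg(3) hk(3) a_minus_def C.smult_r_distr C.smult_r_minus)
  qed (use hp(1) hq(1) hg(1) hk(1) in auto)
  have "inj_on u (carrier ?P)"
    using pu by (intro inj_on_inverseI[of _ "\<lambda>x. (p x, q x)"]) auto
  moreover have "u ` carrier ?P = {x \<in> carrier D. d x = \<zero>\<^bsub>C\<^esub>}"
  proof (intro equalityI subsetI)
    fix y assume "y \<in> u ` carrier ?P"
    then obtain z where z: "z \<in> carrier ?P" "y = u z" by auto
    have "fst z \<in> carrier B" "g (fst z) = k (snd z)" using z(1) by (auto simp: cP)
    then show "y \<in> {x \<in> carrier D. d x = \<zero>\<^bsub>C\<^esub>}"
      using z pu[OF z(1)] hg(1)[of "fst z"] C.minus_eq_zero_iff[of "g (fst z)" "k (snd z)"] by (simp add: d_def)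
  next
    fix y assume "y \<in> {x \<in> carrier D. d x = \<zero>\<^bsub>C\<^esub>}"
    then have y: "y \<in> carrier D" "g (p y) \<ominus>\<^bsub>C\<^esub> k (q y) = \<zero>\<^bsub>C\<^esub>" by (auto simp: d_def)
    have "g (p y) = k (q y)"
      using y C.minus_eq_zero_iff[of "g (p y)" "k (q y)"] hg(1)[OF hp(1)[OF y(1)]] hk(1)[OF hq(1)[OF y(1)]] by simp
    then have "(p y, q y) \<in> carrier ?P" using hp(1)[OF y(1)] hq(1)[OF y(1)] by (simp add: cP)
    moreover have "u (p y, q y) = y" using calculation D(10)[OF y(1)] by (simp add: u_def)
    ultimately show "y \<in> u ` carrier ?P" by force
  qed
  moreover have "d ` carrier D = carrier C"
  proof (intro equalityI subsetI)
    fix c assume "c \<in> carrier C"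
    then obtain b where b: "b \<in> carrier B" "c = g b" using x(8) by auto
    have "d (i b) = g b \<ominus>\<^bsub>C\<^esub> k \<zero>\<^bsub>C'\<^esub>" using b hi(1) D(6,8) by (simp add: d_def)
    also have "\<dots> = c" using b hg(1)[OF b(1)] by (simp add: mod_hom_zero[OF C' x(3) k] a_minus_def)
    finally show "c \<in> d ` carrier D" using hi(1)[OF b(1)] by blast
  qed (use mod_homD(1)[OF dh] in auto)
  ultimately have "exact_seq R ?P u D d C" unfolding exact_seq_def using P(1) D(1) x(3) uh dh by simp
  then show ?thesis by (rule Ul_kernel[OF _ direct_sum_Ul[OF U(2,4) ds] U(3) fibre_product_exact[OF e C' k] U(1,4)])
qed

text \<open>The pushout is a cokernel of A \<rightarrow> B \<oplus> A'. Its universal property is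
  proved against all modules in \<open>'u\<close>, hence also inside every full subcategory that
  contains it. Membership in \<open>Ul\<close> is a separate conclusion, because the same
  construction gives the push-forward of arbitrary extensions.\<close>

lemma pushout_exists:
  fixes A B C A' :: "('a, 'u) module"
  assumes inf: "infinite (UNIV :: 'u set)" and e: "exact_seq R A f B g C" and A': "module R A'"
    and h: "h \<in> mod_hom R A A'"
  obtains f' and B' :: "('a, 'u) module" and h' g' where "exact_seq R A' f' B' g' C" "h' \<in> mod_hom R B B'"
    "!!a. a \<in> carrier A ==> h' (f a) = f' (h a)" "!!b. b \<in> carrier B ==> g' (h' b) = g b"
    "\<forall>T :: ('a, 'u) module. module R T --> (\<forall>u\<in>mod_hom R B T. \<forall>v\<in>mod_hom R A' T.
      (\<forall>a\<in>carrier A. u (f a) = v (h a)) -->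
      (\<exists>!w. w \<in> mod_hom R B' T \<and> (\<forall>b\<in>carrier B. w (h' b) = u b) \<and> (\<forall>a\<in>carrier A'. w (f' a) = v a)))"
    "!!s. A \<in> Ul R \<mm> I s ==> B \<in> Ul R \<mm> I s ==> C \<in> Ul R \<mm> I s ==> A' \<in> Ul R \<mm> I s ==> B' \<in> Ul R \<mm> I s"
proof -
  note x = exact_seqD[OF e]
  interpret A: rmodule R A by (rule rmodule.intro) (rule x(1))
  interpret B: rmodule R B by (rule rmodule.intro) (rule x(2))
  interpret C: rmodule R C by (rule rmodule.intro) (rule x(3))
  interpret A': rmodule R A' by (rule rmodule.intro) (rule A')
  note hf = mod_homD[OF x(4)] and hg = mod_homD[OF x(5)] and hh = mod_homD[OF h]
  obtain P :: "('a, 'u) module" and i j r t where ds: "direct_sum R B A' P i j r t"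
    by (rule direct_sum_exists[OF inf x(2) A'])
  note P = direct_sumD[OF ds] and eP = direct_sum_exact[OF x(2) A' ds]
  interpret P: rmodule R P by (rule rmodule.intro) (rule P(1))
  note hi = mod_homD[OF P(2)] and hj = mod_homD[OF P(3)] and hr = mod_homD[OF P(4)] and ht = mod_homD[OF P(5)]
  \<comment> \<open>The sign makes the images of f a and h a agree in the cokernel.\<close>
  define d where "d = (\<lambda>a\<in>carrier A. i (f a) \<oplus>\<^bsub>P\<^esub> j (\<ominus>\<^bsub>A'\<^esub> h a))"
  have rd: "r (d a) = f a" and td: "t (d a) = \<ominus>\<^bsub>A'\<^esub> h a" and dc: "d a \<in> carrier P" if "a \<in> carrier A" for a
    using that hf(1) hh(1) hi(1) hj(1) P(6-9) by (simp_all add: d_def hr(2) ht(2))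
  have dh: "d \<in> mod_hom R A P"
    unfolding d_def
  proof (rule mod_hom_restrictI[OF x(1)])
    fix a b assume "a \<in> carrier A" "b \<in> carrier A"
    then show "i (f (a \<oplus>\<^bsub>A\<^esub> b)) \<oplus>\<^bsub>P\<^esub> j (\<ominus>\<^bsub>A'\<^esub> h (a \<oplus>\<^bsub>A\<^esub> b)) =
        i (f a) \<oplus>\<^bsub>P\<^esub> j (\<ominus>\<^bsub>A'\<^esub> h a) \<oplus>\<^bsub>P\<^esub> (i (f b) \<oplus>\<^bsub>P\<^esub> j (\<ominus>\<^bsub>A'\<^esub> h b))"
      using hf(1) hh(1) hi(1) hj(1) by (simp add: hf(2) hh(2) hi(2) hj(2) A'.M.minus_add P.M.a_ac)
  next
    fix c a assume "c \<in> carrier R" "a \<in> carrier A"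
    then show "i (f (c \<odot>\<^bsub>A\<^esub> a)) \<oplus>\<^bsub>P\<^esub> j (\<ominus>\<^bsub>A'\<^esub> h (c \<odot>\<^bsub>A\<^esub> a)) = c \<odot>\<^bsub>P\<^esub> (i (f a) \<oplus>\<^bsub>P\<^esub> j (\<ominus>\<^bsub>A'\<^esub> h a))"
      using hf(1) hh(1) hi(1) hj(1)
      by (simp add: hf(3) hh(3) hi(3) hj(3)[symmetric] P.smult_r_distr A'.smult_r_minus)
  qed (use hf(1) hh(1) hi(1) hj(1) in auto)
  have sd: "submodule (d ` carrier A) R P" by (rule mod_hom_image_sm[OF x(1) P(1) dh A.sm_carrier])
  obtain Q :: "('a, 'u) module" and k where Q: "module R Q" "k \<in> mod_hom R P Q" "k ` carrier P = carrier Q"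
    "!!y. y \<in> carrier P ==> k y = \<zero>\<^bsub>Q\<^esub> \<longleftrightarrow> y \<in> d ` carrier A"
    by (rule quotient_exists[OF P(1) sd, of "\<lambda>x. x"]) (simp, rule that)
  interpret Q: rmodule R Q by (rule rmodule.intro) (rule Q(1))
  note hk = mod_homD[OF Q(2)]
  have kd: "k (d a) = \<zero>\<^bsub>Q\<^esub>" if "a \<in> carrier A" for a using Q(4)[OF dc[OF that]] that by blast
  have d_inj: "inj_on d (carrier A)"
  proof (rule inj_onI)
    fix a b assume ab: "a \<in> carrier A" "b \<in> carrier A" "d a = d b"
    then have "f a = f b" using rd by metis
    then show "a = b" using inj_onD[OF x(6)] ab by blast
  qed
  have ed: "exact_seq R A d P k Q"
    unfolding exact_seq_def using x(1) P(1) Q dh d_inj sd P.sm_sub[OF sd] by auto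
  define f' where "f' = compose (carrier A') k j"
  define h' where "h' = compose (carrier B) k i"
  have f'h: "f' \<in> mod_hom R A' Q" unfolding f'_def by (rule mod_hom_compose[OF A' P(3) Q(2)])
  have h'h: "h' \<in> mod_hom R B Q" unfolding h'_def by (rule mod_hom_compose[OF x(2) P(2) Q(2)])
  have f'a: "f' a = k (j a)" if "a \<in> carrier A'" for a using that by (simp add: f'_def compose_def)
  have h'a: "h' b = k (i b)" if "b \<in> carrier B" for b using that by (simp add: h'_def compose_def)
  have comm: "h' (f a) = f' (h a)" if a: "a \<in> carrier A" for a
  proof -
    have c: "k (i (f a)) \<in> carrier Q" "k (j (h a)) \<in> carrier Q" using a hf(1) hh(1) hi(1) hj(1) hk(1) by auto
    have "\<zero>\<^bsub>Q\<^esub> = k (i (f a)) \<oplus>\<^bsub>Q\<^esub> k (j (\<ominus>\<^bsub>A'\<^esub> h a))"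
      using kd[OF a] a hf(1) hh(1) hi(1) hj(1) by (simp add: d_def hk(2))
    also have "\<dots> = k (i (f a)) \<ominus>\<^bsub>Q\<^esub> k (j (h a))"
      using a hh(1) hj(1) by (simp add: mod_hom_neg[OF A' P(1,3)] mod_hom_neg[OF P(1) Q(1,2)] a_minus_def)
    finally have "k (i (f a)) = k (j (h a))" using Q.minus_eq_zero_iff[OF c] by simp
    then show ?thesis using a hf(1) hh(1) by (simp add: f'a h'a)
  qed
  have gr: "compose (carrier P) g r \<in> mod_hom R P C" by (rule mod_hom_compose[OF P(1,4) x(5)])
  have "compose (carrier P) g r y = \<zero>\<^bsub>C\<^esub>" if y: "y \<in> carrier P" "k y = \<zero>\<^bsub>Q\<^esub>" for y
  proof -
    obtain a where "a \<in> carrier A" "y = d a" using Q(4)[OF y(1)] y(2) by auto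
    moreover from this have "g (f a) = \<zero>\<^bsub>C\<^esub>" using x(7) by auto
    ultimately show ?thesis using y(1) rd by (simp add: compose_def)
  qed
  then obtain g' where g': "g' \<in> mod_hom R Q C" "!!y. y \<in> carrier P ==> g' (k y) = compose (carrier P) g r y"
    using factor_epi[OF P(1) Q(1) x(3) Q(2,3) gr] by blast
  have g'k: "g' (k y) = g (r y)" if "y \<in> carrier P" for y using g'(2)[OF that] that by (simp add: compose_def)
  have g'h': "g' (h' b) = g b" if "b \<in> carrier B" for b using that hi(1) P(6) by (simp add: h'a g'k)
  have f'_inj: "inj_on f' (carrier A')"
  proof (rule mod_hom_inj_on[OF A' Q(1) f'h])
    fix a' assume a': "a' \<in> carrier A'" "f' a' = \<zero>\<^bsub>Q\<^esub>"
    then obtain a where a: "a \<in> carrier A" "j a' = d a" using Q(4)[OF hj(1)[OF a'(1)]] by (auto simp: f'a)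
    then have "f a = \<zero>\<^bsub>B\<^esub>" using rd[OF a(1)] P(9)[OF a'(1)] by simp
    then have "a = \<zero>\<^bsub>A\<^esub>"
      using inj_onD[OF x(6), of a "\<zero>\<^bsub>A\<^esub>"] a(1) mod_hom_zero[OF x(1,2,4)] by simp
    then have "j a' = \<zero>\<^bsub>P\<^esub>" using a(2) mod_hom_zero[OF x(1) P(1) dh] by simp
    then show "a' = \<zero>\<^bsub>A'\<^esub>" using P(7)[OF a'(1)] mod_hom_zero[OF P(1) A' P(5)] by simp
  qed
  have im: "f' ` carrier A' = {y \<in> carrier Q. g' y = \<zero>\<^bsub>C\<^esub>}"
  proof (intro equalityI subsetI)
    fix y assume "y \<in> f' ` carrier A'"
    then obtain a where a: "a \<in> carrier A'" "y = f' a" by auto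
    then show "y \<in> {y \<in> carrier Q. g' y = \<zero>\<^bsub>C\<^esub>}"
      using hj(1) hk(1) P(9) by (simp add: f'a g'k mod_hom_zero[OF x(2,3,5)])
  next
    fix y assume "y \<in> {y \<in> carrier Q. g' y = \<zero>\<^bsub>C\<^esub>}"
    then have y: "y \<in> k ` carrier P" "g' y = \<zero>\<^bsub>C\<^esub>" using Q(3) by auto
    then obtain z where z: "z \<in> carrier P" "y = k z" by auto
    have "r z \<in> f ` carrier A" unfolding x(7) using y(2) z hr(1)[OF z(1)] by (simp add: g'k)
    then obtain a where a: "a \<in> carrier A" "r z = f a" by auto
    have c: "i (f a) \<in> carrier P" "j (t z) \<in> carrier P" "k (i (f a)) \<in> carrier Q" "k (j (t z)) \<in> carrier Q"
      "t z \<in> carrier A'" "h a \<in> carrier A'"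
      using a z hf(1) hi(1) hj(1) ht(1) hk(1) hh(1) by auto
    have "y = k (i (f a) \<oplus>\<^bsub>P\<^esub> j (t z))" using P(10)[OF z(1)] a(2) z(2) by simp
    also have "\<dots> = h' (f a) \<oplus>\<^bsub>Q\<^esub> f' (t z)" using c hf(1)[OF a(1)] by (simp add: hk(2) h'a f'a)
    also have "\<dots> = f' (h a \<oplus>\<^bsub>A'\<^esub> t z)"
      using comm[OF a(1)] mod_homD(2)[OF f'h c(6,5)] by simp
    finally show "y \<in> f' ` carrier A'" using c by blast
  qed
  have surj: "g' ` carrier Q = carrier C"
  proof (intro equalityI subsetI)
    fix c assume "c \<in> carrier C"
    then obtain b where "b \<in> carrier B" "c = g b" using x(8) by auto
    then show "c \<in> g' ` carrier Q" using g'h' mod_homD(1)[OF h'h] by (intro image_eqI[of _ _ "h' b"]) auto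
  qed (use mod_homD(1)[OF g'(1)] in auto)
  have e': "exact_seq R A' f' Q g' C" unfolding exact_seq_def using A' Q(1) x(3) f'h g'(1) f'_inj im surj by simp
  have univ: "\<forall>T :: ('a, 'u) module. module R T --> (\<forall>u\<in>mod_hom R B T. \<forall>v\<in>mod_hom R A' T.
      (\<forall>a\<in>carrier A. u (f a) = v (h a)) -->
      (\<exists>!w. w \<in> mod_hom R Q T \<and> (\<forall>b\<in>carrier B. w (h' b) = u b) \<and> (\<forall>a\<in>carrier A'. w (f' a) = v a)))"
  proof (intro allI impI ballI)
    fix T :: "('a, 'u) module" and u v
    assume T: "module R T" and u: "u \<in> mod_hom R B T" and v: "v \<in> mod_hom R A' T"
      and "\<forall>a\<in>carrier A. u (f a) = v (h a)"
    then have uv: "u (f a) = v (h a)" if "a \<in> carrier A" for a using that by blast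
    interpret T: rmodule R T by (rule rmodule.intro) (rule T)
    note hu = mod_homD[OF u] and hv = mod_homD[OF v]
    define m where "m = (\<lambda>y\<in>carrier P. u (r y) \<oplus>\<^bsub>T\<^esub> v (t y))"
    have mh: "m \<in> mod_hom R P T"
      unfolding m_def
    proof (rule mod_hom_restrictI[OF P(1)])
      fix y z assume "y \<in> carrier P" "z \<in> carrier P"
      then show "u (r (y \<oplus>\<^bsub>P\<^esub> z)) \<oplus>\<^bsub>T\<^esub> v (t (y \<oplus>\<^bsub>P\<^esub> z)) =
          u (r y) \<oplus>\<^bsub>T\<^esub> v (t y) \<oplus>\<^bsub>T\<^esub> (u (r z) \<oplus>\<^bsub>T\<^esub> v (t z))"
        using hr(1) ht(1) hu(1) hv(1) by (simp add: hr(2) ht(2) hu(2) hv(2) T.M.a_ac)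
    next
      fix c y assume "c \<in> carrier R" "y \<in> carrier P"
      then show "u (r (c \<odot>\<^bsub>P\<^esub> y)) \<oplus>\<^bsub>T\<^esub> v (t (c \<odot>\<^bsub>P\<^esub> y)) = c \<odot>\<^bsub>T\<^esub> (u (r y) \<oplus>\<^bsub>T\<^esub> v (t y))"
        using hr(1) ht(1) hu(1) hv(1) by (simp add: hr(3) ht(3) hu(3) hv(3) T.smult_r_distr)
    qed (use hr(1) ht(1) hu(1) hv(1) in auto)
    have "m y = \<zero>\<^bsub>T\<^esub>" if y: "y \<in> carrier P" "k y = \<zero>\<^bsub>Q\<^esub>" for y
    proof -
      obtain a where a: "a \<in> carrier A" "y = d a" using Q(4)[OF y(1)] y(2) by auto
      then show ?thesis
        using dc[OF a(1)] rd[OF a(1)] td[OF a(1)] uv[OF a(1)] hh(1)[OF a(1)] hv(1)[OF hh(1)[OF a(1)]]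
        by (simp add: m_def mod_hom_neg[OF A' T v] T.M.r_neg)
    qed
    then obtain w where w: "w \<in> mod_hom R Q T" "!!y. y \<in> carrier P ==> w (k y) = m y"
      using factor_epi[OF P(1) Q(1) T Q(2,3) mh] by blast
    show "\<exists>!w. w \<in> mod_hom R Q T \<and> (\<forall>b\<in>carrier B. w (h' b) = u b) \<and> (\<forall>a\<in>carrier A'. w (f' a) = v a)"
    proof (rule ex1I[of _ w])
      show "w \<in> mod_hom R Q T \<and> (\<forall>b\<in>carrier B. w (h' b) = u b) \<and> (\<forall>a\<in>carrier A'. w (f' a) = v a)"
        using w hi(1) hj(1) P(6-9) hu(1) hv(1)
        by (simp add: h'a f'a m_def mod_hom_zero[OF A' T v] mod_hom_zero[OF x(2) T u])
    next
      fix w2 assume w2: "w2 \<in> mod_hom R Q T \<and> (\<forall>b\<in>carrier B. w2 (h' b) = u b) \<and> (\<forall>a\<in>carrier A'. w2 (f' a) = v a)"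
      show "w2 = w"
      proof (rule mod_hom_ext[OF conjunct1[OF w2] w(1)])
        fix y assume "y \<in> carrier Q"
        then obtain z where z: "z \<in> carrier P" "y = k z" using Q(3) by auto
        have c: "r z \<in> carrier B" "t z \<in> carrier A'" using z hr(1) ht(1) by auto
        have "y = k (i (r z) \<oplus>\<^bsub>P\<^esub> j (t z))" using P(10)[OF z(1)] z(2) by simp
        also have "\<dots> = h' (r z) \<oplus>\<^bsub>Q\<^esub> f' (t z)" using c hi(1) hj(1) by (simp add: hk(2) h'a f'a)
        finally have "w2 y = u (r z) \<oplus>\<^bsub>T\<^esub> v (t z)"
          using w2 c mod_homD(2)[OF conjunct1[OF w2] mod_homD(1)[OF h'h c(1)] mod_homD(1)[OF f'h c(2)]] by simp
        then show "w2 y = w y" using z w(2)[OF z(1)] by (simp add: m_def)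
      qed
    qed
  qed
  have "Q \<in> Ul R \<mm> I s" if U: "A \<in> Ul R \<mm> I s" "B \<in> Ul R \<mm> I s" "C \<in> Ul R \<mm> I s" "A' \<in> Ul R \<mm> I s" for s
  proof -
    have "P \<in> Ul R \<mm> I s" by (rule Ul_split[OF eP U(2,4) P(4,6)])
    then show "Q \<in> Ul R \<mm> I s" by (rule Ul_cokernel[OF ed U(1) _ e' U(4,3)])
  qed
  with e' h'h comm g'h' univ show ?thesis by (rule that)
qed

text \<open>A copy of the fibre product in \<open>'u\<close>, again for arbitrary modules, so that
  it also provides the pull-back of extensions.\<close>

lemma pullback_exists:
  fixes A B C C' :: "('a, 'u) module"
  assumes inf: "infinite (UNIV :: 'u set)" and e: "exact_seq R A f B g C" and C': "module R C'"
    and k: "k \<in> mod_hom R C' C"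
  obtains f' and B' :: "('a, 'u) module" and k' g' where "exact_seq R A f' B' g' C'" "k' \<in> mod_hom R B' B"
    "!!a. a \<in> carrier A ==> k' (f' a) = f a" "!!b. b \<in> carrier B' ==> g (k' b) = k (g' b)"
    "\<forall>T :: ('a, 'u) module. module R T --> (\<forall>u\<in>mod_hom R T B. \<forall>v\<in>mod_hom R T C'.
      (\<forall>t\<in>carrier T. g (u t) = k (v t)) -->
      (\<exists>!w. w \<in> mod_hom R T B' \<and> (\<forall>t\<in>carrier T. k' (w t) = u t) \<and> (\<forall>t\<in>carrier T. g' (w t) = v t)))"
    "!!s. A \<in> Ul R \<mm> I s ==> B \<in> Ul R \<mm> I s ==> C \<in> Ul R \<mm> I s ==> C' \<in> Ul R \<mm> I s ==> B' \<in> Ul R \<mm> I s"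
proof -
  note x = exact_seqD[OF e]
  let ?P = "fibre_product B g C' k"
  note P = fibre_product_module[OF x(2) C' x(3,5) k]
  have cP: "carrier ?P = {(b, c). b \<in> carrier B \<and> c \<in> carrier C' \<and> g b = k c}" by (simp add: fibre_product_def)
  obtain \<iota> :: "'u \<times> 'u => 'u" where "inj \<iota>" by (rule inj_prod_infinite[OF inf])
  then have "inj_on \<iota> (carrier ?P)" by (rule inj_on_subset) simp
  from copy_exists[OF P(1) this] obtain B' :: "('a, 'u) module" and \<phi>
    where B': "module R B'" "\<phi> \<in> mod_iso R ?P B'" .
  obtain \<psi> where \<psi>: "\<psi> \<in> mod_iso R B' ?P" "!!y. y \<in> carrier ?P ==> \<psi> (\<phi> y) = y"
    "!!y. y \<in> carrier B' ==> \<phi> (\<psi> y) = y" by (rule mod_iso_inverse[OF P(1) B']) (rule that)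
  have \<phi>h: "\<phi> \<in> mod_hom R ?P B'" and \<psi>h: "\<psi> \<in> mod_hom R B' ?P" using B'(2) \<psi>(1) by (auto simp: mod_iso_def)
  note h\<phi> = mod_homD[OF \<phi>h] and h\<psi> = mod_homD[OF \<psi>h]
  let ?i = "\<lambda>a\<in>carrier A. (f a, \<zero>\<^bsub>C'\<^esub>)" and ?s = "\<lambda>z\<in>carrier ?P. snd z" and ?f = "\<lambda>z\<in>carrier ?P. fst z"
  have eP: "exact_seq R A ?i ?P ?s C'" by (rule fibre_product_exact[OF e C' k])
  note hi = mod_homD[OF exact_seqD(4)[OF eP]]
  define f' where "f' = compose (carrier A) \<phi> ?i"
  define g' where "g' = compose (carrier B') ?s \<psi>"
  define k' where "k' = compose (carrier B') ?f \<psi>"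
  have f'h: "f' \<in> mod_hom R A B'" unfolding f'_def by (rule mod_hom_compose[OF x(1) exact_seqD(4)[OF eP] \<phi>h])
  have g'h: "g' \<in> mod_hom R B' C'" unfolding g'_def by (rule mod_hom_compose[OF B'(1) \<psi>h P(3)])
  have k'h: "k' \<in> mod_hom R B' B" unfolding k'_def by (rule mod_hom_compose[OF B'(1) \<psi>h P(2)])
  have g'a: "g' y = snd (\<psi> y)" and k'a: "k' y = fst (\<psi> y)" if "y \<in> carrier B'" for y
    using that h\<psi>(1)[OF that] by (simp_all add: g'_def k'_def compose_def)
  have idA: "mod_id A \<in> mod_iso R A A" and idC: "mod_id C' \<in> mod_iso R C' C'"
    using mod_id_hom[OF x(1)] mod_id_hom[OF C'] by (auto simp: mod_iso_def mod_id_def bij_betw_def inj_on_def)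
  have e': "exact_seq R A f' B' g' C'"
  proof (rule exact_seq_iso[OF eP x(1) B'(1) C' f'h g'h idA B'(2) idC])
    show "\<phi> (?i a) = f' (mod_id A a)" if "a \<in> carrier A" for a
      using that by (simp add: f'_def mod_id_def compose_def)
    show "mod_id C' (?s b) = g' (\<phi> b)" if "b \<in> carrier ?P" for b
      using that h\<phi>(1)[OF that] mod_homD(1)[OF P(3) that] by (simp add: g'a \<psi>(2) mod_id_def)
  qed
  show ?thesis
  proof (rule that[OF e' k'h])
    show "k' (f' a) = f a" if "a \<in> carrier A" for a
      using that hi(1)[OF that] mod_homD(1)[OF f'h that] by (simp add: k'a f'_def compose_def \<psi>(2))
    show "g (k' b) = k (g' b)" if "b \<in> carrier B'" for b
      using that h\<psi>(1)[OF that] by (auto simp: k'a g'a cP)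
    show "B' \<in> Ul R \<mm> I s" if "A \<in> Ul R \<mm> I s" "B \<in> Ul R \<mm> I s" "C \<in> Ul R \<mm> I s" "C' \<in> Ul R \<mm> I s" for s
      by (rule Ul_iso[OF fibre_product_Ul[OF inf e k that] B'(2,1)])
    show "\<forall>T :: ('a, 'u) module. module R T --> (\<forall>u\<in>mod_hom R T B. \<forall>v\<in>mod_hom R T C'.
      (\<forall>t\<in>carrier T. g (u t) = k (v t)) -->
      (\<exists>!w. w \<in> mod_hom R T B' \<and> (\<forall>t\<in>carrier T. k' (w t) = u t) \<and> (\<forall>t\<in>carrier T. g' (w t) = v t)))"
    proof (intro allI impI ballI)
    fix T :: "('a, 'u) module" and u v
    assume T: "module R T" and u: "u \<in> mod_hom R T B" and v: "v \<in> mod_hom R T C'"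
      and "\<forall>t\<in>carrier T. g (u t) = k (v t)"
    then have uv: "g (u t) = k (v t)" if "t \<in> carrier T" for t using that by blast
    have "(\<lambda>t\<in>carrier T. (u t, v t)) \<in> mod_hom R T ?P"
      by (rule mod_hom_restrictI[OF T])
        (auto simp: cP uv mod_homD[OF u] mod_homD[OF v], auto simp: fibre_product_def mod_homD[OF u] mod_homD[OF v])
    then have wh: "compose (carrier T) \<phi> (\<lambda>t\<in>carrier T. (u t, v t)) \<in> mod_hom R T B'"
      by (rule mod_hom_compose[OF T _ \<phi>h])
    have pair: "(u t, v t) \<in> carrier ?P" if "t \<in> carrier T" for t
      using that uv mod_homD(1)[OF u] mod_homD(1)[OF v] by (simp add: cP)
    show "\<exists>!w. w \<in> mod_hom R T B' \<and> (\<forall>t\<in>carrier T. k' (w t) = u t) \<and> (\<forall>t\<in>carrier T. g' (w t) = v t)"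
    proof (rule ex1I[of _ "compose (carrier T) \<phi> (\<lambda>t\<in>carrier T. (u t, v t))"])
      show "compose (carrier T) \<phi> (\<lambda>t\<in>carrier T. (u t, v t)) \<in> mod_hom R T B' \<and>
        (\<forall>t\<in>carrier T. k' (compose (carrier T) \<phi> (\<lambda>t\<in>carrier T. (u t, v t)) t) = u t) \<and>
        (\<forall>t\<in>carrier T. g' (compose (carrier T) \<phi> (\<lambda>t\<in>carrier T. (u t, v t)) t) = v t)"
        using wh pair h\<phi>(1) by (auto simp: compose_def k'a g'a \<psi>(2))
    next
      fix w assume w: "w \<in> mod_hom R T B' \<and> (\<forall>t\<in>carrier T. k' (w t) = u t) \<and> (\<forall>t\<in>carrier T. g' (w t) = v t)"
      show "w = compose (carrier T) \<phi> (\<lambda>t\<in>carrier T. (u t, v t))"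
      proof (rule mod_hom_ext[OF conjunct1[OF w] wh])
        fix t assume t: "t \<in> carrier T"
        have wt: "w t \<in> carrier B'" by (rule mod_homD(1)[OF conjunct1[OF w] t])
        have "\<psi> (w t) = (u t, v t)" using w t k'a[OF wt] g'a[OF wt] by (intro prod_eqI) auto
        then show "w t = compose (carrier T) \<phi> (\<lambda>t\<in>carrier T. (u t, v t)) t"
          using \<psi>(3)[OF wt] t by (simp add: compose_def)
      qed
    qed
  qed
  qed
qed

text \<open>By the third isomorphism theorem the cokernel D = B' / A is an extension of C' = B' / B
  by C = B / A.\<close>

lemma inflation_compose:
  fixes A B B' C C' :: "('a, 'u) module"
  assumes e: "exact_seq R A f B g C" and e': "exact_seq R B f' B' g' C'"
    and U: "A \<in> Ul R \<mm> I s" "B' \<in> Ul R \<mm> I s" "C \<in> Ul R \<mm> I s" "C' \<in> Ul R \<mm> I s"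
  obtains q and D :: "('a, 'u) module" where "exact_seq R A (compose (carrier A) f' f) B' q D" "D \<in> Ul R \<mm> I s"
proof -
  note x = exact_seqD[OF e] and x' = exact_seqD[OF e']
  interpret A: rmodule R A by (rule rmodule.intro) (rule x(1))
  interpret B': rmodule R B' by (rule rmodule.intro) (rule x'(2))
  let ?F = "compose (carrier A) f' f"
  note hf = mod_homD[OF x(4)] and hf' = mod_homD[OF x'(4)] and hg = mod_homD[OF x(5)] and hg' = mod_homD[OF x'(5)]
  have F: "?F \<in> mod_hom R A B'" by (rule mod_hom_compose[OF x(1,4) x'(4)])
  have Fa: "?F a = f' (f a)" if "a \<in> carrier A" for a using that by (simp add: compose_def)
  have sF: "submodule (?F ` carrier A) R B'" by (rule mod_hom_image_sm[OF x(1) x'(2) F A.sm_carrier])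
  obtain D :: "('a, 'u) module" and q where D: "module R D" "q \<in> mod_hom R B' D" "q ` carrier B' = carrier D"
    "!!y. y \<in> carrier B' ==> q y = \<zero>\<^bsub>D\<^esub> \<longleftrightarrow> y \<in> ?F ` carrier A"
    by (rule quotient_exists[OF x'(2) sF, of "\<lambda>x. x"]) (simp, rule that)
  have "inj_on ?F (carrier A)"
  proof (rule inj_onI)
    fix a b assume ab: "a \<in> carrier A" "b \<in> carrier A" "?F a = ?F b"
    then have "f a = f b" using inj_onD[OF x'(6), of "f a" "f b"] hf(1) by (simp add: Fa)
    then show "a = b" using inj_onD[OF x(6)] ab by blast
  qed
  then have eF: "exact_seq R A ?F B' q D"
    unfolding exact_seq_def using x(1) x'(2) D F sF B'.sm_sub[OF sF] by auto
  have "compose (carrier B) q f' b = \<zero>\<^bsub>D\<^esub>" if b: "b \<in> carrier B" "g b = \<zero>\<^bsub>C\<^esub>" for b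
  proof -
    obtain a where a: "a \<in> carrier A" "b = f a" using b x(7) by blast
    then have "f' b \<in> ?F ` carrier A" using Fa by (intro image_eqI[of _ _ a]) auto
    then show ?thesis using D(4)[OF hf'(1)[OF b(1)]] b(1) by (simp add: compose_def)
  qed
  then obtain i where i: "i \<in> mod_hom R C D" "!!b. b \<in> carrier B ==> i (g b) = compose (carrier B) q f' b"
    using factor_epi[OF x(2,3) D(1) x(5,8) mod_hom_compose[OF x(2) x'(4) D(2)]] by blast
  have ig: "i (g b) = q (f' b)" if "b \<in> carrier B" for b using i(2)[OF that] that by (simp add: compose_def)
  have "g' y = \<zero>\<^bsub>C'\<^esub>" if y: "y \<in> carrier B'" "q y = \<zero>\<^bsub>D\<^esub>" for y
  proof -
    obtain a where a: "a \<in> carrier A" "y = f' (f a)" using D(4)[OF y(1)] y(2) Fa by auto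
    then have "y \<in> f' ` carrier B" using hf(1) by blast
    then show ?thesis using x'(7) by auto
  qed
  then obtain p where p: "p \<in> mod_hom R D C'" "!!y. y \<in> carrier B' ==> p (q y) = g' y"
    using factor_epi[OF x'(2) D(1) x'(3) D(2,3) x'(5)] by blast
  have "inj_on i (carrier C)"
  proof (rule mod_hom_inj_on[OF x(3) D(1) i(1)])
    fix c assume c: "c \<in> carrier C" "i c = \<zero>\<^bsub>D\<^esub>"
    then obtain b where b: "b \<in> carrier B" "c = g b" using x(8) by auto
    then have "f' b \<in> ?F ` carrier A" using c(2) D(4)[OF hf'(1)[OF b(1)]] by (simp add: ig)
    then obtain a where a: "a \<in> carrier A" "f' b = f' (f a)" using Fa by auto
    then have "b = f a" using inj_onD[OF x'(6) a(2) b(1) hf(1)[OF a(1)]] by simp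
    then have "b \<in> f ` carrier A" using a(1) by blast
    then show "c = \<zero>\<^bsub>C\<^esub>" using b(2) x(7) by auto
  qed
  moreover have "i ` carrier C = {y \<in> carrier D. p y = \<zero>\<^bsub>C'\<^esub>}"
  proof (intro equalityI subsetI)
    fix y assume "y \<in> i ` carrier C"
    then obtain c where c: "c \<in> carrier C" "y = i c" by auto
    then have "c \<in> g ` carrier B" using x(8) by simp
    then obtain b where b: "b \<in> carrier B" "y = i (g b)" using c(2) by auto
    have "f' b \<in> f' ` carrier B" using b by blast
    then show "y \<in> {y \<in> carrier D. p y = \<zero>\<^bsub>C'\<^esub>}"
      using b hf'(1)[OF b(1)] mod_homD(1)[OF D(2) hf'(1)[OF b(1)]] x'(7) by (simp add: ig p(2))
  next
    fix y assume "y \<in> {y \<in> carrier D. p y = \<zero>\<^bsub>C'\<^esub>}"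
    then have "y \<in> q ` carrier B'" "p y = \<zero>\<^bsub>C'\<^esub>" using D(3) by auto
    then obtain z where z: "z \<in> carrier B'" "y = q z" "g' z = \<zero>\<^bsub>C'\<^esub>" using p(2) by auto
    then have "z \<in> f' ` carrier B" using x'(7) by simp
    then obtain b where "b \<in> carrier B" "z = f' b" by auto
    then show "y \<in> i ` carrier C" using z(2) ig hg(1) by (intro image_eqI[of _ _ "g b"]) auto
  qed
  moreover have "p ` carrier D = carrier C'"
  proof -
    have "p ` carrier D = (\<lambda>y. p (q y)) ` carrier B'" unfolding D(3)[symmetric] image_image ..
    also have "\<dots> = g' ` carrier B'" using p(2) by (intro image_cong) auto
    finally show ?thesis using x'(8) by simp
  qed
  ultimately have "exact_seq R C i D p C'" unfolding exact_seq_def using x(3) D(1) x'(3) i(1) p(1) by simp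
  then have "D \<in> Ul R \<mm> I s" by (rule Ul_cokernel[OF eF U(1,2) _ U(3,4)])
  then show ?thesis using that[OF eF] by blast
qed

text \<open>The kernel K of the composite is the preimage under g of A' \<subseteq> C, hence an
  extension of A' by A.\<close>

lemma deflation_compose:
  fixes A A' B C C' :: "('a, 'u) module"
  assumes e: "exact_seq R A f B g C" and e': "exact_seq R A' f' C g' C'"
    and U: "A \<in> Ul R \<mm> I s" "A' \<in> Ul R \<mm> I s" "B \<in> Ul R \<mm> I s" "C' \<in> Ul R \<mm> I s"
  obtains k and K :: "('a, 'u) module" where "exact_seq R K k B (compose (carrier B) g' g) C'" "K \<in> Ul R \<mm> I s"
proof -
  note x = exact_seqD[OF e] and x' = exact_seqD[OF e']
  interpret A': rmodule R A' by (rule rmodule.intro) (rule x'(1))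
  interpret B: rmodule R B by (rule rmodule.intro) (rule x(2))
  interpret C': rmodule R C' by (rule rmodule.intro) (rule x'(3))
  let ?G = "compose (carrier B) g' g"
  note hf = mod_homD[OF x(4)] and hf' = mod_homD[OF x'(4)] and hg = mod_homD[OF x(5)] and hg' = mod_homD[OF x'(5)]
  have G: "?G \<in> mod_hom R B C'" by (rule mod_hom_compose[OF x(2,5) x'(5)])
  have Ga: "?G b = g' (g b)" if "b \<in> carrier B" for b using that by (simp add: compose_def)
  define H where "H = {b \<in> carrier B. ?G b \<in> {\<zero>\<^bsub>C'\<^esub>}}"
  have H: "submodule H R B" unfolding H_def by (rule mod_hom_preimage_sm[OF x(2) x'(3) G B.sm_carrier C'.sm_null])
  define K where "K = B\<lparr>carrier := H\<rparr>"
  have K: "module R K" unfolding K_def by (rule submodule.submodule_is_module[OF H x(2)])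
  have cK: "carrier K = H" "!!a b. a \<oplus>\<^bsub>K\<^esub> b = a \<oplus>\<^bsub>B\<^esub> b" "!!r b. r \<odot>\<^bsub>K\<^esub> b = r \<odot>\<^bsub>B\<^esub> b" "\<zero>\<^bsub>K\<^esub> = \<zero>\<^bsub>B\<^esub>"
    by (simp_all add: K_def)
  have HB: "b \<in> carrier B" "g' (g b) = \<zero>\<^bsub>C'\<^esub>" if "b \<in> H" for b using that by (auto simp: H_def Ga)
  define k where "k = (\<lambda>b\<in>carrier K. b)"
  have kh: "k \<in> mod_hom R K B" unfolding k_def by (rule mod_hom_restrictI[OF K]) (auto simp: cK HB)
  have ka: "k b = b" if "b \<in> H" for b using that by (simp add: k_def cK)
  have "?G ` carrier B = g' ` (g ` carrier B)" unfolding image_image using Ga by (intro image_cong) auto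
  then have "?G ` carrier B = carrier C'" using x(8) x'(8) by simp
  moreover have "k ` carrier K = {b \<in> carrier B. ?G b = \<zero>\<^bsub>C'\<^esub>}"
    unfolding cK using ka by (auto simp: H_def image_iff)
  moreover have "inj_on k (carrier K)" unfolding cK using ka by (auto simp: inj_on_def)
  ultimately have eK: "exact_seq R K k B ?G C'" unfolding exact_seq_def using K x(2) x'(3) kh G by simp
  have gf: "g (f a) = \<zero>\<^bsub>C\<^esub>" if "a \<in> carrier A" for a using that x(7) by auto
  have "?G (f a) = \<zero>\<^bsub>C'\<^esub>" if "a \<in> carrier A" for a
    using that hf(1) gf by (simp add: Ga mod_hom_zero[OF x'(2,3,5)])
  then obtain i where i: "i \<in> mod_hom R A K" "!!a. a \<in> carrier A ==> k (i a) = f a"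
    using lift_mono[OF eK x(1,4)] by blast
  have ia: "i a = f a" if "a \<in> carrier A" for a using i(2)[OF that] ka mod_homD(1)[OF i(1) that] cK by simp
  have "g' (compose (carrier K) g k b) = \<zero>\<^bsub>C'\<^esub>" if "b \<in> carrier K" for b
    using that HB ka by (simp add: compose_def cK)
  then obtain p where p: "p \<in> mod_hom R K A'" "!!b. b \<in> carrier K ==> f' (p b) = compose (carrier K) g k b"
    using lift_mono[OF e' K mod_hom_compose[OF K kh x(5)]] by blast
  have pa: "f' (p b) = g b" if "b \<in> H" for b using that p(2)[of b] ka by (simp add: compose_def cK)
  have f'0: "p b = \<zero>\<^bsub>A'\<^esub> \<longleftrightarrow> g b = \<zero>\<^bsub>C\<^esub>" if b: "b \<in> H" for b
  proof -
    have "p b \<in> carrier A'" using mod_homD(1)[OF p(1)] b cK by simp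
    then show ?thesis
      using pa[OF b] mod_hom_zero[OF x'(1,2,4)] inj_onD[OF x'(6), of "p b" "\<zero>\<^bsub>A'\<^esub>"] by auto
  qed
  have iH: "i a \<in> H" if "a \<in> carrier A" for a using mod_homD(1)[OF i(1) that] cK by simp
  have "inj_on i (carrier A)" using x(6) ia by (simp add: inj_on_def)
  moreover have "i ` carrier A = {b \<in> carrier K. p b = \<zero>\<^bsub>A'\<^esub>}"
  proof (intro equalityI subsetI)
    fix b assume "b \<in> i ` carrier A"
    then obtain a where a: "a \<in> carrier A" "b = i a" by auto
    then show "b \<in> {b \<in> carrier K. p b = \<zero>\<^bsub>A'\<^esub>}" using iH f'0[OF iH] gf by (simp add: cK ia)
  next
    fix b assume "b \<in> {b \<in> carrier K. p b = \<zero>\<^bsub>A'\<^esub>}"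
    then have b: "b \<in> H" "g b = \<zero>\<^bsub>C\<^esub>" using f'0 cK by auto
    then have "b \<in> f ` carrier A" using HB(1) x(7) by simp
    then show "b \<in> i ` carrier A" using ia by (auto simp: image_iff)
  qed
  moreover have "p ` carrier K = carrier A'"
  proof (intro equalityI subsetI)
    fix a assume a: "a \<in> carrier A'"
    have "f' a \<in> g ` carrier B" using hf'(1)[OF a] x(8) by simp
    then obtain b where b: "b \<in> carrier B" "f' a = g b" by auto
    have "g' (f' a) = \<zero>\<^bsub>C'\<^esub>" using a x'(7) by auto
    then have bH: "b \<in> H" using b by (simp add: H_def Ga)
    have "p b = a"
      using inj_onD[OF x'(6), of "p b" a] pa[OF bH] b(2) a mod_homD(1)[OF p(1), of b] bH cK by simp
    then show "a \<in> p ` carrier K" using bH cK by blast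
  qed (use mod_homD(1)[OF p(1)] in auto)
  ultimately have "exact_seq R A i K p A'" unfolding exact_seq_def using x(1) K x'(1) i(1) p(1) by simp
  then have "K \<in> Ul R \<mm> I s" by (rule Ul_kernel[OF eK U(3,4) _ U(1,2)])
  then show ?thesis using that[OF eK] by blast
qed

section \<open>The axioms of an exact category\<close>

lemma zero_module_exists:
  obtains Z :: "('a, 'u) module" where "Z \<in> Ul R \<mm> I s" "carrier Z = {\<zero>\<^bsub>Z\<^esub>}"
proof -
  have T: "module R (triv_mod :: ('a, unit) module)" by (rule triv_module[OF is_cring])
  have c: "carrier (triv_mod :: ('a, unit) module) = {()}" and z: "\<zero>\<^bsub>(triv_mod :: ('a, unit) module)\<^esub> = ()"
    by (auto simp: triv_mod_def)
  have "inj_on (\<lambda>_. undefined :: 'u) (carrier (triv_mod :: ('a, unit) module))" unfolding c by simp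
  from copy_exists[OF T this] obtain Z :: "('a, 'u) module" and \<phi>
    where Z: "module R Z" "\<phi> \<in> mod_iso R (triv_mod :: ('a, unit) module) Z" .
  have tU: "triv_mod \<in> Ul R \<mm> I s" by (rule Ul_zero[OF T]) (simp only: c z)
  have \<phi>: "\<phi> \<in> mod_hom R (triv_mod :: ('a, unit) module) Z" "\<phi> ` {()} = carrier Z"
    using Z(2) c by (auto simp: mod_iso_def bij_betw_def)
  have "\<phi> () = \<zero>\<^bsub>Z\<^esub>" using mod_hom_zero[OF T Z(1) \<phi>(1)] unfolding z .
  then have "carrier Z = {\<zero>\<^bsub>Z\<^esub>}" using \<phi>(2) by simp
  then show ?thesis using that Ul_iso[OF tU Z(2,1)] by blast
qed

text \<open>The universal properties hold against all modules and restrict to test objects in the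
  subcategory; the content of each axiom is that the constructed object is again an Ulrich
  module.\<close>

theorem Ul_exact_category:
  assumes inf: "infinite (UNIV :: 'u set)"
  shows "exact_category R (Ul R \<mm> I s :: ('a, 'u) module set) (short_exact_in R (Ul R \<mm> I s))"
proof -
  let ?U = "Ul R \<mm> I s :: ('a, 'u) module set"
  let ?E = "short_exact_in R ?U"
  have mU: "module R M" if "M \<in> ?U" for M using UlD(3)[OF that] .
  obtain Z :: "('a, 'u) module" where Z: "Z \<in> ?U" "carrier Z = {\<zero>\<^bsub>Z\<^esub>}" by (rule zero_module_exists)
  have additive: "additive_subcategory R ?U"
    unfolding additive_subcategory_def
  proof (intro conjI ballI)
    show "?U \<subseteq> Mod_cat R" using mU by (auto simp: Mod_cat_def)
    show "\<exists>Z\<in>?U. carrier Z = {\<zero>\<^bsub>Z\<^esub>}" using Z by blast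
    fix A B assume A: "A \<in> ?U" and B: "B \<in> ?U"
    obtain P :: "('a, 'u) module" and i j p q where ds: "direct_sum R A B P i j p q"
      by (rule direct_sum_exists[OF inf mU[OF A] mU[OF B]])
    note P = direct_sumD[OF ds]
    have "is_biproduct R A B P"
      unfolding is_biproduct_def compose_zero_iff mod_id_def
      by (intro bexI[OF _ P(2)] bexI[OF _ P(3)] bexI[OF _ P(4)] bexI[OF _ P(5)] conjI)
        (auto simp: P(6-10) compose_def)
    then show "\<exists>P\<in>?U. is_biproduct R A B P" using direct_sum_Ul[OF A B ds] by blast
  qed
  have am: "admissible_mono ?E A f B \<longleftrightarrow> (\<exists>g C. exact_seq R A f B g C \<and> A \<in> ?U \<and> B \<in> ?U \<and> C \<in> ?U)" for A f B
    unfolding admissible_mono_def short_exact_in_iff ..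
  have ae: "admissible_epi ?E B g C \<longleftrightarrow> (\<exists>A f. exact_seq R A f B g C \<and> A \<in> ?U \<and> B \<in> ?U \<and> C \<in> ?U)" for B g C
    unfolding admissible_epi_def short_exact_in_iff ..
  have id1: "admissible_mono ?E A (mod_id A) A" if A: "A \<in> ?U" for A
  proof -
    interpret A: rmodule R A by (rule rmodule.intro[OF mU[OF A]])
    have "exact_seq R A (mod_id A) A (zero_hom A Z) Z"
      unfolding exact_seq_def
      using mU[OF A] mU[OF Z(1)] mod_id_hom[OF mU[OF A]] zero_hom_hom[OF mU[OF A] mU[OF Z(1)]] A.M.zero_closed Z(2)
      by (auto simp: mod_id_def zero_hom_def inj_on_def image_iff)
    then show ?thesis unfolding am using A Z(1) by blast
  qed
  have id2: "admissible_epi ?E A (mod_id A) A" if A: "A \<in> ?U" for A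
  proof -
    interpret A: rmodule R A by (rule rmodule.intro[OF mU[OF A]])
    have "exact_seq R Z (zero_hom Z A) A (mod_id A) A"
      unfolding exact_seq_def
      using mU[OF A] mU[OF Z(1)] mod_id_hom[OF mU[OF A]] zero_hom_hom[OF mU[OF Z(1)] mU[OF A]] A.M.zero_closed Z(2)
      by (auto simp: mod_id_def zero_hom_def inj_on_def image_iff)
    then show ?thesis unfolding ae using A Z(1) by blast
  qed
  have kc: "\<forall>(A, f, B, g, C)\<in>?E. A \<in> ?U \<and> B \<in> ?U \<and> C \<in> ?U \<and> f \<in> mod_hom R A B \<and> g \<in> mod_hom R B C \<and>
      is_kernel_in R ?U (A, f, B, g, C) \<and> is_cokernel_in R ?U (A, f, B, g, C)"
  proof (intro ballI, clarify)
    fix A f B g C assume E: "(A, f, B, g, C) \<in> ?E"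
    then have e: "exact_seq R A f B g C" and ABC: "A \<in> ?U" "B \<in> ?U" "C \<in> ?U" unfolding short_exact_in_iff by auto
    show "A \<in> ?U \<and> B \<in> ?U \<and> C \<in> ?U \<and> f \<in> mod_hom R A B \<and> g \<in> mod_hom R B C \<and>
      is_kernel_in R ?U (A, f, B, g, C) \<and> is_cokernel_in R ?U (A, f, B, g, C)"
      using ABC exact_seqD(4,5)[OF e] exact_kernel[OF e mU] exact_cokernel[OF e mU] by blast
  qed
  have iso: "\<forall>(A, f, B, g, C) \<in> ?E. \<forall>A' \<in> ?U. \<forall>B' \<in> ?U. \<forall>C' \<in> ?U.
        \<forall>f' \<in> mod_hom R A' B'. \<forall>g' \<in> mod_hom R B' C'.
        \<forall>\<alpha> \<in> mod_iso R A A'. \<forall>\<beta> \<in> mod_iso R B B'. \<forall>\<gamma> \<in> mod_iso R C C'.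
          compose (carrier A) \<beta> f = compose (carrier A) f' \<alpha> \<and>
          compose (carrier B) \<gamma> g = compose (carrier B) g' \<beta> --> (A', f', B', g', C') \<in> ?E"
  proof (intro ballI, clarify)
    fix A f B g C A' B' C' f' g' \<alpha> \<beta> \<gamma>
    assume E: "(A, f, B, g, C) \<in> ?E" and U: "A' \<in> ?U" "B' \<in> ?U" "C' \<in> ?U"
      and h: "f' \<in> mod_hom R A' B'" "g' \<in> mod_hom R B' C'"
      and i: "\<alpha> \<in> mod_iso R A A'" "\<beta> \<in> mod_iso R B B'" "\<gamma> \<in> mod_iso R C C'"
      and c: "compose (carrier A) \<beta> f = compose (carrier A) f' \<alpha>" "compose (carrier B) \<gamma> g = compose (carrier B) g' \<beta>"
    have e: "exact_seq R A f B g C" using E unfolding short_exact_in_iff by simp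
    have "exact_seq R A' f' B' g' C'"
      using c unfolding compose_eq_compose_iff by (intro exact_seq_iso[OF e mU[OF U(1)] mU[OF U(2)] mU[OF U(3)] h i]) auto
    then show "(A', f', B', g', C') \<in> ?E" unfolding short_exact_in_iff using U by simp
  qed
  have cm: "admissible_mono ?E A (compose (carrier A) f' f) B'"
    if m: "admissible_mono ?E A f B" "admissible_mono ?E B f' B'" for A f B f' B'
  proof -
    obtain g C where 1: "exact_seq R A f B g C" "A \<in> ?U" "C \<in> ?U" using m(1) unfolding am by blast
    obtain g' C' where 2: "exact_seq R B f' B' g' C'" "B' \<in> ?U" "C' \<in> ?U" using m(2) unfolding am by blast
    obtain q and D :: "('a, 'u) module" where "exact_seq R A (compose (carrier A) f' f) B' q D" "D \<in> ?U"
      by (rule inflation_compose[OF 1(1) 2(1) 1(2) 2(2) 1(3) 2(3)]) (rule that)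
    then show ?thesis unfolding am using 1(2) 2(2) by blast
  qed
  have ce: "admissible_epi ?E B (compose (carrier B) g' g) C'"
    if m: "admissible_epi ?E B g C" "admissible_epi ?E C g' C'" for B g C g' C'
  proof -
    obtain f A where 1: "exact_seq R A f B g C" "A \<in> ?U" "B \<in> ?U" using m(1) unfolding ae by blast
    obtain f' A' where 2: "exact_seq R A' f' C g' C'" "A' \<in> ?U" "C' \<in> ?U" using m(2) unfolding ae by blast
    obtain k and K :: "('a, 'u) module" where "exact_seq R K k B (compose (carrier B) g' g) C'" "K \<in> ?U"
      by (rule deflation_compose[OF 1(1) 2(1) 1(2) 2(2) 1(3) 2(3)]) (rule that)
    then show ?thesis unfolding ae using 1(3) 2(3) by blast
  qed
  have po: "\<exists>f' B' h'. is_pushout_in R ?U A f B h A' f' B' h' \<and> admissible_mono ?E A' f' B'"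
    if A': "A' \<in> ?U" and h: "h \<in> mod_hom R A A'" and m: "admissible_mono ?E A f B" for A f B A' h
  proof -
    obtain g C where 1: "exact_seq R A f B g C" "A \<in> ?U" "B \<in> ?U" "C \<in> ?U" using m unfolding am by blast
    obtain f' and B' :: "('a, 'u) module" and h' g' where 2: "exact_seq R A' f' B' g' C" "h' \<in> mod_hom R B B'"
      "!!a. a \<in> carrier A ==> h' (f a) = f' (h a)" "!!b. b \<in> carrier B ==> g' (h' b) = g b"
      "\<forall>T :: ('a, 'u) module. module R T --> (\<forall>u\<in>mod_hom R B T. \<forall>v\<in>mod_hom R A' T.
        (\<forall>a\<in>carrier A. u (f a) = v (h a)) -->
        (\<exists>!w. w \<in> mod_hom R B' T \<and> (\<forall>b\<in>carrier B. w (h' b) = u b) \<and> (\<forall>a\<in>carrier A'. w (f' a) = v a)))"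
      "!!s. A \<in> Ul R \<mm> I s ==> B \<in> Ul R \<mm> I s ==> C \<in> Ul R \<mm> I s ==> A' \<in> Ul R \<mm> I s ==> B' \<in> Ul R \<mm> I s"
      by (rule pushout_exists[OF inf 1(1) mU[OF A'] h]) (rule that)
    have B': "B' \<in> ?U" by (rule 2(6)[OF 1(2-4) A'])
    have "is_pushout_in R ?U A f B h A' f' B' h'"
      unfolding is_pushout_in_def compose_eq_compose_iff
    proof (intro conjI ballI impI B' exact_seqD(4)[OF 2(1)] 2(2,3))
      fix T u v assume T: "T \<in> ?U" and u: "u \<in> mod_hom R B T" and v: "v \<in> mod_hom R A' T"
        and uv: "\<forall>x\<in>carrier A. u (f x) = v (h x)"
      show "\<exists>!w. w \<in> mod_hom R B' T \<and> compose (carrier B) w h' = u \<and> compose (carrier A') w f' = v"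
        unfolding compose_eq_iff[OF mod_homD(4)[OF u]] compose_eq_iff[OF mod_homD(4)[OF v]]
        using 2(5) mU[OF T] u v uv by blast
    qed
    moreover have "admissible_mono ?E A' f' B'" unfolding am using 2(1) A' B' 1(4) by blast
    ultimately show ?thesis by blast
  qed
  have pb: "\<exists>g' B' k'. is_pullback_in R ?U B g C k C' g' B' k' \<and> admissible_epi ?E B' g' C'"
    if C': "C' \<in> ?U" and k: "k \<in> mod_hom R C' C" and m: "admissible_epi ?E B g C" for B g C C' k
  proof -
    obtain f A where 1: "exact_seq R A f B g C" "A \<in> ?U" "B \<in> ?U" "C \<in> ?U" using m unfolding ae by blast
    obtain f' and B' :: "('a, 'u) module" and k' g' where 2: "exact_seq R A f' B' g' C'" "k' \<in> mod_hom R B' B"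
      "!!a. a \<in> carrier A ==> k' (f' a) = f a" "!!b. b \<in> carrier B' ==> g (k' b) = k (g' b)"
      "\<forall>T :: ('a, 'u) module. module R T --> (\<forall>u\<in>mod_hom R T B. \<forall>v\<in>mod_hom R T C'.
        (\<forall>t\<in>carrier T. g (u t) = k (v t)) -->
        (\<exists>!w. w \<in> mod_hom R T B' \<and> (\<forall>t\<in>carrier T. k' (w t) = u t) \<and> (\<forall>t\<in>carrier T. g' (w t) = v t)))"
      "!!s. A \<in> Ul R \<mm> I s ==> B \<in> Ul R \<mm> I s ==> C \<in> Ul R \<mm> I s ==> C' \<in> Ul R \<mm> I s ==> B' \<in> Ul R \<mm> I s"
      by (rule pullback_exists[OF inf 1(1) mU[OF C'] k]) (rule that)
    have B': "B' \<in> ?U" by (rule 2(6)[OF 1(2-4) C'])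
    have "is_pullback_in R ?U B g C k C' g' B' k'"
      unfolding is_pullback_in_def compose_eq_compose_iff
    proof (intro conjI ballI impI B' exact_seqD(5)[OF 2(1)] 2(2,4))
      fix T u v assume T: "T \<in> ?U" and u: "u \<in> mod_hom R T B" and v: "v \<in> mod_hom R T C'"
        and uv: "\<forall>x\<in>carrier T. g (u x) = k (v x)"
      show "\<exists>!w. w \<in> mod_hom R T B' \<and> compose (carrier T) k' w = u \<and> compose (carrier T) g' w = v"
        unfolding compose_eq_iff[OF mod_homD(4)[OF u]] compose_eq_iff[OF mod_homD(4)[OF v]]
        using 2(5) mU[OF T] u v uv by blast
    qed
    moreover have "admissible_epi ?E B' g' C'" unfolding ae using 2(1) C' B' 1(2) by blast
    ultimately show ?thesis by blast
  qed
  show ?thesis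
    unfolding exact_category_def
  proof (intro conjI)
    show "additive_subcategory R ?U" by (rule additive)
    show "\<forall>A\<in>?U. admissible_mono ?E A (mod_id A) A" using id1 by blast
    show "\<forall>A\<in>?U. admissible_epi ?E A (mod_id A) A" using id2 by blast
    show "\<forall>A f B f' B'. admissible_mono ?E A f B \<and> admissible_mono ?E B f' B' -->
        admissible_mono ?E A (compose (carrier A) f' f) B'" using cm by blast
    show "\<forall>B g C g' C'. admissible_epi ?E B g C \<and> admissible_epi ?E C g' C' -->
        admissible_epi ?E B (compose (carrier B) g' g) C'" using ce by blast
    show "\<forall>A f B. \<forall>A'\<in>?U. \<forall>h\<in>mod_hom R A A'. admissible_mono ?E A f B -->
        (\<exists>f' B' h'. is_pushout_in R ?U A f B h A' f' B' h' \<and> admissible_mono ?E A' f' B')"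
      by (intro allI ballI impI po)
    show "\<forall>B g C. \<forall>C'\<in>?U. \<forall>k\<in>mod_hom R C' C. admissible_epi ?E B g C -->
        (\<exists>g' B' k'. is_pullback_in R ?U B g C k C' g' B' k' \<and> admissible_epi ?E B' g' C')"
      by (intro allI ballI impI pb)
  qed (rule kc, rule iso)
qed

lemma Ul_exact_subcategory:
  assumes inf: "infinite (UNIV :: 'u set)"
  shows "exact_subcategory R (Mod_cat R) (Ul R \<mm> I s :: ('a, 'u) module set) (short_exact_in R (Ul R \<mm> I s))"
    "exact_subcategory R (mod_cat R) (Ul R \<mm> I s :: ('a, 'u) module set) (short_exact_in R (Ul R \<mm> I s))"
proof -
  have "N \<in> Ul R \<mm> I s" if "M \<in> Ul R \<mm> I s" "module R N" "mod_iso R M N \<noteq> {}" for M N :: "('a, 'u) module"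
    using Ul_iso that by blast
  then show "exact_subcategory R (Mod_cat R) (Ul R \<mm> I s :: ('a, 'u) module set) (short_exact_in R (Ul R \<mm> I s))"
    "exact_subcategory R (mod_cat R) (Ul R \<mm> I s :: ('a, 'u) module set) (short_exact_in R (Ul R \<mm> I s))"
    unfolding exact_subcategory_def Mod_cat_def mod_cat_def
    using Ul_exact_category[OF inf, of s] UlD(3,4) by blast+
qed

end

section \<open>Yoneda extensions\<close>

primrec lincomb :: "('a, 'b) module => ('x => 'b) => ('a \<times> 'x) list => 'b" where
  "lincomb Y \<sigma> [] = \<zero>\<^bsub>Y\<^esub>"
| "lincomb Y \<sigma> (p # ps) = fst p \<odot>\<^bsub>Y\<^esub> \<sigma> (snd p) \<oplus>\<^bsub>Y\<^esub> lincomb Y \<sigma> ps"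

text \<open>Lists serve as formal linear combinations, which \<open>lincomb\<close> evaluates along
  any map \<sigma>. For a section \<sigma> of Y \<rightarrow> M the value on a relation measures how
  far \<sigma> is from being linear.\<close>

definition rels :: "('a, 'r) ring_scheme => ('a, 'b) module => ('a \<times> 'b) list set" where
  "rels R M = {ps. set ps \<subseteq> carrier R \<times> carrier M \<and> lincomb M (\<lambda>m. m) ps = \<zero>\<^bsub>M\<^esub>}"

text \<open>
  The extensions admitting a set-theoretic section \<open>\<sigma>\<close> of \<open>g\<close> which maps each linear relation
  \<open>\<Sum> r\<^sub>i m\<^sub>i = 0\<close> of \<open>M\<close> to \<open>\<Sum> r\<^sub>i \<sigma> m\<^sub>i = f (c ps)\<close>. This is a factor set with linear relations in
  place of the pairs \<open>(m, m')\<close> and \<open>(r, m)\<close>; the class depends on the values of \<open>c\<close> on \<open>rels R M\<close> only.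
\<close>

definition ext_class :: "('a, 'r) ring_scheme => ('a, 'u) module => ('a, 'u) module =>
    (('a \<times> 'u) list => 'u) => ('a, 'u) extension set" where
  "ext_class R M N c = {(Y, f, g). exact_seq R N f Y g M \<and>
     (\<exists>\<sigma>. (\<forall>m\<in>carrier M. \<sigma> m \<in> carrier Y \<and> g (\<sigma> m) = m) \<and>
       (\<forall>ps\<in>rels R M. c ps \<in> carrier N \<and> f (c ps) = lincomb Y \<sigma> ps))}"

lemma extensions_iff: "(Y, f, g) \<in> extensions R M N \<longleftrightarrow> exact_seq R N f Y g M"
  by (simp add: extensions_def short_exact_iff)

lemma lincomb_cong: "(!!p. p \<in> set ps ==> \<sigma> (snd p) = \<tau> (snd p)) ==> lincomb Y \<sigma> ps = lincomb Y \<tau> ps"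
  by (induction ps) auto

lemma lincomb_map: "lincomb Y \<sigma> (map (map_prod id k) ps) = lincomb Y (\<lambda>x. \<sigma> (k x)) ps"
  by (induction ps) auto

lemma (in rmodule) lincomb_closed:
  assumes "set ps \<subseteq> carrier R \<times> S" "!!x. x \<in> S ==> \<sigma> x \<in> carrier M"
  shows "lincomb M \<sigma> ps \<in> carrier M"
  using assms(1) by (induction ps) (auto simp: assms(2))

lemma lincomb_hom:
  fixes Y :: "('a, 'b) module" and Y' :: "('a, 'c) module"
  assumes Y: "module R Y" and Y': "module R Y'" and \<phi>: "\<phi> \<in> mod_hom R Y Y'"
    and ps: "set ps \<subseteq> carrier R \<times> S" and \<sigma>: "!!x. x \<in> S ==> \<sigma> x \<in> carrier Y"
  shows "\<phi> (lincomb Y \<sigma> ps) = lincomb Y' (\<lambda>x. \<phi> (\<sigma> x)) ps"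
proof -
  interpret Y: rmodule R Y by (rule rmodule.intro) (rule Y)
  show ?thesis
    using ps
  proof (induction ps)
    case Nil
    then show ?case using mod_hom_zero[OF Y Y' \<phi>] by simp
  next
    case (Cons p ps)
    have "lincomb Y \<sigma> ps \<in> carrier Y" using Cons.prems by (intro Y.lincomb_closed[of _ S] \<sigma>) auto
    moreover have "fst p \<in> carrier R" "\<sigma> (snd p) \<in> carrier Y" using Cons.prems \<sigma> by auto
    ultimately show ?case using Cons by (simp add: mod_homD(2,3)[OF \<phi>])
  qed
qed

lemma rels_map:
  assumes "module R M" "module R M'" "k \<in> mod_hom R M M'" "ps \<in> rels R M"
  shows "map (map_prod id k) ps \<in> rels R M'"
proof -
  have "set ps \<subseteq> carrier R \<times> carrier M" using assms(4) by (simp add: rels_def)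
  moreover from this have "k (lincomb M (\<lambda>m. m) ps) = lincomb M' k ps"
    by (intro lincomb_hom[OF assms(1-3)]) auto
  ultimately show ?thesis
    using assms(4) mod_hom_zero[OF assms(1-3)] mod_homD(1)[OF assms(3)]
    by (auto simp: rels_def lincomb_map)
qed

text \<open>Any choice of preimages under g is a section, and its values on the relations of M lie
  in the kernel of g.\<close>

lemma ext_class_exists:
  assumes e: "exact_seq R N f Y g M"
  obtains c where "(Y, f, g) \<in> ext_class R M N c"
proof -
  note x = exact_seqD[OF e]
  interpret Y: rmodule R Y by (rule rmodule.intro) (rule x(2))
  have "\<forall>m\<in>carrier M. \<exists>y. y \<in> carrier Y \<and> g y = m" using x(8) by (metis imageE)
  then obtain \<sigma> where \<sigma>: "!!m. m \<in> carrier M ==> \<sigma> m \<in> carrier Y" "!!m. m \<in> carrier M ==> g (\<sigma> m) = m"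
    using bchoice[of "carrier M" "\<lambda>m y. y \<in> carrier Y \<and> g y = m"] by blast
  define c where "c ps = inv_into (carrier N) f (lincomb Y \<sigma> ps)" for ps
  have "c ps \<in> carrier N \<and> f (c ps) = lincomb Y \<sigma> ps" if ps: "ps \<in> rels R M" for ps
  proof -
    have s: "set ps \<subseteq> carrier R \<times> carrier M" using ps by (simp add: rels_def)
    have "g (lincomb Y \<sigma> ps) = lincomb M (\<lambda>m. g (\<sigma> m)) ps" by (rule lincomb_hom[OF x(2,3,5) s \<sigma>(1)])
    also have "\<dots> = lincomb M (\<lambda>m. m) ps" using s \<sigma>(2) by (intro lincomb_cong) auto
    finally have "g (lincomb Y \<sigma> ps) = \<zero>\<^bsub>M\<^esub>" using ps by (simp add: rels_def)
    then have "lincomb Y \<sigma> ps \<in> f ` carrier N" unfolding x(7) using Y.lincomb_closed[OF s \<sigma>(1)] by simp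
    then show ?thesis unfolding c_def by (simp add: inv_into_into f_inv_into_f)
  qed
  then show ?thesis using that[of c] e \<sigma> unfolding ext_class_def by blast
qed

lemma (in rmodule) add_cancel_left2:
  assumes "a \<in> carrier M" "s \<in> carrier M" "u \<in> carrier M"
  shows "s \<oplus> ((a \<oplus> \<ominus> s) \<oplus> u) = a \<oplus> u"
proof -
  have "(a \<oplus> \<ominus> s) \<oplus> u = \<ominus> s \<oplus> (a \<oplus> u)" using assms by (simp add: M.a_ac)
  then show ?thesis using assms by (simp add: M.r_neg2)
qed

lemma (in rmodule) add_cancel_left3:
  assumes "a \<in> carrier M" "b \<in> carrier M" "s \<in> carrier M" "u \<in> carrier M" "v \<in> carrier M"
  shows "s \<oplus> ((a \<oplus> (b \<oplus> \<ominus> s)) \<oplus> (u \<oplus> v)) = (a \<oplus> u) \<oplus> (b \<oplus> v)"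
proof -
  have "(a \<oplus> (b \<oplus> \<ominus> s)) \<oplus> (u \<oplus> v) = \<ominus> s \<oplus> ((a \<oplus> u) \<oplus> (b \<oplus> v))"
    using assms by (simp add: M.a_ac)
  then show ?thesis using assms by (simp add: M.r_neg2)
qed

text \<open>Every y is uniquely \<sigma> (g y) + f n, and \<phi> sends it to \<tau> (k (g y)) + f'
  (h n). Linearity of \<phi> compares the values of the two factor sets on the relations that
  express sums and multiples in M, and these values correspond under h and k.\<close>

lemma ext_morphism:
  assumes E: "(Y, f, g) \<in> ext_class R M N c" and E': "(Y', f', g') \<in> ext_class R M' N' c'"
    and k: "k \<in> mod_hom R M M'" and h: "h \<in> mod_hom R N N'"
    and c: "!!ps. ps \<in> rels R M ==> h (c ps) = c' (map (map_prod id k) ps)"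
  obtains \<phi> where "\<phi> \<in> mod_hom R Y Y'" "!!n. n \<in> carrier N ==> \<phi> (f n) = f' (h n)"
    "!!y. y \<in> carrier Y ==> g' (\<phi> y) = k (g y)"
proof -
  obtain \<sigma> where e: "exact_seq R N f Y g M" and \<sigma>: "!!m. m \<in> carrier M ==> \<sigma> m \<in> carrier Y"
    "!!m. m \<in> carrier M ==> g (\<sigma> m) = m" and
    d: "!!ps. ps \<in> rels R M ==> c ps \<in> carrier N" "!!ps. ps \<in> rels R M ==> f (c ps) = lincomb Y \<sigma> ps"
    using E unfolding ext_class_def by blast
  obtain \<tau> where e': "exact_seq R N' f' Y' g' M'" and \<tau>: "!!m. m \<in> carrier M' ==> \<tau> m \<in> carrier Y'"
    "!!m. m \<in> carrier M' ==> g' (\<tau> m) = m" and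
    d': "!!ps. ps \<in> rels R M' ==> f' (c' ps) = lincomb Y' \<tau> ps"
    using E' unfolding ext_class_def by blast
  note x = exact_seqD[OF e] and x' = exact_seqD[OF e']
  interpret M: rmodule R M by (rule rmodule.intro) (rule x(3))
  interpret N: rmodule R N by (rule rmodule.intro) (rule x(1))
  interpret Y: rmodule R Y by (rule rmodule.intro) (rule x(2))
  interpret N': rmodule R N' by (rule rmodule.intro) (rule x'(1))
  interpret Y': rmodule R Y' by (rule rmodule.intro) (rule x'(2))
  interpret M': rmodule R M' by (rule rmodule.intro) (rule x'(3))
  note hf = mod_homD[OF x(4)] and hg = mod_homD[OF x(5)] and hf' = mod_homD[OF x'(4)] and hg' = mod_homD[OF x'(5)]
    and hk = mod_homD[OF k] and hh = mod_homD[OF h]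
  have fh: "f' (h (c ps)) = lincomb Y' (\<lambda>m. \<tau> (k m)) ps" if "ps \<in> rels R M" for ps
    using d'[OF rels_map[OF x(3) x'(3) k that]] c[OF that] by (simp add: lincomb_map)
  have gf: "g (f n) = \<zero>\<^bsub>M\<^esub>" if "n \<in> carrier N" for n using that x(7) by auto
  have gf': "g' (f' n) = \<zero>\<^bsub>M'\<^esub>" if "n \<in> carrier N'" for n using that x'(7) by auto
  have ex: "\<exists>n. n \<in> carrier N \<and> y = \<sigma> (g y) \<oplus>\<^bsub>Y\<^esub> f n" if y: "y \<in> carrier Y" for y
  proof -
    have gy: "g y \<in> carrier M" using y hg(1) by blast
    have "g (y \<ominus>\<^bsub>Y\<^esub> \<sigma> (g y)) = \<zero>\<^bsub>M\<^esub>"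
      using y gy \<sigma> by (simp add: mod_hom_minus[OF x(2,3,5)] M.minus_eq_zero_iff)
    then have "y \<ominus>\<^bsub>Y\<^esub> \<sigma> (g y) \<in> f ` carrier N" unfolding x(7) using y gy \<sigma> by simp
    then obtain n where "n \<in> carrier N" "y \<ominus>\<^bsub>Y\<^esub> \<sigma> (g y) = f n" by auto
    then show ?thesis using Y.add_minus_cancel[of "\<sigma> (g y)" y] y gy \<sigma>(1) by auto
  qed
  define \<nu> where "\<nu> y = (SOME n. n \<in> carrier N \<and> y = \<sigma> (g y) \<oplus>\<^bsub>Y\<^esub> f n)" for y
  have \<nu>: "\<nu> y \<in> carrier N" "y = \<sigma> (g y) \<oplus>\<^bsub>Y\<^esub> f (\<nu> y)" if "y \<in> carrier Y" for y
    using someI_ex[OF ex[OF that]] unfolding \<nu>_def by auto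
  define \<phi> where "\<phi> = (\<lambda>y\<in>carrier Y. \<tau> (k (g y)) \<oplus>\<^bsub>Y'\<^esub> f' (h (\<nu> y)))"
  have \<phi>: "\<phi> y = \<tau> (k m) \<oplus>\<^bsub>Y'\<^esub> f' (h n)"
    if y: "y \<in> carrier Y" and n: "n \<in> carrier N" and m: "g y = m" and eq: "y = \<sigma> m \<oplus>\<^bsub>Y\<^esub> f n" for y n m
  proof -
    have "\<sigma> m \<oplus>\<^bsub>Y\<^esub> f n = \<sigma> m \<oplus>\<^bsub>Y\<^esub> f (\<nu> y)" using eq m \<nu>(2)[OF y] by metis
    then have "f n = f (\<nu> y)" using hf(1)[OF n] hf(1)[OF \<nu>(1)[OF y]] \<sigma>(1)[OF hg(1)[OF y]] m by simp
    then have "n = \<nu> y" using inj_onD[OF x(6)] n \<nu>(1)[OF y] by blast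
    then show ?thesis using y m by (simp add: \<phi>_def)
  qed
  have \<phi>h: "\<phi> \<in> mod_hom R Y Y'"
  proof (rule mod_homI)
    show "\<phi> \<in> extensional (carrier Y)" by (simp add: \<phi>_def)
    show "\<phi> y \<in> carrier Y'" if "y \<in> carrier Y" for y
      using that \<tau>(1) hk(1) hg(1) hf'(1) hh(1) \<nu>(1) by (simp add: \<phi>_def)
  next
    fix y z assume yz: "y \<in> carrier Y" "z \<in> carrier Y"
    \<comment> \<open>The relation m + m' - (m + m') = 0 for m = g y and m' = g z. Its value under c
      is the defect of additivity of \<sigma> at these elements.\<close>
    define ps where "ps = [(\<one>\<^bsub>R\<^esub>, g y), (\<one>\<^bsub>R\<^esub>, g z), (\<ominus>\<^bsub>R\<^esub> \<one>\<^bsub>R\<^esub>, g y \<oplus>\<^bsub>M\<^esub> g z)]"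
    have m: "g y \<in> carrier M" "g z \<in> carrier M" "g y \<oplus>\<^bsub>M\<^esub> g z \<in> carrier M" using yz hg(1) by auto
    have ps: "ps \<in> rels R M"
      using m by (simp add: rels_def ps_def M.smult_l_minus M.M.a_assoc[symmetric] M.M.r_neg)
    define n where "n = c ps \<oplus>\<^bsub>N\<^esub> (\<nu> y \<oplus>\<^bsub>N\<^esub> \<nu> z)"
    have nn: "\<nu> y \<in> carrier N" "\<nu> z \<in> carrier N" "c ps \<in> carrier N" using \<nu>(1) yz d(1)[OF ps] by auto
    have fc: "f (c ps) = \<sigma> (g y) \<oplus>\<^bsub>Y\<^esub> (\<sigma> (g z) \<oplus>\<^bsub>Y\<^esub> \<ominus>\<^bsub>Y\<^esub> \<sigma> (g y \<oplus>\<^bsub>M\<^esub> g z))"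
      unfolding d(2)[OF ps] using m \<sigma>(1) by (simp add: ps_def Y.smult_l_minus)
    have km: "k (g y) \<in> carrier M'" "k (g z) \<in> carrier M'" "k (g y \<oplus>\<^bsub>M\<^esub> g z) \<in> carrier M'" using m hk(1) by auto
    have fc': "f' (h (c ps)) = \<tau> (k (g y)) \<oplus>\<^bsub>Y'\<^esub> (\<tau> (k (g z)) \<oplus>\<^bsub>Y'\<^esub> \<ominus>\<^bsub>Y'\<^esub> \<tau> (k (g y \<oplus>\<^bsub>M\<^esub> g z)))"
      unfolding fh[OF ps] using km \<tau>(1) by (simp add: ps_def Y'.smult_l_minus)
    have "y \<oplus>\<^bsub>Y\<^esub> z = (\<sigma> (g y) \<oplus>\<^bsub>Y\<^esub> f (\<nu> y)) \<oplus>\<^bsub>Y\<^esub> (\<sigma> (g z) \<oplus>\<^bsub>Y\<^esub> f (\<nu> z))"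
      using \<nu>(2)[OF yz(1)] \<nu>(2)[OF yz(2)] by simp
    also have "\<dots> = \<sigma> (g y \<oplus>\<^bsub>M\<^esub> g z) \<oplus>\<^bsub>Y\<^esub> f n"
      using Y.add_cancel_left3[of "\<sigma> (g y)" "\<sigma> (g z)" "\<sigma> (g y \<oplus>\<^bsub>M\<^esub> g z)" "f (\<nu> y)" "f (\<nu> z)"] m \<sigma>(1) nn hf(1)
      by (simp add: n_def hf(2) fc)
    finally have eq: "y \<oplus>\<^bsub>Y\<^esub> z = \<sigma> (g y \<oplus>\<^bsub>M\<^esub> g z) \<oplus>\<^bsub>Y\<^esub> f n" .
    have "\<phi> (y \<oplus>\<^bsub>Y\<^esub> z) = \<tau> (k (g y \<oplus>\<^bsub>M\<^esub> g z)) \<oplus>\<^bsub>Y'\<^esub> f' (h n)"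
      by (rule \<phi>[OF _ _ _ eq]) (use yz nn in \<open>simp_all add: hg(2) n_def\<close>)
    also have "\<dots> = (\<tau> (k (g y)) \<oplus>\<^bsub>Y'\<^esub> f' (h (\<nu> y))) \<oplus>\<^bsub>Y'\<^esub> (\<tau> (k (g z)) \<oplus>\<^bsub>Y'\<^esub> f' (h (\<nu> z)))"
      using Y'.add_cancel_left3[of "\<tau> (k (g y))" "\<tau> (k (g z))" "\<tau> (k (g y \<oplus>\<^bsub>M\<^esub> g z))" "f' (h (\<nu> y))" "f' (h (\<nu> z))"]
        km \<tau>(1) nn hh(1) hf'(1) by (simp add: n_def hf'(2) hh(2) fc')
    finally show "\<phi> (y \<oplus>\<^bsub>Y\<^esub> z) = \<phi> y \<oplus>\<^bsub>Y'\<^esub> \<phi> z" using yz by (simp add: \<phi>_def)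
  next
    fix r y assume ry: "r \<in> carrier R" "y \<in> carrier Y"
    define ps where "ps = [(r, g y), (\<ominus>\<^bsub>R\<^esub> \<one>\<^bsub>R\<^esub>, r \<odot>\<^bsub>M\<^esub> g y)]"
    have m: "g y \<in> carrier M" "r \<odot>\<^bsub>M\<^esub> g y \<in> carrier M" using ry hg(1) by auto
    have ps: "ps \<in> rels R M" using m ry by (simp add: rels_def ps_def M.smult_l_minus M.M.r_neg)
    define n where "n = c ps \<oplus>\<^bsub>N\<^esub> r \<odot>\<^bsub>N\<^esub> \<nu> y"
    have nn: "\<nu> y \<in> carrier N" "c ps \<in> carrier N" using \<nu>(1) ry d(1)[OF ps] by auto
    have fc: "f (c ps) = r \<odot>\<^bsub>Y\<^esub> \<sigma> (g y) \<oplus>\<^bsub>Y\<^esub> \<ominus>\<^bsub>Y\<^esub> \<sigma> (r \<odot>\<^bsub>M\<^esub> g y)"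
      unfolding d(2)[OF ps] using m \<sigma>(1) by (simp add: ps_def Y.smult_l_minus)
    have km: "k (g y) \<in> carrier M'" "k (r \<odot>\<^bsub>M\<^esub> g y) \<in> carrier M'" using m hk(1) by auto
    have fc': "f' (h (c ps)) = r \<odot>\<^bsub>Y'\<^esub> \<tau> (k (g y)) \<oplus>\<^bsub>Y'\<^esub> \<ominus>\<^bsub>Y'\<^esub> \<tau> (k (r \<odot>\<^bsub>M\<^esub> g y))"
      unfolding fh[OF ps] using km \<tau>(1) by (simp add: ps_def Y'.smult_l_minus)
    have "r \<odot>\<^bsub>Y\<^esub> y = r \<odot>\<^bsub>Y\<^esub> (\<sigma> (g y) \<oplus>\<^bsub>Y\<^esub> f (\<nu> y))" using \<nu>(2)[OF ry(2)] by simp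
    also have "\<dots> = \<sigma> (r \<odot>\<^bsub>M\<^esub> g y) \<oplus>\<^bsub>Y\<^esub> f n"
      using Y.add_cancel_left2[of "r \<odot>\<^bsub>Y\<^esub> \<sigma> (g y)" "\<sigma> (r \<odot>\<^bsub>M\<^esub> g y)" "r \<odot>\<^bsub>Y\<^esub> f (\<nu> y)"] ry m \<sigma>(1) nn hf(1)
      by (simp add: n_def hf(2,3) fc Y.smult_r_distr)
    finally have eq: "r \<odot>\<^bsub>Y\<^esub> y = \<sigma> (r \<odot>\<^bsub>M\<^esub> g y) \<oplus>\<^bsub>Y\<^esub> f n" .
    have "\<phi> (r \<odot>\<^bsub>Y\<^esub> y) = \<tau> (k (r \<odot>\<^bsub>M\<^esub> g y)) \<oplus>\<^bsub>Y'\<^esub> f' (h n)"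
      by (rule \<phi>[OF _ _ _ eq]) (use ry nn in \<open>simp_all add: hg(3) n_def\<close>)
    also have "\<dots> = r \<odot>\<^bsub>Y'\<^esub> (\<tau> (k (g y)) \<oplus>\<^bsub>Y'\<^esub> f' (h (\<nu> y)))"
      using Y'.add_cancel_left2[of "r \<odot>\<^bsub>Y'\<^esub> \<tau> (k (g y))" "\<tau> (k (r \<odot>\<^bsub>M\<^esub> g y))" "r \<odot>\<^bsub>Y'\<^esub> f' (h (\<nu> y))"]
        ry km \<tau>(1) nn hh(1) hf'(1) by (simp add: n_def hf'(2,3) hh(2,3) fc' Y'.smult_r_distr)
    finally show "\<phi> (r \<odot>\<^bsub>Y\<^esub> y) = r \<odot>\<^bsub>Y'\<^esub> \<phi> y" using ry by (simp add: \<phi>_def)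
  qed
  show ?thesis
  proof (rule that[OF \<phi>h])
    fix n assume n: "n \<in> carrier N"
    \<comment> \<open>A section need not send 0 to 0; the value of c on the relation 1 0 = 0 is the
      correction.\<close>
    define ps where "ps = [(\<one>\<^bsub>R\<^esub>, \<zero>\<^bsub>M\<^esub>)]"
    have ps: "ps \<in> rels R M" by (simp add: rels_def ps_def)
    have c0: "c ps \<in> carrier N" "f (c ps) = \<sigma> \<zero>\<^bsub>M\<^esub>" using d[OF ps] \<sigma>(1) by (simp_all add: ps_def)
    have "f' (h (c ps)) = \<tau> (k \<zero>\<^bsub>M\<^esub>)" unfolding fh[OF ps] using \<tau>(1) hk(1) by (simp add: ps_def)
    moreover have "\<phi> (f n) = \<tau> (k \<zero>\<^bsub>M\<^esub>) \<oplus>\<^bsub>Y'\<^esub> f' (h (\<ominus>\<^bsub>N\<^esub> c ps \<oplus>\<^bsub>N\<^esub> n))"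
      by (rule \<phi>) (use n c0(1) hf(1) \<sigma>(1) in
        \<open>simp_all add: gf hf(2) mod_hom_neg[OF x(1,2,4)] c0(2) Y.M.r_neg2\<close>)
    ultimately show "\<phi> (f n) = f' (h n)"
      using n c0(1) hf'(1) hh(1) \<tau>(1)[OF hk(1)[OF M.M.zero_closed]]
      by (simp add: hh(2) hf'(2) mod_hom_neg[OF x(1) x'(1) h] mod_hom_neg[OF x'(1,2,4)] Y'.M.r_neg2)
  next
    fix y assume y: "y \<in> carrier Y"
    then show "g' (\<phi> y) = k (g y)"
      using \<tau> hk(1) hg(1) hf'(1) hh(1) \<nu>(1) by (simp add: \<phi>_def hg'(2) gf')
  qed
qed

section \<open>Effect of the operations on factor sets\<close>

lemma ext_class_push:
  assumes E: "(Y, f, g) \<in> ext_class R M N c" and e': "exact_seq R N' f' Y' g' M" and h: "h \<in> mod_hom R N N'"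
    and \<phi>: "\<phi> \<in> mod_hom R Y Y'" "!!n. n \<in> carrier N ==> \<phi> (f n) = f' (h n)" "!!y. y \<in> carrier Y ==> g' (\<phi> y) = g y"
  shows "(Y', f', g') \<in> ext_class R M N' (\<lambda>ps. h (c ps))"
proof -
  obtain \<sigma> where e: "exact_seq R N f Y g M" and \<sigma>: "!!m. m \<in> carrier M ==> \<sigma> m \<in> carrier Y"
    "!!m. m \<in> carrier M ==> g (\<sigma> m) = m" and
    d: "!!ps. ps \<in> rels R M ==> c ps \<in> carrier N" "!!ps. ps \<in> rels R M ==> f (c ps) = lincomb Y \<sigma> ps"
    using E unfolding ext_class_def by blast
  \<comment> \<open>\<phi> carries the section \<sigma> of g to a section of g'.\<close>
  have "f' (h (c ps)) = lincomb Y' (\<lambda>m. \<phi> (\<sigma> m)) ps" if ps: "ps \<in> rels R M" for ps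
  proof -
    have "\<phi> (lincomb Y \<sigma> ps) = lincomb Y' (\<lambda>m. \<phi> (\<sigma> m)) ps"
      by (rule lincomb_hom[OF exact_seqD(2)[OF e] exact_seqD(2)[OF e'] \<phi>(1), of ps "carrier M"])
        (use ps \<sigma>(1) in \<open>auto simp: rels_def\<close>)
    then show ?thesis using d(2)[OF ps] \<phi>(2)[OF d(1)[OF ps]] by metis
  qed
  then show ?thesis
    using e' \<sigma> d(1) mod_homD(1)[OF h] mod_homD(1)[OF \<phi>(1)] \<phi>(3)
    unfolding ext_class_def by (auto intro!: exI[of _ "\<lambda>m. \<phi> (\<sigma> m)"])
qed

text \<open>The section \<tau> of g' is chosen over \<sigma>, that is, with \<phi> (\<tau> m) =
  \<sigma> (k m): any preimage of m under g' can be corrected by an element of f' N. The two factor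
  sets then correspond exactly.\<close>

lemma ext_class_pull:
  assumes E: "(Y, f, g) \<in> ext_class R M N c" and e': "exact_seq R N f' Y' g' M'" and k: "k \<in> mod_hom R M' M"
    and \<phi>: "\<phi> \<in> mod_hom R Y' Y" "!!n. n \<in> carrier N ==> \<phi> (f' n) = f n" "!!y. y \<in> carrier Y' ==> g (\<phi> y) = k (g' y)"
  shows "(Y', f', g') \<in> ext_class R M' N (\<lambda>ps. c (map (map_prod id k) ps))"
proof -
  obtain \<sigma> where e: "exact_seq R N f Y g M" and \<sigma>: "!!m. m \<in> carrier M ==> \<sigma> m \<in> carrier Y"
    "!!m. m \<in> carrier M ==> g (\<sigma> m) = m" and
    d: "!!ps. ps \<in> rels R M ==> c ps \<in> carrier N" "!!ps. ps \<in> rels R M ==> f (c ps) = lincomb Y \<sigma> ps"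
    using E unfolding ext_class_def by blast
  note x = exact_seqD[OF e] and x' = exact_seqD[OF e']
  interpret Y: rmodule R Y by (rule rmodule.intro) (rule x(2))
  interpret Y': rmodule R Y' by (rule rmodule.intro) (rule x'(2))
  interpret M: rmodule R M by (rule rmodule.intro) (rule x(3))
  interpret M': rmodule R M' by (rule rmodule.intro) (rule x'(3))
  note hk = mod_homD[OF k] and hf' = mod_homD[OF x'(4)] and h\<phi> = mod_homD[OF \<phi>(1)]
  have "\<exists>y. y \<in> carrier Y' \<and> g' y = m \<and> \<phi> y = \<sigma> (k m)" if m: "m \<in> carrier M'" for m
  proof -
    have "m \<in> g' ` carrier Y'" using m x'(8) by simp
    then obtain y where y: "y \<in> carrier Y'" "g' y = m" by auto
    have km: "k m \<in> carrier M" using hk(1)[OF m] .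
    have "g (\<sigma> (k m) \<ominus>\<^bsub>Y\<^esub> \<phi> y) = \<zero>\<^bsub>M\<^esub>"
      using y km \<sigma> \<phi>(3) h\<phi>(1) by (simp add: mod_hom_minus[OF x(2,3,5)] M.minus_eq_zero_iff)
    then have "\<sigma> (k m) \<ominus>\<^bsub>Y\<^esub> \<phi> y \<in> f ` carrier N" unfolding x(7) using y km \<sigma> h\<phi>(1) by simp
    then obtain n where n: "n \<in> carrier N" "\<sigma> (k m) \<ominus>\<^bsub>Y\<^esub> \<phi> y = f n" by auto
    have "g' (f' n) = \<zero>\<^bsub>M'\<^esub>" using n(1) x'(7) by auto
    then have "g' (y \<oplus>\<^bsub>Y'\<^esub> f' n) = m" using y n(1) hf'(1) m by (simp add: mod_homD(2)[OF x'(5)])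
    moreover have "\<phi> (y \<oplus>\<^bsub>Y'\<^esub> f' n) = \<sigma> (k m)"
      using y n hf'(1) km \<sigma>(1) h\<phi>(1) Y.add_minus_cancel[of "\<phi> y" "\<sigma> (k m)"] by (simp add: h\<phi>(2) \<phi>(2))
    ultimately show ?thesis using y(1) hf'(1)[OF n(1)] by blast
  qed
  then obtain \<tau> where \<tau>: "!!m. m \<in> carrier M' ==> \<tau> m \<in> carrier Y'" "!!m. m \<in> carrier M' ==> g' (\<tau> m) = m"
    "!!m. m \<in> carrier M' ==> \<phi> (\<tau> m) = \<sigma> (k m)"
    using bchoice[of "carrier M'" "\<lambda>m y. y \<in> carrier Y' \<and> g' y = m \<and> \<phi> y = \<sigma> (k m)"] by blast
  have "c (map (map_prod id k) ps) \<in> carrier N \<and> f' (c (map (map_prod id k) ps)) = lincomb Y' \<tau> ps"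
    if ps: "ps \<in> rels R M'" for ps
  proof -
    let ?ps = "map (map_prod id k) ps"
    have kps: "?ps \<in> rels R M" by (rule rels_map[OF x'(3) x(3) k ps])
    have s: "set ps \<subseteq> carrier R \<times> carrier M'" using ps by (simp add: rels_def)
    have "g' (lincomb Y' \<tau> ps) = lincomb M' (\<lambda>m. g' (\<tau> m)) ps" by (rule lincomb_hom[OF x'(2,3,5) s \<tau>(1)])
    also have "\<dots> = lincomb M' (\<lambda>m. m) ps" using s \<tau>(2) by (intro lincomb_cong) auto
    finally have "g' (lincomb Y' \<tau> ps) = \<zero>\<^bsub>M'\<^esub>" using ps by (simp add: rels_def)
    then have "lincomb Y' \<tau> ps \<in> f' ` carrier N" unfolding x'(7) using Y'.lincomb_closed[OF s \<tau>(1)] by simp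
    then obtain n where n: "n \<in> carrier N" "lincomb Y' \<tau> ps = f' n" by auto
    have "\<phi> (lincomb Y' \<tau> ps) = lincomb Y (\<lambda>m. \<phi> (\<tau> m)) ps" by (rule lincomb_hom[OF x'(2) x(2) \<phi>(1) s \<tau>(1)])
    then have "f n = lincomb Y (\<lambda>m. \<phi> (\<tau> m)) ps" using n \<phi>(2) by simp
    also have "\<dots> = lincomb Y \<sigma> ?ps" unfolding lincomb_map using s \<tau>(3) by (intro lincomb_cong) auto
    also have "\<dots> = f (c ?ps)" using d(2)[OF kps] by simp
    finally have "n = c ?ps" using inj_onD[OF x(6)] n(1) d(1)[OF kps] by blast
    then show ?thesis using n by simp
  qed
  then show ?thesis using e' \<tau>(1,2) unfolding ext_class_def by blast
qed


lemma ext_class_cong: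
  assumes "!!ps. ps \<in> rels R M ==> c ps = c' ps"
  shows "ext_class R M N c = ext_class R M N c'"
  using assms unfolding ext_class_def by simp

lemma ext_classD:
  assumes "(Y, f, g) \<in> ext_class R M N c"
  shows "exact_seq R N f Y g M" "ps \<in> rels R M ==> c ps \<in> carrier N"
  using assms unfolding ext_class_def by auto

lemma map_mod_id: "ps \<in> rels R M ==> map (map_prod id (mod_id M)) ps = ps"
  by (rule map_idI) (auto simp: rels_def mod_id_def)

text \<open>An equivalence preserves the factor set by \<open>ext_class_push\<close> along
  identities, and \<open>ext_morphism\<close> along identities gives the converse. So the Yoneda
  classes are exactly the nonempty sets \<open>ext_class R M N c\<close>.\<close>

lemma yoneda_equiv_iff:
  assumes E: "(Y, f, g) \<in> ext_class R M N c"
  shows "((Y, f, g), (Y', f', g')) \<in> yoneda_equiv R M N \<longleftrightarrow> (Y', f', g') \<in> ext_class R M N c"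
proof
  note x = exact_seqD[OF ext_classD(1)[OF E]] and c = ext_classD(2)[OF E]
  assume "((Y, f, g), (Y', f', g')) \<in> yoneda_equiv R M N"
  then obtain \<phi> where e': "exact_seq R N f' Y' g' M" and \<phi>: "\<phi> \<in> mod_hom R Y Y'"
    "compose (carrier N) \<phi> f = f'" "compose (carrier Y) g' \<phi> = g"
    unfolding yoneda_equiv_def extensions_iff by auto
  have "(Y', f', g') \<in> ext_class R M N (\<lambda>ps. mod_id N (c ps))"
    by (rule ext_class_push[OF E e' mod_id_hom[OF x(1)] \<phi>(1)])
      (simp_all add: compose_def mod_id_def flip: \<phi>(2,3))
  moreover have "ext_class R M N (\<lambda>ps. mod_id N (c ps)) = ext_class R M N c"
    by (rule ext_class_cong) (simp add: mod_id_def c)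
  ultimately show "(Y', f', g') \<in> ext_class R M N c" by simp
next
  note x = exact_seqD[OF ext_classD(1)[OF E]] and c = ext_classD(2)[OF E]
  assume E': "(Y', f', g') \<in> ext_class R M N c"
  note x' = exact_seqD[OF ext_classD(1)[OF E']]
  have "mod_id N (c ps) = c (map (map_prod id (mod_id M)) ps)" if "ps \<in> rels R M" for ps
    using c[OF that] unfolding map_mod_id[OF that] by (simp add: mod_id_def)
  then obtain \<phi> where \<phi>: "\<phi> \<in> mod_hom R Y Y'" "!!n. n \<in> carrier N ==> \<phi> (f n) = f' (mod_id N n)"
    "!!y. y \<in> carrier Y ==> g' (\<phi> y) = mod_id M (g y)"
    using ext_morphism[OF E E' mod_id_hom[OF x(3)] mod_id_hom[OF x(1)]] by blast
  have "compose (carrier N) \<phi> f = f'" "compose (carrier Y) g' \<phi> = g"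
    unfolding compose_eq_iff[OF mod_homD(4)[OF x'(4)]] compose_eq_iff[OF mod_homD(4)[OF x(5)]]
    using \<phi>(2,3) mod_homD(1)[OF x(5)] by (simp_all add: mod_id_def)
  then show "((Y, f, g), (Y', f', g')) \<in> yoneda_equiv R M N"
    unfolding yoneda_equiv_def extensions_iff using \<phi>(1) ext_classD(1)[OF E] ext_classD(1)[OF E'] by auto
qed

lemma yoneda_class:
  assumes "E \<in> ext_class R M N c"
  shows "yoneda_equiv R M N `` {E} = ext_class R M N c"
proof -
  obtain Y f g where E: "E = (Y, f, g)" by (cases E)
  show ?thesis using yoneda_equiv_iff[of Y f g R M N c] assms unfolding E by auto
qed

lemma Ext1_carrier: "e \<in> carrier (Ext1 R M N) \<longleftrightarrow> e \<noteq> {} \<and> (\<exists>c. e = ext_class R M N c)"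
proof
  assume "e \<in> carrier (Ext1 R M N)"
  then obtain E where E: "E \<in> extensions R M N" "e = yoneda_equiv R M N `` {E}"
    by (auto simp: Ext1_def elim: quotientE)
  obtain Y f g where Y: "E = (Y, f, g)" by (cases E)
  obtain c where "E \<in> ext_class R M N c"
    using E(1) unfolding Y extensions_iff by (rule ext_class_exists)
  then show "e \<noteq> {} \<and> (\<exists>c. e = ext_class R M N c)" using yoneda_class E(2) by blast
next
  assume "e \<noteq> {} \<and> (\<exists>c. e = ext_class R M N c)"
  then obtain c Y f g where e: "e = ext_class R M N c" "(Y, f, g) \<in> e" by auto
  then have "(Y, f, g) \<in> extensions R M N" unfolding extensions_iff using ext_classD(1) by blast
  then show "e \<in> carrier (Ext1 R M N)"
    using e yoneda_class[of "(Y, f, g)" R M N c] quotientI[of "(Y, f, g)" "extensions R M N" "yoneda_equiv R M N"]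
    by (simp add: Ext1_def)
qed

lemma ext_class_eqI: "E \<in> ext_class R M N c ==> E \<in> ext_class R M N c' ==> ext_class R M N c = ext_class R M N c'"
  using yoneda_class by blast

text \<open>A morphism composes the factor set with h, and \<open>ext_morphism\<close> provides a
  morphism to every extension that has the composed factor set. That such an extension exists is
  shown apart, in \<open>push_exists\<close>.\<close>

lemma ext_push_class:
  assumes ne: "ext_class R M N c \<noteq> {}" and h: "h \<in> mod_hom R N N'"
  shows "ext_push R M N N' h (ext_class R M N c) = ext_class R M N' (\<lambda>ps. h (c ps))"
proof (intro equalityI subsetI)
  fix E assume "E \<in> ext_push R M N N' h (ext_class R M N c)"
  then obtain Y' f' g' Y f g \<phi> where E: "E = (Y', f', g')" "exact_seq R N' f' Y' g' M" "(Y, f, g) \<in> ext_class R M N c"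
    and \<phi>: "\<phi> \<in> mod_hom R Y Y'" "compose (carrier N) \<phi> f = compose (carrier N) f' h" "compose (carrier Y) g' \<phi> = g"
    unfolding ext_push_def by (auto simp: extensions_iff)
  have "\<phi> (f n) = f' (h n)" if "n \<in> carrier N" for n using \<phi>(2) that unfolding compose_eq_compose_iff by blast
  moreover have "g' (\<phi> y) = g y" if "y \<in> carrier Y" for y using \<phi>(3) that by (auto simp: compose_def)
  ultimately show "E \<in> ext_class R M N' (\<lambda>ps. h (c ps))"
    unfolding E(1) by (rule ext_class_push[OF E(3,2) h \<phi>(1)])
next
  fix E assume E: "E \<in> ext_class R M N' (\<lambda>ps. h (c ps))"
  obtain Y' f' g' where E': "E = (Y', f', g')" by (cases E)
  obtain Y f g where Y: "(Y, f, g) \<in> ext_class R M N c" using ne by auto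
  note x = exact_seqD[OF ext_classD(1)[OF Y]]
  have "h (c ps) = h (c (map (map_prod id (mod_id M)) ps))" if "ps \<in> rels R M" for ps
    using that by (simp add: map_mod_id)
  then obtain \<phi> where \<phi>: "\<phi> \<in> mod_hom R Y Y'" "!!n. n \<in> carrier N ==> \<phi> (f n) = f' (h n)"
    "!!y. y \<in> carrier Y ==> g' (\<phi> y) = mod_id M (g y)"
    using ext_morphism[OF Y E[unfolded E'] mod_id_hom[OF x(3)] h] by blast
  have "compose (carrier N) \<phi> f = compose (carrier N) f' h" "compose (carrier Y) g' \<phi> = g"
    unfolding compose_eq_compose_iff compose_eq_iff[OF mod_homD(4)[OF x(5)]]
    using \<phi>(2,3) mod_homD(1)[OF x(5)] by (simp_all add: mod_id_def)
  then show "E \<in> ext_push R M N N' h (ext_class R M N c)"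
    unfolding ext_push_def E' using Y \<phi>(1) ext_classD(1)[OF E[unfolded E']] by (auto simp: extensions_iff)
qed

lemma ext_pull_class:
  assumes ne: "ext_class R M N c \<noteq> {}" and k: "k \<in> mod_hom R M' M"
  shows "ext_pull R M' M N k (ext_class R M N c) = ext_class R M' N (\<lambda>ps. c (map (map_prod id k) ps))"
proof (intro equalityI subsetI)
  fix E assume "E \<in> ext_pull R M' M N k (ext_class R M N c)"
  then obtain Y' f' g' Y f g \<phi> where E: "E = (Y', f', g')" "exact_seq R N f' Y' g' M'" "(Y, f, g) \<in> ext_class R M N c"
    and \<phi>: "\<phi> \<in> mod_hom R Y' Y" "compose (carrier N) \<phi> f' = f" "compose (carrier Y') g \<phi> = compose (carrier Y') k g'"
    unfolding ext_pull_def by (auto simp: extensions_iff)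
  have "g (\<phi> y) = k (g' y)" if "y \<in> carrier Y'" for y using \<phi>(3) that unfolding compose_eq_compose_iff by blast
  moreover have "\<phi> (f' n) = f n" if "n \<in> carrier N" for n using \<phi>(2) that by (auto simp: compose_def)
  ultimately show "E \<in> ext_class R M' N (\<lambda>ps. c (map (map_prod id k) ps))"
    unfolding E(1) by (intro ext_class_pull[OF E(3,2) k \<phi>(1)])
next
  fix E assume E: "E \<in> ext_class R M' N (\<lambda>ps. c (map (map_prod id k) ps))"
  obtain Y' f' g' where E': "E = (Y', f', g')" by (cases E)
  obtain Y f g where Y: "(Y, f, g) \<in> ext_class R M N c" using ne by auto
  note x = exact_seqD[OF ext_classD(1)[OF Y]] and x' = exact_seqD[OF ext_classD(1)[OF E[unfolded E']]]
  have "mod_id N (c (map (map_prod id k) ps)) = c (map (map_prod id k) ps)" if "ps \<in> rels R M'" for ps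
    using ext_classD(2)[OF E[unfolded E'] that] by (simp add: mod_id_def)
  then obtain \<phi> where \<phi>: "\<phi> \<in> mod_hom R Y' Y" "!!n. n \<in> carrier N ==> \<phi> (f' n) = f (mod_id N n)"
    "!!y. y \<in> carrier Y' ==> g (\<phi> y) = k (g' y)"
    using ext_morphism[OF E[unfolded E'] Y k mod_id_hom[OF x(1)]] by blast
  have "compose (carrier N) \<phi> f' = f" "compose (carrier Y') g \<phi> = compose (carrier Y') k g'"
    unfolding compose_eq_compose_iff compose_eq_iff[OF mod_homD(4)[OF x(4)]]
    using \<phi>(2,3) by (simp_all add: mod_id_def)
  then show "E \<in> ext_pull R M' M N k (ext_class R M N c)"
    unfolding ext_pull_def E' using Y \<phi>(1) ext_classD(1)[OF E[unfolded E']] by (auto simp: extensions_iff)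
qed

text \<open>Linear combinations in the fibre product are formed componentwise, so the section m
  \<mapsto> \<phi> (\<sigma> m, \<tau> m) has the sum of the two factor sets.\<close>

lemma ext_class_baer:
  assumes E1: "(Y1, f1, g1) \<in> ext_class R M N c1" and E2: "(Y2, f2, g2) \<in> ext_class R M N c2"
    and e: "exact_seq R N f Y g M" and \<phi>: "\<phi> \<in> mod_hom R (fibre_product Y1 g1 Y2 g2) Y"
    and f: "!!n1 n2. n1 \<in> carrier N ==> n2 \<in> carrier N ==> \<phi> (f1 n1, f2 n2) = f (n1 \<oplus>\<^bsub>N\<^esub> n2)"
    and g: "!!y1 y2. (y1, y2) \<in> carrier (fibre_product Y1 g1 Y2 g2) ==> g (\<phi> (y1, y2)) = g1 y1"
  shows "(Y, f, g) \<in> ext_class R M N (\<lambda>ps. c1 ps \<oplus>\<^bsub>N\<^esub> c2 ps)"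
proof -
  obtain \<sigma> where e1: "exact_seq R N f1 Y1 g1 M" and \<sigma>: "!!m. m \<in> carrier M ==> \<sigma> m \<in> carrier Y1"
    "!!m. m \<in> carrier M ==> g1 (\<sigma> m) = m" and
    c1: "!!ps. ps \<in> rels R M ==> c1 ps \<in> carrier N" "!!ps. ps \<in> rels R M ==> f1 (c1 ps) = lincomb Y1 \<sigma> ps"
    using E1 unfolding ext_class_def by blast
  obtain \<tau> where e2: "exact_seq R N f2 Y2 g2 M" and \<tau>: "!!m. m \<in> carrier M ==> \<tau> m \<in> carrier Y2"
    "!!m. m \<in> carrier M ==> g2 (\<tau> m) = m" and
    c2: "!!ps. ps \<in> rels R M ==> c2 ps \<in> carrier N" "!!ps. ps \<in> rels R M ==> f2 (c2 ps) = lincomb Y2 \<tau> ps"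
    using E2 unfolding ext_class_def by blast
  note x = exact_seqD[OF e] and x1 = exact_seqD[OF e1] and x2 = exact_seqD[OF e2]
  interpret N: rmodule R N by (rule rmodule.intro) (rule x(1))
  let ?P = "fibre_product Y1 g1 Y2 g2"
  have P: "module R ?P" by (rule fibre_product_module(1)[OF x1(2) x2(2) x(3) x1(5) x2(5)])
  have pair: "(\<sigma> m, \<tau> m) \<in> carrier ?P" if "m \<in> carrier M" for m
    using that \<sigma> \<tau> by (simp add: fibre_product_def)
  have lc: "lincomb ?P (\<lambda>m. (\<sigma> m, \<tau> m)) ps = (lincomb Y1 \<sigma> ps, lincomb Y2 \<tau> ps)" for ps
    by (induction ps) (simp_all add: fibre_product_def)
  have "f (c1 ps \<oplus>\<^bsub>N\<^esub> c2 ps) = lincomb Y (\<lambda>m. \<phi> (\<sigma> m, \<tau> m)) ps" if ps: "ps \<in> rels R M" for ps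
  proof -
    have "f (c1 ps \<oplus>\<^bsub>N\<^esub> c2 ps) = \<phi> (lincomb ?P (\<lambda>m. (\<sigma> m, \<tau> m)) ps)"
      using f[OF c1(1)[OF ps] c2(1)[OF ps]] unfolding lc by (simp add: c1(2)[OF ps] c2(2)[OF ps])
    also have "\<dots> = lincomb Y (\<lambda>m. \<phi> (\<sigma> m, \<tau> m)) ps"
      by (rule lincomb_hom[OF P x(2) \<phi>, of ps "carrier M"]) (use ps pair in \<open>auto simp: rels_def\<close>)
    finally show ?thesis .
  qed
  moreover have "\<phi> (\<sigma> m, \<tau> m) \<in> carrier Y" "g (\<phi> (\<sigma> m, \<tau> m)) = m" if "m \<in> carrier M" for m
    using mod_homD(1)[OF \<phi> pair[OF that]] g[OF pair[OF that]] \<sigma>(2)[OF that] by simp_all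
  ultimately show ?thesis
    using e c1(1) c2(1) unfolding ext_class_def by (auto intro!: exI[of _ "\<lambda>m. \<phi> (\<sigma> m, \<tau> m)"])
qed

subsection \<open>Finite generation\<close>

text \<open>The argument for submodules of N^P, by induction on P: the i-th coordinates form a
  finitely generated submodule of N, and the elements with i-th coordinate 0 fall under the
  induction hypothesis. D is a relation and not a map because an extension class has many factor
  sets.\<close>

lemma fin_gen_by_coordinates:
  fixes E :: "('a, 'e) module" and N :: "('a, 'n) module" and D :: "'e => ('i => 'n) => bool"
  assumes E: "module R E" and N: "noetherian_module R N" and P: "finite P"
    and add: "!!e c e' c'. D e c ==> D e' c' ==> D (e \<oplus>\<^bsub>E\<^esub> e') (\<lambda>i. c i \<oplus>\<^bsub>N\<^esub> c' i)"
    and smult: "!!r e c. r \<in> carrier R ==> D e c ==> D (r \<odot>\<^bsub>E\<^esub> e) (\<lambda>i. r \<odot>\<^bsub>N\<^esub> c i)"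
    and cl: "!!e c. D e c ==> e \<in> carrier E" "!!e c i. D e c ==> i \<in> P ==> c i \<in> carrier N"
    and zero: "!!e c. D e c ==> (!!i. i \<in> P ==> c i = \<zero>\<^bsub>N\<^esub>) ==> e = \<zero>\<^bsub>E\<^esub>"
  shows "\<exists>S. finite S \<and> S \<subseteq> {e. \<exists>c. D e c} \<and> {e. \<exists>c. D e c} \<subseteq> mod_span R E S"
  using P add smult cl zero
proof (induction P arbitrary: D rule: finite_induct)
  case empty
  interpret E: rmodule R E by (rule rmodule.intro) (rule E)
  have "{e. \<exists>c. D e c} \<subseteq> {\<zero>\<^bsub>E\<^esub>}" using empty(5) by auto
  then show ?case using E.sm_zero[OF E.sm_span[of "{}"]] by (intro exI[of _ "{}"]) auto
next
  case (insert i P)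
  note D = insert.prems
  interpret E: rmodule R E by (rule rmodule.intro) (rule E)
  interpret N: noetherian_module R N by (rule N)
  show ?case
  proof (cases "\<exists>e c. D e c")
    case False
    then show ?thesis by (intro exI[of _ "{}"]) auto
  next
    case True
    then obtain e0 c0 where D0: "D e0 c0" by blast
    define L where "L W = {n. \<exists>e\<in>W. \<exists>c. D e c \<and> c i = n}" for W
    have LI: "n \<in> L W" if "e \<in> W" "D e c" "c i = n" for W e c n using that unfolding L_def by blast
    have L: "submodule (L W) R N" if W: "submodule W R E" for W
    proof (rule N.smI)
      show "L W \<subseteq> carrier N" using D(4) by (auto simp: L_def)
      have "D (\<zero>\<^bsub>R\<^esub> \<odot>\<^bsub>E\<^esub> e0) (\<lambda>i. \<zero>\<^bsub>R\<^esub> \<odot>\<^bsub>N\<^esub> c0 i)" by (rule D(2)[OF _ D0]) simp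
      then show "\<zero>\<^bsub>N\<^esub> \<in> L W"
        by (rule LI[rotated]) (use D(3)[OF D0] D(4)[OF D0, of i] E.sm_zero[OF W] in simp_all)
      show "x \<oplus>\<^bsub>N\<^esub> y \<in> L W" if xy: "x \<in> L W" "y \<in> L W" for x y
      proof -
        from xy obtain e c e' c' where *: "e \<in> W" "D e c" "c i = x" "e' \<in> W" "D e' c'" "c' i = y" by (auto simp: L_def)
        show ?thesis by (rule LI[OF E.sm_add[OF W *(1,4)] D(1)[OF *(2,5)]]) (simp add: *(3,6))
      qed
      show "r \<odot>\<^bsub>N\<^esub> x \<in> L W" if rx: "r \<in> carrier R" "x \<in> L W" for r x
      proof -
        from rx obtain e c where *: "e \<in> W" "D e c" "c i = x" by (auto simp: L_def)
        show ?thesis by (rule LI[OF E.sm_smult[OF W rx(1) *(1)] D(2)[OF rx(1) *(2)]]) (simp add: *(3))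
      qed
    qed
    obtain T where T: "finite T" "T \<subseteq> L (carrier E)" "mod_span R N T = L (carrier E)"
      using N.sm_fin_gen[OF L[OF E.sm_carrier]] by blast
    have "\<forall>n\<in>T. \<exists>e. \<exists>c. D e c \<and> c i = n" using T(2) by (auto simp: L_def)
    then obtain t where t: "!!n. n \<in> T ==> \<exists>c. D (t n) c \<and> c i = n" by metis
    define D' where "D' e c \<longleftrightarrow> D e c \<and> c i = \<zero>\<^bsub>N\<^esub>" for e c
    have "\<exists>S. finite S \<and> S \<subseteq> {e. \<exists>c. D' e c} \<and> {e. \<exists>c. D' e c} \<subseteq> mod_span R E S"
    proof (rule insert.IH)
      show "D' (e \<oplus>\<^bsub>E\<^esub> e') (\<lambda>i. c i \<oplus>\<^bsub>N\<^esub> c' i)" if "D' e c" "D' e' c'" for e c e' c'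
        using that D(1) by (simp add: D'_def)
      show "D' (r \<odot>\<^bsub>E\<^esub> e) (\<lambda>i. r \<odot>\<^bsub>N\<^esub> c i)" if "r \<in> carrier R" "D' e c" for r e c
        using that D(2) by (simp add: D'_def)
      show "e = \<zero>\<^bsub>E\<^esub>" if "D' e c" "!!j. j \<in> P ==> c j = \<zero>\<^bsub>N\<^esub>" for e c
        using that D(5)[of e c] unfolding D'_def by blast
    qed (use D(3,4) in \<open>auto simp: D'_def\<close>)
    then obtain S where S: "finite S" "S \<subseteq> {e. \<exists>c. D' e c}" "{e. \<exists>c. D' e c} \<subseteq> mod_span R E S" by blast
    define W where "W = mod_span R E (S \<union> t ` T)"
    have gens: "S \<union> t ` T \<subseteq> {e. \<exists>c. D e c}" using S(2) t by (auto simp: D'_def)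
    have W: "submodule W R E" unfolding W_def using gens D(3) by (intro E.sm_span) blast
    have incl: "S \<union> t ` T \<subseteq> W" unfolding W_def by (rule E.span_incl)
    have SW: "mod_span R E S \<subseteq> W" using incl by (intro E.span_least W) auto
    have "L (carrier E) \<subseteq> L W"
      unfolding T(3)[symmetric]
    proof (rule N.span_least[OF _ L[OF W]])
      show "T \<subseteq> L W" using t incl unfolding L_def by blast
    qed
    \<comment> \<open>Subtracting an e' \<in> W with the same i-th coordinate leaves an element with
      i-th coordinate 0.\<close>
    moreover have "e \<in> W" if De: "D e c" and cL: "c i \<in> L W" for e c
    proof -
      obtain e' c' where e': "e' \<in> W" "D e' c'" "c' i = c i" using cL by (auto simp: L_def)
      have c: "e \<in> carrier E" "e' \<in> carrier E" "c i \<in> carrier N" using D(3,4) De e'(2) by auto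
      have "D (e \<oplus>\<^bsub>E\<^esub> (\<ominus>\<^bsub>R\<^esub> \<one>\<^bsub>R\<^esub>) \<odot>\<^bsub>E\<^esub> e') (\<lambda>j. c j \<oplus>\<^bsub>N\<^esub> (\<ominus>\<^bsub>R\<^esub> \<one>\<^bsub>R\<^esub>) \<odot>\<^bsub>N\<^esub> c' j)"
        by (rule D(1)[OF De D(2)[OF _ e'(2)]]) simp
      moreover have "c i \<oplus>\<^bsub>N\<^esub> (\<ominus>\<^bsub>R\<^esub> \<one>\<^bsub>R\<^esub>) \<odot>\<^bsub>N\<^esub> c' i = \<zero>\<^bsub>N\<^esub>"
        using c(3) by (simp add: e'(3) N.smult_l_minus N.M.r_neg)
      ultimately have "e \<oplus>\<^bsub>E\<^esub> (\<ominus>\<^bsub>R\<^esub> \<one>\<^bsub>R\<^esub>) \<odot>\<^bsub>E\<^esub> e' \<in> {e. \<exists>c. D' e c}" unfolding D'_def by blast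
      then have "e \<oplus>\<^bsub>E\<^esub> (\<ominus>\<^bsub>R\<^esub> \<one>\<^bsub>R\<^esub>) \<odot>\<^bsub>E\<^esub> e' \<in> W" using S(3) SW by blast
      then show ?thesis
        using E.sm_add_iff2[OF W c(1), of "(\<ominus>\<^bsub>R\<^esub> \<one>\<^bsub>R\<^esub>) \<odot>\<^bsub>E\<^esub> e'"] E.sm_smult[OF W _ e'(1), of "\<ominus>\<^bsub>R\<^esub> \<one>\<^bsub>R\<^esub>"] by simp
    qed
    moreover have "c i \<in> L (carrier E)" if "D e c" for e c using that D(3) by (auto simp: L_def)
    ultimately have "{e. \<exists>c. D e c} \<subseteq> W" by blast
    then show ?thesis using gens S(1) T(1) unfolding W_def by (intro exI[of _ "S \<union> t ` T"]) auto
  qed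
qed

lemma (in rmodule) lincomb_sm:
  assumes "sm H" "set ps \<subseteq> carrier R \<times> S" "!!x. x \<in> S ==> \<sigma> x \<in> H"
  shows "lincomb M \<sigma> ps \<in> H"
  using assms(2) by (induction ps) (auto intro!: sm_add[OF assms(1)] sm_smult[OF assms(1)] sm_zero[OF assms(1)] assms(3))

lemma (in rmodule) span_lincomb:
  assumes "finite G" "G \<subseteq> carrier M" "x \<in> mod_span R M G"
  shows "\<exists>ps. set ps \<subseteq> carrier R \<times> G \<and> x = lincomb M (\<lambda>m. m) ps"
  using assms
proof (induction G arbitrary: x rule: finite_induct)
  case empty
  then have "x = \<zero>" using span_least[OF empty_subsetI sm_null] by auto
  then show ?case by (intro exI[of _ "[]"]) simp
next
  case (insert m G)
  then obtain r y where y: "r \<in> carrier R" "y \<in> mod_span R M G" "x = r \<odot> m \<oplus> y" using span_insert[of G m] by auto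
  obtain ps where "set ps \<subseteq> carrier R \<times> G" "y = lincomb M (\<lambda>m. m) ps" using insert y(2) by blast
  then show ?case using y by (intro exI[of _ "(r, m) # ps"]) auto
qed

text \<open>By induction on the generators, using that the ideal \<open>(\<langle>G\<rangle> : m)\<close> is finitely generated.\<close>

lemma finite_relations:
  fixes R :: "('a, 'r) ring_scheme" and M :: "('a, 'b) module"
  assumes M: "module R M" and R: "noetherian_ring R" and G: "finite G" "G \<subseteq> carrier M"
  shows "\<exists>P. finite P \<and> P \<subseteq> rels R M \<and> (\<forall>(Y :: ('a, 'c) module) g \<sigma>. module R Y --> g \<in> mod_hom R Y M -->
    (\<forall>m\<in>carrier M. \<sigma> m \<in> carrier Y \<and> g (\<sigma> m) = m) --> (\<forall>ps\<in>P. lincomb Y \<sigma> ps = \<zero>\<^bsub>Y\<^esub>) -->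
    (\<forall>y\<in>mod_span R Y (\<sigma> ` G). g y = \<zero>\<^bsub>M\<^esub> --> y = \<zero>\<^bsub>Y\<^esub>))"
  using G
proof (induction G rule: finite_induct)
  case empty
  have "y = \<zero>\<^bsub>Y\<^esub>" if Y: "module R Y" and y: "y \<in> mod_span R Y {}" for Y :: "('a, 'c) module" and y
  proof -
    interpret Y: rmodule R Y by (rule rmodule.intro) (rule Y)
    show ?thesis using Y.span_least[OF empty_subsetI Y.sm_null] y by auto
  qed
  then show ?case by (intro exI[of _ "{}"]) auto
next
  case (insert m G)
  interpret M: rmodule R M by (rule rmodule.intro) (rule M)
  interpret R: noetherian_ring R by (rule R)
  have m: "m \<in> carrier M" "G \<subseteq> carrier M" using insert by auto
  note sG = M.sm_span[OF m(2)]
  \<comment> \<open>The scalars that can occur with m in a relation over G. One relation for each of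
    finitely many generators of this ideal controls the coefficient of m in all of them.\<close>
  define J where "J = sub_ann R M (mod_span R M G) {m}"
  have "ideal J R" unfolding J_def by (rule M.sub_ann_ideal[OF sG]) (use m in simp)
  then obtain A where A: "A \<subseteq> carrier R" "finite A" "J = genideal R A" using R.finetely_gen by blast
  have AJ: "A \<subseteq> J" unfolding A(3) using M.R.genideal_self[OF A(1)] .
  have "\<exists>ps. set ps \<subseteq> carrier R \<times> G \<and> (a, m) # ps \<in> rels R M" if a: "a \<in> A" for a
  proof -
    have am: "a \<in> carrier R" "a \<odot>\<^bsub>M\<^esub> m \<in> mod_span R M G" using a AJ by (auto simp: J_def sub_ann_def)
    obtain ps where ps: "set ps \<subseteq> carrier R \<times> G" "\<ominus>\<^bsub>M\<^esub> (a \<odot>\<^bsub>M\<^esub> m) = lincomb M (\<lambda>m. m) ps"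
      using M.span_lincomb[OF insert.hyps(1) m(2) M.sm_neg[OF sG am(2)]] by blast
    then have "(a, m) # ps \<in> rels R M" using am m by (auto simp: rels_def M.M.r_neg simp flip: ps(2))
    then show ?thesis using ps(1) by blast
  qed
  then obtain \<omega> where \<omega>: "!!a. a \<in> A ==> set (\<omega> a) \<subseteq> carrier R \<times> G" "!!a. a \<in> A ==> (a, m) # \<omega> a \<in> rels R M"
    by metis
  obtain P where P: "finite P" "P \<subseteq> rels R M" and
    IH: "\<forall>(Y :: ('a, 'c) module) g \<sigma>. module R Y --> g \<in> mod_hom R Y M -->
      (\<forall>m\<in>carrier M. \<sigma> m \<in> carrier Y \<and> g (\<sigma> m) = m) --> (\<forall>ps\<in>P. lincomb Y \<sigma> ps = \<zero>\<^bsub>Y\<^esub>) -->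
      (\<forall>y\<in>mod_span R Y (\<sigma> ` G). g y = \<zero>\<^bsub>M\<^esub> --> y = \<zero>\<^bsub>Y\<^esub>)"
    using insert.IH[OF m(2)] by (elim exE conjE) (rule that)
  \<comment> \<open>If the selected relations hold for \<sigma>, then g is injective on the span of
    the \<sigma>-images. The coefficient r of \<sigma> m in an element of the kernel lies in J, so r
    \<sigma> m already lies in the span H of \<sigma> G, where the induction hypothesis
    applies.\<close>
  have main: "y = \<zero>\<^bsub>Y\<^esub>"
    if Y: "module R Y" and g: "g \<in> mod_hom R Y M" and \<sigma>: "\<forall>m\<in>carrier M. \<sigma> m \<in> carrier Y \<and> g (\<sigma> m) = m"
      and z: "\<forall>ps\<in>P \<union> (\<lambda>a. (a, m) # \<omega> a) ` A. lincomb Y \<sigma> ps = \<zero>\<^bsub>Y\<^esub>"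
      and y: "y \<in> mod_span R Y (\<sigma> ` insert m G)" "g y = \<zero>\<^bsub>M\<^esub>" for Y :: "('a, 'c) module" and g \<sigma> y
  proof -
    interpret Y: rmodule R Y by (rule rmodule.intro) (rule Y)
    define H where "H = mod_span R Y (\<sigma> ` G)"
    have \<sigma>G: "\<sigma> ` G \<subseteq> carrier Y" "\<sigma> m \<in> carrier Y" using \<sigma> m by auto
    have H: "submodule H R Y" unfolding H_def by (rule Y.sm_span[OF \<sigma>G(1)])
    have "A \<subseteq> sub_ann R Y H {\<sigma> m}"
    proof
      fix a assume a: "a \<in> A"
      have "lincomb Y \<sigma> (\<omega> a) \<in> H"
        by (rule Y.lincomb_sm[OF H \<omega>(1)[OF a]]) (use Y.span_incl[of "\<sigma> ` G"] in \<open>auto simp: H_def\<close>)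
      moreover have "lincomb Y \<sigma> ((a, m) # \<omega> a) = \<zero>\<^bsub>Y\<^esub>" using z a by blast
      then have "a \<odot>\<^bsub>Y\<^esub> \<sigma> m \<oplus>\<^bsub>Y\<^esub> lincomb Y \<sigma> (\<omega> a) \<in> H" using Y.sm_zero[OF H] by simp
      ultimately have "a \<odot>\<^bsub>Y\<^esub> \<sigma> m \<in> H" using Y.sm_add_iff2[OF H, of "a \<odot>\<^bsub>Y\<^esub> \<sigma> m"] a A(1) \<sigma>G(2) by auto
      then show "a \<in> sub_ann R Y H {\<sigma> m}" using a A(1) by (auto simp: sub_ann_def)
    qed
    then have JH: "J \<subseteq> sub_ann R Y H {\<sigma> m}"
      unfolding A(3) using \<sigma>G(2) by (intro M.R.genideal_minimal Y.sub_ann_ideal[OF H]) auto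
    obtain r y' where r: "r \<in> carrier R" "y' \<in> H" "y = r \<odot>\<^bsub>Y\<^esub> \<sigma> m \<oplus>\<^bsub>Y\<^esub> y'"
      using y(1) Y.span_insert[OF \<sigma>G] by (auto simp: H_def)
    have "g ` \<sigma> ` G = G" using \<sigma> m(2) by (force simp: image_iff)
    then have "g ` H = mod_span R M G" using mod_hom_span[OF Y M g \<sigma>G(1)] by (simp add: H_def)
    then have gy': "g y' \<in> mod_span R M G" using imageI[OF r(2), of g] by simp
    have "r \<odot>\<^bsub>M\<^esub> m \<oplus>\<^bsub>M\<^esub> g y' = \<zero>\<^bsub>M\<^esub>"
      using y(2) r Y.sm_in[OF H r(2)] \<sigma>G(2) \<sigma> m(1) by (simp add: mod_homD(2,3)[OF g])
    then have "r \<odot>\<^bsub>M\<^esub> m \<in> mod_span R M G"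
      using M.sm_add_iff2[OF sG _ gy', of "r \<odot>\<^bsub>M\<^esub> m"] r(1) m(1) M.sm_zero[OF sG] by simp
    then have "r \<in> J" using r(1) by (simp add: J_def sub_ann_def)
    then have "y \<in> H" using JH r(2) unfolding r(3) by (auto simp: sub_ann_def intro: Y.sm_add[OF H])
    moreover have "\<forall>ps\<in>P. lincomb Y \<sigma> ps = \<zero>\<^bsub>Y\<^esub>" using z by blast
    ultimately show ?thesis using IH Y g \<sigma> y(2) unfolding H_def by (elim allE[of _ Y] allE[of _ g] allE[of _ \<sigma>]) blast
  qed
  show ?case
  proof (intro exI[of _ "P \<union> (\<lambda>a. (a, m) # \<omega> a) ` A"] conjI allI impI ballI)
    show "finite (P \<union> (\<lambda>a. (a, m) # \<omega> a) ` A)" using P(1) A(2) by simp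
    show "P \<union> (\<lambda>a. (a, m) # \<omega> a) ` A \<subseteq> rels R M" using P(2) \<omega>(2) by auto
  qed (rule main)
qed

text \<open>g maps the span H of \<sigma> G onto M, since G generates M, and is injective on it; the
  inverse of this restriction is the splitting.\<close>

lemma split_extensionI:
  assumes e: "exact_seq R N f Y g M" and G: "G \<subseteq> carrier M" "mod_span R M G = carrier M"
    and \<sigma>: "!!m. m \<in> carrier M ==> \<sigma> m \<in> carrier Y" "!!m. m \<in> carrier M ==> g (\<sigma> m) = m"
    and z: "!!y. y \<in> mod_span R Y (\<sigma> ` G) ==> g y = \<zero>\<^bsub>M\<^esub> ==> y = \<zero>\<^bsub>Y\<^esub>"
  shows "(Y, f, g) \<in> split_extensions R M N"
proof -
  note x = exact_seqD[OF e]
  interpret Y: rmodule R Y by (rule rmodule.intro) (rule x(2))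
  interpret M: rmodule R M by (rule rmodule.intro) (rule x(3))
  note hg = mod_homD[OF x(5)]
  define H where "H = mod_span R Y (\<sigma> ` G)"
  have \<sigma>G: "\<sigma> ` G \<subseteq> carrier Y" using \<sigma>(1) G(1) by blast
  have H: "submodule H R Y" unfolding H_def by (rule Y.sm_span[OF \<sigma>G])
  have "g ` \<sigma> ` G = G" using \<sigma>(2) G(1) by (force simp: image_iff)
  then have gH: "g ` H = carrier M" unfolding H_def using mod_hom_span[OF x(2,3,5) \<sigma>G] G(2) by simp
  have uniq: "y = y'" if y: "y \<in> H" "y' \<in> H" "g y = g y'" for y y'
  proof -
    have c: "y \<in> carrier Y" "y' \<in> carrier Y" using y Y.sm_in[OF H] by auto
    have "g (y \<ominus>\<^bsub>Y\<^esub> y') = \<zero>\<^bsub>M\<^esub>"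
      using c y(3) hg(1) by (simp add: mod_hom_minus[OF x(2,3,5)] M.minus_eq_zero_iff)
    then show ?thesis using z[of "y \<ominus>\<^bsub>Y\<^esub> y'"] Y.sm_minus[OF H y(1,2)] c by (simp add: H_def Y.minus_eq_zero_iff)
  qed
  define \<tau> where "\<tau> = (\<lambda>m\<in>carrier M. SOME y. y \<in> H \<and> g y = m)"
  have \<tau>: "\<tau> m \<in> H" "g (\<tau> m) = m" if m: "m \<in> carrier M" for m
  proof -
    have "\<exists>y. y \<in> H \<and> g y = m" using m unfolding gH[symmetric] by blast
    from someI_ex[OF this] show "\<tau> m \<in> H" "g (\<tau> m) = m" using m by (simp_all add: \<tau>_def)
  qed
  have \<tau>Y: "\<tau> m \<in> carrier Y" if "m \<in> carrier M" for m using Y.sm_in[OF H \<tau>(1)[OF that]] .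
  have "\<tau> \<in> mod_hom R M Y"
  proof (rule mod_homI[OF \<tau>Y])
    show "\<tau> \<in> extensional (carrier M)" by (simp add: \<tau>_def)
    show "\<tau> (m \<oplus>\<^bsub>M\<^esub> m') = \<tau> m \<oplus>\<^bsub>Y\<^esub> \<tau> m'" if "m \<in> carrier M" "m' \<in> carrier M" for m m'
      by (rule uniq) (use that \<tau>Y \<tau> Y.sm_add[OF H] in \<open>simp_all add: hg(2)\<close>)
    show "\<tau> (r \<odot>\<^bsub>M\<^esub> m) = r \<odot>\<^bsub>Y\<^esub> \<tau> m" if "r \<in> carrier R" "m \<in> carrier M" for r m
      by (rule uniq) (use that \<tau>Y \<tau> Y.sm_smult[OF H] in \<open>simp_all add: hg(3)\<close>)
  qed
  moreover have "compose (carrier M) g \<tau> = mod_id M" using \<tau>(2) by (auto simp: compose_def mod_id_def fun_eq_iff)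
  ultimately show ?thesis unfolding split_extensions_def using e by (auto simp: extensions_iff)
qed

subsection \<open>The extension functor\<close>

locale ext_functor = primary_local R \<mm> I for R :: "('a, 'r) ring_scheme" (structure) and \<mm> I +
  fixes universe :: "'u itself"
  assumes inf: "infinite (UNIV :: 'u set)"
begin

abbreviation cl :: "('a, 'u) module => ('a, 'u) module => (('a \<times> 'u) list => 'u) => ('a, 'u) extension set" where
  "cl \<equiv> ext_class R"

abbreviation Ulr :: "nat => ('a, 'u) module set" where
  "Ulr \<equiv> Ul R \<mm> I"

text \<open>The construction is made for arbitrary modules, and membership of its middle term in the
  Ulrich class is recorded alongside for all s, so one extension serves both Ext and its
  subfunctor.\<close>

lemma push_exists:
  assumes E: "(Y, f, g) \<in> cl M N c" and N': "module R N'" and h: "h \<in> mod_hom R N N'"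
  shows "\<exists>Y' f' g'. (Y', f', g') \<in> cl M N' (\<lambda>ps. h (c ps)) \<and>
    (\<forall>s. N \<in> Ulr s --> Y \<in> Ulr s --> M \<in> Ulr s --> N' \<in> Ulr s --> Y' \<in> Ulr s)"
proof -
  note e = ext_classD(1)[OF E]
  obtain f' and Y' :: "('a, 'u) module" and h' g' where 1: "exact_seq R N' f' Y' g' M" "h' \<in> mod_hom R Y Y'"
    "!!a. a \<in> carrier N ==> h' (f a) = f' (h a)" "!!b. b \<in> carrier Y ==> g' (h' b) = g b"
    "!!s. N \<in> Ulr s ==> Y \<in> Ulr s ==> M \<in> Ulr s ==> N' \<in> Ulr s ==> Y' \<in> Ulr s"
    by (rule pushout_exists[OF inf e N' h]) (rule that)
  have "(Y', f', g') \<in> cl M N' (\<lambda>ps. h (c ps))" by (rule ext_class_push[OF E 1(1) h 1(2-4)])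
  then show ?thesis using 1(5) by blast
qed

lemma pull_exists:
  assumes E: "(Y, f, g) \<in> cl M N c" and M': "module R M'" and k: "k \<in> mod_hom R M' M"
  shows "\<exists>Y' f' g'. (Y', f', g') \<in> cl M' N (\<lambda>ps. c (map (map_prod id k) ps)) \<and>
    (\<forall>s. N \<in> Ulr s --> Y \<in> Ulr s --> M \<in> Ulr s --> M' \<in> Ulr s --> Y' \<in> Ulr s)"
proof -
  note e = ext_classD(1)[OF E]
  obtain f' and Y' :: "('a, 'u) module" and k' g' where 1: "exact_seq R N f' Y' g' M'" "k' \<in> mod_hom R Y' Y"
    "!!a. a \<in> carrier N ==> k' (f' a) = f a" "!!b. b \<in> carrier Y' ==> g (k' b) = k (g' b)"
    "!!s. N \<in> Ulr s ==> Y \<in> Ulr s ==> M \<in> Ulr s ==> M' \<in> Ulr s ==> Y' \<in> Ulr s"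
    by (rule pullback_exists[OF inf e M' k]) (rule that)
  have "(Y', f', g') \<in> cl M' N (\<lambda>ps. c (map (map_prod id k) ps))" by (rule ext_class_pull[OF E 1(1) k 1(2-4)])
  then show ?thesis using 1(5) by blast
qed

text \<open>Y is the quotient of the fibre product P of Y1 and Y2 over M by the antidiagonal copy of
  N. The sequences 0 \<rightarrow> N \<rightarrow> P \<rightarrow> Y \<rightarrow> 0 and 0
  \<rightarrow> N \<rightarrow> Y \<rightarrow> M \<rightarrow> 0 put it into the Ulrich
  class.\<close>

lemma baer_exists:
  fixes Y1 Y2 M N :: "('a, 'u) module"
  assumes e1: "exact_seq R N f1 Y1 g1 M" and e2: "exact_seq R N f2 Y2 g2 M"
  obtains Y :: "('a, 'u) module" and f g \<phi> where "exact_seq R N f Y g M" "\<phi> \<in> mod_hom R (fibre_product Y1 g1 Y2 g2) Y"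
    "!!n1 n2. n1 \<in> carrier N ==> n2 \<in> carrier N ==> \<phi> (f1 n1, f2 n2) = f (n1 \<oplus>\<^bsub>N\<^esub> n2)"
    "!!y1 y2. (y1, y2) \<in> carrier (fibre_product Y1 g1 Y2 g2) ==> g (\<phi> (y1, y2)) = g1 y1"
    "!!s. N \<in> Ulr s ==> Y1 \<in> Ulr s ==> Y2 \<in> Ulr s ==> M \<in> Ulr s ==> Y \<in> Ulr s"
proof -
  note x1 = exact_seqD[OF e1] and x2 = exact_seqD[OF e2]
  interpret N: rmodule R N by (rule rmodule.intro) (rule x1(1))
  interpret M: rmodule R M by (rule rmodule.intro) (rule x1(3))
  interpret Y1: rmodule R Y1 by (rule rmodule.intro) (rule x1(2))
  interpret Y2: rmodule R Y2 by (rule rmodule.intro) (rule x2(2))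
  note h1 = mod_homD[OF x1(4)] and h2 = mod_homD[OF x2(4)] and k1 = mod_homD[OF x1(5)] and k2 = mod_homD[OF x2(5)]
  let ?P = "fibre_product Y1 g1 Y2 g2"
  note P = fibre_product_module[OF x1(2) x2(2) x1(3) x1(5) x2(5)]
  interpret P: rmodule R ?P by (rule rmodule.intro) (rule P(1))
  have cP: "carrier ?P = {(y, z). y \<in> carrier Y1 \<and> z \<in> carrier Y2 \<and> g1 y = g2 z}" by (simp add: fibre_product_def)
  have addP: "(a, b) \<oplus>\<^bsub>?P\<^esub> (a', b') = (a \<oplus>\<^bsub>Y1\<^esub> a', b \<oplus>\<^bsub>Y2\<^esub> b')" and smP: "r \<odot>\<^bsub>?P\<^esub> (a, b) = (r \<odot>\<^bsub>Y1\<^esub> a, r \<odot>\<^bsub>Y2\<^esub> b)"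
    for a b a' b' r by (simp_all add: fibre_product_def)
  have z1: "g1 (f1 n) = \<zero>\<^bsub>M\<^esub>" and z2: "g2 (f2 n) = \<zero>\<^bsub>M\<^esub>" if "n \<in> carrier N" for n using that x1(7) x2(7) by auto
  have f0: "f1 \<zero>\<^bsub>N\<^esub> = \<zero>\<^bsub>Y1\<^esub>" "f2 \<zero>\<^bsub>N\<^esub> = \<zero>\<^bsub>Y2\<^esub>" using mod_hom_zero[OF x1(1,2,4)] mod_hom_zero[OF x2(1,2,4)] .
  have inP: "(f1 n, f2 n') \<in> carrier ?P" if "n \<in> carrier N" "n' \<in> carrier N" for n n'
    using that z1 z2 h1(1) h2(1) by (simp add: cP)
  define d where "d = (\<lambda>n\<in>carrier N. (f1 n, f2 (\<ominus>\<^bsub>N\<^esub> n)))"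
  have dh: "d \<in> mod_hom R N ?P"
    unfolding d_def
  proof (rule mod_hom_restrictI[OF x1(1)])
    show "(f1 (n \<oplus>\<^bsub>N\<^esub> n'), f2 (\<ominus>\<^bsub>N\<^esub> (n \<oplus>\<^bsub>N\<^esub> n'))) = (f1 n, f2 (\<ominus>\<^bsub>N\<^esub> n)) \<oplus>\<^bsub>?P\<^esub> (f1 n', f2 (\<ominus>\<^bsub>N\<^esub> n'))"
      if "n \<in> carrier N" "n' \<in> carrier N" for n n' using that by (simp add: addP h1(2) N.M.minus_add h2(2))
    show "(f1 (r \<odot>\<^bsub>N\<^esub> n), f2 (\<ominus>\<^bsub>N\<^esub> (r \<odot>\<^bsub>N\<^esub> n))) = r \<odot>\<^bsub>?P\<^esub> (f1 n, f2 (\<ominus>\<^bsub>N\<^esub> n))"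
      if "r \<in> carrier R" "n \<in> carrier N" for r n using that by (simp add: smP h1(3) N.smult_r_minus[symmetric] h2(3))
  qed (rule inP, simp_all)
  have sd: "submodule (d ` carrier N) R ?P" by (rule mod_hom_image_sm[OF x1(1) P(1) dh N.sm_carrier])
  obtain \<iota> :: "'u \<times> 'u => 'u" where "inj \<iota>" by (rule inj_prod_infinite[OF inf])
  then have inj: "inj_on \<iota> (carrier ?P)" by (rule inj_on_subset) simp
  obtain Y :: "('a, 'u) module" and q where Y: "module R Y" "q \<in> mod_hom R ?P Y" "q ` carrier ?P = carrier Y"
    "!!y. y \<in> carrier ?P ==> q y = \<zero>\<^bsub>Y\<^esub> \<longleftrightarrow> y \<in> d ` carrier N"
    by (rule quotient_exists[OF P(1) sd inj]) (rule that)
  interpret Y: rmodule R Y by (rule rmodule.intro) (rule Y(1))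
  note hq = mod_homD[OF Y(2)]
  have d_inj: "inj_on d (carrier N)" using inj_onD[OF x1(6)] by (auto simp: d_def inj_on_def)
  have "d ` carrier N = {z \<in> carrier ?P. q z = \<zero>\<^bsub>Y\<^esub>}" using Y(4) P.sm_sub[OF sd] by blast
  then have ed: "exact_seq R N d ?P q Y" unfolding exact_seq_def using x1(1) P(1) Y(1-3) dh d_inj by simp
  have q0: "q (f1 n, f2 (\<ominus>\<^bsub>N\<^esub> n)) = \<zero>\<^bsub>Y\<^esub>" if "n \<in> carrier N" for n
    using Y(4)[OF inP, of n "\<ominus>\<^bsub>N\<^esub> n"] that by (auto simp: d_def)
  define f where "f = (\<lambda>n\<in>carrier N. q (f1 n, f2 \<zero>\<^bsub>N\<^esub>))"
  have fh: "f \<in> mod_hom R N Y"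
    unfolding f_def
  proof (rule mod_hom_restrictI[OF x1(1)])
    show "q (f1 n, f2 \<zero>\<^bsub>N\<^esub>) \<in> carrier Y" if "n \<in> carrier N" for n using that by (intro hq(1) inP) auto
    show "q (f1 (n \<oplus>\<^bsub>N\<^esub> n'), f2 \<zero>\<^bsub>N\<^esub>) = q (f1 n, f2 \<zero>\<^bsub>N\<^esub>) \<oplus>\<^bsub>Y\<^esub> q (f1 n', f2 \<zero>\<^bsub>N\<^esub>)"
      if "n \<in> carrier N" "n' \<in> carrier N" for n n'
      using that hq(2)[OF inP[of n "\<zero>\<^bsub>N\<^esub>"] inP[of n' "\<zero>\<^bsub>N\<^esub>"]] by (simp add: addP h1(2) f0)
    show "q (f1 (r \<odot>\<^bsub>N\<^esub> n), f2 \<zero>\<^bsub>N\<^esub>) = r \<odot>\<^bsub>Y\<^esub> q (f1 n, f2 \<zero>\<^bsub>N\<^esub>)" if "r \<in> carrier R" "n \<in> carrier N" for r n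
      using that hq(3)[OF _ inP[of n "\<zero>\<^bsub>N\<^esub>"]] by (simp add: smP h1(3) f0)
  qed
  have qf: "q (f1 n1, f2 n2) = f (n1 \<oplus>\<^bsub>N\<^esub> n2)" if n: "n1 \<in> carrier N" "n2 \<in> carrier N" for n1 n2
  proof -
    \<comment> \<open>Modulo the antidiagonal the second component can be moved into the
      first.\<close>
    have "(f1 n1, f2 n2) = (f1 (n1 \<oplus>\<^bsub>N\<^esub> n2), f2 \<zero>\<^bsub>N\<^esub>) \<oplus>\<^bsub>?P\<^esub> (f1 (\<ominus>\<^bsub>N\<^esub> n2), f2 (\<ominus>\<^bsub>N\<^esub> (\<ominus>\<^bsub>N\<^esub> n2)))"
      unfolding addP using n by (simp add: h1(2)[symmetric] h2(2)[symmetric] N.M.a_assoc N.M.r_neg)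
    then have "q (f1 n1, f2 n2) = q (f1 (n1 \<oplus>\<^bsub>N\<^esub> n2), f2 \<zero>\<^bsub>N\<^esub>) \<oplus>\<^bsub>Y\<^esub> q (f1 (\<ominus>\<^bsub>N\<^esub> n2), f2 (\<ominus>\<^bsub>N\<^esub> (\<ominus>\<^bsub>N\<^esub> n2)))"
      using hq(2)[OF inP[of "n1 \<oplus>\<^bsub>N\<^esub> n2" "\<zero>\<^bsub>N\<^esub>"] inP[of "\<ominus>\<^bsub>N\<^esub> n2" "\<ominus>\<^bsub>N\<^esub> (\<ominus>\<^bsub>N\<^esub> n2)"]] n by simp
    also have "\<dots> = f (n1 \<oplus>\<^bsub>N\<^esub> n2)"
      using n q0[of "\<ominus>\<^bsub>N\<^esub> n2"] hq(1)[OF inP[of "n1 \<oplus>\<^bsub>N\<^esub> n2" "\<zero>\<^bsub>N\<^esub>"]] by (simp add: f_def)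
    finally show ?thesis .
  qed
  define u where "u = (\<lambda>z\<in>carrier ?P. g1 (fst z))"
  have uh: "u \<in> mod_hom R ?P M"
    unfolding u_def by (rule mod_hom_restrictI[OF P(1)]) (auto simp: fibre_product_def k1 k2)
  have "u z = \<zero>\<^bsub>M\<^esub>" if "z \<in> carrier ?P" "q z = \<zero>\<^bsub>Y\<^esub>" for z
    using Y(4)[OF that(1)] that z1 by (auto simp: u_def d_def)
  then obtain g where g: "g \<in> mod_hom R Y M" "!!z. z \<in> carrier ?P ==> g (q z) = u z"
    using factor_epi[OF P(1) Y(1) x1(3) Y(2,3) uh] by blast
  have gq: "g (q (y, z)) = g1 y" if "(y, z) \<in> carrier ?P" for y z using g(2)[OF that] that by (simp add: u_def)
  have "inj_on f (carrier N)"
  proof (rule mod_hom_inj_on[OF x1(1) Y(1) fh])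
    fix n assume n: "n \<in> carrier N" "f n = \<zero>\<^bsub>Y\<^esub>"
    then obtain n' where n': "n' \<in> carrier N" "f1 n = f1 n'" "f2 \<zero>\<^bsub>N\<^esub> = f2 (\<ominus>\<^bsub>N\<^esub> n')"
      using Y(4)[OF inP[of n "\<zero>\<^bsub>N\<^esub>"]] by (auto simp: f_def d_def)
    have "\<ominus>\<^bsub>N\<^esub> n' = \<zero>\<^bsub>N\<^esub>" using inj_onD[OF x2(6) n'(3)] n'(1) by simp
    then have "n' = \<zero>\<^bsub>N\<^esub>" using n'(1) N.M.minus_minus[of n'] by simp
    moreover have "n = n'" using inj_onD[OF x1(6) n'(2)] n(1) n'(1) by simp
    ultimately show "n = \<zero>\<^bsub>N\<^esub>" by simp
  qed
  moreover have "f ` carrier N = {y \<in> carrier Y. g y = \<zero>\<^bsub>M\<^esub>}"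
  proof (intro equalityI subsetI)
    fix y assume "y \<in> f ` carrier N"
    then obtain n where n: "n \<in> carrier N" "y = f n" by auto
    then show "y \<in> {y \<in> carrier Y. g y = \<zero>\<^bsub>M\<^esub>}"
      using mod_homD(1)[OF fh n(1)] gq[OF inP[of n "\<zero>\<^bsub>N\<^esub>"]] z1 by (simp add: f_def)
  next
    fix y assume "y \<in> {y \<in> carrier Y. g y = \<zero>\<^bsub>M\<^esub>}"
    then have "y \<in> q ` carrier ?P" "g y = \<zero>\<^bsub>M\<^esub>" using Y(3) by auto
    then obtain a b where ab: "(a, b) \<in> carrier ?P" "y = q (a, b)" "g1 a = \<zero>\<^bsub>M\<^esub>" using gq by auto
    then have "a \<in> f1 ` carrier N" "b \<in> f2 ` carrier N" unfolding x1(7) x2(7) by (auto simp: cP)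
    then obtain n1 n2 where "n1 \<in> carrier N" "n2 \<in> carrier N" "a = f1 n1" "b = f2 n2" by auto
    then show "y \<in> f ` carrier N" using qf ab(2) by auto
  qed
  moreover have "g ` carrier Y = carrier M"
  proof (intro equalityI subsetI)
    fix m assume "m \<in> carrier M"
    then have "m \<in> g1 ` carrier Y1" "m \<in> g2 ` carrier Y2" using x1(8) x2(8) by auto
    then obtain a b where ab: "a \<in> carrier Y1" "b \<in> carrier Y2" "m = g1 a" "m = g2 b" by auto
    then have "(a, b) \<in> carrier ?P" by (simp add: cP)
    then show "m \<in> g ` carrier Y" using gq ab(3) hq(1) by (intro image_eqI[of _ _ "q (a, b)"]) auto
  qed (use mod_homD(1)[OF g(1)] in auto)
  ultimately have e: "exact_seq R N f Y g M" unfolding exact_seq_def using x1(1,3) Y(1) fh g(1) by simp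
  show ?thesis
  proof (rule that[OF e Y(2) qf gq])
    fix s assume U: "N \<in> Ulr s" "Y1 \<in> Ulr s" "Y2 \<in> Ulr s" "M \<in> Ulr s"
    have "?P \<in> Ul R \<mm> I s" by (rule fibre_product_Ul[OF inf e1 x2(5) U(1,2,4,3)])
    then show "Y \<in> Ulr s" by (rule Ul_cokernel[OF ed U(1) _ e U(1,4)])
  qed
qed

lemma baer_class:
  assumes 1: "(Y1, f1, g1) \<in> cl M N c1" and 2: "(Y2, f2, g2) \<in> cl M N c2"
  shows "baer_sum R M N (cl M N c1) (cl M N c2) = cl M N (\<lambda>ps. c1 ps \<oplus>\<^bsub>N\<^esub> c2 ps)"
    and "\<exists>Y f g. (Y, f, g) \<in> cl M N (\<lambda>ps. c1 ps \<oplus>\<^bsub>N\<^esub> c2 ps) \<and>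
      (\<forall>s. N \<in> Ulr s --> Y1 \<in> Ulr s --> Y2 \<in> Ulr s --> M \<in> Ulr s --> Y \<in> Ulr s)"
proof -
  let ?c = "\<lambda>ps. c1 ps \<oplus>\<^bsub>N\<^esub> c2 ps"
  let ?P = "fibre_product Y1 g1 Y2 g2"
  note e1 = ext_classD(1)[OF 1] and e2 = ext_classD(1)[OF 2]
  note P = fibre_product_module[OF exact_seqD(2)[OF e1] exact_seqD(2)[OF e2] exact_seqD(3,5)[OF e1] exact_seqD(5)[OF e2]]
  obtain Y0 f0 g0 \<phi> where e0: "exact_seq R N f0 Y0 g0 M" and \<phi>: "\<phi> \<in> mod_hom R ?P Y0"
    "!!n1 n2. n1 \<in> carrier N ==> n2 \<in> carrier N ==> \<phi> (f1 n1, f2 n2) = f0 (n1 \<oplus>\<^bsub>N\<^esub> n2)"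
    "!!y1 y2. (y1, y2) \<in> carrier ?P ==> g0 (\<phi> (y1, y2)) = g1 y1"
    and U: "!!s. N \<in> Ulr s ==> Y1 \<in> Ulr s ==> Y2 \<in> Ulr s ==> M \<in> Ulr s ==> Y0 \<in> Ulr s"
    by (rule baer_exists[OF e1 e2]) (rule that)
  have Y0: "(Y0, f0, g0) \<in> cl M N ?c" by (rule ext_class_baer[OF 1 2 e0 \<phi>])
  then show "\<exists>Y f g. (Y, f, g) \<in> cl M N ?c \<and>
      (\<forall>s. N \<in> Ulr s --> Y1 \<in> Ulr s --> Y2 \<in> Ulr s --> M \<in> Ulr s --> Y \<in> Ulr s)" using U by blast
  show "baer_sum R M N (cl M N c1) (cl M N c2) = cl M N ?c"
  proof (intro equalityI subsetI)
    fix E assume "E \<in> baer_sum R M N (cl M N c1) (cl M N c2)"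
    then obtain Y f g A1 a1 b1 A2 a2 b2 \<psi> where E: "E = (Y, f, g)" "exact_seq R N f Y g M"
      "(A1, a1, b1) \<in> cl M N c1" "(A2, a2, b2) \<in> cl M N c2" "\<psi> \<in> mod_hom R (fibre_product A1 b1 A2 b2) Y"
      "\<forall>n1 \<in> carrier N. \<forall>n2 \<in> carrier N. \<psi> (a1 n1, a2 n2) = f (n1 \<oplus>\<^bsub>N\<^esub> n2)"
      "\<forall>(y1, y2) \<in> carrier (fibre_product A1 b1 A2 b2). g (\<psi> (y1, y2)) = b1 y1"
      unfolding baer_sum_def extensions_iff by auto
    show "E \<in> cl M N ?c" unfolding E(1) by (rule ext_class_baer[OF E(3,4,2,5)]) (use E(6,7) in auto)
  next
    \<comment> \<open>Any extension in this class is equivalent to the constructed one; composing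
      \<phi> with the equivalence gives the morphism that the Baer sum asks for.\<close>
    fix E assume E: "E \<in> cl M N ?c"
    obtain Y f g where Y: "E = (Y, f, g)" by (cases E)
    have "((Y0, f0, g0), (Y, f, g)) \<in> yoneda_equiv R M N" using yoneda_equiv_iff[OF Y0] E Y by blast
    then obtain \<psi> where \<psi>: "\<psi> \<in> mod_hom R Y0 Y" "compose (carrier N) \<psi> f0 = f" "compose (carrier Y0) g \<psi> = g0"
      unfolding yoneda_equiv_def by auto
    have \<psi>f: "\<psi> (f0 n) = f n" if "n \<in> carrier N" for n using \<psi>(2) that by (auto simp: compose_def)
    have \<psi>g: "g (\<psi> y) = g0 y" if "y \<in> carrier Y0" for y using \<psi>(3) that by (auto simp: compose_def)
    interpret N: rmodule R N by (rule rmodule.intro) (rule exact_seqD(1)[OF e1])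
    define \<theta> where "\<theta> = compose (carrier ?P) \<psi> \<phi>"
    have \<theta>: "\<theta> \<in> mod_hom R ?P Y" unfolding \<theta>_def by (rule mod_hom_compose[OF P(1) \<phi>(1) \<psi>(1)])
    have z: "b x = \<zero>\<^bsub>M\<^esub>" if "exact_seq R N a A b M" "x \<in> a ` carrier N" for a b A x
      using exact_seqD(7)[OF that(1)] that(2) by auto
    have "(f1 n1, f2 n2) \<in> carrier ?P" if "n1 \<in> carrier N" "n2 \<in> carrier N" for n1 n2
      using that z[OF e1] z[OF e2] mod_homD(1)[OF exact_seqD(4)[OF e1]] mod_homD(1)[OF exact_seqD(4)[OF e2]]
      by (simp add: fibre_product_def)
    then have "\<theta> (f1 n1, f2 n2) = f (n1 \<oplus>\<^bsub>N\<^esub> n2)" if "n1 \<in> carrier N" "n2 \<in> carrier N" for n1 n2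
      using that by (simp add: \<theta>_def compose_def \<phi>(2) \<psi>f)
    moreover have "g (\<theta> z) = g1 (fst z)" if "z \<in> carrier ?P" for z
      using that \<phi>(3)[of "fst z" "snd z"] mod_homD(1)[OF \<phi>(1) that] by (simp add: \<theta>_def compose_def \<psi>g)
    ultimately show "E \<in> baer_sum R M N (cl M N c1) (cl M N c2)"
      unfolding baer_sum_def Y using 1 2 \<theta> ext_classD(1)[OF E[unfolded Y]] unfolding extensions_iff
      by (auto intro!: bexI[OF _ 1] bexI[OF _ 2] bexI[OF _ \<theta>])
  qed
qed

text \<open>A linear section maps all relations to 0. Conversely, every extension with factor set 0
  is equivalent to the direct sum, and the equivalence carries the inclusion of M to a
  section.\<close>

lemma split_class:
  fixes M N :: "('a, 'u) module"
  assumes M: "module R M" and N: "module R N"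
  shows "split_extensions R M N = cl M N (\<lambda>_. \<zero>\<^bsub>N\<^esub>)"
    and "\<exists>Y f g. (Y, f, g) \<in> cl M N (\<lambda>_. \<zero>\<^bsub>N\<^esub>) \<and> (\<forall>s. N \<in> Ulr s --> M \<in> Ulr s --> Y \<in> Ulr s)"
proof -
  interpret N: rmodule R N by (rule rmodule.intro) (rule N)
  have sub: "(Y, f, g) \<in> cl M N (\<lambda>_. \<zero>\<^bsub>N\<^esub>)"
    if e: "exact_seq R N f Y g M" and \<sigma>: "\<sigma> \<in> mod_hom R M Y" "!!m. m \<in> carrier M ==> g (\<sigma> m) = m" for Y f g \<sigma>
  proof -
    note x = exact_seqD[OF e]
    have "f \<zero>\<^bsub>N\<^esub> = lincomb Y \<sigma> ps" if ps: "ps \<in> rels R M" for ps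
    proof -
      have "\<sigma> (lincomb M (\<lambda>m. m) ps) = lincomb Y \<sigma> ps"
        by (rule lincomb_hom[OF M x(2) \<sigma>(1), of ps "carrier M"]) (use ps in \<open>auto simp: rels_def\<close>)
      then show ?thesis using ps mod_hom_zero[OF M x(2) \<sigma>(1)] mod_hom_zero[OF x(1,2,4)] by (simp add: rels_def)
    qed
    then show ?thesis unfolding ext_class_def using e \<sigma>(2) mod_homD(1)[OF \<sigma>(1)] by auto
  qed
  obtain P :: "('a, 'u) module" and i j p q where ds: "direct_sum R N M P i j p q"
    by (rule direct_sum_exists[OF inf N M])
  note P = direct_sumD[OF ds] and e = direct_sum_exact[OF N M ds]
  have P0: "(P, i, q) \<in> cl M N (\<lambda>_. \<zero>\<^bsub>N\<^esub>)" by (rule sub[OF e P(3,7)])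
  have "P \<in> Ulr s" if "N \<in> Ulr s" "M \<in> Ulr s" for s by (rule Ul_split[OF e that P(4,6)])
  with P0 show "\<exists>Y f g. (Y, f, g) \<in> cl M N (\<lambda>_. \<zero>\<^bsub>N\<^esub>) \<and> (\<forall>s. N \<in> Ulr s --> M \<in> Ulr s --> Y \<in> Ulr s)" by blast
  show "split_extensions R M N = cl M N (\<lambda>_. \<zero>\<^bsub>N\<^esub>)"
  proof (intro equalityI subsetI)
    fix E assume "E \<in> split_extensions R M N"
    then obtain Y f g \<sigma> where E: "E = (Y, f, g)" "exact_seq R N f Y g M" "\<sigma> \<in> mod_hom R M Y"
      "compose (carrier M) g \<sigma> = mod_id M" unfolding split_extensions_def extensions_iff by auto
    have "g (\<sigma> m) = m" if "m \<in> carrier M" for m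
      using fun_cong[OF E(4), of m] that by (simp add: compose_def mod_id_def)
    then show "E \<in> cl M N (\<lambda>_. \<zero>\<^bsub>N\<^esub>)" unfolding E(1) by (rule sub[OF E(2,3)])
  next
    fix E assume E: "E \<in> cl M N (\<lambda>_. \<zero>\<^bsub>N\<^esub>)"
    obtain Y f g where Y: "E = (Y, f, g)" by (cases E)
    have "((P, i, q), (Y, f, g)) \<in> yoneda_equiv R M N" using yoneda_equiv_iff[OF P0] E Y by blast
    then obtain \<psi> where \<psi>: "\<psi> \<in> mod_hom R P Y" "compose (carrier P) g \<psi> = q"
      unfolding yoneda_equiv_def by auto
    have "g (\<psi> y) = q y" if "y \<in> carrier P" for y using \<psi>(2) that by (auto simp: compose_def)
    then have "compose (carrier M) g (compose (carrier M) \<psi> j) = mod_id M"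
      using P(7) mod_homD(1)[OF P(3)] by (auto simp: compose_def mod_id_def fun_eq_iff)
    then show "E \<in> split_extensions R M N"
      using mod_hom_compose[OF M P(3) \<psi>(1)] ext_classD(1)[OF E[unfolded Y]]
      unfolding split_extensions_def Y extensions_iff by auto
  qed
qed

end

section \<open>Ext as a bifunctor into finitely generated modules\<close>

context ext_functor
begin

lemma Ext1_cases:
  fixes M N :: "('a, 'u) module"
  assumes "e \<in> carrier (Ext1 R M N)"
  obtains c where "e = cl M N c" "cl M N c \<noteq> {}" "!!ps. ps \<in> rels R M ==> c ps \<in> carrier N"
proof -
  obtain c where c: "e = cl M N c" "e \<noteq> {}" using assms unfolding Ext1_carrier by blast
  then obtain Y f g where "(Y, f, g) \<in> cl M N c" by auto
  then show ?thesis using that[of c] c ext_classD(2) by blast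
qed

lemma cl_carrier: "cl M N c \<noteq> {} ==> cl M N c \<in> carrier (Ext1 R M N)"
  unfolding Ext1_carrier by blast

lemma Ext1_add:
  fixes M N :: "('a, 'u) module"
  assumes "cl M N c \<noteq> {}" "cl M N c' \<noteq> {}"
  shows "cl M N c \<oplus>\<^bsub>Ext1 R M N\<^esub> cl M N c' = cl M N (\<lambda>ps. c ps \<oplus>\<^bsub>N\<^esub> c' ps)"
    "cl M N (\<lambda>ps. c ps \<oplus>\<^bsub>N\<^esub> c' ps) \<noteq> {}"
proof -
  obtain Y f g Y' f' g' where E: "(Y, f, g) \<in> cl M N c" "(Y', f', g') \<in> cl M N c'" using assms by auto
  show "cl M N c \<oplus>\<^bsub>Ext1 R M N\<^esub> cl M N c' = cl M N (\<lambda>ps. c ps \<oplus>\<^bsub>N\<^esub> c' ps)"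
    using baer_class(1)[OF E] by (simp add: Ext1_def)
  show "cl M N (\<lambda>ps. c ps \<oplus>\<^bsub>N\<^esub> c' ps) \<noteq> {}" using baer_class(2)[OF E] by blast
qed

lemma scalar_hom: "module R N ==> r \<in> carrier R ==> (\<lambda>n\<in>carrier N. r \<odot>\<^bsub>N\<^esub> n) \<in> mod_hom R N N"
proof (rule mod_hom_restrictI)
  assume N: "module R N" and r: "r \<in> carrier R"
  interpret N: rmodule R N by (rule rmodule.intro) (rule N)
  show "r \<odot>\<^bsub>N\<^esub> n \<in> carrier N" if "n \<in> carrier N" for n using that r by simp
  show "r \<odot>\<^bsub>N\<^esub> (m \<oplus>\<^bsub>N\<^esub> n) = r \<odot>\<^bsub>N\<^esub> m \<oplus>\<^bsub>N\<^esub> r \<odot>\<^bsub>N\<^esub> n" if "m \<in> carrier N" "n \<in> carrier N" for m n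
    using that r by (simp add: N.smult_r_distr)
  show "r \<odot>\<^bsub>N\<^esub> (s \<odot>\<^bsub>N\<^esub> n) = s \<odot>\<^bsub>N\<^esub> (r \<odot>\<^bsub>N\<^esub> n)" if "s \<in> carrier R" "n \<in> carrier N" for s n
    using that r by (rule_tac N.smult_comm)
qed

lemma Ext1_smult:
  fixes M N :: "('a, 'u) module"
  assumes r: "r \<in> carrier R" and ne: "cl M N c \<noteq> {}"
  shows "r \<odot>\<^bsub>Ext1 R M N\<^esub> cl M N c = cl M N (\<lambda>ps. r \<odot>\<^bsub>N\<^esub> c ps)" "cl M N (\<lambda>ps. r \<odot>\<^bsub>N\<^esub> c ps) \<noteq> {}"
    "\<exists>(Y, f, g)\<in>cl M N c. Y \<in> Ulr s ==> M \<in> Ulr s ==> N \<in> Ulr s ==>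
      \<exists>(Y, f, g)\<in>cl M N (\<lambda>ps. r \<odot>\<^bsub>N\<^esub> c ps). Y \<in> Ulr s"
proof -
  let ?h = "\<lambda>n\<in>carrier N. r \<odot>\<^bsub>N\<^esub> n"
  obtain Y0 f0 g0 where E0: "(Y0, f0, g0) \<in> cl M N c" using ne by auto
  have N: "module R N" using exact_seqD(1)[OF ext_classD(1)[OF E0]] .
  have eq: "cl M N (\<lambda>ps. ?h (c ps)) = cl M N (\<lambda>ps. r \<odot>\<^bsub>N\<^esub> c ps)"
    by (rule ext_class_cong) (simp add: ext_classD(2)[OF E0])
  show "r \<odot>\<^bsub>Ext1 R M N\<^esub> cl M N c = cl M N (\<lambda>ps. r \<odot>\<^bsub>N\<^esub> c ps)"
    using ext_push_class[OF ne scalar_hom[OF N r]] eq by (simp add: Ext1_def)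
  have p: "\<exists>Y' f' g'. (Y', f', g') \<in> cl M N (\<lambda>ps. r \<odot>\<^bsub>N\<^esub> c ps) \<and>
      (\<forall>s. N \<in> Ulr s --> Y \<in> Ulr s --> M \<in> Ulr s --> N \<in> Ulr s --> Y' \<in> Ulr s)"
    if "(Y, f, g) \<in> cl M N c" for Y f g
    using push_exists[OF that N scalar_hom[OF N r]] unfolding eq .
  show "cl M N (\<lambda>ps. r \<odot>\<^bsub>N\<^esub> c ps) \<noteq> {}" using p[OF E0] by (elim exE) auto
  assume "\<exists>(Y, f, g)\<in>cl M N c. Y \<in> Ulr s" and U: "M \<in> Ulr s" "N \<in> Ulr s"
  then obtain Y f g where E: "(Y, f, g) \<in> cl M N c" "Y \<in> Ulr s" by auto
  obtain Y' f' g' where "(Y', f', g') \<in> cl M N (\<lambda>ps. r \<odot>\<^bsub>N\<^esub> c ps)" "Y' \<in> Ulr s"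
    using p[OF E(1)] E(2) U by (elim exE) auto
  then show "\<exists>(Y, f, g)\<in>cl M N (\<lambda>ps. r \<odot>\<^bsub>N\<^esub> c ps). Y \<in> Ulr s" by auto
qed

lemma Ext1_zero:
  fixes M N :: "('a, 'u) module"
  assumes "module R M" "module R N"
  shows "\<zero>\<^bsub>Ext1 R M N\<^esub> = cl M N (\<lambda>_. \<zero>\<^bsub>N\<^esub>)" "cl M N (\<lambda>_. \<zero>\<^bsub>N\<^esub>) \<noteq> {}"
  using split_class(1)[OF assms] split_class(2)[OF assms] by (auto simp: Ext1_def)

lemma Ext1_module:
  fixes M N :: "('a, 'u) module"
  assumes M: "module R M" and N: "module R N"
  shows "module R (Ext1 R M N)"
proof -
  interpret N: rmodule R N by (rule rmodule.intro) (rule N)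
  note z = Ext1_zero[OF M N]
  show ?thesis
  proof (rule moduleI[OF is_cring abelian_groupI])
    fix x y assume xy: "x \<in> carrier (Ext1 R M N)" "y \<in> carrier (Ext1 R M N)"
    obtain a where a: "x = cl M N a" "cl M N a \<noteq> {}" "!!ps. ps \<in> rels R M ==> a ps \<in> carrier N" by (rule Ext1_cases[OF xy(1)]) (rule that)
    obtain b where b: "y = cl M N b" "cl M N b \<noteq> {}" "!!ps. ps \<in> rels R M ==> b ps \<in> carrier N" by (rule Ext1_cases[OF xy(2)]) (rule that)
    note ab = Ext1_add[OF a(2) b(2)]
    show "x \<oplus>\<^bsub>Ext1 R M N\<^esub> y \<in> carrier (Ext1 R M N)" unfolding a(1) b(1) ab(1) by (rule cl_carrier[OF ab(2)])
    show "x \<oplus>\<^bsub>Ext1 R M N\<^esub> y = y \<oplus>\<^bsub>Ext1 R M N\<^esub> x"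
      unfolding a(1) b(1) ab(1) Ext1_add(1)[OF b(2) a(2)]
      by (rule ext_class_cong) (simp add: a(3) b(3) N.M.a_comm)
    show "r \<odot>\<^bsub>Ext1 R M N\<^esub> (x \<oplus>\<^bsub>Ext1 R M N\<^esub> y) = r \<odot>\<^bsub>Ext1 R M N\<^esub> x \<oplus>\<^bsub>Ext1 R M N\<^esub> r \<odot>\<^bsub>Ext1 R M N\<^esub> y"
      if r: "r \<in> carrier R" for r
      unfolding a(1) b(1) ab(1) Ext1_smult(1)[OF r ab(2)] Ext1_smult(1)[OF r a(2)] Ext1_smult(1)[OF r b(2)]
        Ext1_add(1)[OF Ext1_smult(2)[OF r a(2)] Ext1_smult(2)[OF r b(2)]]
      by (rule ext_class_cong) (simp add: a(3) b(3) r N.smult_r_distr)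
    fix w assume w: "w \<in> carrier (Ext1 R M N)"
    obtain c where c: "w = cl M N c" "cl M N c \<noteq> {}" "!!ps. ps \<in> rels R M ==> c ps \<in> carrier N" by (rule Ext1_cases[OF w]) (rule that)
    show "x \<oplus>\<^bsub>Ext1 R M N\<^esub> y \<oplus>\<^bsub>Ext1 R M N\<^esub> w = x \<oplus>\<^bsub>Ext1 R M N\<^esub> (y \<oplus>\<^bsub>Ext1 R M N\<^esub> w)"
      unfolding a(1) b(1) c(1) ab(1) Ext1_add(1)[OF b(2) c(2)] Ext1_add(1)[OF ab(2) c(2)]
        Ext1_add(1)[OF a(2) Ext1_add(2)[OF b(2) c(2)]]
      by (rule ext_class_cong) (simp add: a(3) b(3) c(3) N.M.a_assoc)
  next
    show "\<zero>\<^bsub>Ext1 R M N\<^esub> \<in> carrier (Ext1 R M N)" unfolding z(1) by (rule cl_carrier[OF z(2)])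
  next
    fix x assume x: "x \<in> carrier (Ext1 R M N)"
    obtain a where a: "x = cl M N a" "cl M N a \<noteq> {}" "!!ps. ps \<in> rels R M ==> a ps \<in> carrier N" by (rule Ext1_cases[OF x]) (rule that)
    show "\<zero>\<^bsub>Ext1 R M N\<^esub> \<oplus>\<^bsub>Ext1 R M N\<^esub> x = x"
      unfolding a(1) z(1) Ext1_add(1)[OF z(2) a(2)] by (rule ext_class_cong) (simp add: a(3))
    show "\<one> \<odot>\<^bsub>Ext1 R M N\<^esub> x = x"
      unfolding a(1) Ext1_smult(1)[OF one_closed a(2)] by (rule ext_class_cong) (simp add: a(3))
    show sm: "r \<odot>\<^bsub>Ext1 R M N\<^esub> x \<in> carrier (Ext1 R M N)" if r: "r \<in> carrier R" for r
      unfolding a(1) Ext1_smult(1)[OF r a(2)] by (rule cl_carrier[OF Ext1_smult(2)[OF r a(2)]])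
    have m1: "\<ominus> \<one> \<in> carrier R" by simp
    have "(\<ominus> \<one>) \<odot>\<^bsub>Ext1 R M N\<^esub> x \<oplus>\<^bsub>Ext1 R M N\<^esub> x = \<zero>\<^bsub>Ext1 R M N\<^esub>"
      unfolding a(1) z(1) Ext1_smult(1)[OF m1 a(2)] Ext1_add(1)[OF Ext1_smult(2)[OF m1 a(2)] a(2)]
      by (rule ext_class_cong) (simp add: a(3) N.smult_l_minus N.M.l_neg)
    then show "\<exists>y\<in>carrier (Ext1 R M N). y \<oplus>\<^bsub>Ext1 R M N\<^esub> x = \<zero>\<^bsub>Ext1 R M N\<^esub>" using sm[OF m1] by blast
    fix r s assume rs: "r \<in> carrier R" "s \<in> carrier R"
    show "(r \<oplus> s) \<odot>\<^bsub>Ext1 R M N\<^esub> x = r \<odot>\<^bsub>Ext1 R M N\<^esub> x \<oplus>\<^bsub>Ext1 R M N\<^esub> s \<odot>\<^bsub>Ext1 R M N\<^esub> x"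
      unfolding a(1) Ext1_smult(1)[OF a_closed[OF rs] a(2)] Ext1_smult(1)[OF rs(1) a(2)] Ext1_smult(1)[OF rs(2) a(2)]
        Ext1_add(1)[OF Ext1_smult(2)[OF rs(1) a(2)] Ext1_smult(2)[OF rs(2) a(2)]]
      by (rule ext_class_cong) (simp add: a(3) rs N.smult_l_distr)
    show "(r \<otimes> s) \<odot>\<^bsub>Ext1 R M N\<^esub> x = r \<odot>\<^bsub>Ext1 R M N\<^esub> (s \<odot>\<^bsub>Ext1 R M N\<^esub> x)"
      unfolding a(1) Ext1_smult(1)[OF m_closed[OF rs] a(2)] Ext1_smult(1)[OF rs(2) a(2)]
        Ext1_smult(1)[OF rs(1) Ext1_smult(2)[OF rs(2) a(2)]]
      by (rule ext_class_cong) (simp add: a(3) rs N.smult_assoc1)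
  qed
qed

text \<open>The coordinates of a class are the values of its factor sets on the relations from
  \<open>finite_relations\<close>. If they all vanish, the span of \<sigma> G maps isomorphically
  onto M, and the extension splits.\<close>

lemma Ext1_fin_gen:
  fixes M N :: "('a, 'u) module"
  assumes M: "module R M" "fin_gen R M" and N: "module R N" "fin_gen R N"
  shows "fin_gen R (Ext1 R M N)"
proof -
  let ?E = "Ext1 R M N"
  have R: "noetherian_ring R" by unfold_locales
  interpret E: rmodule R ?E by (rule rmodule.intro) (rule Ext1_module[OF M(1) N(1)])
  obtain G where G: "finite G" "G \<subseteq> carrier M" "mod_span R M G = carrier M" using M(2) by (auto simp: fin_gen_def)
  obtain P where P: "finite P" "P \<subseteq> rels R M" and
    split: "\<forall>(Y :: ('a, 'u) module) g \<sigma>. module R Y --> g \<in> mod_hom R Y M -->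
      (\<forall>m\<in>carrier M. \<sigma> m \<in> carrier Y \<and> g (\<sigma> m) = m) --> (\<forall>ps\<in>P. lincomb Y \<sigma> ps = \<zero>\<^bsub>Y\<^esub>) -->
      (\<forall>y\<in>mod_span R Y (\<sigma> ` G). g y = \<zero>\<^bsub>M\<^esub> --> y = \<zero>\<^bsub>Y\<^esub>)"
    using finite_relations[OF M(1) R G(1,2)] by (elim exE conjE) (rule that)
  have zero: "e = \<zero>\<^bsub>?E\<^esub>"
    if D: "e = cl M N c \<and> cl M N c \<noteq> {}" and z: "!!ps. ps \<in> P ==> c ps = \<zero>\<^bsub>N\<^esub>" for e c
  proof -
    obtain Y f g where E: "(Y, f, g) \<in> cl M N c" using D by auto
    then obtain \<sigma> where e: "exact_seq R N f Y g M" and \<sigma>: "\<forall>m\<in>carrier M. \<sigma> m \<in> carrier Y \<and> g (\<sigma> m) = m"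
      and c: "!!ps. ps \<in> rels R M ==> f (c ps) = lincomb Y \<sigma> ps"
      unfolding ext_class_def by blast
    note x = exact_seqD[OF e]
    have l: "lincomb Y \<sigma> ps = \<zero>\<^bsub>Y\<^esub>" if "ps \<in> P" for ps
      using c[of ps] z[OF that] P(2) that mod_hom_zero[OF x(1,2,4)] by auto
    have "(Y, f, g) \<in> split_extensions R M N"
    proof (rule split_extensionI[OF e G(2,3), of \<sigma>])
      show "y = \<zero>\<^bsub>Y\<^esub>" if "y \<in> mod_span R Y (\<sigma> ` G)" "g y = \<zero>\<^bsub>M\<^esub>" for y
        by (rule split[rule_format, OF x(2,5), of \<sigma>]) (use \<sigma> l that in auto)
    qed (use \<sigma> in auto)
    then have "cl M N c = cl M N (\<lambda>_. \<zero>\<^bsub>N\<^esub>)"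
      unfolding split_class(1)[OF M(1) N(1)] using E by (intro ext_class_eqI)
    then show ?thesis using D by (simp add: Ext1_zero(1)[OF M(1) N(1)])
  qed
  have "\<exists>S. finite S \<and> S \<subseteq> {e. \<exists>c. e = cl M N c \<and> cl M N c \<noteq> {}} \<and>
      {e. \<exists>c. e = cl M N c \<and> cl M N c \<noteq> {}} \<subseteq> mod_span R ?E S"
  proof (rule fin_gen_by_coordinates[OF Ext1_module[OF M(1) N(1)] noetherian_moduleI[OF R N] P(1)])
    show "c ps \<in> carrier N" if e: "e = cl M N c \<and> cl M N c \<noteq> {}" and ps: "ps \<in> P" for e c ps
    proof -
      obtain Y f g where "(Y, f, g) \<in> cl M N c" using e by auto
      then show ?thesis using ext_classD(2) P(2) ps by blast
    qed
  qed (use Ext1_add Ext1_smult(1,2) cl_carrier zero in auto)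
  moreover have "{e. \<exists>c. e = cl M N c \<and> cl M N c \<noteq> {}} = carrier ?E" (is "?L = _")
  proof (intro equalityI subsetI)
    fix e assume "e \<in> ?L"
    then show "e \<in> carrier ?E" using cl_carrier by auto
  next
    fix e assume e: "e \<in> carrier ?E"
    obtain c where "e = cl M N c" "cl M N c \<noteq> {}" by (rule Ext1_cases[OF e]) (rule that)
    then show "e \<in> ?L" by blast
  qed
  ultimately obtain S where S: "finite S" "S \<subseteq> carrier ?E" "carrier ?E \<subseteq> mod_span R ?E S" by auto
  moreover have "mod_span R ?E S \<subseteq> carrier ?E" by (rule E.span_least[OF S(2) E.sm_carrier])
  ultimately show ?thesis unfolding fin_gen_def by blast
qed

text \<open>On factor sets the map is composition with h and with the action of k on relations, from
  which functoriality can be read off. For the third claim the intermediate extension of M by N'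
  stays in the Ulrich class.\<close>

lemma Ext1_map_class:
  fixes M N M' N' :: "('a, 'u) module"
  assumes ne: "cl M N c \<noteq> {}" and M': "module R M'" and N': "module R N'"
    and k: "k \<in> mod_hom R M' M" and h: "h \<in> mod_hom R N N'"
  shows "Ext1_map R M N M' N' k h (cl M N c) = cl M' N' (\<lambda>ps. h (c (map (map_prod id k) ps)))"
    "cl M' N' (\<lambda>ps. h (c (map (map_prod id k) ps))) \<noteq> {}"
    "\<exists>(Y, f, g)\<in>cl M N c. Y \<in> Ulr s ==> M \<in> Ulr s ==> N \<in> Ulr s ==> M' \<in> Ulr s ==> N' \<in> Ulr s ==>
      \<exists>(Y, f, g)\<in>cl M' N' (\<lambda>ps. h (c (map (map_prod id k) ps))). Y \<in> Ulr s"
proof -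
  obtain Y0 f0 g0 where E0: "(Y0, f0, g0) \<in> cl M N c" using ne by auto
  have ne': "cl M N' (\<lambda>ps. h (c ps)) \<noteq> {}" using push_exists[OF E0 N' h] by blast
  then obtain Y1 f1 g1 where E1: "(Y1, f1, g1) \<in> cl M N' (\<lambda>ps. h (c ps))" by auto
  show "Ext1_map R M N M' N' k h (cl M N c) = cl M' N' (\<lambda>ps. h (c (map (map_prod id k) ps)))"
    unfolding Ext1_map_def using cl_carrier[OF ne] ext_push_class[OF ne h] ext_pull_class[OF ne' k] by simp
  show "cl M' N' (\<lambda>ps. h (c (map (map_prod id k) ps))) \<noteq> {}" using pull_exists[OF E1 M' k] by blast
  assume "\<exists>(Y, f, g)\<in>cl M N c. Y \<in> Ulr s" and U: "M \<in> Ulr s" "N \<in> Ulr s" "M' \<in> Ulr s" "N' \<in> Ulr s"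
  then obtain Y f g where E: "(Y, f, g) \<in> cl M N c" "Y \<in> Ulr s" by auto
  obtain Y2 f2 g2 where E2: "(Y2, f2, g2) \<in> cl M N' (\<lambda>ps. h (c ps))" "Y2 \<in> Ulr s"
    using push_exists[OF E(1) N' h] E(2) U by blast
  show "\<exists>(Y, f, g)\<in>cl M' N' (\<lambda>ps. h (c (map (map_prod id k) ps))). Y \<in> Ulr s"
    using pull_exists[OF E2(1) M' k] E2(2) U by blast
qed

lemma Ext1_map_hom:
  fixes M N M' N' :: "('a, 'u) module"
  assumes M: "module R M" and N: "module R N" and M': "module R M'" and N': "module R N'"
    and k: "k \<in> mod_hom R M' M" and h: "h \<in> mod_hom R N N'"
  shows "Ext1_map R M N M' N' k h \<in> mod_hom R (Ext1 R M N) (Ext1 R M' N')"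
proof (rule mod_homI)
  note m = Ext1_map_class[OF _ M' N' k h]
  have kc: "map (map_prod id k) ps \<in> rels R M" if "ps \<in> rels R M'" for ps by (rule rels_map[OF M' M k that])
  show "Ext1_map R M N M' N' k h \<in> extensional (carrier (Ext1 R M N))" by (simp add: Ext1_map_def)
  fix x assume x: "x \<in> carrier (Ext1 R M N)"
  obtain a where a: "x = cl M N a" "cl M N a \<noteq> {}" "!!ps. ps \<in> rels R M ==> a ps \<in> carrier N" by (rule Ext1_cases[OF x]) (rule that)
  show "Ext1_map R M N M' N' k h x \<in> carrier (Ext1 R M' N')" unfolding a(1) m(1)[OF a(2)] by (rule cl_carrier[OF m(2)[OF a(2)]])
  show "Ext1_map R M N M' N' k h (r \<odot>\<^bsub>Ext1 R M N\<^esub> x) = r \<odot>\<^bsub>Ext1 R M' N'\<^esub> Ext1_map R M N M' N' k h x"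
    if r: "r \<in> carrier R" for r
    unfolding a(1) Ext1_smult(1)[OF r a(2)] m(1)[OF a(2)] m(1)[OF Ext1_smult(2)[OF r a(2)]] Ext1_smult(1)[OF r m(2)[OF a(2)]]
    by (rule ext_class_cong) (simp add: kc a(3) mod_homD(3)[OF h r])
  fix y assume y: "y \<in> carrier (Ext1 R M N)"
  obtain b where b: "y = cl M N b" "cl M N b \<noteq> {}" "!!ps. ps \<in> rels R M ==> b ps \<in> carrier N" by (rule Ext1_cases[OF y]) (rule that)
  show "Ext1_map R M N M' N' k h (x \<oplus>\<^bsub>Ext1 R M N\<^esub> y) =
      Ext1_map R M N M' N' k h x \<oplus>\<^bsub>Ext1 R M' N'\<^esub> Ext1_map R M N M' N' k h y"
    unfolding a(1) b(1) Ext1_add(1)[OF a(2) b(2)] m(1)[OF a(2)] m(1)[OF b(2)] m(1)[OF Ext1_add(2)[OF a(2) b(2)]]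
      Ext1_add(1)[OF m(2)[OF a(2)] m(2)[OF b(2)]]
    by (rule ext_class_cong) (simp add: kc a(3) b(3) mod_homD(2)[OF h])
qed

lemma Ext1_map_id:
  fixes M N :: "('a, 'u) module"
  assumes M: "module R M" and N: "module R N" and x: "x \<in> carrier (Ext1 R M N)"
  shows "Ext1_map R M N M N (mod_id M) (mod_id N) x = x"
proof -
  obtain a where a: "x = cl M N a" "cl M N a \<noteq> {}" "!!ps. ps \<in> rels R M ==> a ps \<in> carrier N" by (rule Ext1_cases[OF x]) (rule that)
  show ?thesis
    unfolding a(1) Ext1_map_class(1)[OF a(2) M N mod_id_hom[OF M] mod_id_hom[OF N]]
  proof (rule ext_class_cong)
    fix ps assume "ps \<in> rels R M"
    then show "mod_id N (a (map (map_prod id (mod_id M)) ps)) = a ps"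
      using a(3) unfolding map_mod_id[OF \<open>ps \<in> rels R M\<close>] by (simp add: mod_id_def)
  qed
qed

lemma Ext1_map_compose:
  fixes M N M' N' M'' N'' :: "('a, 'u) module"
  assumes m: "module R M" "module R M'" "module R N'" "module R M''" "module R N''"
    and k: "k \<in> mod_hom R M' M" "k' \<in> mod_hom R M'' M'" and h: "h \<in> mod_hom R N N'" "h' \<in> mod_hom R N' N''"
    and N: "module R N" and x: "x \<in> carrier (Ext1 R M N)"
  shows "Ext1_map R M N M'' N'' (compose (carrier M'') k k') (compose (carrier N) h' h) x =
    Ext1_map R M' N' M'' N'' k' h' (Ext1_map R M N M' N' k h x)"
proof -
  obtain a where a: "x = cl M N a" "cl M N a \<noteq> {}" "!!ps. ps \<in> rels R M ==> a ps \<in> carrier N" by (rule Ext1_cases[OF x]) (rule that)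
  note c = Ext1_map_class[OF a(2) m(2,3) k(1) h(1)]
  show ?thesis
    unfolding a(1) c(1) Ext1_map_class(1)[OF c(2) m(4,5) k(2) h(2)]
      Ext1_map_class(1)[OF a(2) m(4,5) mod_hom_compose[OF m(4) k(2,1)] mod_hom_compose[OF N h]]
  proof (rule ext_class_cong)
    fix ps assume ps: "ps \<in> rels R M''"
    have eq: "map (map_prod id (compose (carrier M'') k k')) ps = map (map_prod id k) (map (map_prod id k') ps)"
      using ps by (auto simp: rels_def compose_def)
    have "map (map_prod id k) (map (map_prod id k') ps) \<in> rels R M"
      by (rule rels_map[OF m(2,1) k(1) rels_map[OF m(4,2) k(2) ps]])
    from a(3)[OF this] show "compose (carrier N) h' h (a (map (map_prod id (compose (carrier M'') k k')) ps)) =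
        h' (h (a (map (map_prod id k) (map (map_prod id k') ps))))"
      unfolding eq by (simp add: compose_def)
  qed
qed

section \<open>The subfunctor of Ulrich extensions\<close>

lemma Ext1_in_carrier:
  "e \<in> carrier (Ext1_in R \<C> M N) \<longleftrightarrow> e \<in> carrier (Ext1 R M N) \<and> (\<exists>(Y, f, g)\<in>e. Y \<in> \<C>)"
  by (simp add: Ext1_in_def)

lemma Ext1_in_simps:
  "x \<oplus>\<^bsub>Ext1_in R \<C> M N\<^esub> y = x \<oplus>\<^bsub>Ext1 R M N\<^esub> y" "r \<odot>\<^bsub>Ext1_in R \<C> M N\<^esub> x = r \<odot>\<^bsub>Ext1 R M N\<^esub> x"
  by (simp_all add: Ext1_in_def)

text \<open>Zero, multiples and sums correspond to direct sums, pushouts along scalars and Baer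
  sums, whose middle terms are Ulrich modules.\<close>

lemma Ext1_in_submodule:
  fixes M N :: "('a, 'u) module"
  assumes M: "M \<in> Ulr s" and N: "N \<in> Ulr s"
  shows "submodule (carrier (Ext1_in R (Ulr s) M N)) R (Ext1 R M N)"
proof -
  note mM = UlD(3)[OF M] and mN = UlD(3)[OF N]
  interpret E: rmodule R "Ext1 R M N" by (rule rmodule.intro) (rule Ext1_module[OF mM mN])
  show ?thesis
  proof (rule E.smI)
    show "carrier (Ext1_in R (Ulr s) M N) \<subseteq> carrier (Ext1 R M N)" by (rule subsetI) (simp add: Ext1_in_carrier)
    note z = Ext1_zero[OF mM mN]
    have "\<exists>(Y, f, g)\<in>cl M N (\<lambda>_. \<zero>\<^bsub>N\<^esub>). Y \<in> Ulr s" using split_class(2)[OF mM mN] M N by blast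
    then show "\<zero>\<^bsub>Ext1 R M N\<^esub> \<in> carrier (Ext1_in R (Ulr s) M N)"
      unfolding Ext1_in_carrier z(1) using cl_carrier[OF z(2)] by blast
    fix x assume x: "x \<in> carrier (Ext1_in R (Ulr s) M N)"
    obtain a where a: "x = cl M N a" "cl M N a \<noteq> {}" "\<exists>(Y, f, g)\<in>cl M N a. Y \<in> Ulr s"
      using x unfolding Ext1_in_carrier Ext1_carrier by blast
    show "r \<odot>\<^bsub>Ext1 R M N\<^esub> x \<in> carrier (Ext1_in R (Ulr s) M N)" if r: "r \<in> carrier R" for r
      unfolding Ext1_in_carrier a(1) Ext1_smult(1)[OF r a(2)]
      using cl_carrier[OF Ext1_smult(2)[OF r a(2)]] Ext1_smult(3)[OF r a(2,3) M N] by blast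
    fix y assume y: "y \<in> carrier (Ext1_in R (Ulr s) M N)"
    obtain b where b: "y = cl M N b" "cl M N b \<noteq> {}" "\<exists>(Y, f, g)\<in>cl M N b. Y \<in> Ulr s"
      using y unfolding Ext1_in_carrier Ext1_carrier by blast
    obtain Y f g Y' f' g' where E: "(Y, f, g) \<in> cl M N a" "Y \<in> Ulr s" "(Y', f', g') \<in> cl M N b" "Y' \<in> Ulr s"
      using a(3) b(3) by blast
    show "x \<oplus>\<^bsub>Ext1 R M N\<^esub> y \<in> carrier (Ext1_in R (Ulr s) M N)"
      unfolding Ext1_in_carrier a(1) b(1) Ext1_add(1)[OF a(2) b(2)]
      using cl_carrier[OF Ext1_add(2)[OF a(2) b(2)]] baer_class(2)[OF E(1,3)] E(2,4) M N by blast
  qed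
qed

lemma Ext1_in_closed:
  fixes M N M' N' :: "('a, 'u) module"
  assumes U: "M \<in> Ulr s" "N \<in> Ulr s" "M' \<in> Ulr s" "N' \<in> Ulr s"
    and k: "k \<in> mod_hom R M' M" and h: "h \<in> mod_hom R N N'" and x: "x \<in> carrier (Ext1_in R (Ulr s) M N)"
  shows "Ext1_map R M N M' N' k h x \<in> carrier (Ext1_in R (Ulr s) M' N')"
proof -
  obtain a where a: "x = cl M N a" "cl M N a \<noteq> {}" "\<exists>(Y, f, g)\<in>cl M N a. Y \<in> Ulr s"
    using x unfolding Ext1_in_carrier Ext1_carrier by blast
  note m = Ext1_map_class[OF a(2) UlD(3)[OF U(3)] UlD(3)[OF U(4)] k h]
  show ?thesis unfolding Ext1_in_carrier a(1) m(1) using cl_carrier[OF m(2)] m(3)[OF a(3) U] by blast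
qed

theorem Ext1_in_subfunctor:
  "subfunctor R (Ulr s) (Ext1_in R (Ulr s)) (Ext1_in_map R (Ulr s)) (Ext1 R) (Ext1_map R)"
proof -
  let ?U = "Ulr s" and ?G = "Ext1_in R (Ulr s)"
  have R: "noetherian_ring R" by unfold_locales
  have m: "module R M" and fg: "fin_gen R M" if "M \<in> ?U" for M using UlD(3,4)[OF that] by blast+
  have E: "module R (Ext1 R M N)" "fin_gen R (Ext1 R M N)" if "M \<in> ?U" "N \<in> ?U" for M N
    using Ext1_module[OF m m] Ext1_fin_gen[OF m fg m fg] that by blast+
  have G: "module R (?G M N)" if "M \<in> ?U" "N \<in> ?U" for M N
    using submodule.submodule_is_module[OF Ext1_in_submodule[OF that] E(1)[OF that]] by (simp add: Ext1_in_def)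
  have sub: "x \<in> carrier (Ext1 R M N)" if "x \<in> carrier (?G M N)" for x M N using that by (simp add: Ext1_in_carrier)
  have incl: "mod_id (?G M N) \<in> mod_hom R (?G M N) (Ext1 R M N)" if "M \<in> ?U" "N \<in> ?U" for M N
    unfolding mod_id_def by (rule mod_hom_restrictI[OF G[OF that]]) (simp_all add: sub Ext1_in_simps)
  \<comment> \<open>Finite generation is inherited from the full Ext module, since R is
    Noetherian.\<close>
  have Gfg: "fin_gen R (?G M N)" if "M \<in> ?U" "N \<in> ?U" for M N
    by (rule fin_gen_submodule[OF G[OF that] E(1)[OF that] incl[OF that] _ R E(2)[OF that]])
      (auto simp: mod_id_def inj_on_def)
  have Gm: "Ext1_in_map R ?U M N M' N' k h x = Ext1_map R M N M' N' k h x"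
    if "x \<in> carrier (?G M N)" for M N M' N' k h x using that by (simp add: Ext1_in_map_def)
  have Ghom: "Ext1_in_map R ?U M N M' N' k h \<in> mod_hom R (?G M N) (?G M' N')"
    if U: "M \<in> ?U" "N \<in> ?U" "M' \<in> ?U" "N' \<in> ?U" and k: "k \<in> mod_hom R M' M" and h: "h \<in> mod_hom R N N'"
    for M N M' N' k h
    unfolding Ext1_in_map_def
  proof (rule mod_hom_restrictI[OF G[OF U(1,2)]])
    note H = mod_homD[OF Ext1_map_hom[OF m[OF U(1)] m[OF U(2)] m[OF U(3)] m[OF U(4)] k h]]
    show "Ext1_map R M N M' N' k h x \<in> carrier (?G M' N')" if "x \<in> carrier (?G M N)" for x
      by (rule Ext1_in_closed[OF U k h that])
  qed (simp_all add: Ext1_in_simps sub mod_homD(2,3)[OF Ext1_map_hom[OF m[OF U(1)] m[OF U(2)] m[OF U(3)] m[OF U(4)] k h]])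
  have F: "bifunctor_to_mod R ?U (Ext1 R) (Ext1_map R)"
    unfolding bifunctor_to_mod_def
  proof (intro conjI ballI)
    fix M N assume U: "M \<in> ?U" "N \<in> ?U"
    show "Ext1 R M N \<in> mod_cat R" using E[OF U] by (simp add: mod_cat_def)
    show "Ext1_map R M N M N (mod_id M) (mod_id N) = mod_id (Ext1 R M N)"
    proof (rule mod_hom_ext[OF _ mod_id_hom[OF E(1)[OF U]]])
      show "Ext1_map R M N M N (mod_id M) (mod_id N) \<in> mod_hom R (Ext1 R M N) (Ext1 R M N)"
        using m U by (intro Ext1_map_hom mod_id_hom) auto
      show "Ext1_map R M N M N (mod_id M) (mod_id N) x = mod_id (Ext1 R M N) x" if "x \<in> carrier (Ext1 R M N)" for x
        using Ext1_map_id[OF m[OF U(1)] m[OF U(2)] that] that by (simp add: mod_id_def[of "Ext1 R M N"])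
    qed
  next
    fix M N M' N' k h
    assume U: "M \<in> ?U" "N \<in> ?U" "M' \<in> ?U" "N' \<in> ?U" and k: "k \<in> mod_hom R M' M" and h: "h \<in> mod_hom R N N'"
    show H: "Ext1_map R M N M' N' k h \<in> mod_hom R (Ext1 R M N) (Ext1 R M' N')"
      by (rule Ext1_map_hom[OF m[OF U(1)] m[OF U(2)] m[OF U(3)] m[OF U(4)] k h])
    fix M'' N'' k' h'
    assume U': "M'' \<in> ?U" "N'' \<in> ?U" and k': "k' \<in> mod_hom R M'' M'" and h': "h' \<in> mod_hom R N' N''"
    show "Ext1_map R M N M'' N'' (compose (carrier M'') k k') (compose (carrier N) h' h) =
        compose (carrier (Ext1 R M N)) (Ext1_map R M' N' M'' N'' k' h') (Ext1_map R M N M' N' k h)"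
    proof (rule extensionalityI[of _ "carrier (Ext1 R M N)"])
      fix x assume x: "x \<in> carrier (Ext1 R M N)"
      show "Ext1_map R M N M'' N'' (compose (carrier M'') k k') (compose (carrier N) h' h) x =
          compose (carrier (Ext1 R M N)) (Ext1_map R M' N' M'' N'' k' h') (Ext1_map R M N M' N' k h) x"
        unfolding compose_hom_apply[OF x]
        by (rule Ext1_map_compose[OF m[OF U(1)] m[OF U(3)] m[OF U(4)] m[OF U'(1)] m[OF U'(2)] k k' h h' m[OF U(2)] x])
    qed (simp_all add: Ext1_map_def compose_def)
  qed
  have FG: "bifunctor_to_mod R ?U ?G (Ext1_in_map R ?U)"
    unfolding bifunctor_to_mod_def
  proof (intro conjI ballI)
    fix M N assume U: "M \<in> ?U" "N \<in> ?U"
    show "?G M N \<in> mod_cat R" using G[OF U] Gfg[OF U] by (simp add: mod_cat_def)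
    show "Ext1_in_map R ?U M N M N (mod_id M) (mod_id N) = mod_id (?G M N)"
      unfolding Ext1_in_map_def mod_id_def[of "?G M N"]
      by (rule restrict_ext) (rule Ext1_map_id[OF m[OF U(1)] m[OF U(2)] sub])
  next
    fix M N M' N' k h
    assume U: "M \<in> ?U" "N \<in> ?U" "M' \<in> ?U" "N' \<in> ?U" and k: "k \<in> mod_hom R M' M" and h: "h \<in> mod_hom R N N'"
    show "Ext1_in_map R ?U M N M' N' k h \<in> mod_hom R (?G M N) (?G M' N')" by (rule Ghom[OF U k h])
    fix M'' N'' k' h'
    assume U': "M'' \<in> ?U" "N'' \<in> ?U" and k': "k' \<in> mod_hom R M'' M'" and h': "h' \<in> mod_hom R N' N''"
    show "Ext1_in_map R ?U M N M'' N'' (compose (carrier M'') k k') (compose (carrier N) h' h) =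
        compose (carrier (?G M N)) (Ext1_in_map R ?U M' N' M'' N'' k' h') (Ext1_in_map R ?U M N M' N' k h)"
    proof (rule extensionalityI[of _ "carrier (?G M N)"])
      fix x assume x: "x \<in> carrier (?G M N)"
      show "Ext1_in_map R ?U M N M'' N'' (compose (carrier M'') k k') (compose (carrier N) h' h) x =
          compose (carrier (?G M N)) (Ext1_in_map R ?U M' N' M'' N'' k' h') (Ext1_in_map R ?U M N M' N' k h) x"
        unfolding compose_hom_apply[OF x] Gm[OF x] Gm[OF Ext1_in_closed[OF U k h x]]
        by (rule Ext1_map_compose[OF m[OF U(1)] m[OF U(3)] m[OF U(4)] m[OF U'(1)] m[OF U'(2)] k k' h h' m[OF U(2)] sub[OF x]])
    qed (simp_all add: Ext1_in_map_def compose_def)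
  qed
  show ?thesis
    unfolding subfunctor_def
  proof (intro conjI ballI F FG Ext1_in_submodule incl)
    fix M N M' N' k h
    assume U: "M \<in> ?U" "N \<in> ?U" "M' \<in> ?U" "N' \<in> ?U" and k: "k \<in> mod_hom R M' M" and h: "h \<in> mod_hom R N N'"
    show "compose (carrier (?G M N)) (Ext1_map R M N M' N' k h) (mod_id (?G M N)) =
        compose (carrier (?G M N)) (mod_id (?G M' N')) (Ext1_in_map R ?U M N M' N' k h)"
      unfolding compose_eq_compose_iff using Ext1_in_closed[OF U k h] by (simp add: mod_id_def Gm)
  qed
qed

end

theorem corollary4p7:
  fixes R :: "('a, 'r) ring_scheme" and \<mm> I :: "'a set" and s :: nat
  assumes "noetherian_ring R" and "local_ring R \<mm>" and "m_primary R \<mm> I"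
    and "infinite (UNIV :: 'u set)" and "\<exists>\<iota> :: 'a \<Rightarrow> 'u. inj_on \<iota> (carrier R)"
  shows "let \<U> = (Ul R \<mm> I s :: ('a, 'u) module set) in
    exact_subcategory R (Mod_cat R) \<U> (short_exact_in R \<U>) \<and>
    exact_subcategory R (mod_cat R) \<U> (short_exact_in R \<U>) \<and>
    subfunctor R \<U> (Ext1_in R \<U>) (Ext1_in_map R \<U>) (Ext1 R) (Ext1_map R)"
proof -
  have "noetherian_local R \<mm>"
    unfolding noetherian_local_def noetherian_local_axioms_def using assms(1,2) by (simp add: local_ring_def)
  then have "primary_local R \<mm> I"
    unfolding primary_local_def primary_local_axioms_def using assms(3) by simp
  then interpret ext_functor R \<mm> I "TYPE('u)"
    unfolding ext_functor_def ext_functor_axioms_def using assms(4) by simp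
  show ?thesis unfolding Let_def using Ul_exact_subcategory[OF inf] Ext1_in_subfunctor by blast
qed

end
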